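(* Consider the Cauchy problem $$ iu_t=\mathcal{T}_4(u,u,u),\qquad u(t=0)=u_0. $$ (i) It is locally wellposed in $X$ for each of the spaces $X=L^2$; $X=L^{2,\sigma}$ with any $\sigma\ge0$; $X=H^\sigma$ with any $\sigma\ge0$; $X=L^{\infty,s}$ with any $s>1/2$; $X=L^{p,s}$ with any $p\ge2$ and $s>1/2-1/p$. (ii) It is globally wellposed in $L^2$. (iii) Persistence of regularity: for initial data in $H^\sigma$, the global $L^2$ solution is in $H^\sigma$ for all time.
   Context: All functions of $x$ are $\mathbb{R}\to\mathbb{C}$. In (iii), $\sigma\geq 0$ is arbitrary. $H=-\Delta+x^2$ on $L^2(\mathbb{R})$, and $e^{itH}$ is the unitary propagator of $iu_t+Hu=0$ (so $e^{itH}\phi_n=e^{it(2n+1)}\phi_n$ for the Hermite functions $\phi_n$, $H\phi_n=(2n+1)\phi_n$). Define $$\mathcal{T}_4(f_1,f_2,f_3)=\frac{8}{\pi}\int_{-\pi/4}^{\pi/4}e^{-itH}\left[(e^{itH}f_1)(e^{itH}f_2)\overline{(e^{itH}f_3)}\right]dt ,$$ equivalently, by duality, $\int_{\mathbb{R}}\mathcal{T}_4(f_1,f_2,f_3)\overline{g}\,dx=4\cdot\frac{2}{\pi}\int_0^{\pi/2}\int_{\mathbb{R}}(e^{itH}f_1)(e^{itH}f_2)\overline{(e^{itH}f_3)(e^{itH}g)}\,dx\,dt$ for $g\in L^2$. With $\langle x\rangle=\sqrt{1+x^2}$: $\|f\|_{L^{p,s}}=\|\langle x\rangle^sf\|_{L^p}$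 for $2\le p\le\infty$, and $\|f\|_{H^\sigma}=\|\langle\xi\rangle^\sigma\widehat{f}\|_{L^2}$. Solutions are understood in the Duhamel (integral) sense, continuous in time with values in $X$; wellposedness is in the usual sense (existence, uniqueness and continuous dependence on $u_0\in X$). *)

theory Defs
  imports "HOL-Analysis.Analysis" "HOL-Probability.Essential_Supremum"
    "HOL-Computational_Algebra.Polynomial"
begin

section \<open>The Hilbert space of square-integrable functions on the line\<close>

definition square_integrable :: "(real \<Rightarrow> complex) \<Rightarrow> bool" where
  "square_integrable f \<longleftrightarrow>
     f \<in> borel_measurable borel \<and> integrable lborel (\<lambda>x. (norm (f x))\<^sup>2)"

lemma square_integrable_measurable [measurable_dest]:
  "square_integrable f \<Longrightarrow> f \<in> borel_measurable borel"
  by (simp add: square_integrable_def)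

lemma borel_measurable_cnj [measurable]: "cnj \<in> borel_measurable borel"
  by (intro borel_measurable_continuous_onI continuous_intros)

lemma square_integrable_bound:
  assumes "f \<in> borel_measurable borel" "integrable lborel g"
    and "AE x in lborel. (norm (f x))\<^sup>2 \<le> g x"
  shows "square_integrable f"
  unfolding square_integrable_def
proof
  show "integrable lborel (\<lambda>x. (norm (f x))\<^sup>2)"
    using assms(1)
    by (intro Bochner_Integration.integrable_bound[OF assms(2)]) (use assms(3) in auto)
qed (fact assms(1))

lemma square_integrable_zero: "square_integrable (\<lambda>_. 0)"
  by (simp add: square_integrable_def)

lemma square_integrable_cmult:
  assumes "square_integrable f" shows "square_integrable (\<lambda>x. c * f x)"
  using assms by (auto simp: square_integrable_def norm_mult power_mult_distrib)

lemma square_integrable_cmult_right: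
  "square_integrable f \<Longrightarrow> square_integrable (\<lambda>x. f x * c)"
  using square_integrable_cmult[of f c] by (simp add: mult.commute)

lemma norm_add_sq_le: "(norm (a + b))\<^sup>2 \<le> 2 * (norm a)\<^sup>2 + 2 * (norm (b::complex))\<^sup>2"
proof -
  have "(norm (a + b))\<^sup>2 \<le> (norm a + norm b)\<^sup>2"
    by (intro power_mono norm_triangle_ineq) auto
  also have "\<dots> \<le> 2 * (norm a)\<^sup>2 + 2 * (norm b)\<^sup>2"
    using sum_squares_bound[of "norm a" "norm b"] by (simp add: power2_sum)
  finally show ?thesis .
qed

lemma square_integrable_add:
  assumes "square_integrable f" "square_integrable g"
  shows "square_integrable (\<lambda>x. f x + g x)"
proof (rule square_integrable_bound)
  show "integrable lborel (\<lambda>x. 2 * (norm (f x))\<^sup>2 + 2 * (norm (g x))\<^sup>2)"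
    using assms by (auto simp: square_integrable_def)
  show "(\<lambda>x. f x + g x) \<in> borel_measurable borel"
    using assms by measurable
qed (auto simp: norm_add_sq_le)

lemma square_integrable_diff:
  assumes "square_integrable f" "square_integrable g"
  shows "square_integrable (\<lambda>x. f x - g x)"
  using square_integrable_add[OF assms(1) square_integrable_cmult[OF assms(2), of "-1"]] by simp

lemma square_integrable_integrable_mult:
  assumes "square_integrable f" "square_integrable g"
  shows "integrable lborel (\<lambda>x. f x * cnj (g x))"
proof (rule Bochner_Integration.integrable_bound)
  show "integrable lborel (\<lambda>x. (norm (f x))\<^sup>2 + (norm (g x))\<^sup>2)"
    using assms by (auto simp: square_integrable_def)
  show "(\<lambda>x. f x * cnj (g x)) \<in> borel_measurable lborel"
    using assms by measurable
  have "norm (f x) * norm (g x) \<le> (norm (f x))\<^sup>2 + (norm (g x))\<^sup>2" for x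
    using sum_squares_bound[of "norm (f x)" "norm (g x)"]
          mult_nonneg_nonneg[of "norm (f x)" "norm (g x)", OF norm_ge_zero norm_ge_zero]
    by linarith
  then show "AE x in lborel. norm (f x * cnj (g x)) \<le> norm ((norm (f x))\<^sup>2 + (norm (g x))\<^sup>2)"
    by (auto simp: norm_mult)
qed

lemma square_integrable_integrable_inner:
  assumes "square_integrable f" "square_integrable g"
  shows "integrable lborel (\<lambda>x. f x \<bullet> g x)"
proof -
  have "(\<lambda>x. f x \<bullet> g x) = (\<lambda>x. Re (f x * cnj (g x)))"
    by (auto simp: inner_complex_def)
  then show ?thesis
    using integrable_Re[OF square_integrable_integrable_mult[OF assms]] by simp
qed

definition ae_equal :: "(real \<Rightarrow> complex) \<Rightarrow> (real \<Rightarrow> complex) \<Rightarrow> bool" where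
  "ae_equal f g \<longleftrightarrow>
     square_integrable f \<and> square_integrable g \<and> (AE x in lborel. f x = g x)"

quotient_type L2 = "real \<Rightarrow> complex" / partial: ae_equal
proof (rule part_equivpI)
  show "\<exists>f. ae_equal f f"
    by (rule exI[of _ "\<lambda>_. 0"]) (simp add: ae_equal_def square_integrable_zero)
  show "symp ae_equal"
    by (auto simp: symp_def ae_equal_def elim: eventually_mono)
  show "transp ae_equal"
    by (auto simp: transp_def ae_equal_def elim: eventually_elim2)
qed

instantiation L2 :: real_inner
begin

lift_definition zero_L2 :: L2 is "\<lambda>_. 0"
  by (simp add: ae_equal_def square_integrable_zero)

lift_definition plus_L2 :: "L2 \<Rightarrow> L2 \<Rightarrow> L2" is "\<lambda>f g x. f x + g x"
  by (auto simp: ae_equal_def square_integrable_add elim: eventually_elim2)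

lift_definition minus_L2 :: "L2 \<Rightarrow> L2 \<Rightarrow> L2" is "\<lambda>f g x. f x - g x"
  by (auto simp: ae_equal_def square_integrable_diff elim: eventually_elim2)

lift_definition uminus_L2 :: "L2 \<Rightarrow> L2" is "\<lambda>f x. - f x"
  using square_integrable_cmult[of _ "-1"]
  by (auto simp: ae_equal_def elim: eventually_mono)

lift_definition scaleR_L2 :: "real \<Rightarrow> L2 \<Rightarrow> L2" is "\<lambda>c f x. complex_of_real c * f x"
  by (auto simp: ae_equal_def square_integrable_cmult elim: eventually_mono)

lift_definition inner_L2 :: "L2 \<Rightarrow> L2 \<Rightarrow> real" is "\<lambda>f g. LBINT x. f x \<bullet> g x"
  by (rule integral_cong_AE)
     (auto simp: ae_equal_def dest: square_integrable_measurable elim: eventually_elim2)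

definition norm_L2 :: "L2 \<Rightarrow> real" where "norm_L2 f = sqrt (f \<bullet> f)"
definition sgn_L2 :: "L2 \<Rightarrow> L2" where "sgn_L2 f = inverse (norm f) *\<^sub>R f"
definition dist_L2 :: "L2 \<Rightarrow> L2 \<Rightarrow> real" where "dist_L2 f g = norm (f - g)"
definition uniformity_L2 :: "(L2 \<times> L2) filter" where
  "uniformity_L2 = (INF e\<in>{0<..}. principal {(x, y). dist x y < e})"
definition open_L2 :: "L2 set \<Rightarrow> bool" where
  "open_L2 U \<longleftrightarrow> (\<forall>x\<in>U. \<forall>\<^sub>F (x', y) in uniformity. x' = x \<longrightarrow> y \<in> U)"

instance
proof
  fix f g h :: L2 and a b :: real
  show "f + g + h = f + (g + h)"
    by transfer (auto simp: ae_equal_def square_integrable_add add.assoc)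
  show "f + g = g + f"
    by transfer (auto simp: ae_equal_def square_integrable_add add.commute)
  show "0 + f = f"
    by transfer (auto simp: ae_equal_def)
  show "- f + f = 0"
    by transfer (auto simp: ae_equal_def square_integrable_zero)
  show "f - g = f + - g"
    by transfer (auto simp: ae_equal_def square_integrable_diff)
  show "a *\<^sub>R (f + g) = a *\<^sub>R f + a *\<^sub>R g"
    by transfer (auto simp: ae_equal_def algebra_simps
        intro!: square_integrable_add square_integrable_cmult square_integrable_cmult_right)
  show "(a + b) *\<^sub>R f = a *\<^sub>R f + b *\<^sub>R f"
    by transfer (auto simp: ae_equal_def algebra_simps
        intro!: square_integrable_add square_integrable_cmult square_integrable_cmult_right)
  show "a *\<^sub>R b *\<^sub>R f = (a * b) *\<^sub>R f"
    by transfer (auto simp: ae_equal_def algebra_simps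
        intro!: square_integrable_cmult square_integrable_cmult_right)
  show "1 *\<^sub>R f = f"
    by transfer (auto simp: ae_equal_def)
  show "f \<bullet> g = g \<bullet> f"
    by transfer (simp add: inner_commute)
  show "(f + g) \<bullet> h = f \<bullet> h + g \<bullet> h"
    by transfer (simp add: ae_equal_def inner_add_left square_integrable_integrable_inner)
  show "(a *\<^sub>R f) \<bullet> g = a * (f \<bullet> g)"
    by transfer (simp flip: scaleR_conv_of_real)
  show "0 \<le> f \<bullet> f"
    by transfer simp
  show "f \<bullet> f = 0 \<longleftrightarrow> f = 0"
  proof (transfer)
    fix f assume f: "ae_equal f f"
    then have "integrable lborel (\<lambda>x. f x \<bullet> f x)"
      by (simp add: ae_equal_def square_integrable_integrable_inner)
    then have "(LBINT x. f x \<bullet> f x) = 0 \<longleftrightarrow> (AE x in lborel. f x \<bullet> f x = 0)"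
      by (intro integral_nonneg_eq_0_iff_AE) auto
    then show "(LBINT x. f x \<bullet> f x) = 0 \<longleftrightarrow> ae_equal f (\<lambda>_. 0)"
      using f by (simp add: ae_equal_def square_integrable_zero)
  qed
qed (simp_all add: norm_L2_def sgn_L2_def dist_L2_def uniformity_L2_def open_L2_def)

end

text \<open>The class of \<open>f\<close>; the value \<open>0\<close> for functions that are not square-integrable is a
  convention.\<close>

definition L2_of :: "(real \<Rightarrow> complex) \<Rightarrow> L2" where
  "L2_of f = (if square_integrable f then abs_L2 f else 0)"

lemma square_integrable_rep [simp]: "square_integrable (rep_L2 f)"
  using Quotient3_rep_reflp[OF Quotient3_L2, of f] by (simp add: ae_equal_def)

lemma rep_L2_measurable [measurable]: "rep_L2 f \<in> borel_measurable borel"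
  using square_integrable_rep by (rule square_integrable_measurable)

lemma L2_of_rep [simp]: "L2_of (rep_L2 f) = f"
  by (simp add: L2_of_def Quotient3_abs_rep[OF Quotient3_L2])

lemma rep_L2_of:
  assumes "square_integrable f"
  shows "AE x in lborel. rep_L2 (L2_of f) x = f x"
  using Quotient3_rep_abs[OF Quotient3_L2, of f] assms
  by (simp add: L2_of_def ae_equal_def)

lemma L2_of_eq_iff:
  assumes "square_integrable f" "square_integrable g"
  shows "L2_of f = L2_of g \<longleftrightarrow> (AE x in lborel. f x = g x)"
  using Quotient3_rel[OF Quotient3_L2, of f g] assms
  by (auto simp: L2_of_def ae_equal_def)

lemma L2_of_add:
  assumes "square_integrable f" "square_integrable g"
  shows "L2_of (\<lambda>x. f x + g x) = L2_of f + L2_of g"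
  using assms by (simp add: L2_of_def square_integrable_add plus_L2.abs_eq ae_equal_def)

lemma L2_of_diff:
  assumes "square_integrable f" "square_integrable g"
  shows "L2_of (\<lambda>x. f x - g x) = L2_of f - L2_of g"
  using assms by (simp add: L2_of_def square_integrable_diff minus_L2.abs_eq ae_equal_def)

lemma norm_L2_of:
  assumes "square_integrable f"
  shows "norm (L2_of f) = sqrt (LBINT x. (norm (f x))\<^sup>2)"
  using assms by (simp add: norm_L2_def L2_of_def inner_L2.abs_eq ae_equal_def power2_norm_eq_inner)

lemma norm_L2_rep: "norm f = sqrt (LBINT x. (norm (rep_L2 f x))\<^sup>2)"
  using norm_L2_of[OF square_integrable_rep, of f] by simp

lift_definition scaleC :: "complex \<Rightarrow> L2 \<Rightarrow> L2" (infixr "*\<^sub>C" 75) is "\<lambda>c f x. c * f x"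
  by (auto simp: ae_equal_def square_integrable_cmult elim: eventually_mono)

lemma L2_of_cmult:
  assumes "square_integrable f"
  shows "L2_of (\<lambda>x. c * f x) = c *\<^sub>C L2_of f"
  using assms by (simp add: L2_of_def square_integrable_cmult scaleC.abs_eq ae_equal_def)

lemma scaleC_of_real: "complex_of_real c *\<^sub>C f = c *\<^sub>R f"
  by transfer (auto simp: ae_equal_def square_integrable_cmult)

lemma scaleC_add: "c *\<^sub>C (f + g) = c *\<^sub>C f + c *\<^sub>C g"
  by transfer (auto simp: ae_equal_def algebra_simps
        intro!: square_integrable_add square_integrable_cmult square_integrable_cmult_right)

lemma norm_scaleC: "norm (c *\<^sub>C f) = norm c * norm f"
proof -
  have "norm (c *\<^sub>C f) = norm (L2_of (\<lambda>x. c * rep_L2 f x))"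
    by (simp add: L2_of_cmult)
  then show ?thesis
    by (simp add: norm_L2_of square_integrable_cmult norm_mult power_mult_distrib
        norm_L2_rep[of f] real_sqrt_mult)
qed

lemma bounded_linear_scaleC: "bounded_linear (\<lambda>f. c *\<^sub>C f)"
proof (rule bounded_linear_intro)
  show "c *\<^sub>C (r *\<^sub>R f) = r *\<^sub>R (c *\<^sub>C f)" for r f
    by transfer (auto simp: ae_equal_def algebra_simps
        intro!: square_integrable_cmult square_integrable_cmult_right)
  show "norm (c *\<^sub>C f) \<le> norm f * norm c" for f
    by (simp add: norm_scaleC)
qed (auto simp: scaleC_add)


lemma tendsto_L2_of:
  assumes s: "\<And>i. square_integrable (s i)" and f: "square_integrable f"
    and g: "square_integrable g"
    and lim: "AE x in lborel. (\<lambda>i. s i x) \<longlonglongrightarrow> f x"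
    and bound: "\<And>i. AE x in lborel. norm (s i x) \<le> norm (g x)"
  shows "(\<lambda>i. L2_of (s i)) \<longlonglongrightarrow> L2_of f"
proof -
  note [measurable] = s[THEN square_integrable_measurable] square_integrable_measurable[OF f]
  have "(\<lambda>i. \<integral>x. (norm (s i x - f x))\<^sup>2 \<partial>lborel) \<longlonglongrightarrow> (\<integral>x. (0::real) \<partial>(lborel::real measure))"
  proof (rule integral_dominated_convergence)
    show "integrable lborel (\<lambda>x. 2 * (norm (g x))\<^sup>2 + 2 * (norm (f x))\<^sup>2)"
      using f g by (auto simp: square_integrable_def)
    show "AE x in lborel. (\<lambda>i. (norm (s i x - f x))\<^sup>2) \<longlonglongrightarrow> 0"
      using lim
    proof eventually_elim
      case (elim x)
      then have "(\<lambda>i. norm (s i x - f x)) \<longlonglongrightarrow> 0"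
        using LIM_zero_iff tendsto_norm_zero by blast
      from tendsto_power[OF this, of 2] show ?case by simp
    qed
    show "AE x in lborel. norm ((norm (s i x - f x))\<^sup>2)
        \<le> 2 * (norm (g x))\<^sup>2 + 2 * (norm (f x))\<^sup>2" for i
      using bound[of i]
    proof eventually_elim
      case (elim x)
      have "(norm (s i x))\<^sup>2 \<le> (norm (g x))\<^sup>2"
        using elim by (intro power_mono) auto
      moreover have "(norm (s i x - f x))\<^sup>2 \<le> 2 * (norm (s i x))\<^sup>2 + 2 * (norm (f x))\<^sup>2"
        using norm_add_sq_le[of "s i x" "- f x"] by simp
      ultimately show ?case by (subst real_norm_def, subst abs_of_nonneg) (simp, linarith)
    qed
  qed simp_all
  then have "(\<lambda>i. sqrt (\<integral>x. (norm (s i x - f x))\<^sup>2 \<partial>lborel)) \<longlonglongrightarrow> 0"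
    using tendsto_real_sqrt by fastforce
  then have "(\<lambda>i. norm (L2_of (s i) - L2_of f)) \<longlonglongrightarrow> 0"
    using s f by (simp add: norm_L2_of square_integrable_diff flip: L2_of_diff)
  then show ?thesis
    using LIM_zero_cancel tendsto_norm_zero_iff by blast
qed

lemma L2_Cauchy_subsequence_limit:
  fixes X :: "nat \<Rightarrow> L2"
  assumes X: "\<And>n. norm (X (Suc n) - X n) \<le> (1/2)^n"
  shows "convergent X"
proof -
  define f where "f n = rep_L2 (X n)" for n
  define d where "d n x = norm (f (Suc n) x - f n x)" for n x
  define G where "G N x = (\<Sum>n<N. d n x)" for N x
  define H where "H x = (\<Sum>n. d n x)" for x
  have [measurable]: "f n \<in> borel_measurable borel" for n
    by (simp add: f_def)
  have [measurable]: "d n \<in> borel_measurable borel" for n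
    unfolding d_def by measurable
  have [measurable]: "G N \<in> borel_measurable borel" for N
    unfolding G_def by measurable
  have [measurable]: "H \<in> borel_measurable borel"
    unfolding H_def by measurable
  have sqf: "square_integrable (f n)" for n
    by (simp add: f_def)
  have sqd: "square_integrable (\<lambda>x. complex_of_real (d n x))" for n
    using square_integrable_diff[OF sqf sqf, of "Suc n" n]
    by (auto simp: square_integrable_def d_def)
  have norm_d: "norm (L2_of (\<lambda>x. complex_of_real (d n x))) \<le> (1/2)^n" for n
  proof -
    have "norm (L2_of (\<lambda>x. complex_of_real (d n x))) = norm (L2_of (\<lambda>x. f (Suc n) x - f n x))"
      by (simp add: norm_L2_of sqd square_integrable_diff sqf) (simp add: d_def)
    also have "\<dots> = norm (X (Suc n) - X n)"
      by (simp add: L2_of_diff sqf) (simp add: f_def)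
    finally show ?thesis using X by simp
  qed
  have sqG: "square_integrable (\<lambda>x. complex_of_real (G N x)) \<and>
      norm (L2_of (\<lambda>x. complex_of_real (G N x))) \<le> (\<Sum>n<N. (1/2)^n)" for N
  proof (induction N)
    case 0
    then show ?case
      by (simp add: G_def square_integrable_zero norm_L2_of)
  next
    case (Suc N)
    have *: "(\<lambda>x. complex_of_real (G (Suc N) x)) =
        (\<lambda>x. complex_of_real (G N x) + complex_of_real (d N x))"
      by (simp add: G_def)
    show ?case
      unfolding * using Suc norm_d[of N] norm_triangle_ineq
      by (auto simp: square_integrable_add sqd L2_of_add intro: norm_triangle_le)
  qed
  have geo: "(\<Sum>n<N. (1/2::real)^n) \<le> 2" for N
    by (induction N) (auto simp: geometric_sum)
  have intG: "(\<integral>\<^sup>+x. ennreal ((G N x)\<^sup>2) \<partial>lborel) \<le> 4" for N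
  proof -
    have "norm (L2_of (\<lambda>x. complex_of_real (G N x))) = sqrt (LBINT x. (G N x)\<^sup>2)"
      using sqG[of N] by (simp add: norm_L2_of)
    then have "sqrt (LBINT x. (G N x)\<^sup>2) \<le> 2"
      using sqG[of N] geo[of N] by linarith
    then have "(LBINT x. (G N x)\<^sup>2) \<le> 4"
      using real_sqrt_le_iff[of "LBINT x. (G N x)\<^sup>2" 4] by simp
    moreover have "integrable lborel (\<lambda>x. (G N x)\<^sup>2)"
      using sqG[of N] by (simp add: square_integrable_def)
    ultimately show ?thesis
      by (subst nn_integral_eq_integral) (auto simp: ennreal_leI simp flip: ennreal_numeral)
  qed
  have d0: "0 \<le> d n x" for n x
    by (simp add: d_def)
  have G0: "0 \<le> G N x" for N x
    by (simp add: G_def sum_nonneg d0)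
  have incG: "G N x \<le> G (Suc N) x" for N x
    by (simp add: G_def d0)
  have "(\<integral>\<^sup>+x. (SUP N. ennreal ((G N x)\<^sup>2)) \<partial>lborel) = (SUP N. \<integral>\<^sup>+x. ennreal ((G N x)\<^sup>2) \<partial>lborel)"
    by (intro nn_integral_monotone_convergence_SUP incseq_SucI)
       (auto simp: le_fun_def intro!: ennreal_leI power_mono incG G0)
  also have "\<dots> \<le> 4"
    by (intro SUP_least intG)
  finally have int_sup: "(\<integral>\<^sup>+x. (SUP N. ennreal ((G N x)\<^sup>2)) \<partial>lborel) \<le> 4" .
  then have "(\<integral>\<^sup>+x. (SUP N. ennreal ((G N x)\<^sup>2)) \<partial>lborel) \<noteq> \<infinity>"
    by (metis ennreal_numeral ennreal_neq_top neq_top_trans infinity_ennreal_def)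
  then have "AE x in lborel. (SUP N. ennreal ((G N x)\<^sup>2)) \<noteq> \<infinity>"
    by (intro nn_integral_PInf_AE) auto
  then have summ: "AE x in lborel. summable (\<lambda>n. d n x)"
  proof eventually_elim
    case (elim x)
    then obtain B where B: "(SUP N. ennreal ((G N x)\<^sup>2)) = ennreal B" "0 \<le> B"
      by (cases "SUP N. ennreal ((G N x)\<^sup>2)") auto
    have "(G N x)\<^sup>2 \<le> B" for N
    proof -
      have "ennreal ((G N x)\<^sup>2) \<le> ennreal B"
        unfolding B(1)[symmetric] by (intro SUP_upper) auto
      then show ?thesis using B by simp
    qed
    then have "G N x \<le> sqrt B" for N
      using G0 real_le_rsqrt by blast
    then show ?case
      by (intro summableI_nonneg_bounded[where x = "sqrt B"]) (auto simp: d0 G_def)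
  qed
  have GH: "G N x \<le> H x" if "summable (\<lambda>n. d n x)" for N x
    unfolding G_def H_def using that d0 by (intro sum_le_suminf) auto
  have sqH: "square_integrable (\<lambda>x. complex_of_real (H x))"
  proof -
    have "(\<integral>\<^sup>+x. ennreal ((H x)\<^sup>2) \<partial>lborel) \<le> (\<integral>\<^sup>+x. (SUP N. ennreal ((G N x)\<^sup>2)) \<partial>lborel)"
    proof (rule nn_integral_mono_AE)
      show "AE x in lborel. ennreal ((H x)\<^sup>2) \<le> (SUP N. ennreal ((G N x)\<^sup>2))"
        using summ
      proof eventually_elim
        case (elim x)
        then have "(\<lambda>N. G N x) \<longlonglongrightarrow> H x"
          unfolding G_def H_def by (rule summable_LIMSEQ)
        then have "(\<lambda>N. ennreal ((G N x)\<^sup>2)) \<longlonglongrightarrow> ennreal ((H x)\<^sup>2)"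
          by (intro tendsto_intros)
        then show ?case
          by (rule LIMSEQ_le_const2) (intro exI[of _ 0] allI impI SUP_upper UNIV_I)
      qed
    qed
    also have "\<dots> < \<infinity>"
      using int_sup by (rule order.strict_trans1) simp
    finally have "integrable lborel (\<lambda>x. (H x)\<^sup>2)"
      by (intro integrableI_nonneg) auto
    then show ?thesis
      by (simp add: square_integrable_def)
  qed
  define F where "F x = lim (\<lambda>n. f n x)" for x
  define g where "g x = complex_of_real (norm (f 0 x)) + complex_of_real (H x)" for x
  have sqg: "square_integrable g"
    unfolding g_def using sqf[of 0] sqH
    by (intro square_integrable_add) (auto simp: square_integrable_def)
  have fG: "norm (f n x) \<le> norm (f 0 x) + G n x" for n x
  proof (induction n)
    case 0 then show ?case by (simp add: G_def)
  next
    case (Suc n)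
    have "norm (f (Suc n) x) \<le> norm (f n x) + d n x"
      unfolding d_def by (simp add: norm_triangle_sub)
    with Suc show ?case by (simp add: G_def)
  qed
  have norm_g: "norm (g x) = norm (f 0 x) + H x" if "summable (\<lambda>n. d n x)" for x
  proof -
    have "0 \<le> H x"
      using GH[OF that, of 0] by (simp add: G_def)
    moreover have "g x = complex_of_real (norm (f 0 x) + H x)"
      by (simp add: g_def)
    ultimately show ?thesis
      by (metis abs_of_nonneg add_nonneg_nonneg norm_ge_zero norm_of_real)
  qed
  have bound: "AE x in lborel. norm (f n x) \<le> norm (g x)" for n
    using summ
  proof eventually_elim
    case (elim x)
    show ?case
      using fG[of n x] GH[OF elim, of n] norm_g[OF elim] by linarith
  qed
  have lim: "AE x in lborel. (\<lambda>n. f n x) \<longlonglongrightarrow> F x"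
    using summ
  proof eventually_elim
    case (elim x)
    then have "summable (\<lambda>n. f (Suc n) x - f n x)"
      unfolding d_def by (rule summable_norm_cancel)
    then have "convergent (\<lambda>n. \<Sum>i<n. f (Suc i) x - f i x)"
      by (simp add: summable_iff_convergent)
    then have "convergent (\<lambda>n. f n x - f 0 x)"
      by (subst (asm) sum_lessThan_telescope[of "\<lambda>n. f n x" for x])
    then have "convergent (\<lambda>n. (f n x - f 0 x) + f 0 x)"
      by (intro convergent_add convergent_const)
    then show ?case
      by (simp add: F_def convergent_LIMSEQ_iff)
  qed
  have [measurable]: "F \<in> borel_measurable borel"
    unfolding F_def by measurable
  have "square_integrable F"
  proof (rule square_integrable_bound)
    show "integrable lborel (\<lambda>x. (norm (g x))\<^sup>2)"
      using sqg by (simp add: square_integrable_def)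
    have "AE x in lborel. \<forall>n. norm (f n x) \<le> norm (g x)"
      using bound by (simp add: AE_all_countable)
    with lim show "AE x in lborel. (norm (F x))\<^sup>2 \<le> (norm (g x))\<^sup>2"
    proof eventually_elim
      case (elim x)
      have "norm (F x) \<le> norm (g x)"
        using tendsto_norm[OF elim(1)] elim(2) by (intro LIMSEQ_le_const2) auto
      then show ?case by (intro power_mono) auto
    qed
  qed measurable
  then have "(\<lambda>n. L2_of (f n)) \<longlonglongrightarrow> L2_of F"
    using sqf sqg lim bound by (intro tendsto_L2_of)
  then show ?thesis
    by (auto simp: f_def convergent_def)
qed

instance L2 :: banach
proof
  fix X :: "nat \<Rightarrow> L2"
  assume X: "Cauchy X"
  have "\<exists>r. strict_mono r \<and> (\<forall>n. norm (X (r (Suc n)) - X (r n)) \<le> (1/2)^n)"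
  proof -
    have "\<exists>M. \<forall>m\<ge>M. \<forall>k\<ge>M. norm (X m - X k) < (1/2)^n" for n :: nat
      using X by (intro CauchyD) auto
    then obtain M where M: "\<And>n m k. m \<ge> M n \<Longrightarrow> k \<ge> M n \<Longrightarrow> norm (X m - X k) < (1/2)^n"
      by metis
    define r where "r n = (\<Sum>i\<le>n. Suc (M i))" for n :: nat
    have "M n \<le> r n" for n
      unfolding r_def by (rule order_trans[OF _ member_le_sum[of n]]) auto
    moreover have "strict_mono r"
      by (auto simp: strict_mono_Suc_iff r_def)
    moreover have "r n \<le> r (Suc n)" for n
      by (simp add: r_def)
    ultimately show ?thesis
      using M by (intro exI[of _ r]) (metis less_imp_le order_trans)
  qed
  then obtain r where r: "strict_mono r" "\<And>n. norm (X (r (Suc n)) - X (r n)) \<le> (1/2)^n"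
    by auto
  have "convergent (\<lambda>n. X (r n))"
    using r(2) by (rule L2_Cauchy_subsequence_limit)
  then show "convergent X"
    using Cauchy_converges_subseq[OF X r(1)] by (auto simp: convergent_def o_def)
qed


definition L2_indicator :: "real set \<Rightarrow> L2" where
  "L2_indicator A = L2_of (indicator A)"

definition rat_step :: "(rat \<times> rat \<times> rat \<times> rat) list \<Rightarrow> L2" where
  "rat_step xs = (\<Sum>(p, q, a, b)\<leftarrow>xs.
     Complex (of_rat p) (of_rat q) *\<^sub>C L2_indicator {of_rat a..of_rat b})"

lemma scaleC_scaleC: "c *\<^sub>C d *\<^sub>C f = (c * d) *\<^sub>C f"
  by transfer (auto simp: ae_equal_def algebra_simps
        intro!: square_integrable_cmult square_integrable_cmult_right)

lemma scaleC_zero [simp]: "c *\<^sub>C 0 = 0"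
  using bounded_linear_scaleC[of c] by (rule linear_simps)

lemma scaleC_diff_left: "(c - d) *\<^sub>C f = c *\<^sub>C f - d *\<^sub>C f"
  by transfer (auto simp: ae_equal_def algebra_simps
        intro!: square_integrable_diff square_integrable_cmult square_integrable_cmult_right)

lemma scaleC_one [simp]: "1 *\<^sub>C f = f"
  by transfer (auto simp: ae_equal_def)

lemma rat_step_Cons:
  "rat_step ((p, q, a, b) # xs) =
     Complex (of_rat p) (of_rat q) *\<^sub>C L2_indicator {of_rat a..of_rat b} + rat_step xs"
  by (simp add: rat_step_def)

lemma rat_step_scale:
  "Complex (of_rat p) (of_rat q) *\<^sub>C rat_step xs \<in> range rat_step"
proof (induction xs)
  case Nil
  have "Complex (of_rat p) (of_rat q) *\<^sub>C rat_step [] = rat_step []"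
    by (simp add: rat_step_def)
  then show ?case by (metis rangeI)
next
  case (Cons y ys)
  obtain p' q' a b where y: "y = (p', q', a, b)" by (cases y)
  obtain zs where zs: "Complex (of_rat p) (of_rat q) *\<^sub>C rat_step ys = rat_step zs"
    using Cons by auto
  have c: "Complex (of_rat p) (of_rat q) * Complex (of_rat p') (of_rat q') =
      Complex (of_rat (p * p' - q * q')) (of_rat (p * q' + q * p'))"
    by (simp add: complex_mult of_rat_mult of_rat_diff of_rat_add)
  have "Complex (of_rat p) (of_rat q) *\<^sub>C rat_step (y # ys) =
      rat_step ((p * p' - q * q', p * q' + q * p', a, b) # zs)"
    unfolding y rat_step_Cons scaleC_add scaleC_scaleC c zs ..
  then show ?case by (metis rangeI)
qed

abbreviation rat_steps :: "L2 set" where "rat_steps \<equiv> closure (range rat_step)"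

lemma rat_steps_add:
  assumes "f \<in> rat_steps" "g \<in> rat_steps" shows "f + g \<in> rat_steps"
proof -
  obtain F G where "\<And>n. F n \<in> range rat_step" "F \<longlonglongrightarrow> f" "\<And>n. G n \<in> range rat_step" "G \<longlonglongrightarrow> g"
    using assms unfolding closure_sequential by metis
  moreover have "a + b \<in> range rat_step" if "a \<in> range rat_step" "b \<in> range rat_step" for a b
  proof -
    from that obtain xs ys where "a = rat_step xs" "b = rat_step ys" by auto
    then have "a + b = rat_step (xs @ ys)" by (simp add: rat_step_def)
    then show ?thesis by simp
  qed
  ultimately show ?thesis
    unfolding closure_sequential by (intro exI[of _ "\<lambda>n. F n + G n"]) (auto intro: tendsto_add)
qed

lemma rat_steps_scaleC:
  assumes "f \<in> rat_steps" shows "c *\<^sub>C f \<in> rat_steps"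
proof -
  have step: "c *\<^sub>C g \<in> rat_steps" if "g \<in> range rat_step" for g
    unfolding closure_approachable
  proof (intro allI impI)
    fix e :: real assume e: "0 < e"
    define e' where "e' = e / (2 * (norm g + 1))"
    have e': "0 < e'" using e by (simp add: e'_def add_nonneg_pos)
    obtain p where p: "Re c < of_rat p" "of_rat p < Re c + e'"
      using of_rat_dense[of "Re c" "Re c + e'"] e' by auto
    obtain q where q: "Im c < of_rat q" "of_rat q < Im c + e'"
      using of_rat_dense[of "Im c" "Im c + e'"] e' by auto
    define k where "k = Complex (of_rat p) (of_rat q)"
    have "norm (k - c) \<le> \<bar>Re (k - c)\<bar> + \<bar>Im (k - c)\<bar>"
      by (rule cmod_le)
    also have "\<dots> < 2 * e'"
      using p q by (simp add: k_def)
    finally have kc: "norm (k - c) < 2 * e'" .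
    have "dist (k *\<^sub>C g) (c *\<^sub>C g) = norm (k - c) * norm g"
      by (simp add: dist_norm norm_scaleC flip: scaleC_diff_left)
    also have "\<dots> \<le> norm (k - c) * (norm g + 1)"
      by (intro mult_left_mono) auto
    also have "\<dots> < 2 * e' * (norm g + 1)"
      by (intro mult_strict_right_mono kc add_nonneg_pos) auto
    also have "\<dots> = e"
    proof -
      have "norm g + 1 \<noteq> 0" using norm_ge_zero[of g] by linarith
      then show ?thesis by (simp add: e'_def field_simps)
    qed
    finally show "\<exists>y\<in>range rat_step. dist y (c *\<^sub>C g) < e"
      using rat_step_scale that unfolding k_def by blast
  qed
  have "(\<lambda>f. c *\<^sub>C f) ` closure (range rat_step) \<subseteq> rat_steps"
    using step linear_continuous_on[OF bounded_linear_scaleC[of c]]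
    by (intro image_closure_subset) auto
  then show ?thesis using assms by auto
qed

lemma rat_steps_diff:
  assumes "f \<in> rat_steps" "g \<in> rat_steps" shows "f - g \<in> rat_steps"
  using rat_steps_add[OF assms(1) rat_steps_scaleC[OF assms(2), of "-1"]] scaleC_of_real[of "-1" g]
  by simp

lemma rat_steps_zero: "0 \<in> rat_steps"
proof -
  have "(0::L2) = rat_step []" by (simp add: rat_step_def)
  then have "0 \<in> range rat_step" by (metis rangeI)
  then show ?thesis by (rule subsetD[OF closure_subset])
qed

lemma rat_steps_sum: "(\<And>i. i \<in> A \<Longrightarrow> f i \<in> rat_steps) \<Longrightarrow> sum f A \<in> rat_steps"
  by (induction A rule: infinite_finite_induct) (simp_all add: rat_steps_zero rat_steps_add)

lemma square_integrable_indicator: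
  assumes "A \<in> sets borel" "emeasure lborel A < \<infinity>"
  shows "square_integrable (indicator A)"
proof -
  have "(\<lambda>x. (norm (indicator A x :: complex))\<^sup>2) = indicator A"
    by (auto simp: indicator_def)
  then show ?thesis
    using assms by (auto simp: square_integrable_def)
qed

lemma L2_indicator_limit:
  assumes "\<And>n. A n \<in> sets borel" "\<And>n. A n \<subseteq> B" "B \<in> sets borel" "emeasure lborel B < \<infinity>"
    and "C \<in> sets borel" "C \<subseteq> B"
    and "\<And>x. (\<lambda>n. indicator (A n) x :: complex) \<longlonglongrightarrow> indicator C x"
  shows "(\<lambda>n. L2_indicator (A n)) \<longlonglongrightarrow> L2_indicator C"
proof -
  have *: "emeasure lborel S < \<infinity>" if "S \<subseteq> B" for S
    using emeasure_mono[OF that, of lborel] assms(3,4) by (simp add: order.strict_trans1)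
  show ?thesis
    unfolding L2_indicator_def
  proof (rule tendsto_L2_of)
    show "square_integrable (indicator B)"
      using assms by (intro square_integrable_indicator)
    show "AE x in lborel. norm (indicator (A i) x :: complex) \<le> norm (indicator B x :: complex)" for i
      using assms(2)[of i] by (auto simp: indicator_def)
  qed (use assms * in \<open>auto intro!: square_integrable_indicator\<close>)
qed

lemma indicator_Icc_in_rat_steps: "L2_indicator {a..b} \<in> rat_steps"
proof -
  have "\<exists>p. a - 1 / real (Suc n) < of_rat p \<and> of_rat p < a" for n
    using of_rat_dense[of "a - 1 / real (Suc n)" a] by auto
  then obtain p where p: "\<And>n. a - 1 / real (Suc n) < of_rat (p n)" "\<And>n. of_rat (p n) < a"
    by metis
  have "\<exists>q. b < of_rat q \<and> of_rat q < b + 1 / real (Suc n)" for n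
    using of_rat_dense[of b "b + 1 / real (Suc n)"] by auto
  then obtain q where q: "\<And>n. b < of_rat (q n)" "\<And>n. of_rat (q n) < b + 1 / real (Suc n)"
    by metis
  have le1: "1 / real (Suc n) \<le> 1" for n by simp
  have "(\<lambda>n. L2_indicator {of_rat (p n)..of_rat (q n)}) \<longlonglongrightarrow> L2_indicator {a..b}"
  proof (rule L2_indicator_limit[where B = "{a - 1..b + 1}"])
    show "{of_rat (p n)..of_rat (q n)} \<subseteq> {a - 1..b + 1}" for n
    proof -
      have "a - 1 \<le> of_rat (p n)" "of_rat (q n) \<le> b + 1"
        using p(1)[of n] q(2)[of n] le1[of n] by linarith+
      then show ?thesis by auto
    qed
    show "(\<lambda>n. indicator {of_rat (p n)..of_rat (q n)} x :: complex) \<longlonglongrightarrow> indicator {a..b} x" for x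
    proof (rule tendsto_eventually)
      have lim: "(\<lambda>n. 1 / real (Suc n)) \<longlonglongrightarrow> 0"
        by (rule LIMSEQ_Suc) (rule lim_1_over_n)
      consider "x < a" | "x > b" | "x \<in> {a..b}" by force
      then show "\<forall>\<^sub>F n in sequentially.
          (indicator {of_rat (p n)..of_rat (q n)} x :: complex) = indicator {a..b} x"
      proof cases
        case 1
        then have "\<forall>\<^sub>F n in sequentially. 1 / real (Suc n) < a - x"
          by (intro order_tendstoD(2)[OF lim]) auto
        then show ?thesis
        proof eventually_elim
          case (elim n)
          then have "x < of_rat (p n)" using p(1)[of n] by linarith
          then show ?case using 1 by auto
        qed
      next
        case 2
        then have "\<forall>\<^sub>F n in sequentially. 1 / real (Suc n) < x - b"
          by (intro order_tendstoD(2)[OF lim]) auto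
        then show ?thesis
        proof eventually_elim
          case (elim n)
          then have "x > of_rat (q n)" using q(2)[of n] by linarith
          then show ?case using 2 by auto
        qed
      next
        case 3
        have "x \<in> {of_rat (p n)..of_rat (q n)}" for n
          using 3 p(2)[of n] q(1)[of n] by simp
        then show ?thesis using 3 by simp
      qed
    qed
  qed (auto simp: emeasure_lborel_Icc_eq)
  moreover have "L2_indicator {of_rat (p n)..of_rat (q n)} \<in> range rat_step" for n
  proof
    have "Complex (of_rat 1) (of_rat 0) = 1" by (simp add: complex_eq_iff)
    then show "L2_indicator {of_rat (p n)..of_rat (q n)} = rat_step [(1, 0, p n, q n)]"
      by (simp add: rat_step_def del: of_rat_1 of_rat_0)
  qed simp
  ultimately show ?thesis
    unfolding closure_sequential by (intro exI conjI allI)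
qed

lemma indicator_bounded_in_rat_steps:
  assumes "A \<in> sets borel"
  shows "L2_indicator (A \<inter> {-r..r}) \<in> rat_steps"
  using assms
proof (induction A rule: borel_set_induct)
  case empty
  show ?case using indicator_Icc_in_rat_steps[of 1 0] by simp
next
  case (interval a b)
  have "{a..b} \<inter> {-r..r} = {max a (-r)..min b r}" by auto
  then show ?case using indicator_Icc_in_rat_steps by simp
next
  case (compl A)
  have fin: "emeasure lborel (B \<inter> {-r..r}) < \<infinity>" if "B \<in> sets borel" for B
    using emeasure_mono[of "B \<inter> {-r..r}" "{-r..r}" lborel]
    by (auto simp: emeasure_lborel_Icc_eq intro: order.strict_trans1)
  have "L2_indicator (- A \<inter> {-r..r}) = L2_indicator {-r..r} - L2_indicator (A \<inter> {-r..r})"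
  proof -
    have "(indicator (- A \<inter> {-r..r}) :: real \<Rightarrow> complex) =
        (\<lambda>x. indicator {-r..r} x - indicator (A \<inter> {-r..r}) x)"
      by (auto simp: indicator_def fun_eq_iff)
    then show ?thesis
      unfolding L2_indicator_def using compl(1) fin[of A] fin[of UNIV]
      by (simp add: L2_of_diff square_integrable_indicator)
  qed
  then show ?case
    using rat_steps_diff[OF indicator_Icc_in_rat_steps compl(2)] by simp
next
  case (union f)
  have fin: "emeasure lborel (B \<inter> {-r..r}) < \<infinity>" if "B \<in> sets borel" for B
    using emeasure_mono[of "B \<inter> {-r..r}" "{-r..r}" lborel]
    by (auto simp: emeasure_lborel_Icc_eq intro: order.strict_trans1)
  have step: "L2_indicator ((\<Union>i<n. f i) \<inter> {-r..r}) \<in> rat_steps" for n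
  proof (induction n)
    case 0
    show ?case using indicator_Icc_in_rat_steps[of 1 0] by simp
  next
    case (Suc n)
    have "f n \<inter> f i = {}" if "i < n" for i
      using union(1) that by (auto simp: disjoint_family_on_def)
    then have disj: "f n \<inter> (\<Union>i<n. f i) = {}" by blast
    have "(indicator ((\<Union>i<Suc n. f i) \<inter> {-r..r}) :: real \<Rightarrow> complex) =
        (\<lambda>x. indicator (f n \<inter> {-r..r}) x + indicator ((\<Union>i<n. f i) \<inter> {-r..r}) x)"
      using disj by (auto simp: lessThan_Suc indicator_def fun_eq_iff)
    moreover have "square_integrable (indicator (f n \<inter> {-r..r}))"
      "square_integrable (indicator ((\<Union>i<n. f i) \<inter> {-r..r}))"
      using union(2) fin by (auto intro!: square_integrable_indicator)
    ultimately have "L2_indicator ((\<Union>i<Suc n. f i) \<inter> {-r..r}) =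
        L2_indicator (f n \<inter> {-r..r}) + L2_indicator ((\<Union>i<n. f i) \<inter> {-r..r})"
      unfolding L2_indicator_def by (simp add: L2_of_add)
    then show ?case
      using rat_steps_add[OF union(3)[of n] Suc] by simp
  qed
  have "(\<lambda>n. L2_indicator ((\<Union>i<n. f i) \<inter> {-r..r})) \<longlonglongrightarrow> L2_indicator ((\<Union>i. f i) \<inter> {-r..r})"
  proof (rule L2_indicator_limit[where B = "{-r..r}"])
    fix x
    show "(\<lambda>n. indicator ((\<Union>i<n. f i) \<inter> {-r..r}) x :: complex)
        \<longlonglongrightarrow> indicator ((\<Union>i. f i) \<inter> {-r..r}) x"
    proof (cases "x \<in> (\<Union>i. f i)")
      case True
      then obtain i where "x \<in> f i" by auto
      then have "\<forall>\<^sub>F n in sequentially. (indicator ((\<Union>i<n. f i) \<inter> {-r..r}) x :: complex)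
          = indicator ((\<Union>i. f i) \<inter> {-r..r}) x"
        by (intro eventually_mono[OF eventually_gt_at_top[of i]]) (auto simp: indicator_def)
      then show ?thesis by (rule tendsto_eventually)
    qed auto
  qed (use union(2) in \<open>auto simp: emeasure_lborel_Icc_eq\<close>)
  then show ?case
    by (rule closed_sequentially[OF closed_closure step])
qed

lemma indicator_in_rat_steps:
  assumes "A \<in> sets borel" "emeasure lborel A < \<infinity>"
  shows "L2_indicator A \<in> rat_steps"
proof -
  have "(\<lambda>n. L2_indicator (A \<inter> {- real n..real n})) \<longlonglongrightarrow> L2_indicator A"
  proof (rule L2_indicator_limit[where B = A])
    fix x
    obtain k where k: "\<bar>x\<bar> \<le> real k" using real_arch_simple by blast
    have "\<forall>\<^sub>F n in sequentially.
        (indicator (A \<inter> {- real n..real n}) x :: complex) = indicator A x"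
      using eventually_ge_at_top[of k]
    proof eventually_elim
      case (elim n)
      then have "x \<in> {- real n..real n}" using k by auto
      then show ?case by (simp add: indicator_def)
    qed
    then show "(\<lambda>n. indicator (A \<inter> {- real n..real n}) x :: complex) \<longlonglongrightarrow> indicator A x"
      by (rule tendsto_eventually)
  qed (use assms in auto)
  then show ?thesis
    by (rule closed_sequentially[OF closed_closure indicator_bounded_in_rat_steps[OF assms(1)]])
qed

lemma simple_in_rat_steps:
  assumes s: "simple_function lborel s" and sq: "square_integrable s"
  shows "L2_of s \<in> rat_steps"
proof -
  have fin: "finite (range s)"
    using simple_functionD(1)[OF s] by simp
  define A where "A y = s -` {y}" for y
  have A: "A y \<in> sets borel" for y
    using simple_functionD(2)[OF s, of "{y}"] by (simp add: A_def)
  have Afin: "emeasure lborel (A y) < \<infinity>" if "y \<noteq> 0" for y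
  proof -
    have "integrable lborel (\<lambda>x. (norm (s x))\<^sup>2 / (norm y)\<^sup>2)"
      using sq by (auto simp: square_integrable_def)
    then have "integrable lborel (indicator (A y) :: real \<Rightarrow> real)"
      by (rule Bochner_Integration.integrable_bound)
         (use A that in \<open>auto simp: A_def indicator_def\<close>)
    then show ?thesis
      using A by (simp add: integrable_indicator_iff)
  qed
  define t where "t y = (\<lambda>x. y * indicator (A y) x)" for y
  have sqt: "square_integrable (t y)" for y
    unfolding t_def
    by (cases "y = 0")
       (auto intro!: square_integrable_cmult square_integrable_indicator A Afin
         simp: square_integrable_zero)
  have "square_integrable (\<lambda>x. \<Sum>y\<in>B. t y x) \<and>
      L2_of (\<lambda>x. \<Sum>y\<in>B. t y x) = (\<Sum>y\<in>B. L2_of (t y))"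
    if "finite B" for B
    using that
  proof (induction B)
    case empty
    then show ?case by (simp add: square_integrable_zero L2_of_def zero_L2.abs_eq)
  next
    case (insert y B)
    then show ?case by (simp add: square_integrable_add L2_of_add sqt)
  qed
  then have sum_t: "L2_of (\<lambda>x. \<Sum>y\<in>range s. t y x) = (\<Sum>y\<in>range s. L2_of (t y))"
    using fin by blast
  have s_eq: "(\<lambda>x. \<Sum>y\<in>range s. t y x) = s"
  proof
    fix x
    have "(\<Sum>y\<in>range s. t y x) = (\<Sum>y\<in>range s. if y = s x then y else 0)"
      by (intro sum.cong) (auto simp: A_def t_def indicator_def)
    then show "(\<Sum>y\<in>range s. t y x) = s x"
      using fin by simp
  qed
  have "L2_of (t y) \<in> rat_steps" for y
  proof (cases "y = 0")
    case True
    then show ?thesis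
      using rat_steps_zero by (simp add: t_def L2_of_def square_integrable_zero zero_L2.abs_eq)
  next
    case False
    then show ?thesis
      using rat_steps_scaleC[OF indicator_in_rat_steps[OF A Afin[OF False]], of y]
        L2_of_cmult[OF square_integrable_indicator[OF A Afin[OF False]], of y]
      by (simp add: t_def L2_indicator_def)
  qed
  then have "(\<Sum>y\<in>range s. L2_of (t y)) \<in> rat_steps"
    by (intro rat_steps_sum)
  then show ?thesis
    by (simp only: sum_t[symmetric] s_eq)
qed

lemma rat_step_dense: "rat_steps = UNIV"
proof -
  have "f \<in> rat_steps" for f
  proof -
    have "\<exists>s. (\<forall>i. simple_function lborel (s i)) \<and>
        (\<forall>x\<in>space lborel. (\<lambda>i. s i x) \<longlonglongrightarrow> rep_L2 f x) \<and>
        (\<forall>i. \<forall>x\<in>space lborel. dist (s i x) 0 \<le> 2 * dist (rep_L2 f x) 0)"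
      by (rule borel_measurable_implies_sequence_metric) simp
    then obtain s where s0: "(\<forall>i. simple_function lborel (s i)) \<and>
        (\<forall>x\<in>space lborel. (\<lambda>i. s i x) \<longlonglongrightarrow> rep_L2 f x) \<and>
        (\<forall>i. \<forall>x\<in>space lborel. dist (s i x) 0 \<le> 2 * dist (rep_L2 f x) 0)" ..
    have s: "\<And>i. simple_function lborel (s i)"
      "\<And>x. (\<lambda>i. s i x) \<longlonglongrightarrow> rep_L2 f x" "\<And>i x. norm (s i x) \<le> 2 * norm (rep_L2 f x)"
      using s0 by simp_all
    have sq2: "square_integrable (\<lambda>x. 2 * rep_L2 f x)"
      by (simp add: square_integrable_cmult)
    have sqs: "square_integrable (s i)" for i
    proof (rule square_integrable_bound)
      show "s i \<in> borel_measurable borel"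
        using borel_measurable_simple_function[OF s(1)] by simp
      show "integrable lborel (\<lambda>x. (norm (2 * rep_L2 f x))\<^sup>2)"
        using sq2 by (simp add: square_integrable_def)
      show "AE x in lborel. (norm (s i x))\<^sup>2 \<le> (norm (2 * rep_L2 f x))\<^sup>2"
        using s(3) by (intro AE_I2 power_mono) (auto simp: norm_mult)
    qed
    have "(\<lambda>i. L2_of (s i)) \<longlonglongrightarrow> L2_of (rep_L2 f)"
      by (rule tendsto_L2_of[OF sqs square_integrable_rep sq2]) (simp_all add: s norm_mult)
    moreover have "L2_of (s i) \<in> rat_steps" for i
      by (rule simple_in_rat_steps[OF s(1) sqs])
    ultimately have "L2_of (rep_L2 f) \<in> rat_steps"
      using closed_sequentially[OF closed_closure, of "\<lambda>i. L2_of (s i)" "range rat_step"] by blast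
    then show ?thesis by simp
  qed
  then show ?thesis by blast
qed

instance L2 :: second_countable_topology
proof
  define B where "B = (\<lambda>(xs, n). ball (rat_step xs) (1 / real (Suc n))) ` UNIV"
  have "topological_basis B"
  proof (rule topological_basisI)
    fix U :: "L2 set" and x assume "open U" "x \<in> U"
    then obtain e where e: "e > 0" "ball x e \<subseteq> U"
      using open_contains_ball by blast
    obtain n where n: "1 / real (Suc n) < e / 2"
      using nat_approx_posE[of "e / 2"] e by auto
    have "x \<in> rat_steps" by (simp add: rat_step_dense)
    moreover have "0 < 1 / real (Suc n)" by simp
    ultimately have "\<exists>y\<in>range rat_step. dist y x < 1 / real (Suc n)"
      unfolding closure_approachable by blast
    then obtain xs where xs: "dist (rat_step xs) x < 1 / real (Suc n)"
      by blast
    have "ball (rat_step xs) (1 / real (Suc n)) \<subseteq> ball x e"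
    proof
      fix y assume "y \<in> ball (rat_step xs) (1 / real (Suc n))"
      then have "dist x y < e"
        using xs n dist_triangle[of x y "rat_step xs"] by (simp add: dist_commute)
      then show "y \<in> ball x e" by simp
    qed
    then show "\<exists>B'\<in>B. x \<in> B' \<and> B' \<subseteq> U"
      using e(2) xs by (intro bexI[of _ "ball (rat_step xs) (1 / real (Suc n))"])
        (auto simp: B_def simp del: of_nat_Suc)
  qed (auto simp: B_def)
  then show "\<exists>B::L2 set set. countable B \<and> open = generate_topology B"
    by (intro exI[of _ B]) (auto simp: B_def topological_basis_imp_subbasis)
qed


section \<open>The harmonic oscillator and its propagator\<close>

definition cinner :: "L2 \<Rightarrow> L2 \<Rightarrow> complex" where
  "cinner f g = (\<integral>x. rep_L2 f x * cnj (rep_L2 g x) \<partial>lborel)"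

primrec hermite_poly :: "nat \<Rightarrow> real poly" where
  "hermite_poly 0 = 1"
| "hermite_poly (Suc n) = [:0, 2:] * hermite_poly n - pderiv (hermite_poly n)"

definition hermite_fun :: "nat \<Rightarrow> real \<Rightarrow> real" where
  "hermite_fun n x = exp (- x\<^sup>2 / 2) * poly (hermite_poly n) x / sqrt (2 ^ n * fact n * sqrt pi)"

lemma hermite_poly_ode:
  "pderiv (pderiv (hermite_poly n)) - [:0, 2:] * pderiv (hermite_poly n)
     + smult (2 * real n) (hermite_poly n) = 0"
proof (induction n)
  case (Suc n)
  define H where "H = hermite_poly n"
  have IH: "pderiv (pderiv H) = [:0, 2:] * pderiv H - smult (2 * real n) H"
    using Suc by (simp add: H_def algebra_simps)
  have d: "pderiv (hermite_poly (Suc n)) = smult (2 * real (Suc n)) H"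
  proof -
    have "pderiv (hermite_poly (Suc n)) =
        smult 2 H + [:0, 2:] * pderiv H - pderiv (pderiv H)"
      by (simp add: H_def pderiv_diff pderiv_mult pderiv_pCons pderiv_smult)
    also have "\<dots> = smult 2 H + smult (2 * real n) H"
      by (simp add: IH)
    also have "\<dots> = smult (2 * real (Suc n)) H"
      by (simp add: algebra_simps flip: smult_add_left)
    finally show ?thesis .
  qed
  show ?case
    unfolding d by (simp add: pderiv_smult smult_diff_right H_def)
qed (simp add: pderiv_1)

lemma hermite_fun_eigenfunction:
  "- deriv (deriv (hermite_fun n)) x + x\<^sup>2 * hermite_fun n x = (2 * real n + 1) * hermite_fun n x"
proof -
  define c where "c = sqrt (2 ^ n * fact n * sqrt pi)"
  define p where "p = poly (hermite_poly n)"
  define p' where "p' = poly (pderiv (hermite_poly n))"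
  define p'' where "p'' = poly (pderiv (pderiv (hermite_poly n)))"
  have "c > 0" by (simp add: c_def)
  have [derivative_intros]: "(p has_real_derivative p' x) (at x)"
    "(p' has_real_derivative p'' x) (at x)" for x
    unfolding p_def p'_def p''_def by (rule poly_DERIV)+
  have h: "hermite_fun n = (\<lambda>x. exp (- x\<^sup>2 / 2) * p x / c)"
    by (auto simp: hermite_fun_def c_def p_def)
  have "(hermite_fun n has_real_derivative exp (- x\<^sup>2 / 2) * (p' x - x * p x) / c) (at x)" for x
    unfolding h using \<open>c > 0\<close>
    by (auto intro!: derivative_eq_intros simp: field_simps)
  then have d: "deriv (hermite_fun n) = (\<lambda>x. exp (- x\<^sup>2 / 2) * (p' x - x * p x) / c)"
    by (auto intro!: DERIV_imp_deriv)
  have "((\<lambda>x. exp (- x\<^sup>2 / 2) * (p' x - x * p x) / c) has_real_derivative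
      exp (- x\<^sup>2 / 2) * (p'' x - 2 * x * p' x + (x\<^sup>2 - 1) * p x) / c) (at x)"
    using \<open>c > 0\<close>
    by (auto intro!: derivative_eq_intros simp: field_simps power2_eq_square)
  then have dd: "deriv (deriv (hermite_fun n)) x =
      exp (- x\<^sup>2 / 2) * (p'' x - 2 * x * p' x + (x\<^sup>2 - 1) * p x) / c"
    unfolding d by (rule DERIV_imp_deriv)
  have "poly (pderiv (pderiv (hermite_poly n)) - [:0, 2:] * pderiv (hermite_poly n)
     + smult (2 * real n) (hermite_poly n)) x = 0"
    unfolding hermite_poly_ode by simp
  then have "p'' x = 2 * x * p' x - 2 * real n * p x"
    by (simp add: p_def p'_def p''_def algebra_simps)
  then have *: "p'' x - 2 * x * p' x + (x\<^sup>2 - 1) * p x = (x\<^sup>2 - 1 - 2 * real n) * p x"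
    by (simp add: algebra_simps)
  show ?thesis
    unfolding dd * using \<open>c > 0\<close> by (simp add: h field_simps)
qed

definition hermite_L2 :: "nat \<Rightarrow> L2" where
  "hermite_L2 n = L2_of (\<lambda>x. complex_of_real (hermite_fun n x))"

text \<open>\<open>e\<^sup>i\<^sup>t\<^sup>H\<close> with \<open>H = -\<Delta> + x\<^sup>2\<close>, by the spectral decomposition of \<open>H\<close> in the orthonormal basis
  of Hermite functions; the series converges in \<open>L\<^sup>2\<close>.\<close>

definition propagator :: "real \<Rightarrow> L2 \<Rightarrow> L2" where
  "propagator t f =
     (\<Sum>n. (cis (t * (2 * real n + 1)) * cinner f (hermite_L2 n)) *\<^sub>C hermite_L2 n)"

section \<open>The trilinear operator\<close>

definition cubic :: "L2 \<Rightarrow> L2 \<Rightarrow> L2 \<Rightarrow> L2" where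
  "cubic f g h = L2_of (\<lambda>x. rep_L2 f x * rep_L2 g x * cnj (rep_L2 h x))"

text \<open>An \<open>L\<^sup>2\<close>-valued Bochner integral. For \<open>f\<^sub>1\<close>, \<open>f\<^sub>2\<close>, \<open>f\<^sub>3\<close> in \<open>L\<^sup>2\<close> the Strichartz estimate
  puts the product under the integral in \<open>L\<^sup>2\<close> for almost every \<open>t\<close>, so the convention in
  \<open>L2_of\<close> only affects a null set of times.\<close>

definition T4 :: "L2 \<Rightarrow> L2 \<Rightarrow> L2 \<Rightarrow> L2" where
  "T4 f\<^sub>1 f\<^sub>2 f\<^sub>3 = (8 / pi) *\<^sub>R
     (LBINT t = - pi / 4..pi / 4.
        propagator (- t) (cubic (propagator t f\<^sub>1) (propagator t f\<^sub>2) (propagator t f\<^sub>3)))"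

section \<open>Function spaces\<close>

definition bracket :: "real \<Rightarrow> real" where
  "bracket x = sqrt (1 + x\<^sup>2)"

definition weighted_Lp :: "real \<Rightarrow> real \<Rightarrow> (real \<Rightarrow> complex) set" where
  "weighted_Lp p s = {f \<in> borel_measurable borel.
     integrable lborel (\<lambda>x. (bracket x powr s * norm (f x)) powr p)}"

definition weighted_Lp_norm :: "real \<Rightarrow> real \<Rightarrow> (real \<Rightarrow> complex) \<Rightarrow> real" where
  "weighted_Lp_norm p s f = (\<integral>x. (bracket x powr s * norm (f x)) powr p \<partial>lborel) powr (1 / p)"

definition weighted_esssup :: "real \<Rightarrow> (real \<Rightarrow> complex) \<Rightarrow> ereal" where
  "weighted_esssup s f = esssup lborel (\<lambda>x. ereal (bracket x powr s * norm (f x)))"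

definition weighted_Linf :: "real \<Rightarrow> (real \<Rightarrow> complex) set" where
  "weighted_Linf s = {f \<in> borel_measurable borel. weighted_esssup s f < \<infinity>}"

lemma bracket_ge_1: "1 \<le> bracket x"
  by (simp add: bracket_def)

lemma bracket_pos: "0 < bracket x"
  using bracket_ge_1[of x] by linarith

lemma bracket_measurable [measurable]: "bracket \<in> borel_measurable borel"
  unfolding bracket_def by measurable

lemma integrable_bracket_powr:
  assumes "1 < r" shows "integrable lborel (\<lambda>x. bracket x powr (- r))"
proof -
  define h where "h x = (1 + x) powr (- r) * indicator {0..} x" for x :: real
  have [measurable]: "h \<in> borel_measurable borel"
    unfolding h_def by measurable
  have "(\<integral>\<^sup>+x. ennreal ((1 + x) powr (- r)) * indicator {0..} x \<partial>lborel)
      = ennreal (0 - (- ((1 + 0) powr (1 - r)) / (r - 1)))"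
  proof (rule nn_integral_FTC_atLeast)
    show "((\<lambda>x. - ((1 + x) powr (1 - r)) / (r - 1)) has_real_derivative (1 + x) powr (- r)) (at x)"
      if "0 \<le> x" for x
    proof -
      have "((\<lambda>x. 1 + x) has_real_derivative 1) (at x)"
        by (auto intro!: derivative_eq_intros)
      then have "((\<lambda>x. (1 + x) powr (1 - r)) has_real_derivative
          (1 - r) * (1 + x) powr (1 - r - of_nat 1) * 1) (at x)"
        using that by (intro DERIV_fun_powr) auto
      from DERIV_cdivide[OF DERIV_minus[OF this], of "r - 1"] show ?thesis
        using assms by (simp flip: mult_minus_left)
    qed
    have "((\<lambda>x. (1 + x) powr (1 - r)) \<longlongrightarrow> 0) at_top"
      using assms
      by (intro tendsto_neg_powr filterlim_tendsto_add_at_top[OF tendsto_const filterlim_ident]) auto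
    from tendsto_divide[OF tendsto_minus[OF this] tendsto_const, of "r - 1"]
    show "((\<lambda>x. - ((1 + x) powr (1 - r)) / (r - 1)) \<longlongrightarrow> 0) at_top"
      using assms by simp
  qed auto
  then have "(\<integral>\<^sup>+x. ennreal (h x) \<partial>lborel) < \<infinity>"
    by (simp add: h_def ennreal_mult ennreal_indicator)
  then have h: "integrable lborel h"
    by (intro integrableI_nonneg) (auto simp: h_def)
  have h': "integrable lborel (\<lambda>x. h (0 + (-1) * x))"
    by (rule lborel_integrable_real_affine[OF h]) simp
  show ?thesis
  proof (rule Bochner_Integration.integrable_bound)
    show "integrable lborel (\<lambda>x. 2 powr (r / 2) * (h x + h (0 + (-1) * x)))"
      using h h' by auto
    show "AE x in lborel. norm (bracket x powr (- r))
        \<le> norm (2 powr (r / 2) * (h x + h (0 + (-1) * x)))"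
    proof (rule AE_I2)
      fix x :: real
      have "(1 + \<bar>x\<bar>)\<^sup>2 \<le> 2 * (1 + x\<^sup>2)"
        using sum_squares_bound[of 1 "\<bar>x\<bar>"] by (simp add: power2_sum)
      then have "((1 + \<bar>x\<bar>) / sqrt 2)\<^sup>2 \<le> 1 + x\<^sup>2"
        by (simp add: power_divide)
      then have "(1 + \<bar>x\<bar>) / sqrt 2 \<le> bracket x"
        unfolding bracket_def by (rule real_le_rsqrt)
      then have "bracket x powr (- r) \<le> ((1 + \<bar>x\<bar>) / sqrt 2) powr (- r)"
        using assms by (intro powr_mono2') auto
      also have "\<dots> = 2 powr (r / 2) * (1 + \<bar>x\<bar>) powr (- r)"
        by (simp add: powr_divide powr_minus powr_half_sqrt[symmetric] powr_powr field_simps)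
      also have "\<dots> \<le> 2 powr (r / 2) * (h x + h (0 + (-1) * x))"
        by (intro mult_left_mono) (auto simp: h_def indicator_def)
      finally show "norm (bracket x powr (- r))
          \<le> norm (2 powr (r / 2) * (h x + h (0 + (-1) * x)))"
        by simp
    qed
  qed measurable
qed

text \<open>The following embeddings show that realising the weighted spaces as sets of \<open>L\<^sup>2\<close> classes
  below loses no function.\<close>

lemma weighted_Lp_square_integrable:
  assumes f: "f \<in> weighted_Lp p s" and p: "2 \<le> p" and s: "1 / 2 - 1 / p < s \<or> (p = 2 \<and> 0 \<le> s)"
  shows "square_integrable f"
proof (rule square_integrable_bound)
  show [measurable]: "f \<in> borel_measurable borel"
    using f by (simp add: weighted_Lp_def)
  define W where "W x = (bracket x powr s * norm (f x)) powr p" for x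
  have W: "integrable lborel W"
    using f by (simp add: weighted_Lp_def W_def[abs_def])
  define V where "V x = (if p = 2 then 0 else bracket x powr (- (2 * s * p / (p - 2))))" for x
  have V: "integrable lborel V"
  proof (cases "p = 2")
    case False
    then have "1 < 2 * s * p / (p - 2)"
      using p s by (simp add: field_simps)
    then show ?thesis
      using integrable_bracket_powr[of "2 * s * p / (p - 2)"] False by (simp add: V_def[abs_def])
  qed (simp add: V_def[abs_def])
  show "integrable lborel (\<lambda>x. W x + V x)"
    using W V by simp
  have "(norm (f x))\<^sup>2 \<le> W x + V x" for x
  proof (cases "p = 2")
    case True
    then have "0 \<le> s"
      using s by auto
    then have "1 \<le> bracket x powr s"
      by (intro ge_one_powr_ge_zero bracket_ge_1)
    then have "norm (f x) \<le> bracket x powr s * norm (f x)"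
      using mult_right_mono[of 1 "bracket x powr s" "norm (f x)"] by simp
    then have "(norm (f x))\<^sup>2 \<le> (bracket x powr s * norm (f x))\<^sup>2"
      by (intro power_mono) auto
    also have "\<dots> = W x"
      using True by (simp add: W_def)
    finally show ?thesis
      using True by (simp add: V_def)
  next
    case False
    with p have p: "2 < p" by simp
    define A where "A = bracket x powr s * norm (f x)"
    define B where "B = bracket x powr (- 2 * s)"
    have AB: "(norm (f x))\<^sup>2 = A\<^sup>2 * B"
      using bracket_pos[of x]
      by (simp add: A_def B_def power_mult_distrib powr_minus powr_add power2_eq_square
          flip: mult_2) (simp add: field_simps flip: powr_add)
    have "A\<^sup>2 * B \<le> (A\<^sup>2) powr (p / 2) / (p / 2) + B powr (p / (p - 2)) / (p / (p - 2))"
      using p by (intro Youngs_inequality) (auto simp: field_simps B_def)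
    also have "(A\<^sup>2) powr (p / 2) = W x"
    proof -
      have "A\<^sup>2 = A powr 2"
        by (simp add: A_def)
      then show ?thesis
        by (simp add: W_def powr_powr flip: A_def)
    qed
    also have "B powr (p / (p - 2)) = V x"
      using False by (simp add: B_def V_def powr_powr)
    also have "W x / (p / 2) \<le> W x"
    proof -
      have "0 \<le> W x" by (simp add: W_def)
      then have "2 * W x \<le> p * W x"
        using p by (intro mult_right_mono) auto
      then show ?thesis
        using p by (simp add: field_simps)
    qed
    also have "V x / (p / (p - 2)) \<le> V x"
    proof -
      have "0 \<le> V x" by (simp add: V_def)
      then have "(p - 2) * V x \<le> p * V x"
        by (intro mult_right_mono) auto
      then show ?thesis
        using p by (simp add: field_simps)
    qed
    finally show ?thesis
      using AB by simp
  qed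
  then show "AE x in lborel. (norm (f x))\<^sup>2 \<le> W x + V x"
    by simp
qed

lemma weighted_Linf_square_integrable:
  assumes f: "f \<in> weighted_Linf s" and s: "1 / 2 < s"
  shows "square_integrable f"
proof -
  obtain C :: real where C: "weighted_esssup s f < ereal C"
    using f ereal_dense2[of "weighted_esssup s f" \<infinity>] by (auto simp: weighted_Linf_def)
  show ?thesis
  proof (rule square_integrable_bound)
    show "f \<in> borel_measurable borel"
      using f by (simp add: weighted_Linf_def)
    show "integrable lborel (\<lambda>x. C\<^sup>2 * bracket x powr (- (2 * s)))"
      using integrable_bracket_powr[of "2 * s"] s by auto
    have "AE x in lborel. ereal (bracket x powr s * norm (f x)) \<le> weighted_esssup s f"
      unfolding weighted_esssup_def by (rule esssup_AE)
    then show "AE x in lborel. (norm (f x))\<^sup>2 \<le> C\<^sup>2 * bracket x powr (- (2 * s))"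
    proof eventually_elim
      case (elim x)
      then have "bracket x powr s * norm (f x) \<le> C"
        using C by (metis ereal_less_eq(3) less_imp_le order_trans)
      then have "(bracket x powr s * norm (f x))\<^sup>2 \<le> C\<^sup>2"
        by (intro power_mono) auto
      moreover have "(bracket x powr s)\<^sup>2 = bracket x powr (2 * s)"
        by (simp add: power2_eq_square flip: powr_add)
      ultimately have "bracket x powr (2 * s) * (norm (f x))\<^sup>2 \<le> C\<^sup>2"
        by (simp add: power_mult_distrib)
      then show ?case
        using bracket_pos[of x] by (simp add: powr_minus field_simps)
    qed
  qed
qed

definition Lp_space :: "real \<Rightarrow> real \<Rightarrow> L2 set" where
  "Lp_space p s = {f. rep_L2 f \<in> weighted_Lp p s}"

definition Lp_norm :: "real \<Rightarrow> real \<Rightarrow> L2 \<Rightarrow> real" where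
  "Lp_norm p s f = weighted_Lp_norm p s (rep_L2 f)"

definition Linf_space :: "real \<Rightarrow> L2 set" where
  "Linf_space s = {f. rep_L2 f \<in> weighted_Linf s}"

definition Linf_norm :: "real \<Rightarrow> L2 \<Rightarrow> real" where
  "Linf_norm s f = real_of_ereal (weighted_esssup s (rep_L2 f))"

lemma L2_of_in_Lp_space:
  assumes f: "square_integrable f"
  shows "L2_of f \<in> Lp_space p s \<longleftrightarrow> f \<in> weighted_Lp p s"
    and "Lp_norm p s (L2_of f) = weighted_Lp_norm p s f"
proof -
  have [measurable]: "f \<in> borel_measurable borel"
    using f by (rule square_integrable_measurable)
  have ae: "AE x in lborel. (bracket x powr s * norm (rep_L2 (L2_of f) x)) powr p =
      (bracket x powr s * norm (f x)) powr p"
    using rep_L2_of[OF f] by eventually_elim simp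
  have "integrable lborel (\<lambda>x. (bracket x powr s * norm (rep_L2 (L2_of f) x)) powr p) \<longleftrightarrow>
      integrable lborel (\<lambda>x. (bracket x powr s * norm (f x)) powr p)"
    by (intro integrable_cong_AE ae) measurable
  moreover have "(\<integral>x. (bracket x powr s * norm (rep_L2 (L2_of f) x)) powr p \<partial>lborel) =
      (\<integral>x. (bracket x powr s * norm (f x)) powr p \<partial>lborel)"
    by (intro integral_cong_AE ae) measurable
  ultimately show "L2_of f \<in> Lp_space p s \<longleftrightarrow> f \<in> weighted_Lp p s"
    and "Lp_norm p s (L2_of f) = weighted_Lp_norm p s f"
    unfolding Lp_space_def weighted_Lp_def Lp_norm_def weighted_Lp_norm_def
    by simp_all
qed

lemma L2_of_in_Linf_space:
  assumes f: "square_integrable f"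
  shows "L2_of f \<in> Linf_space s \<longleftrightarrow> f \<in> weighted_Linf s"
    and "Linf_norm s (L2_of f) = real_of_ereal (weighted_esssup s f)"
proof -
  have [measurable]: "f \<in> borel_measurable borel"
    using f by (rule square_integrable_measurable)
  have "AE x in lborel. ereal (bracket x powr s * norm (rep_L2 (L2_of f) x)) =
      ereal (bracket x powr s * norm (f x))"
    using rep_L2_of[OF f] by eventually_elim simp
  then have "weighted_esssup s (rep_L2 (L2_of f)) = weighted_esssup s f"
    unfolding weighted_esssup_def by (intro esssup_AE_cong) auto
  then show "L2_of f \<in> Linf_space s \<longleftrightarrow> f \<in> weighted_Linf s"
    and "Linf_norm s (L2_of f) = real_of_ereal (weighted_esssup s f)"
    by (simp_all add: Linf_space_def Linf_norm_def weighted_Linf_def)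
qed

text \<open>The Fourier--Plancherel transform: the \<open>L\<^sup>2\<close> limit of the Fourier integrals of the truncations.\<close>

definition fourier :: "L2 \<Rightarrow> L2" where
  "fourier f = lim (\<lambda>n::nat. L2_of (\<lambda>\<xi>. complex_of_real (1 / sqrt (2 * pi)) *
     (LBINT x = - real n..real n. rep_L2 f x * cis (- (x * \<xi>)))))"

definition sobolev :: "real \<Rightarrow> L2 set" where
  "sobolev \<sigma> = {f. fourier f \<in> Lp_space 2 \<sigma>}"

definition sobolev_norm :: "real \<Rightarrow> L2 \<Rightarrow> real" where
  "sobolev_norm \<sigma> f = Lp_norm 2 \<sigma> (fourier f)"

section \<open>The Cauchy problem\<close>

text \<open>In the following, a space \<open>X\<close> with norm \<open>N\<close> is a subset of \<open>L\<^sup>2\<close>. The Duhamel integral is taken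
  in \<open>L\<^sup>2\<close>, into which all the spaces under consideration embed continuously. The interval
  integral is oriented, so that \<open>t < 0\<close> is allowed.\<close>

definition solution ::
  "L2 set \<Rightarrow> (L2 \<Rightarrow> real) \<Rightarrow> real set \<Rightarrow> L2 \<Rightarrow> (real \<Rightarrow> L2) \<Rightarrow> bool" where
  "solution X N I u\<^sub>0 u \<longleftrightarrow>
     (\<forall>t\<in>I. u t \<in> X) \<and>
     (\<forall>t\<in>I. ((\<lambda>s. N (u s - u t)) \<longlongrightarrow> 0) (at t within I)) \<and>
     (\<forall>t\<in>I. u t = u\<^sub>0 - \<i> *\<^sub>C (LBINT s = 0..t. T4 (u s) (u s) (u s)))"

definition unique_solutions :: "L2 set \<Rightarrow> (L2 \<Rightarrow> real) \<Rightarrow> bool" where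
  "unique_solutions X N \<longleftrightarrow>
     (\<forall>u\<^sub>0\<in>X. \<forall>I u v. is_interval I \<and> 0 \<in> I \<and> solution X N I u\<^sub>0 u \<and> solution X N I u\<^sub>0 v \<longrightarrow>
        (\<forall>t\<in>I. u t = v t))"

text \<open>\<open>S\<close> is the map from data to solutions.\<close>

definition locally_wellposed :: "L2 set \<Rightarrow> (L2 \<Rightarrow> real) \<Rightarrow> bool" where
  "locally_wellposed X N \<longleftrightarrow>
     unique_solutions X N \<and>
     (\<forall>u\<^sub>0\<in>X. \<exists>T>0. \<exists>\<delta>>0. \<exists>S. let B = {v \<in> X. N (v - u\<^sub>0) < \<delta>} in
        (\<forall>v\<in>B. solution X N {-T..T} v (S v)) \<and>
        (\<forall>v\<in>B. \<forall>\<epsilon>>0. \<exists>\<eta>>0. \<forall>w\<in>B. N (w - v) < \<eta> \<longrightarrow>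
           (\<forall>t\<in>{-T..T}. N (S w t - S v t) < \<epsilon>)))"

definition globally_wellposed :: "L2 set \<Rightarrow> (L2 \<Rightarrow> real) \<Rightarrow> bool" where
  "globally_wellposed X N \<longleftrightarrow>
     unique_solutions X N \<and>
     (\<exists>S. (\<forall>v\<in>X. solution X N UNIV v (S v)) \<and>
        (\<forall>v\<in>X. \<forall>T>0. \<forall>\<epsilon>>0. \<exists>\<eta>>0. \<forall>w\<in>X. N (w - v) < \<eta> \<longrightarrow>
           (\<forall>t\<in>{-T..T}. N (S w t - S v t) < \<epsilon>)))"

end

(*
Mehler's formula writes e^{itH} as an oscillatory integral operator. Inserting it in the trilinear
operator T, the time integral becomes an oscillatory integral that is computed up to a bound,
and T(f, g, h) is dominated pointwise by the positive operator with kernel |a b|^{-1/2},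
  T+(F, G, H)(x) = int int |a|^{-1/2} |b|^{-1/2} F(x + a) G(x + b) H(x + a + b) da db.
A weight <x>^s may be moved to one of the three factors. What remains is Schur's test (p > 2, the
other two factors being bounded in the Kato norm), a direct bound (p = infinity), or a weighted
Cauchy--Schwarz inequality (p = 2). Since the Fourier transform is e^{-i pi H / 4} up to a phase, it
intertwines T with the same operator over the time interval shifted by pi / 4, which settles H^sigma.
The Cauchy problem is solved by Picard iteration for a nonlinearity that is truncated in L^2; the bounds
in X pass to the limit because balls of X are closed in L^2.
*)
theory Submission
  imports Defs "HOL-Probability.Probability" "HOL-Real_Asymp.Real_Asymp"
begin

text \<open>Absolute values cannot be put inside the time integral: at a fixed time the kernel of
  the quartic form has size \<open>1 / (2 * pi * \<bar>sin (2 * t)\<bar>)\<close>, whose time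
  integral diverges logarithmically. The phase is a b cot(2t); its oscillation leaves a logarithm of
  1 / |a b| where the product is small and a decay like 1 / |a b| where it is large. Both are
  dominated by |a b|^(-1/2), which factorises and is homogeneous. That T is defined and bounded on
  L^2 is settled beforehand by a Strichartz estimate, L^2 in time and L^\<infinity> in space; on
  bounded time intervals it needs only the local integrability of |t|^(-1/2). It also justifies the
  passage from bounded functions of compact support to all of L^2. The range s > 1/2 - 1/p is what
  makes the Kato norm finite for p > 2. At p = 2 Hoelder's inequality fails logarithmically, whence
  the separate argument. Persistence in H^\<sigma> rests on an estimate that is linear in the
  H^\<sigma> norm, the other two factors entering only through the conserved L^2 norm.\<close>

abbreviation "bmeas \<equiv> borel_measurable borel"
abbreviation "cplx \<equiv> complex_of_real"
abbreviation nn_lborel :: "('a::euclidean_space => ennreal) => ennreal" (binder "NN " 10)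
 where "nn_lborel f \<equiv> nn_integral lborel f"


text \<open>All integrations by parts on the line (Hermite functions, complex Gaussians, the Mehler
  kernel) take this form; the boundary terms are the two limits of the antiderivative.\<close>

lemma integral_derivative_decay:
 fixes F f :: "real => 'a::euclidean_space"
 assumes F: "\<And>x. (F has_vector_derivative f x) (at x)"
  and f: "continuous_on UNIV f" "integrable lborel f"
  and lim: "(F \<longlongrightarrow> 0) at_top" "(F \<longlongrightarrow> 0) at_bot"
 shows "(LBINT x. f x) = 0"
proof -
 have "(LBINT x=-\<infinity>..\<infinity>. f x) = 0 - 0"
 proof (rule interval_integral_FTC_integrable)
  show "isCont f x" for x
   using f(1) by (simp add: continuous_on_eq_continuous_at)
  show "set_integrable lborel (einterval (- \<infinity>) \<infinity>) f"
   using f(2) by (simp add: set_integrable_def einterval_iff)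
  show "((F \<circ> real_of_ereal) \<longlongrightarrow> 0) (at_right (- \<infinity>))"
   using lim(2) by (simp add: ereal_tendsto_simps)
  show "((F \<circ> real_of_ereal) \<longlongrightarrow> 0) (at_left \<infinity>)"
   using lim(1) by (simp add: ereal_tendsto_simps)
 qed (use F in auto)
 then show ?thesis
  by (simp add: interval_lebesgue_integral_def set_lebesgue_integral_def)
qed

section \<open>Integrability and decay of polynomials times Gaussians\<close>

lemma integrable_monomial_gauss:
 assumes "0 < a"
 shows "integrable lborel (%x::real. x ^ k * exp (- (a * x\<^sup>2)))"
proof -
 define s where "s = 1 / sqrt (2 * a)"
 have s: "0 < s" "s\<^sup>2 = 1 / (2 * a)"
  using assms by (simp_all add: s_def power_divide)
 have "integrable lborel (%x. sqrt (2 * pi * s\<^sup>2) * (normal_density 0 s x * (x - 0) ^ k))"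
  by (intro integrable_mult_right integrable_normal_moment s)
 moreover have "sqrt (2 * pi * s\<^sup>2) * (normal_density 0 s x * (x - 0) ^ k)
   = x ^ k * exp (- (a * x\<^sup>2))" for x
  using assms s by (simp add: normal_density_def)
 ultimately show ?thesis by (simp only:)
qed

lemma integrable_poly_gauss:
 assumes "0 < a"
 shows "integrable lborel (%x::real. poly p x * exp (- (a * x\<^sup>2)))"
proof -
 have "integrable lborel (%x. \<Sum>i\<le>degree p. coeff p i * (x ^ i * exp (- (a * x\<^sup>2))))"
  by (intro Bochner_Integration.integrable_sum integrable_mult_right integrable_monomial_gauss assms)
 then show ?thesis
  by (simp add: poly_altdef sum_distrib_right mult.assoc)
qed

lemma monomial_gauss_tendsto:
 assumes "0 < a"
 shows "((%x::real. x ^ k * exp (- (a * x\<^sup>2))) \<longlongrightarrow> 0) at_top"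
  and "((%x::real. x ^ k * exp (- (a * x\<^sup>2))) \<longlongrightarrow> 0) at_bot"
proof -
 show top: "((%x::real. x ^ k * exp (- (a * x\<^sup>2))) \<longlongrightarrow> 0) at_top"
  using assms by real_asymp
 have "((%x::real. (-1) ^ k * (x ^ k * exp (- (a * x\<^sup>2)))) \<longlongrightarrow> (-1) ^ k * 0) at_top"
  by (intro tendsto_mult_left top)
 then show "((%x::real. x ^ k * exp (- (a * x\<^sup>2))) \<longlongrightarrow> 0) at_bot"
  by (simp add: filterlim_at_bot_mirror mult.assoc[symmetric] power_mult_distrib[symmetric] del: mult.assoc)
qed

lemma poly_gauss_tendsto:
 assumes "0 < a"
 shows "((%x::real. poly p x * exp (- (a * x\<^sup>2))) \<longlongrightarrow> 0) at_top"
  and "((%x::real. poly p x * exp (- (a * x\<^sup>2))) \<longlongrightarrow> 0) at_bot"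
proof -
 have eq: "poly p x * exp (- (a * x\<^sup>2)) = (\<Sum>i\<le>degree p. coeff p i * (x ^ i * exp (- (a * x\<^sup>2))))" for x
  by (simp add: poly_altdef sum_distrib_right mult.assoc)
 show "((%x::real. poly p x * exp (- (a * x\<^sup>2))) \<longlongrightarrow> 0) at_top"
  "((%x::real. poly p x * exp (- (a * x\<^sup>2))) \<longlongrightarrow> 0) at_bot"
  unfolding eq
  by (rule tendsto_null_sum, rule tendsto_mult_right_zero, rule monomial_gauss_tendsto, rule assms)+
qed

section \<open>Hermite functions\<close>

text \<open>Differentiating the defining recursion produces a second derivative; adding the
  vanishing expression of \<open>hermite_poly_ode\<close> removes it.\<close>

lemma pderiv_hermite_Suc: "pderiv (hermite_poly (Suc n)) = smult (2 * real (Suc n)) (hermite_poly n)"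
proof -
 have "pderiv (hermite_poly (Suc n)) =
   smult 2 (hermite_poly n) - (pderiv (pderiv (hermite_poly n)) - [:0, 2:] * pderiv (hermite_poly n)
   + smult (2 * real n) (hermite_poly n)) + smult (2 * real n) (hermite_poly n)"
  by (simp add: pderiv_diff pderiv_mult pderiv_pCons pderiv_smult)
 also have "... = smult (2 * real (Suc n)) (hermite_poly n)"
  unfolding hermite_poly_ode by (simp add: algebra_simps flip: smult_add_left)
 finally show ?thesis .
qed

lemma pderiv_hermite: "pderiv (hermite_poly n) = smult (2 * real n) (hermite_poly (n - 1))"
 by (cases n) (simp_all add: pderiv_hermite_Suc pderiv_1 del: hermite_poly.simps(2))

lemma poly_hermite_recurrence:
 "poly (hermite_poly (Suc n)) x =
   2 * x * poly (hermite_poly n) x - 2 * real n * poly (hermite_poly (n - 1)) x"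
 by (simp add: pderiv_hermite)

text \<open>By the recursion, \<open>hermite_poly (Suc n)\<close> times exp(-x^2) is minus the
  derivative of \<open>hermite_poly n\<close> times exp(-x^2). The difference of the two integrands
  is therefore the derivative of \<open>hermite_poly n * q\<close> times the Gaussian.\<close>

lemma integral_hermite_Suc_mult:
 "(LBINT x. poly (hermite_poly (Suc n) * q) x * exp (- x\<^sup>2))
   = (LBINT x. poly (hermite_poly n * pderiv q) x * exp (- x\<^sup>2))"
proof -
 note I = integrable_poly_gauss[of 1, simplified]
 have "(LBINT x. poly (hermite_poly n * pderiv q - hermite_poly (Suc n) * q) x * exp (- x\<^sup>2)) = 0"
 proof (rule integral_derivative_decay)
  show "((%x. poly (hermite_poly n * q) x * exp (- x\<^sup>2)) has_vector_derivative
   poly (hermite_poly n * pderiv q - hermite_poly (Suc n) * q) x * exp (- x\<^sup>2)) (at x)" for x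
   unfolding has_real_derivative_iff_has_vector_derivative[symmetric]
   by (auto intro!: derivative_eq_intros poly_DERIV simp: algebra_simps)
  show "((%x. poly (hermite_poly n * q) x * exp (- x\<^sup>2)) \<longlongrightarrow> 0) at_top"
   "((%x. poly (hermite_poly n * q) x * exp (- x\<^sup>2)) \<longlongrightarrow> 0) at_bot"
   using poly_gauss_tendsto[of 1 "hermite_poly n * q"] by simp_all
 qed (auto intro!: continuous_intros I simp del: poly_mult poly_diff)
 also have "(LBINT x. poly (hermite_poly n * pderiv q - hermite_poly (Suc n) * q) x * exp (- x\<^sup>2))
   = (LBINT x. poly (hermite_poly n * pderiv q) x * exp (- x\<^sup>2) - poly (hermite_poly (Suc n) * q) x * exp (- x\<^sup>2))"
  by (simp only: poly_diff left_diff_distrib)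
 also have "... = (LBINT x. poly (hermite_poly n * pderiv q) x * exp (- x\<^sup>2))
   - (LBINT x. poly (hermite_poly (Suc n) * q) x * exp (- x\<^sup>2))"
  by (intro Bochner_Integration.integral_diff I)
 finally show ?thesis by simp
qed

lemma integral_gauss: "(LBINT x. exp (- x\<^sup>2)) = sqrt pi"
proof -
 have "(LBINT x. normal_density 0 (1 / sqrt 2) x) = 1"
  by (rule integral_normal_density) simp
 moreover have "normal_density 0 (1 / sqrt 2) x = exp (- x\<^sup>2) / sqrt pi" for x
  by (simp add: normal_density_def power_divide)
 ultimately show ?thesis by (simp add: field_simps)
qed

text \<open>Integration by parts lowers the left index and, since H_m' = 2 m H_(m-1), also the right
  one. The induction ends at the Gaussian integral or at the derivative of the constant 1.\<close>

lemma integral_hermite_mult: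
 "(LBINT x. poly (hermite_poly n * hermite_poly m) x * exp (- x\<^sup>2))
   = (if n = m then 2 ^ n * fact n * sqrt pi else 0)"
proof (induction n arbitrary: m)
 case 0
 show ?case
 proof (cases m)
  case 0 then show ?thesis by (simp add: integral_gauss)
 next
  case (Suc k)
  have "(LBINT x. poly (hermite_poly 0 * hermite_poly m) x * exp (- x\<^sup>2))
   = (LBINT x. poly (hermite_poly (Suc k) * 1) x * exp (- x\<^sup>2))"
   using Suc by simp
  also have "... = 0"
   by (subst integral_hermite_Suc_mult) (simp add: pderiv_1)
  finally show ?thesis using Suc by simp
 qed
next
 case (Suc n)
 have "(LBINT x. poly (hermite_poly (Suc n) * hermite_poly m) x * exp (- x\<^sup>2))
  = (LBINT x. 2 * real m * (poly (hermite_poly n * hermite_poly (m - 1)) x * exp (- x\<^sup>2)))"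
  unfolding integral_hermite_Suc_mult pderiv_hermite by (simp add: mult_ac)
 also have "... = 2 * real m * (LBINT x. poly (hermite_poly n * hermite_poly (m - 1)) x * exp (- x\<^sup>2))"
  by simp
 finally show ?case
  unfolding Suc by (cases m) (auto simp: fact_Suc)
qed

definition hermite_norm :: "nat => real" where
 "hermite_norm n = sqrt (2 ^ n * fact n * sqrt pi)"

lemma hermite_norm_pos: "0 < hermite_norm n"
 by (simp add: hermite_norm_def)

lemma hermite_fun_alt: "hermite_fun n x = poly (hermite_poly n) x * exp (- (1/2 * x\<^sup>2)) / hermite_norm n"
 by (simp add: hermite_fun_def hermite_norm_def)

lemma hermite_fun_measurable [measurable]: "hermite_fun n \<in> bmeas"
 unfolding hermite_fun_alt[abs_def]
 by (intro borel_measurable_continuous_onI continuous_intros) (use hermite_norm_pos in \<open>auto simp: less_le\<close>)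

lemma integrable_hermite_fun: "integrable lborel (hermite_fun n)"
 unfolding hermite_fun_alt[abs_def] by (intro integrable_divide integrable_poly_gauss) simp

lemma hermite_fun_mult:
 "hermite_fun n x * hermite_fun m x =
   poly (hermite_poly n * hermite_poly m) x * exp (- x\<^sup>2) / (hermite_norm n * hermite_norm m)"
proof -
 have "exp (- (1/2 * x\<^sup>2)) * exp (- (1/2 * x\<^sup>2)) = exp (- x\<^sup>2)"
  by (simp flip: exp_add)
 then show ?thesis by (simp add: hermite_fun_alt)
qed

lemma integral_hermite_fun_mult:
 "(LBINT x. hermite_fun n x * hermite_fun m x) = (if n = m then 1 else 0)"
proof -
 have "hermite_norm m * hermite_norm m = 2 ^ m * fact m * sqrt pi"
  by (simp add: hermite_norm_def)
 then show ?thesis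
  unfolding hermite_fun_mult using hermite_norm_pos[of m]
  by (simp add: integral_hermite_mult del: poly_mult)
qed

lemma square_integrable_hermite: "square_integrable (%x. cplx (hermite_fun n x))"
proof -
 have "integrable lborel (%x. hermite_fun n x * hermite_fun n x)"
  unfolding hermite_fun_mult
  using integrable_poly_gauss[of 1] by (auto simp del: poly_mult)
 then show ?thesis
  by (simp add: square_integrable_def power2_eq_square)
qed

lemma cinner_L2_of:
 assumes "square_integrable f" "square_integrable g"
 shows "cinner (L2_of f) (L2_of g) = (LBINT x. f x * cnj (g x))"
 unfolding cinner_def
proof (rule integral_cong_AE)
 show "AE x in lborel. rep_L2 (L2_of f) x * cnj (rep_L2 (L2_of g) x) = f x * cnj (g x)"
  using rep_L2_of[OF assms(1)] rep_L2_of[OF assms(2)] by eventually_elim simp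
qed (use assms in measurable)

lemma cinner_hermite: "cinner (hermite_L2 n) (hermite_L2 m) = (if n = m then 1 else 0)"
proof -
 have "cinner (hermite_L2 n) (hermite_L2 m) = (LBINT x. cplx (hermite_fun n x * hermite_fun m x))"
  unfolding hermite_L2_def by (subst cinner_L2_of) (simp_all add: square_integrable_hermite)
 also have "... = cplx (if n = m then 1 else 0)"
  by (subst integral_complex_of_real, subst integral_hermite_fun_mult) simp
 finally show ?thesis by simp
qed

section \<open>Exponential moments\<close>

text \<open>Termwise integration of the exponential series, dominated by
  \<open>norm (\<psi> x) * exp \<bar>\<xi> * x\<bar>\<close>. The transform is thus determined by
  the moments; this serves both the completeness of the Hermite functions and the transform of
  complex Gaussians.\<close>

lemma exp_moment_sums:
 fixes \<psi> :: "real => complex"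
 assumes [measurable]: "\<psi> \<in> bmeas"
  and int: "integrable lborel (%x. norm (\<psi> x) * exp \<bar>\<xi> * x\<bar>)"
 shows "(%n. (LBINT x. \<psi> x * x ^ n) * ((\<i> * \<xi>) ^ n / fact n)) sums
  (LBINT x. \<psi> x * exp (\<i> * cplx (\<xi> * x)))"
proof -
 define z where "z x = \<i> * cplx (\<xi> * x)" for x
 have z: "norm (z x) = \<bar>\<xi> * x\<bar>" for x
  by (simp add: z_def norm_mult abs_mult)
 have [measurable]: "z \<in> bmeas"
  unfolding z_def[abs_def] by measurable
 have expsum: "(%n. z x ^ n / fact n) sums exp (z x)" for x
  using exp_converges[of "z x"] by (simp add: scaleR_conv_of_real divide_inverse mult.commute)
 have bound: "norm (\<psi> x * (\<Sum>k\<in>A. z x ^ k / fact k)) <= norm (\<psi> x) * exp \<bar>\<xi> * x\<bar>" if "finite A" for A x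
 proof -
  have "norm (\<Sum>k\<in>A. z x ^ k / fact k) <= (\<Sum>k\<in>A. \<bar>\<xi> * x\<bar> ^ k / fact k)"
   by (rule order_trans[OF norm_sum]) (simp add: norm_divide norm_power z)
  also have "... <= exp \<bar>\<xi> * x\<bar>"
   using exp_converges[of "\<bar>\<xi> * x\<bar>"] that
  proof -
   have s: "(%k. \<bar>\<xi> * x\<bar> ^ k / fact k) sums exp \<bar>\<xi> * x\<bar>"
    using exp_converges[of "\<bar>\<xi> * x\<bar>"] by (simp add: divide_inverse mult.commute)
   show ?thesis
    unfolding sums_unique[OF s] by (rule sum_le_suminf[OF sums_summable[OF s] that]) simp
  qed
  finally show ?thesis
   by (simp add: norm_mult mult_left_mono)
 qed
 have intk: "integrable lborel (%x. \<psi> x * (\<Sum>k\<in>A. z x ^ k / fact k))" if "finite A" for A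
  by (rule Bochner_Integration.integrable_bound[OF int]) (use bound[OF that] in auto)
 have "(%n. (LBINT x. \<psi> x * (\<Sum>k<n. z x ^ k / fact k))) \<longlonglongrightarrow> (LBINT x. \<psi> x * exp (z x))"
 proof (rule integral_dominated_convergence[OF _ _ int])
  show "AE x in lborel. (%n. \<psi> x * (\<Sum>k<n. z x ^ k / fact k)) \<longlonglongrightarrow> \<psi> x * exp (z x)"
   using expsum by (auto simp: sums_def intro!: tendsto_mult_left)
 qed (use bound in auto)
 moreover have "(LBINT x. \<psi> x * (\<Sum>k<n. z x ^ k / fact k))
   = (\<Sum>k<n. (LBINT x. \<psi> x * x ^ k) * ((\<i> * \<xi>) ^ k / fact k))" for n
 proof -
  have *: "(LBINT x. \<psi> x * (z x ^ k / fact k)) = (LBINT x. \<psi> x * x ^ k) * ((\<i> * \<xi>) ^ k / fact k)" for k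
   by (subst integral_mult_left_zero[symmetric]) (simp add: z_def power_mult_distrib field_simps)
  show ?thesis
   unfolding sum_distrib_left *[symmetric]
   by (rule Bochner_Integration.integral_sum) (use intk[of "{k}" for k] in auto)
 qed
 ultimately show ?thesis
  by (simp add: sums_def z_def)
qed

text \<open>The positive and the negative part have equal transforms and, at \<xi> = 0, equal mass.
  Divided by that mass they are densities of probability measures with the same characteristic
  function, and Levy's uniqueness theorem identifies them.\<close>

lemma fourier_integral_zero_imp_zero_real:
 fixes r :: "real => real"
 assumes int: "integrable lborel r"
  and zero: "\<And>\<xi>. (LBINT x. cplx (r x) * exp (\<i> * cplx (\<xi> * x))) = 0"
 shows "AE x in lborel. r x = 0"
proof -
 have [measurable]: "r \<in> bmeas" using int by auto
 define p where "p x = max 0 (r x)" for x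
 define q where "q x = max 0 (- r x)" for x
 define P :: "real => (real => real) => real measure" where
  "P c g = density lborel (%x. ennreal (g x / c))" for c g
 have [measurable]: "p \<in> bmeas" "q \<in> bmeas"
  unfolding p_def[abs_def] q_def[abs_def] by measurable
 have pq: "r x = p x - q x" "0 <= p x" "0 <= q x" for x
  by (auto simp: p_def q_def)
 have ip: "integrable lborel p" "integrable lborel q"
  by (rule Bochner_Integration.integrable_bound[OF int]; auto simp: p_def q_def)+
 have char_eq: "(LBINT x. cplx (p x) * exp (\<i> * cplx (\<xi> * x)))
   = (LBINT x. cplx (q x) * exp (\<i> * cplx (\<xi> * x)))" for \<xi>
 proof -
  have I: "integrable lborel (%x. cplx (g x) * exp (\<i> * cplx (\<xi> * x)))"
   if "integrable lborel g" for g
   using that by (intro Bochner_Integration.integrable_bound[OF that])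
    (auto simp: norm_mult intro!: borel_measurable_times borel_measurable_continuous_onI continuous_intros
      dest: borel_measurable_integrable)
  have "0 = (LBINT x. cplx (p x) * exp (\<i> * cplx (\<xi> * x))
    - cplx (q x) * exp (\<i> * cplx (\<xi> * x)))"
   using zero[of \<xi>] by (simp add: pq(1) left_diff_distrib)
  also have "... = (LBINT x. cplx (p x) * exp (\<i> * cplx (\<xi> * x)))
   - (LBINT x. cplx (q x) * exp (\<i> * cplx (\<xi> * x)))"
   by (intro Bochner_Integration.integral_diff I ip)
  finally show ?thesis by simp
 qed
 define c where "c = (LBINT x. p x)"
 have cq: "c = (LBINT x. q x)"
  using char_eq[of 0] by (simp add: c_def)
 have "c \<ge> 0" by (simp add: c_def pq)
 show ?thesis
 \<comment> \<open>Zero mass cannot be normalised, but then both parts vanish almost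
   everywhere.\<close>
 proof (cases "c = 0")
  case True
  have "AE x in lborel. p x = 0" "AE x in lborel. q x = 0"
   using True cq pq integral_nonneg_eq_0_iff_AE[OF ip(1)] integral_nonneg_eq_0_iff_AE[OF ip(2)]
   by (auto simp: c_def)
  then show ?thesis by eventually_elim (simp add: pq(1))
 next
  case False
  with \<open>c \<ge> 0\<close> have c: "c > 0" by simp

  have rd: "real_distribution (P c g)" if "\<And>x. 0 <= g x" "integrable lborel g" "(LBINT x. g x) = c" for g
  proof -
   have [measurable]: "g \<in> bmeas" using that by auto
   have "emeasure (P c g) (space (P c g)) = (NN x. ennreal (g x / c))"
    by (simp add: P_def emeasure_density)
   also have "... = ennreal (LBINT x. g x / c)"
    by (intro nn_integral_eq_integral) (use that c in auto)
   also have "... = 1" using that(3) c by simp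
   finally have "prob_space (P c g)" by (rule prob_spaceI)
   then show ?thesis
    by (intro real_distribution.intro) (auto simp: P_def real_distribution_axioms_def)
  qed
  have ch: "char (P c g) t = (LBINT x. cplx (g x) * exp (\<i> * cplx (t * x))) / c"
   if "\<And>x. 0 <= g x" "integrable lborel g" for g t
  proof -
   have [measurable]: "g \<in> bmeas" using that by auto
   have "char (P c g) t = (LBINT x. (g x / c) *\<^sub>R exp (\<i> * cplx (t * x)))"
    unfolding char_def P_def
    by (subst integral_density) (use that c in \<open>auto intro!: borel_measurable_continuous_onI continuous_intros\<close>)
   then show ?thesis by (simp add: scaleR_conv_of_real)
  qed
  have "P c p = P c q"
  proof (rule Levy_uniqueness)
   show "char (P c p) = char (P c q)"
    by (rule ext) (simp only: ch[OF pq(2) ip(1)] ch[OF pq(3) ip(2)] char_eq)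
  qed (use rd pq ip cq c_def in auto)
  then have "AE x in lborel. ennreal (p x / c) = ennreal (q x / c)"
   unfolding P_def using ip pq c
   by (subst (asm) sigma_finite_measure.density_unique_iff[OF sigma_finite_lborel]) auto
  then show ?thesis
  proof eventually_elim
   case (elim x)
   then show ?case using c pq(2,3)[of x] by (simp add: pq(1) ennreal_inj)
  qed
 qed
qed

text \<open>The transform of the conjugate of \<psi> at \<xi> is the conjugate of the transform of
  \<psi> at -\<xi>, so it vanishes too; hence so do the transforms of the real and the imaginary
  part.\<close>

lemma fourier_integral_zero_imp_zero:
 fixes \<psi> :: "real => complex"
 assumes int: "integrable lborel \<psi>"
  and zero: "\<And>\<xi>. (LBINT x. \<psi> x * exp (\<i> * cplx (\<xi> * x))) = 0"
 shows "AE x in lborel. \<psi> x = 0"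
proof -
 have I: "integrable lborel (%x. g x * exp (\<i> * cplx (\<xi> * x)))"
  if "integrable lborel g" for g \<xi>
  using that by (intro Bochner_Integration.integrable_bound[OF that])
   (auto simp: norm_mult intro!: borel_measurable_times borel_measurable_continuous_onI continuous_intros
      dest: borel_measurable_integrable)
 have ic: "integrable lborel (%x. cnj (\<psi> x))" using int by simp
 have zc: "(LBINT x. cnj (\<psi> x) * exp (\<i> * cplx (\<xi> * x))) = 0" for \<xi>
 proof -
  have "(LBINT x. cnj (\<psi> x) * exp (\<i> * cplx (\<xi> * x)))
   = (LBINT x. cnj (\<psi> x * exp (\<i> * cplx (- \<xi> * x))))"
   by (simp add: exp_cnj)
  also have "... = cnj (LBINT x. \<psi> x * exp (\<i> * cplx (- \<xi> * x)))"
   by (rule Bochner_Integration.integral_cnj)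
  also have "... = 0" using zero[of "-\<xi>"] by simp
  finally show ?thesis .
 qed
 have "AE x in lborel. Re (\<psi> x) = 0"
 proof (rule fourier_integral_zero_imp_zero_real)
  fix \<xi>
  have "(LBINT x. (1/2) * (\<psi> x * exp (\<i> * cplx (\<xi> * x)) + cnj (\<psi> x) * exp (\<i> * cplx (\<xi> * x)))) = 0"
   using zero[of \<xi>] zc[of \<xi>]
   by (subst Bochner_Integration.integral_mult_right_zero, subst Bochner_Integration.integral_add[OF I[OF int] I[OF ic]]) simp
  also have "(%x. (1/2) * (\<psi> x * exp (\<i> * cplx (\<xi> * x)) + cnj (\<psi> x) * exp (\<i> * cplx (\<xi> * x))))
   = (%x. cplx (Re (\<psi> x)) * exp (\<i> * cplx (\<xi> * x)))"
   by (rule ext) (simp add: complex_add_cnj flip: distrib_right)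
  finally show "(LBINT x. cplx (Re (\<psi> x)) * exp (\<i> * cplx (\<xi> * x))) = 0" .
 qed (use int in auto)
 moreover have "AE x in lborel. Im (\<psi> x) = 0"
 proof (rule fourier_integral_zero_imp_zero_real)
  fix \<xi>
  have "(LBINT x. (1/(2*\<i>)) * (\<psi> x * exp (\<i> * cplx (\<xi> * x)) - cnj (\<psi> x) * exp (\<i> * cplx (\<xi> * x)))) = 0"
   using zero[of \<xi>] zc[of \<xi>]
   by (subst Bochner_Integration.integral_mult_right_zero, subst Bochner_Integration.integral_diff[OF I[OF int] I[OF ic]]) simp
  also have "(%x. (1/(2*\<i>)) * (\<psi> x * exp (\<i> * cplx (\<xi> * x)) - cnj (\<psi> x) * exp (\<i> * cplx (\<xi> * x))))
   = (%x. cplx (Im (\<psi> x)) * exp (\<i> * cplx (\<xi> * x)))"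
  proof (rule ext)
   fix x
   have "cplx (Im (\<psi> x)) = (1/(2*\<i>)) * (\<psi> x - cnj (\<psi> x))"
    by (simp add: complex_eq_iff)
   then show "(1/(2*\<i>)) * (\<psi> x * exp (\<i> * cplx (\<xi> * x)) - cnj (\<psi> x) * exp (\<i> * cplx (\<xi> * x)))
    = cplx (Im (\<psi> x)) * exp (\<i> * cplx (\<xi> * x))"
    by (simp only: left_diff_distrib mult.assoc)
  qed
  finally show "(LBINT x. cplx (Im (\<psi> x)) * exp (\<i> * cplx (\<xi> * x))) = 0" .
 qed (use int in auto)
 ultimately show ?thesis by eventually_elim (simp add: complex_eq_iff)
qed

section \<open>The complex inner product\<close>

lemma rep_L2_add: "AE x in lborel. rep_L2 (f + g) x = rep_L2 f x + rep_L2 g x"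
 using rep_L2_of[OF square_integrable_add[OF square_integrable_rep square_integrable_rep, of f g]]
 by (simp add: L2_of_add)

lemma rep_L2_diff: "AE x in lborel. rep_L2 (f - g) x = rep_L2 f x - rep_L2 g x"
 using rep_L2_of[OF square_integrable_diff[OF square_integrable_rep square_integrable_rep, of f g]]
 by (simp add: L2_of_diff)

lemma rep_L2_scaleC: "AE x in lborel. rep_L2 (c *\<^sub>C f) x = c * rep_L2 f x"
 using rep_L2_of[OF square_integrable_cmult[OF square_integrable_rep, of c f]]
 by (simp add: L2_of_cmult)

lemma L2_of_AE_cong:
 assumes "square_integrable f" "g \<in> bmeas" "AE x in lborel. f x = g x"
 shows "square_integrable g" "L2_of f = L2_of g"
proof -
 show g: "square_integrable g"
  by (rule square_integrable_bound[of g "%x. (norm (f x))\<^sup>2"])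
   (use assms in \<open>auto simp: square_integrable_def elim: eventually_mono\<close>)
 show "L2_of f = L2_of g"
  using L2_of_eq_iff[OF assms(1) g] assms(3) by simp
qed

lemma L2_eq_iff_rep: "f = g \<longleftrightarrow> (AE x in lborel. rep_L2 f x = rep_L2 g x)"
 using L2_of_eq_iff[OF square_integrable_rep square_integrable_rep, of f g] by simp

lemma cinner_integrable: "integrable lborel (%x. rep_L2 f x * cnj (rep_L2 g x))"
 by (intro square_integrable_integrable_mult square_integrable_rep)

lemma cinner_add_left: "cinner (f + g) h = cinner f h + cinner g h"
proof -
 have "cinner (f + g) h = (LBINT x. rep_L2 f x * cnj (rep_L2 h x) + rep_L2 g x * cnj (rep_L2 h x))"
  unfolding cinner_def
 proof (rule integral_cong_AE)
  show "AE x in lborel. rep_L2 (f + g) x * cnj (rep_L2 h x) =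
    rep_L2 f x * cnj (rep_L2 h x) + rep_L2 g x * cnj (rep_L2 h x)"
   using rep_L2_add[of f g] by eventually_elim (simp add: distrib_right)
 qed measurable
 then show ?thesis
  by (simp add: cinner_def Bochner_Integration.integral_add cinner_integrable)
qed

lemma cinner_scaleC_left: "cinner (c *\<^sub>C f) h = c * cinner f h"
proof -
 have "cinner (c *\<^sub>C f) h = (LBINT x. c * (rep_L2 f x * cnj (rep_L2 h x)))"
  unfolding cinner_def
 proof (rule integral_cong_AE)
  show "AE x in lborel. rep_L2 (c *\<^sub>C f) x * cnj (rep_L2 h x) = c * (rep_L2 f x * cnj (rep_L2 h x))"
   using rep_L2_scaleC[of c f] by eventually_elim simp
 qed measurable
 then show ?thesis by (simp add: cinner_def)
qed

lemma cinner_commute: "cinner g f = cnj (cinner f g)"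
 unfolding cinner_def Bochner_Integration.integral_cnj[symmetric] by (simp add: mult.commute)

lemma cinner_add_right: "cinner h (f + g) = cinner h f + cinner h g"
 by (metis cinner_add_left cinner_commute complex_cnj_add)

lemma cinner_scaleC_right: "cinner h (c *\<^sub>C f) = cnj c * cinner h f"
 by (metis cinner_scaleC_left cinner_commute complex_cnj_mult)

lemma cinner_scaleR_left: "cinner (c *\<^sub>R f) h = cplx c * cinner f h"
 by (simp add: cinner_scaleC_left flip: scaleC_of_real)

lemma Re_cinner: "Re (cinner f g) = inner f g"
proof -
 have "inner f g = inner (L2_of (rep_L2 f)) (L2_of (rep_L2 g))" by simp
 also have "... = (LBINT x. rep_L2 f x \<bullet> rep_L2 g x)"
  by (simp add: L2_of_def inner_L2.abs_eq ae_equal_def)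
 also have "... = (LBINT x. Re (rep_L2 f x * cnj (rep_L2 g x)))"
  by (simp add: inner_complex_def)
 also have "... = Re (cinner f g)"
  unfolding cinner_def by (rule integral_Re[OF cinner_integrable])
 finally show ?thesis by simp
qed

lemma cinner_self: "cinner f f = cplx ((norm f)\<^sup>2)"
proof (rule complex_eqI)
 show "Re (cinner f f) = Re (cplx ((norm f)\<^sup>2))"
  by (simp add: Re_cinner power2_norm_eq_inner)
 have "cinner f f = cnj (cinner f f)" by (rule cinner_commute)
 then have "Im (cinner f f) = Im (cnj (cinner f f))" by simp
 then show "Im (cinner f f) = Im (cplx ((norm f)\<^sup>2))" by simp
qed

text \<open>After a rotation of \<open>f\<close> by the phase of \<open>cinner f g\<close> the
  product is real and nonnegative, and the real Cauchy-Schwarz inequality applies.\<close>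

lemma norm_cinner_le: "norm (cinner f g) <= norm f * norm g"
proof (cases "cinner f g = 0")
 case False
 define c where "c = cnj (sgn (cinner f g))"
 have c: "norm c = 1" using False by (simp add: c_def norm_sgn)
 have "c * cinner f g = cplx (norm (cinner f g))"
  using False by (simp add: c_def sgn_eq complex_norm_square[symmetric] power2_eq_square mult.commute)
 then have "norm (cinner f g) = Re (cinner (c *\<^sub>C f) g)"
  by (simp add: cinner_scaleC_left)
 also have "... <= norm (c *\<^sub>C f) * norm g"
  unfolding Re_cinner by (rule norm_cauchy_schwarz)
 finally show ?thesis using c by (simp add: norm_scaleC)
qed auto

lemma bounded_linear_cinner_left: "bounded_linear (%f. cinner f g)"
 by (rule bounded_linear_intro[where K = "norm g"])
  (auto simp: cinner_add_left cinner_scaleR_left scaleR_conv_of_real norm_cinner_le)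

lemma bounded_linear_cinner_right: "bounded_linear (%g. cinner f g)"
proof -
 have "bounded_linear (%g. cnj (cinner g f))"
  by (intro bounded_linear_compose[OF bounded_linear_cnj] bounded_linear_cinner_left)
 then show ?thesis by (simp flip: cinner_commute)
qed

lemmas cinner_diff_left = linear_diff[OF bounded_linear.linear[OF bounded_linear_cinner_left]]
lemmas cinner_diff_right = linear_diff[OF bounded_linear.linear[OF bounded_linear_cinner_right]]
lemmas cinner_sum_left = linear_sum[OF bounded_linear.linear[OF bounded_linear_cinner_left]]
lemmas cinner_zero_left [simp] = linear_0[OF bounded_linear.linear[OF bounded_linear_cinner_left]]
lemmas cinner_zero_right [simp] = linear_0[OF bounded_linear.linear[OF bounded_linear_cinner_right]]

lemma tendsto_cinner [tendsto_intros]: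
 assumes "(f \<longlongrightarrow> a) F" "(g \<longlongrightarrow> b) F"
 shows "((%x. cinner (f x) (g x)) \<longlongrightarrow> cinner a b) F"
proof -
 have "bounded_bilinear cinner"
 proof
  show "\<exists>K. \<forall>a b. norm (cinner a b) <= norm a * norm b * K"
   using norm_cinner_le by (intro exI[of _ 1]) auto
 qed (auto simp: cinner_add_left cinner_add_right cinner_scaleC_left scaleR_conv_of_real
    cinner_scaleC_right simp flip: scaleC_of_real)
 then show ?thesis using assms by (rule bounded_bilinear.tendsto)
qed

section \<open>Completeness of the Hermite functions\<close>

lemma gauss_half_bound: "exp (- (1/2 * x\<^sup>2)) * exp \<bar>\<xi> * x\<bar> <= exp (\<xi>\<^sup>2) * exp (- (1/4 * x\<^sup>2))" for x \<xi> :: real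
proof -
 have "0 <= (\<bar>\<xi>\<bar> - \<bar>x\<bar> / 2)\<^sup>2" by simp
 also have "... = \<xi>\<^sup>2 - \<bar>\<xi> * x\<bar> + 1/4 * x\<^sup>2"
  by (simp add: power2_eq_square algebra_simps abs_mult)
 finally show ?thesis by (simp flip: exp_add)
qed

text \<open>The growth condition covers bounded functions as well as square-integrable ones; this
  matters because \<open>mehler_op t f\<close> is at first known only to be bounded. The function
  \<open>g\<close> times exp(-x^2/2) has all exponential moments, its moments are combinations of
  Hermite coefficients and vanish, and so its Fourier transform is a vanishing power series.\<close>

lemma hermite_complete:
 fixes g :: "real => complex"
 assumes int: "integrable lborel (%x. g x * exp (- (1/4 * x\<^sup>2)))"
  and g [measurable]: "g \<in> bmeas"
  and zero: "\<And>n. (LBINT x. g x * hermite_fun n x) = 0"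
 shows "AE x in lborel. g x = 0"
proof -
 define \<psi> where "\<psi> x = g x * exp (- (1/2 * x\<^sup>2))" for x
 have [measurable]: "\<psi> \<in> bmeas"
  unfolding \<psi>_def[abs_def] by measurable
 have iexp: "integrable lborel (%x. norm (\<psi> x) * exp \<bar>\<xi> * x\<bar>)" for \<xi>
 proof (rule Bochner_Integration.integrable_bound)
  show "integrable lborel (%x. exp (\<xi>\<^sup>2) * norm (g x * exp (- (1/4 * x\<^sup>2))))"
   using int by auto
  show "AE x in lborel. norm (norm (\<psi> x) * exp \<bar>\<xi> * x\<bar>) <= norm (exp (\<xi>\<^sup>2) * norm (g x * exp (- (1/4 * x\<^sup>2))))"
  proof (rule AE_I2)
   fix x
   show "norm (norm (\<psi> x) * exp \<bar>\<xi> * x\<bar>) <= norm (exp (\<xi>\<^sup>2) * norm (g x * exp (- (1/4 * x\<^sup>2))))"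
    using mult_left_mono[OF gauss_half_bound[of x \<xi>], of "norm (g x)"]
    by (simp add: \<psi>_def norm_mult mult_ac)
  qed
 qed measurable
 have ip: "integrable lborel (%x. \<psi> x * cplx (poly p x))" for p
 proof -
  have "integrable lborel (%x. \<psi> x * x ^ k)" for k :: nat
  proof (rule Bochner_Integration.integrable_bound)
   show "integrable lborel (%x. fact k * (norm (\<psi> x) * exp \<bar>1 * x\<bar>))"
    using iexp[of 1] by auto
   show "AE x in lborel. norm (\<psi> x * cplx (x ^ k)) <= norm (fact k * (norm (\<psi> x) * exp \<bar>1 * x\<bar>))"
   proof (rule AE_I2)
    fix x :: real
    have s: "(%k. \<bar>x\<bar> ^ k / fact k) sums exp \<bar>x\<bar>"
     using exp_converges[of "\<bar>x\<bar>"] by (simp add: divide_inverse_commute)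
    have "(\<Sum>j\<in>{k}. \<bar>x\<bar> ^ j / fact j) <= exp \<bar>x\<bar>"
     unfolding sums_unique[OF s] by (rule sum_le_suminf[OF sums_summable[OF s]]) auto
    then have "\<bar>x\<bar> ^ k <= fact k * exp \<bar>x\<bar>" by (simp add: field_simps)
    from mult_left_mono[OF this, of "norm (\<psi> x)"]
    show "norm (\<psi> x * cplx (x ^ k)) <= norm (fact k * (norm (\<psi> x) * exp \<bar>1 * x\<bar>))"
     by (simp add: norm_mult norm_power mult_ac)
   qed
  qed measurable
  then have "integrable lborel (%x. \<Sum>i\<le>degree p. cplx (coeff p i) * (\<psi> x * x ^ i))"
   by (intro Bochner_Integration.integrable_sum integrable_mult_right) auto
  then show ?thesis
   by (simp add: poly_altdef sum_distrib_left mult_ac)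
 qed
 have H: "(LBINT x. \<psi> x * cplx (poly (hermite_poly k) x)) = 0" for k
 proof -
  have "(%x. \<psi> x * cplx (poly (hermite_poly k) x)) =
    (%x. cplx (hermite_norm k) * (g x * hermite_fun k x))"
   using hermite_norm_pos[of k] by (auto simp: \<psi>_def hermite_fun_alt)
  then show ?thesis using zero[of k] by simp
 qed
 \<comment> \<open>Induction on the power for all \<open>k\<close> at once, by x H_k = H_(k+1) / 2 +
   k H_(k-1).\<close>
 have mom: "(LBINT x. \<psi> x * cplx (poly ([:0, 1:] ^ n * hermite_poly k) x)) = 0" for n k
 proof (induction n arbitrary: k)
  case 0 then show ?case using H by simp
 next
  case (Suc n)
  have "poly ([:0, 1:] ^ Suc n * hermite_poly k) x =
    (1/2) * poly ([:0, 1:] ^ n * hermite_poly (Suc k)) x + real k * poly ([:0, 1:] ^ n * hermite_poly (k - 1)) x" for x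
  proof -
   have e: "x * poly (hermite_poly k) x = (1/2) * poly (hermite_poly (Suc k)) x + real k * poly (hermite_poly (k - 1)) x"
    using poly_hermite_recurrence[of k x] by (simp add: field_simps del: hermite_poly.simps)
   have "poly ([:0, 1:] ^ Suc n * hermite_poly k) x = x ^ n * (x * poly (hermite_poly k) x)"
    by simp
   then show ?thesis
    unfolding e by (simp add: algebra_simps del: hermite_poly.simps)
  qed
  then have "(LBINT x. \<psi> x * cplx (poly ([:0, 1:] ^ Suc n * hermite_poly k) x))
   = (LBINT x. (1/2) * (\<psi> x * cplx (poly ([:0, 1:] ^ n * hermite_poly (Suc k)) x))
     + of_nat k * (\<psi> x * cplx (poly ([:0, 1:] ^ n * hermite_poly (k - 1)) x)))"
   by (simp add: algebra_simps del: hermite_poly.simps poly_mult power_Suc)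
  also have "... = (LBINT x. (1/2) * (\<psi> x * cplx (poly ([:0, 1:] ^ n * hermite_poly (Suc k)) x)))
     + (LBINT x. of_nat k * (\<psi> x * cplx (poly ([:0, 1:] ^ n * hermite_poly (k - 1)) x)))"
   by (intro Bochner_Integration.integral_add integrable_mult_right ip)
  also have "... = 0"
   unfolding Bochner_Integration.integral_mult_right_zero Suc by simp
  finally show ?case .
 qed
 have moment: "(LBINT x. \<psi> x * cplx (x ^ n)) = 0" for n
  using mom[of n 0] by simp
 have "AE x in lborel. \<psi> x = 0"
 proof (rule fourier_integral_zero_imp_zero)
  show "integrable lborel \<psi>" using ip[of 1] by simp
  fix \<xi>
  show "(LBINT x. \<psi> x * exp (\<i> * cplx (\<xi> * x))) = 0"
   using exp_moment_sums[OF _ iexp[of \<xi>]] unfolding moment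
   by (simp add: sums_iff)
 qed
 then show ?thesis
  by eventually_elim (simp add: \<psi>_def)
qed

text \<open>The algebraic identities for \<open>propagator\<close> are obtained below by comparing
  Hermite coefficients.\<close>

lemma L2_eqI_hermite:
 assumes "\<And>n. cinner f (hermite_L2 n) = cinner g (hermite_L2 n)"
 shows "f = g"
proof -
 define h where "h = rep_L2 (f - g)"
 have [measurable]: "h \<in> bmeas" by (simp add: h_def)
 have "AE x in lborel. h x = 0"
 proof (rule hermite_complete)
  have "square_integrable (%x. cplx (exp (- (1/4 * x\<^sup>2))))"
   using integrable_poly_gauss[of "1/2" 1]
   by (simp add: square_integrable_def power2_eq_square flip: exp_add)
  from square_integrable_integrable_mult[OF square_integrable_rep[of "f - g"] this]
  show "integrable lborel (%x. h x * exp (- (1/4 * x\<^sup>2)))" by (simp add: h_def)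
  fix n
  have "(LBINT x. h x * hermite_fun n x) = cinner (L2_of h) (hermite_L2 n)"
   unfolding hermite_L2_def h_def
   by (subst cinner_L2_of) (auto simp: square_integrable_hermite)
  also have "... = 0" using assms[of n] by (simp add: h_def cinner_diff_left)
  finally show "(LBINT x. h x * hermite_fun n x) = 0" .
 qed measurable
 then have "AE x in lborel. rep_L2 f x = rep_L2 g x"
  using rep_L2_diff[of f g] unfolding h_def by eventually_elim simp
 then show ?thesis by (simp add: L2_eq_iff_rep)
qed

section \<open>The propagator\<close>

lemma norm_hermite_sum:
 assumes "finite A"
 shows "(norm (\<Sum>k\<in>A. c k *\<^sub>C hermite_L2 k))\<^sup>2 = (\<Sum>k\<in>A. (norm (c k))\<^sup>2)"
 using assms
proof (induction A)
 case (insert a A)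
 have "cinner (c a *\<^sub>C hermite_L2 a) (\<Sum>k\<in>A. c k *\<^sub>C hermite_L2 k) = 0"
  using insert(1,2)
  by (subst cinner_commute, simp add: cinner_sum_left cinner_scaleC_left cinner_scaleC_right cinner_hermite)
   (auto intro!: sum.neutral simp: cinner_scaleC_left cinner_hermite)
 then have "inner (c a *\<^sub>C hermite_L2 a) (\<Sum>k\<in>A. c k *\<^sub>C hermite_L2 k) = 0"
  by (simp flip: Re_cinner)
 moreover have "(norm (hermite_L2 a))\<^sup>2 = 1"
  using cinner_self[of "hermite_L2 a"] by (simp add: cinner_hermite flip: of_real_power)
 ultimately show ?case
  using insert by (simp add: norm_scaleC power_mult_distrib dot_norm)
qed simp

lemma cinner_hermite_sum:
 assumes "finite A"
 shows "cinner (\<Sum>k\<in>A. c k *\<^sub>C hermite_L2 k) (hermite_L2 n) = (if n \<in> A then c n else 0)"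
 using assms
 by (simp add: cinner_sum_left cinner_scaleC_left cinner_hermite if_distrib[of "(*) _"] cong: if_cong)

text \<open>By Pythagoras the squared norm of a block of the series is a block of the scalar series,
  so the partial sums are Cauchy.\<close>

lemma summable_hermite:
 assumes "summable (%k. (norm (c k))\<^sup>2)"
 shows "summable (%k. c k *\<^sub>C hermite_L2 k)"
 unfolding summable_Cauchy
proof (intro allI impI)
 fix e :: real assume e: "0 < e"
 then have "0 < e\<^sup>2" by simp
 then obtain N where N: "\<And>m n. m \<ge> N ==> norm (\<Sum>k=m..<n. (norm (c k))\<^sup>2) < e\<^sup>2"
  using assms unfolding summable_Cauchy by meson
 have "norm (\<Sum>k=m..<n. c k *\<^sub>C hermite_L2 k) < e" if "m \<ge> N" for m n
 proof -
  have "(norm (\<Sum>k=m..<n. c k *\<^sub>C hermite_L2 k))\<^sup>2 < e\<^sup>2"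
   using N[OF that, of n] by (simp add: norm_hermite_sum sum_nonneg)
  then show ?thesis using e by (simp add: power2_less_imp_less)
 qed
 then show "\<exists>N. \<forall>m\<ge>N. \<forall>n. norm (\<Sum>k=m..<n. c k *\<^sub>C hermite_L2 k) < e" by blast
qed

text \<open>The projection \<open>p\<close> onto the span satisfies
  \<open>inner p f = (norm p)\<^sup>2\<close>; the claim is the expansion of the square of
  \<open>norm (p - f)\<close>.\<close>

lemma bessel:
 assumes "finite A"
 shows "(\<Sum>k\<in>A. (norm (cinner f (hermite_L2 k)))\<^sup>2) <= (norm f)\<^sup>2"
proof -
 define p where "p = (\<Sum>k\<in>A. cinner f (hermite_L2 k) *\<^sub>C hermite_L2 k)"
 have "cinner p f = (\<Sum>k\<in>A. cinner f (hermite_L2 k) * cnj (cinner f (hermite_L2 k)))"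
  by (simp add: p_def cinner_sum_left cinner_scaleC_left flip: cinner_commute)
 also have "... = cplx ((norm p)\<^sup>2)"
  unfolding p_def norm_hermite_sum[OF assms]
  by (simp flip: complex_norm_square)
 finally have "inner p f = (norm p)\<^sup>2"
  by (simp flip: Re_cinner)
 moreover have "0 <= (norm (p - f))\<^sup>2" by simp
 ultimately have "(norm p)\<^sup>2 <= (norm f)\<^sup>2"
  by (simp add: dot_norm_neg field_simps)
 then show ?thesis unfolding p_def norm_hermite_sum[OF assms] .
qed

lemma summable_bessel: "summable (%k. (norm (cinner f (hermite_L2 k)))\<^sup>2)"
 by (rule summableI_nonneg_bounded[of _ "(norm f)\<^sup>2"]) (auto intro: bessel)

lemma propagator_sums:
 "(%n. (cis (t * (2 * real n + 1)) * cinner f (hermite_L2 n)) *\<^sub>C hermite_L2 n) sums propagator t f"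
 unfolding propagator_def
 by (rule summable_sums, rule summable_hermite) (simp add: norm_mult summable_bessel)

lemma cinner_propagator_hermite:
 "cinner (propagator t f) (hermite_L2 n) = cis (t * (2 * real n + 1)) * cinner f (hermite_L2 n)"
proof -
 let ?c = "%n. cis (t * (2 * real n + 1)) * cinner f (hermite_L2 n)"
 have "(%m. cinner (\<Sum>k<m. ?c k *\<^sub>C hermite_L2 k) (hermite_L2 n)) \<longlonglongrightarrow> cinner (propagator t f) (hermite_L2 n)"
  using propagator_sums[of t f] unfolding sums_def by (intro tendsto_intros)
 moreover have "(%m. cinner (\<Sum>k<m. ?c k *\<^sub>C hermite_L2 k) (hermite_L2 n)) \<longlonglongrightarrow> ?c n"
  by (rule tendsto_eventually, rule eventually_mono[OF eventually_gt_at_top[of n]])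
   (simp add: cinner_hermite_sum)
 ultimately show ?thesis by (rule LIMSEQ_unique)
qed

lemma propagator_0 [simp]: "propagator 0 f = f"
 by (rule L2_eqI_hermite) (simp add: cinner_propagator_hermite)

lemma propagator_propagator: "propagator s (propagator t f) = propagator (s + t) f"
 by (rule L2_eqI_hermite) (simp add: cinner_propagator_hermite cis_mult distrib_right)

lemma propagator_add: "propagator t (f + g) = propagator t f + propagator t g"
 by (rule L2_eqI_hermite) (simp add: cinner_propagator_hermite cinner_add_left distrib_left)

lemma propagator_scaleC: "propagator t (c *\<^sub>C f) = c *\<^sub>C propagator t f"
 by (rule L2_eqI_hermite) (simp add: cinner_propagator_hermite cinner_scaleC_left)

lemma norm_propagator [simp]: "norm (propagator t f) = norm f"
proof -
 have lim: "(%m. (norm (\<Sum>k<m. (cis (t * (2 * real k + 1)) * cinner f (hermite_L2 k)) *\<^sub>C hermite_L2 k))\<^sup>2)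
   \<longlonglongrightarrow> (norm (propagator t f))\<^sup>2" for t
  using propagator_sums[of t f] unfolding sums_def by (intro tendsto_intros)
 have "(norm (propagator t f))\<^sup>2 = (norm (propagator 0 f))\<^sup>2"
  by (rule LIMSEQ_unique[OF lim]) (use lim[of 0] in \<open>simp add: norm_hermite_sum norm_mult\<close>)
 then show ?thesis by simp
qed

lemma bounded_linear_propagator: "bounded_linear (propagator t)"
 by (rule bounded_linear_intro[where K = 1])
  (auto simp: propagator_add propagator_scaleC simp flip: scaleC_of_real)

lemmas propagator_diff = linear_diff[OF bounded_linear.linear[OF bounded_linear_propagator]]
lemmas propagator_zero [simp] = linear_0[OF bounded_linear.linear[OF bounded_linear_propagator]]

text \<open>Polarisation gives the real part. The imaginary part is, up to sign, the real inner
  product with \<open>\<i> *\<^sub>C f\<close>, and the propagator commutes with \<i>.\<close>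

lemma cinner_propagator: "cinner (propagator t f) (propagator t g) = cinner f g"
proof -
 have R: "inner (propagator t f) (propagator t g) = inner f g" for f g
  by (simp add: dot_norm flip: propagator_add)
 have I: "Im (cinner f g) = - inner (\<i> *\<^sub>C f) g" for f g
  by (simp add: cinner_scaleC_left flip: Re_cinner)
 show ?thesis
  by (rule complex_eqI) (simp_all add: Re_cinner R I flip: propagator_scaleC)
qed

lemma cinner_propagator_left: "cinner (propagator t f) g = cinner f (propagator (- t) g)"
 using cinner_propagator[of t f "propagator (-t) g"] by (simp add: propagator_propagator)

text \<open>The remainder of the Hermite expansion at time t is the image of the remainder at time 0
  under an isometry, so the expansion converges uniformly in t.\<close>

lemma continuous_propagator: "continuous_on UNIV (%t. propagator t f)"
proof (rule uniform_limit_theorem)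
 define S where "S t n = (\<Sum>k<n. (cis (t * (2 * real k + 1)) * cinner f (hermite_L2 k)) *\<^sub>C hermite_L2 k)"
  for t n
 have S: "S t n = propagator t (S 0 n)" for t n
  by (rule L2_eqI_hermite) (simp add: cinner_propagator_hermite S_def cinner_hermite_sum)
 have lim: "S 0 \<longlonglongrightarrow> f"
  using propagator_sums[of 0 f] by (simp add: sums_def S_def[abs_def])
 show "uniform_limit UNIV (%n t. S t n) (%t. propagator t f) sequentially"
 proof (rule uniform_limitI)
  fix e :: real assume "0 < e"
  with lim have "\<forall>\<^sub>F n in sequentially. dist (S 0 n) f < e"
   by (rule tendstoD)
  then show "\<forall>\<^sub>F n in sequentially. \<forall>t\<in>UNIV. dist (S t n) (propagator t f) < e"
  proof eventually_elim
   case (elim n)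
   then show ?case by (subst S) (simp add: dist_norm flip: propagator_diff)
  qed
 qed
 have "continuous_on UNIV (%t. S t n)" for n
 proof -
  have scont: "continuous_on UNIV (%t. c t *\<^sub>C h)" if "continuous_on UNIV c" for c :: "real => complex" and h
   unfolding continuous_on_iff
  proof (intro ballI allI impI)
   fix x and e :: real assume "0 < e"
   then have "0 < e / (norm h + 1)" by (simp add: add_nonneg_pos)
   then have "\<exists>d>0. \<forall>y\<in>UNIV. dist y x < d --> dist (c y) (c x) < e / (norm h + 1)"
    using that unfolding continuous_on_iff by blast
   then obtain d where d: "d > 0" "\<And>y. dist y x < d ==> dist (c y) (c x) < e / (norm h + 1)"
    by blast
   have "dist (c y *\<^sub>C h) (c x *\<^sub>C h) < e" if "dist y x < d" for y
   proof -
    have "dist (c y *\<^sub>C h) (c x *\<^sub>C h) = dist (c y) (c x) * norm h"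
     by (simp add: dist_norm norm_scaleC flip: scaleC_diff_left)
    also have "... <= dist (c y) (c x) * (norm h + 1)" by (intro mult_left_mono) auto
    also have "... < e / (norm h + 1) * (norm h + 1)"
     by (intro mult_strict_right_mono d(2) that) (simp add: add_nonneg_pos)
    also have "... = e" by (simp add: add_nonneg_eq_0_iff)
    finally show ?thesis .
   qed
   then show "\<exists>d>0. \<forall>y\<in>UNIV. dist y x < d --> dist (c y *\<^sub>C h) (c x *\<^sub>C h) < e"
    using d(1) by blast
  qed
  show ?thesis unfolding S_def by (intro continuous_intros scont)
 qed
 then show "\<forall>\<^sub>F n in sequentially. continuous_on UNIV (%t. S t n)" by simp
qed simp

lemma continuous_propagator_joint: "continuous_on UNIV (%(t, f). propagator t f)"
 unfolding continuous_on_def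
proof safe
 fix t f
 have "((%p. norm (snd p - f) + dist (propagator (fst p) f) (propagator t f)) \<longlongrightarrow> norm (f - f) + 0) (at (t, f))"
 proof (intro tendsto_intros)
  have "isCont (%t. propagator t f) t"
   using continuous_propagator by (simp add: continuous_on_eq_continuous_at)
  then have "((%p::real \<times> L2. propagator (fst p) f) \<longlongrightarrow> propagator t f) (at (t, f))"
   by (rule isCont_tendsto_compose) (use tendsto_fst[OF tendsto_ident_at, of "(t,f)" UNIV] in simp)
  then show "((%p::real \<times> L2. dist (propagator (fst p) f) (propagator t f)) \<longlongrightarrow> 0) (at (t, f))"
   by (simp add: tendsto_dist_iff[symmetric])
  show "(snd \<longlongrightarrow> f) (at (t, f))"
   using tendsto_snd[OF tendsto_ident_at, of "(t,f)" UNIV] by simp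
 qed
 then have z: "((%p. norm (snd p - f) + dist (propagator (fst p) f) (propagator t f)) \<longlongrightarrow> 0) (at (t, f))"
  by simp
 have le: "dist (propagator s g) (propagator t f) <= norm (g - f) + dist (propagator s f) (propagator t f)" for s g
  using dist_triangle[of "propagator s g" "propagator t f" "propagator s f"]
  by (simp add: dist_norm flip: propagator_diff)
 show "((%(t, f). propagator t f) \<longlongrightarrow> propagator t f) (at (t, f))"
  by (rule metric_tendsto_imp_tendsto[OF z], rule always_eventually)
   (auto intro: order_trans[OF le])
qed

section \<open>Mehler's formula\<close>

lemma complex_monomial_gauss:
 fixes \<alpha> :: complex
 assumes "0 < Re \<alpha>"
 shows "integrable lborel (%x::real. exp (- (\<alpha> / 2 * (cplx x)\<^sup>2)) * (cplx x) ^ k)"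
  and "((%x::real. exp (- (\<alpha> / 2 * (cplx x)\<^sup>2)) * (cplx x) ^ k) \<longlongrightarrow> 0) at_top"
  and "((%x::real. exp (- (\<alpha> / 2 * (cplx x)\<^sup>2)) * (cplx x) ^ k) \<longlongrightarrow> 0) at_bot"
proof -
 define a where "a = Re \<alpha> / 2"
 have a: "a > 0" using assms by (simp add: a_def)
 have norm_eq: "norm (exp (- (\<alpha> / 2 * (cplx x)\<^sup>2)) * (cplx x) ^ k) = norm (x ^ k * exp (- (a * x\<^sup>2)))" for x :: real
  by (simp add: norm_mult norm_power a_def abs_mult power_abs mult.commute flip: of_real_power of_real_mult)
 show "integrable lborel (%x::real. exp (- (\<alpha> / 2 * (cplx x)\<^sup>2)) * (cplx x) ^ k)"
 proof (rule Bochner_Integration.integrable_bound[OF integrable_monomial_gauss[OF a, of k]])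
  have "(%x::real. exp (- (\<alpha> / 2 * (cplx x)\<^sup>2)) * (cplx x) ^ k) \<in> bmeas"
   by (intro borel_measurable_continuous_onI continuous_intros) auto
  then show "(%x::real. exp (- (\<alpha> / 2 * (cplx x)\<^sup>2)) * (cplx x) ^ k) \<in> borel_measurable lborel"
   by simp
 qed (use norm_eq in auto)
 show "((%x::real. exp (- (\<alpha> / 2 * (cplx x)\<^sup>2)) * (cplx x) ^ k) \<longlongrightarrow> 0) at_top"
  by (rule tendsto_norm_zero_cancel)
   (use tendsto_norm_zero[OF monomial_gauss_tendsto(1)[OF a, of k]] in \<open>simp only: norm_eq\<close>)
 show "((%x::real. exp (- (\<alpha> / 2 * (cplx x)\<^sup>2)) * (cplx x) ^ k) \<longlongrightarrow> 0) at_bot"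
  by (rule tendsto_norm_zero_cancel)
   (use tendsto_norm_zero[OF monomial_gauss_tendsto(2)[OF a, of k]] in \<open>simp only: norm_eq\<close>)
qed

text \<open>Integrating the derivative of exp(-\<alpha> x^2 / 2) x^k gives k m(k - 1) = \<alpha> m(k
  + 1), which determines every moment up to the factor \<open>m 0\<close>.\<close>

lemma complex_gauss_moments:
 fixes \<alpha> :: complex
 assumes \<alpha>: "0 < Re \<alpha>"
 defines "m \<equiv> %k. (LBINT x. exp (- (\<alpha> / 2 * (cplx x)\<^sup>2)) * (cplx x) ^ k)"
 shows "m (Suc (2 * k)) = 0"
  and "m (2 * k) / fact (2 * k) = (1 / (2 * \<alpha>)) ^ k / fact k * m 0"
proof -
 have \<alpha>0: "\<alpha> \<noteq> 0" using \<alpha> by auto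
 note I = complex_monomial_gauss[OF \<alpha>]
 have der: "((%x. exp (- (\<alpha> / 2 * (cplx x)\<^sup>2)) * (cplx x) ^ k) has_vector_derivative
   of_nat k * (exp (- (\<alpha> / 2 * (cplx x)\<^sup>2)) * (cplx x) ^ (k - 1))
   - \<alpha> * (exp (- (\<alpha> / 2 * (cplx x)\<^sup>2)) * (cplx x) ^ Suc k)) (at x)" for x k
 proof -
  have "((%z. exp (- (\<alpha> / 2 * z\<^sup>2)) * z ^ k) has_field_derivative
   of_nat k * (exp (- (\<alpha> / 2 * z\<^sup>2)) * z ^ (k - 1)) - \<alpha> * (exp (- (\<alpha> / 2 * z\<^sup>2)) * z ^ Suc k)) (at z)" for z
   by (auto intro!: derivative_eq_intros simp: algebra_simps)
  from has_vector_derivative_real_field[OF this] show ?thesis .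
 qed
 have rec: "of_nat k * m (k - 1) = \<alpha> * m (Suc k)" for k
 proof -
  have "(LBINT x. of_nat k * (exp (- (\<alpha> / 2 * (cplx x)\<^sup>2)) * (cplx x) ^ (k - 1))
   - \<alpha> * (exp (- (\<alpha> / 2 * (cplx x)\<^sup>2)) * (cplx x) ^ Suc k)) = 0"
   by (rule integral_derivative_decay[OF der])
    (use I in \<open>auto intro!: continuous_intros I Bochner_Integration.integrable_diff integrable_mult_right simp del: power_Suc\<close>)
  then show ?thesis
   using I by (subst (asm) Bochner_Integration.integral_diff) (auto simp: m_def simp del: power_Suc)
 qed
 show "m (Suc (2 * k)) = 0"
 proof (induction k)
  case 0 show ?case using rec[of 0] \<alpha>0 by simp
 next
  case (Suc k) show ?case using rec[of "2 * Suc k"] \<alpha>0 Suc by simp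
 qed
 show "m (2 * k) / fact (2 * k) = (1 / (2 * \<alpha>)) ^ k / fact k * m 0"
 proof (induction k)
  case (Suc k)
  have "b \<noteq> 0 ==> a \<noteq> 0 ==> F \<noteq> 0 ==>
    b / \<alpha> * M / (2 * a * b * F) = (1 / (2 * \<alpha>)) / a * (M / F)" for a b F M :: complex
   using \<alpha>0 by (simp add: field_simps)
  moreover have "m (2 * Suc k) = (2 * of_nat k + 1) / \<alpha> * m (2 * k)"
   using rec[of "Suc (2 * k)"] \<alpha>0 by (simp add: field_simps)
  moreover have "fact (2 * Suc k) = 2 * (of_nat k + 1) * (2 * of_nat k + 1) * (fact (2 * k) :: complex)"
   by (simp add: algebra_simps)
  moreover have "(2 * of_nat k + 1 :: complex) \<noteq> 0" "(of_nat k + 1 :: complex) \<noteq> 0"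
   by (simp_all add: complex_eq_iff)
  ultimately have "m (2 * Suc k) / fact (2 * Suc k) = (1 / (2 * \<alpha>)) / (of_nat k + 1) * (m (2 * k) / fact (2 * k))"
   by (simp only: fact_nonzero not_False_eq_True)
  also have "... = (1 / (2 * \<alpha>)) ^ Suc k / fact (Suc k) * m 0"
   unfolding Suc power_Suc fact_Suc by (simp add: add.commute)
  finally show ?case .
 qed simp
qed

text \<open>The moment series resums to an exponential. The Gaussian integral itself stays as an
  unevaluated factor, so that no branch of the complex square root has to be chosen.\<close>

lemma gauss_fourier_complex:
 fixes \<alpha> :: complex
 assumes \<alpha>: "0 < Re \<alpha>"
 shows "(LBINT x. exp (- (\<alpha> / 2 * (cplx x)\<^sup>2)) * exp (\<i> * cplx (\<xi> * x)))
   = (LBINT x. exp (- (\<alpha> / 2 * (cplx x)\<^sup>2))) * exp (- (cplx \<xi>)\<^sup>2 / (2 * \<alpha>))"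
proof -
 define \<psi> where "\<psi> x = exp (- (\<alpha> / 2 * (cplx x)\<^sup>2))" for x
 define m where "m k = (LBINT x. \<psi> x * (cplx x) ^ k)" for k
 note M = complex_gauss_moments[OF \<alpha>, folded \<psi>_def, folded m_def]
 have \<psi>m: "\<psi> \<in> bmeas"
  unfolding \<psi>_def[abs_def] by (intro borel_measurable_continuous_onI continuous_intros)
 have int: "integrable lborel (%x. norm (\<psi> x) * exp \<bar>\<xi> * x\<bar>)"
 proof (rule Bochner_Integration.integrable_bound)
  define r where "r = Re \<alpha>"
  have r: "r > 0" using \<alpha> by (simp add: r_def)
  show "integrable lborel (%x. exp (\<xi>\<^sup>2 / r) * (x ^ 0 * exp (- (r / 4 * x\<^sup>2))))"
   by (intro integrable_mult_right integrable_monomial_gauss) (use r in auto)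
  show "AE x in lborel. norm (norm (\<psi> x) * exp \<bar>\<xi> * x\<bar>) <= norm (exp (\<xi>\<^sup>2 / r) * (x ^ 0 * exp (- (r / 4 * x\<^sup>2))))"
  proof (rule AE_I2)
   fix x :: real
   \<comment> \<open>Half of the Gaussian decay absorbs the factor exp |\<xi> x|.\<close>
   have "0 <= (\<bar>\<xi>\<bar> / sqrt r - sqrt r * \<bar>x\<bar> / 2)\<^sup>2" by simp
   also have "... = \<xi>\<^sup>2 / r - \<bar>\<xi> * x\<bar> + r / 4 * x\<^sup>2"
    using r by (simp add: power2_diff power_divide power_mult_distrib abs_mult)
   finally have "\<bar>\<xi> * x\<bar> - r / 2 * x\<^sup>2 <= \<xi>\<^sup>2 / r - r / 4 * x\<^sup>2" by simp
   then have "exp (\<bar>\<xi> * x\<bar> - r / 2 * x\<^sup>2) <= exp (\<xi>\<^sup>2 / r - r / 4 * x\<^sup>2)" by simp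
   moreover have "norm (\<psi> x) * exp \<bar>\<xi> * x\<bar> = exp (\<bar>\<xi> * x\<bar> - r / 2 * x\<^sup>2)"
    by (simp add: \<psi>_def r_def flip: of_real_power exp_add)
   ultimately show "norm (norm (\<psi> x) * exp \<bar>\<xi> * x\<bar>) <= norm (exp (\<xi>\<^sup>2 / r) * (x ^ 0 * exp (- (r / 4 * x\<^sup>2))))"
    by (simp flip: exp_add)
  qed
 qed (use \<psi>m in measurable)
 have S1: "(%n. m n * ((\<i> * \<xi>) ^ n / fact n)) sums (LBINT x. \<psi> x * exp (\<i> * cplx (\<xi> * x)))"
  using exp_moment_sums[OF \<psi>m int] by (simp add: m_def)
 define w where "w = - (cplx \<xi>)\<^sup>2 / (2 * \<alpha>)"
 have "(%k. w ^ k /\<^sub>R fact k * m 0) sums (exp w * m 0)"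
  by (intro sums_mult2 exp_converges)
 \<comment> \<open>The exponential series is spread over the even indices to match the moment
   series, whose odd terms vanish.\<close>
 then have "(%n. if even n then w ^ (n div 2) /\<^sub>R fact (n div 2) * m 0 else 0) sums (exp w * m 0)"
  by (subst sums_mono_reindex[of "%k. 2 * k", symmetric]) (auto simp: strict_mono_def elim!: evenE)
 also have "(%n. if even n then w ^ (n div 2) /\<^sub>R fact (n div 2) * m 0 else 0) = (%n. m n * ((\<i> * \<xi>) ^ n / fact n))"
 proof
  fix n
  show "(if even n then w ^ (n div 2) /\<^sub>R fact (n div 2) * m 0 else 0) = m n * ((\<i> * \<xi>) ^ n / fact n)"
  proof (cases "even n")
   case True
   then obtain k where k: "n = 2 * k" by (auto elim: evenE)
   have "m n * ((\<i> * \<xi>) ^ n / fact n) = (m (2 * k) / fact (2 * k)) * ((\<i> * \<xi>)\<^sup>2) ^ k"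
    unfolding k by (simp add: power_mult)
   also have "... = w ^ k / fact k * m 0"
    unfolding M(2) w_def by (simp add: power_mult_distrib power_divide power_minus')
   finally show ?thesis using True by (simp add: k scaleR_conv_of_real divide_inverse_commute)
  next
   case False
   then obtain k where "n = Suc (2 * k)" by (metis oddE Suc_eq_plus1)
   then show ?thesis using M(1) by simp
  qed
 qed
 finally have "(LBINT x. \<psi> x * exp (\<i> * cplx (\<xi> * x))) = exp w * m 0"
  by (rule sums_unique2[OF S1])
 also have "... = m 0 * exp w" by (rule mult.commute)
 finally show ?thesis unfolding \<psi>_def m_def w_def power_0 mult_1_right .
qed

text \<open>The kernel of \<open>e\<^sup>i\<^sup>t\<^sup>H\<close> up to a factor of modulus one that depends on \<open>t\<close> only and cancels in the
 trilinear operator.\<close>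

definition mehler :: "real => real => real => complex" where
 "mehler t x y = cplx (1 / sqrt (2 * pi * \<bar>sin (2 * t)\<bar>)) *
   cis (x * y / sin (2 * t) - (x\<^sup>2 + y\<^sup>2) * (cos (2 * t) / sin (2 * t)) / 2)"

definition mehler_op :: "real => (real => complex) => real => complex" where
 "mehler_op t f x = (LBINT y. mehler t x y * f y)"

lemma norm_mehler: "norm (mehler t x y) = 1 / sqrt (2 * pi * \<bar>sin (2 * t)\<bar>)"
 by (simp add: mehler_def norm_mult del: of_real_divide)

lemma mehler_sym: "mehler t x y = mehler t y x"
 by (simp add: mehler_def mult.commute add.commute)

lemma measurable_cis [measurable]: "cis \<in> bmeas"
 by (intro borel_measurable_continuous_onI continuous_intros)

lemma measurable_mehler [measurable]: "case_prod (mehler t) \<in> borel_measurable (borel \<Otimes>\<^sub>M borel)"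
 unfolding mehler_def[abs_def] by measurable

lemma mehler_op_measurable [measurable]:
 assumes [measurable]: "f \<in> bmeas"
 shows "mehler_op t f \<in> bmeas"
 unfolding mehler_op_def[abs_def] by measurable

lemma norm_mehler_op_le:
 assumes "integrable lborel f"
 shows "norm (mehler_op t f x) <= 1 / sqrt (2 * pi * \<bar>sin (2 * t)\<bar>) * (LBINT y. norm (f y))"
proof -
 have "norm (mehler_op t f x) <= (LBINT y. norm (mehler t x y * f y))"
  unfolding mehler_op_def by (rule integral_norm_bound)
 then show ?thesis by (simp add: norm_mult norm_mehler)
qed

definition hermite_gauss :: "nat => real => real" where
 "hermite_gauss n x = poly (hermite_poly n) x * exp (- (1/2 * x\<^sup>2))"

text \<open>For n = 0 this is the transform of a complex Gaussian. Integration by parts expresses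
  multiplication by y under the integral through multiplication by x and a derivative, and the
  Hermite recursion then carries the relation from degrees m and m - 1 to m + 1, each degree
  contributing one factor cis(2t). The constant \<omega> is common to all n.\<close>

lemma mehler_hermite_gauss:
 assumes s: "sin (2 * t) \<noteq> 0"
 shows "\<exists>\<omega>. \<forall>n x. mehler_op t (%y. cplx (hermite_gauss n y)) x
   = \<omega> * cis (2 * t) ^ n * cplx (hermite_gauss n x)"
proof -
 define s where "s = sin (2 * t)"
 define c where "c = cos (2 * t)"
 define k where "k = c / s"
 define e where "e = cis (2 * t)"
 have s0: "s \<noteq> 0" using s by (simp add: s_def)
 have sc: "s\<^sup>2 + c\<^sup>2 = 1" by (simp add: s_def c_def)
 have e: "e = Complex c s" by (simp add: e_def c_def s_def cis.code)
 define E where "E x y = cis (x * y / s - (x\<^sup>2 + y\<^sup>2) * k / 2)" for x y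
 have mehler_E: "mehler t x y = cplx (1 / sqrt (2 * pi * \<bar>s\<bar>)) * E x y" for x y
  by (simp add: mehler_def E_def s_def c_def k_def)
 have normE: "norm (E x y) = 1" for x y by (simp add: E_def)
 have [measurable]: "E x \<in> bmeas" for x
  unfolding E_def[abs_def] by measurable
 define P where "P p y = cplx (poly p y * exp (- (1/2 * y\<^sup>2)))" for p y
 have int: "integrable lborel (%y. E x y * P p y)" for x p
 proof (rule Bochner_Integration.integrable_bound[OF integrable_poly_gauss[of "1/2" p]])
  have [measurable]: "P p \<in> bmeas"
   unfolding P_def[abs_def] by (intro borel_measurable_continuous_onI continuous_intros) auto
  show "(%y. E x y * P p y) \<in> borel_measurable lborel"
   by measurable
 qed (auto simp: norm_mult normE P_def)
 have limits: "((%y. E x y * P p y) \<longlongrightarrow> 0) at_top" "((%y. E x y * P p y) \<longlongrightarrow> 0) at_bot" for x p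
  using poly_gauss_tendsto[of "1/2" p, THEN tendsto_norm_zero]
  by (intro tendsto_norm_zero_cancel[of "%y. E x y * P p y"], simp add: norm_mult normE P_def abs_mult)+
 define J where "J p x = (LBINT y. E x y * P p y)" for p x
 have J_lin: "J (p + q) x = J p x + J q x" "J (smult r p) x = r * J p x" for p q r x
 proof -
  have Padd: "P (p + q) y = P p y + P q y" and Psmult: "P (smult r p) y = cplx r * P p y" for y
   by (simp_all add: P_def distrib_right)
  have "J (p + q) x = (LBINT y. E x y * P p y + E x y * P q y)"
   unfolding J_def Padd distrib_left ..
  then show "J (p + q) x = J p x + J q x"
   by (simp add: J_def Bochner_Integration.integral_add int)
  have "J (smult r p) x = (LBINT y. cplx r * (E x y * P p y))"
   unfolding J_def Psmult by (simp only: mult.left_commute)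
  then show "J (smult r p) x = r * J p x" by (simp add: J_def)
 qed
 \<comment> \<open>The three terms are the integrals of the three parts of the y-derivative of
   \<open>E x y * P p y\<close>.\<close>
 have parts: "(\<i> * x / s) * J p x - (1 + \<i> * k) * J ([:0, 1:] * p) x + J (pderiv p) x = 0" for p x
 proof -
  define D where "D y = (\<i> * x / s) * (E x y * P p y) - (1 + \<i> * k) * (E x y * P ([:0, 1:] * p) y) + E x y * P (pderiv p) y" for y
  have "((%y. E x y * P p y) has_vector_derivative D y) (at y)" for y
  proof -
   have 1: "((%y. E x y) has_vector_derivative \<i> * E x y * (x / s - y * k)) (at y)"
   proof -
    have "((%y. x * y / s - (x\<^sup>2 + y\<^sup>2) * k / 2) has_real_derivative (x / s - y * k)) (at y)"
     by (auto intro!: derivative_eq_intros simp: s0)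
    moreover have "(cis has_vector_derivative \<i> * cis z) (at z)" for z
    proof -
     have "((%z. exp (\<i> * z)) has_field_derivative \<i> * exp (\<i> * z)) (at z)" for z
      by (auto intro!: derivative_eq_intros)
     from has_vector_derivative_real_field[OF this] show ?thesis
      by (simp add: cis_conv_exp[abs_def])
    qed
    ultimately have "((cis \<circ> (%y. x * y / s - (x\<^sup>2 + y\<^sup>2) * k / 2)) has_vector_derivative
      (x / s - y * k) *\<^sub>R (\<i> * cis (x * y / s - (x\<^sup>2 + y\<^sup>2) * k / 2))) (at y)"
     by (intro vector_diff_chain_at) (auto simp: has_real_derivative_iff_has_vector_derivative)
    then show ?thesis
     by (simp add: E_def o_def scaleR_conv_of_real mult_ac)
   qed
   have 2: "(P p has_vector_derivative P (pderiv p) y - P ([:0, 1:] * p) y) (at y)"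
   proof -
    have "((%y. poly p y * exp (- (1/2 * y\<^sup>2))) has_real_derivative
     poly (pderiv p) y * exp (- (1/2 * y\<^sup>2)) - poly ([:0, 1:] * p) y * exp (- (1/2 * y\<^sup>2))) (at y)"
     by (auto intro!: derivative_eq_intros poly_DERIV simp: algebra_simps)
    from has_vector_derivative_of_real[OF this]
    show ?thesis by (simp add: P_def[abs_def])
   qed
   from has_vector_derivative_mult[OF 1 2] show ?thesis
    by (rule has_vector_derivative_eq_rhs) (simp add: D_def P_def algebra_simps)
  qed
  then have "(LBINT y. D y) = 0"
  proof (rule integral_derivative_decay[OF _ _ _ limits])
   show "integrable lborel D" unfolding D_def[abs_def] by (intro Bochner_Integration.integrable_add
     Bochner_Integration.integrable_diff integrable_mult_right int)
   show "continuous_on UNIV D" unfolding D_def[abs_def] E_def P_def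
    by (intro continuous_intros) (auto simp: s0)
  qed
  moreover have "(LBINT y. D y) = (\<i> * x / s) * J p x - (1 + \<i> * k) * J ([:0, 1:] * p) x + J (pderiv p) x"
   unfolding D_def J_def
   by (subst Bochner_Integration.integral_add, (intro Bochner_Integration.integrable_diff integrable_mult_right int)+,
     subst Bochner_Integration.integral_diff, (intro integrable_mult_right int)+,
     subst (1 2) Bochner_Integration.integral_mult_right_zero, rule refl)
  ultimately show ?thesis by simp
 qed
 define w where "w = (LBINT y. exp (- ((1 + \<i> * k) / 2 * (cplx y)\<^sup>2)))"
 \<comment> \<open>As 1 + \<i> k = \<i> cis(-2t) / s, this inverts the coefficient of the first
   moment in \<open>parts\<close>.\<close>
 have k1: "(1 + \<i> * k) * (- \<i> * s * e) = 1"
 proof -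
  have "c * (c * s) + s * (s * s) = s" using sc by algebra
  then show ?thesis
   using s0 by (simp add: e k_def complex_eq_iff field_simps power2_eq_square)
 qed
 \<comment> \<open>In the induction step below the two contributions of \<open>B\<close> combine to
   a multiple of this square.\<close>
 have e2: "e\<^sup>2 = 1 + 2 * \<i> * s * e"
  using sc by (simp add: e complex_eq_iff power2_eq_square algebra_simps)
 have J0: "J 1 x = w * P 1 x" for x
 proof -
  define \<alpha> where "\<alpha> = 1 + \<i> * cplx k"
  have \<alpha>: "\<alpha> * (- \<i> * s * e) = 1" using k1 by (simp add: \<alpha>_def)
  then have \<alpha>0: "\<alpha> \<noteq> 0" by auto
  have pt: "E x y * P 1 y = cis (- (x\<^sup>2 * k / 2)) * (exp (- (\<alpha> / 2 * (cplx y)\<^sup>2)) * exp (\<i> * cplx (x / s * y)))" for y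
   unfolding E_def P_def \<alpha>_def cis_conv_exp poly_1 mult_1 exp_of_real[symmetric] mult_exp_exp
   by (rule arg_cong[where f = exp]) (simp add: algebra_simps add_divide_distrib diff_divide_distrib)
  have "J 1 x = cis (- (x\<^sup>2 * k / 2)) * (w * exp (- (cplx (x / s))\<^sup>2 / (2 * \<alpha>)))"
   unfolding J_def pt Bochner_Integration.integral_mult_right_zero w_def
   by (subst gauss_fourier_complex) (simp_all add: \<alpha>_def)
  also have "cis (- (x\<^sup>2 * k / 2)) * (w * exp (- (cplx (x / s))\<^sup>2 / (2 * \<alpha>)))
    = w * exp (\<i> * cplx (- (x\<^sup>2 * k / 2)) - (cplx (x / s))\<^sup>2 / (2 * \<alpha>))"
   unfolding cis_conv_exp mult.left_commute[of _ w] mult_exp_exp by simp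
  also have "\<i> * cplx (- (x\<^sup>2 * k / 2)) - (cplx (x / s))\<^sup>2 / (2 * \<alpha>)
    = cplx (- (1/2 * x\<^sup>2))"
  proof -
   have "1 / \<alpha> = - \<i> * s * e" using \<alpha> \<alpha>0 by (simp add: field_simps)
   then have q: "(cplx (x / s))\<^sup>2 / (2 * \<alpha>) = (cplx (x / s))\<^sup>2 / 2 * (- \<i> * s * e)"
    by (metis divide_divide_eq_left mult.right_neutral times_divide_eq_right)
   show ?thesis
    unfolding q using s0 by (simp add: e k_def complex_eq_iff power2_eq_square field_simps)
  qed
  also have "exp (cplx (- (1/2 * x\<^sup>2))) = P 1 x"
   by (simp add: P_def flip: exp_of_real)
  finally show ?thesis .
 qed
 have main: "J (hermite_poly n) x = w * e ^ n * P (hermite_poly n) x" for n x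
 proof (induction n arbitrary: x rule: less_induct)
  case (less n)
  show ?case
  proof (cases n)
   case 0 then show ?thesis using J0 by simp
  next
   case (Suc m)
   define A where "A = J ([:0, 1:] * hermite_poly m) x"
   define B where "B = of_nat m * J (hermite_poly (m - 1)) x"
   have Jm: "J (hermite_poly m) x = w * e ^ m * P (hermite_poly m) x"
    using less[of m] Suc by simp
   have B: "B * e\<^sup>2 = of_nat m * (w * e ^ Suc m * P (hermite_poly (m - 1)) x)"
   proof (cases m)
    case (Suc j)
    then show ?thesis using less[of j x] \<open>n = Suc m\<close> by (simp add: B_def power2_eq_square mult_ac)
   qed (simp add: B_def)
   have "(1 + \<i> * k) * A = (\<i> * x / s) * J (hermite_poly m) x + 2 * B"
   proof -
    have gen: "a - b + d = 0 ==> b = a + d" for a b d :: complex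
     by algebra
    show ?thesis
     by (rule gen) (use parts[of x "hermite_poly m"] in \<open>simp add: pderiv_hermite J_lin A_def B_def mult.assoc\<close>)
   qed
   then have "(1 + \<i> * k) * (- \<i> * s * e) * A = (- \<i> * s * e) * ((\<i> * x / s) * J (hermite_poly m) x + 2 * B)"
    by (simp add: mult_ac)
   then have A: "A = (- \<i> * s * e) * ((\<i> * x / s) * J (hermite_poly m) x + 2 * B)"
    unfolding k1 by simp
   have A': "A = e * x * J (hermite_poly m) x - 2 * \<i> * s * e * B"
    unfolding A using s0 by (simp add: field_simps)
   have Hn: "hermite_poly n = smult 2 ([:0, 1:] * hermite_poly m) + smult (- (2 * real m)) (hermite_poly (m - 1))"
    unfolding Suc hermite_poly.simps(2) pderiv_hermite by simp
   have "J (hermite_poly n) x = 2 * A - 2 * B"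
    unfolding Hn J_lin A_def B_def by simp
   also have "... = 2 * (e * x * J (hermite_poly m) x) - 2 * (B * e\<^sup>2)"
    unfolding A' e2 by (simp add: algebra_simps)
   also have "... = w * e ^ n * (2 * x * P (hermite_poly m) x - 2 * of_nat m * P (hermite_poly (m - 1)) x)"
    unfolding B Jm Suc by (simp add: algebra_simps)
   also have "2 * x * P (hermite_poly m) x - 2 * of_nat m * P (hermite_poly (m - 1)) x = P (hermite_poly n) x"
    unfolding Suc P_def poly_hermite_recurrence by (simp add: algebra_simps)
   finally show ?thesis .
  qed
 qed
 have "mehler_op t (%y. cplx (hermite_gauss n y)) x
   = (cplx (1 / sqrt (2 * pi * \<bar>s\<bar>)) * w) * cis (2 * t) ^ n * cplx (hermite_gauss n x)" for n x
 proof -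
  have "mehler_op t (%y. cplx (hermite_gauss n y)) x =
    (LBINT y. cplx (1 / sqrt (2 * pi * \<bar>s\<bar>)) * (E x y * P (hermite_poly n) y))"
   unfolding mehler_op_def mehler_E P_def hermite_gauss_def by (simp add: mult.assoc)
  also have "... = cplx (1 / sqrt (2 * pi * \<bar>s\<bar>)) * J (hermite_poly n) x"
   unfolding J_def by (rule Bochner_Integration.integral_mult_right_zero)
  finally show ?thesis
   unfolding main by (simp add: P_def e_def hermite_gauss_def)
 qed
 then show ?thesis by blast
qed

lemma hermite_fun_gauss: "hermite_fun n x = hermite_gauss n x / hermite_norm n"
 by (simp add: hermite_fun_alt hermite_gauss_def)

lemma integrable_mult_bounded:
 fixes f g :: "real => complex"
 assumes "integrable lborel f" "g \<in> bmeas" "\<And>x. norm (g x) <= C"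
 shows "integrable lborel (%x. f x * g x)"
proof (rule Bochner_Integration.integrable_bound)
 show "integrable lborel (%x. C * norm (f x))" using assms(1) by auto
 have [measurable]: "f \<in> bmeas" using assms(1) by auto
 show "(%x. f x * g x) \<in> borel_measurable lborel" using assms(2) by measurable
 have "norm (f x) * norm (g x) <= norm (f x) * \<bar>C\<bar>" for x
  using assms(3)[of x] by (intro mult_left_mono) auto
 then show "AE x in lborel. norm (f x * g x) <= norm (C * norm (f x))"
  by (auto simp: norm_mult abs_mult mult.commute)
qed

lemma mehler_adjoint:
 assumes f: "integrable lborel f" and g: "integrable lborel g"
 shows "(LBINT x. mehler_op t f x * g x) = (LBINT y. f y * mehler_op t g y)"
proof -
 have [measurable]: "f \<in> bmeas" "g \<in> bmeas" using f g by auto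
 have int: "integrable (lborel \<Otimes>\<^sub>M lborel) (%(x, y). mehler t x y * f y * g x)"
 proof (rule Bochner_Integration.integrable_bound)
  have "integrable (lborel \<Otimes>\<^sub>M lborel) (%(x, y). norm (g x) * norm (f y))"
   using f g by (intro lborel_pair.Fubini_integrable) auto
  then show "integrable (lborel \<Otimes>\<^sub>M lborel) (%(x, y). 1 / sqrt (2 * pi * \<bar>sin (2 * t)\<bar>) * (norm (g x) * norm (f y)))"
   by (simp add: case_prod_unfold)
 qed (auto simp: norm_mult norm_mehler mult.commute intro!: AE_I2)
 have "(LBINT x. mehler_op t f x * g x) = (LBINT x. LBINT y. mehler t x y * f y * g x)"
  by (simp add: mehler_op_def)
 also have "... = (LBINT y. LBINT x. mehler t x y * f y * g x)"
  using lborel_pair.Fubini_integral[OF int] by simp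
 also have "... = (LBINT y. f y * mehler_op t g y)"
  unfolding mehler_op_def Bochner_Integration.integral_mult_right_zero[symmetric]
  by (simp add: mehler_sym mult_ac)
 finally show ?thesis .
qed

lemma square_integrable_gauss: "0 < a ==> square_integrable (%x. cplx (exp (- (a * x\<^sup>2))))"
 using integrable_poly_gauss[of "2 * a" 1]
 by (simp add: square_integrable_def mult.assoc exp_double[symmetric])

text \<open>Both sides have the same integrals against Hermite functions, because the symmetric
  kernel can be moved onto the Hermite function. Completeness is applied to functions rather than to
  classes, since square-integrability of \<open>mehler_op t f\<close> is a consequence and not yet
  known. The factor cis(-t) accounts for the difference between cis(t (2n + 1)) and
  cis(2t)^n.\<close>

lemma mehler_propagator_AE:
 assumes H: "\<And>n x. mehler_op t (%y. cplx (hermite_gauss n y)) x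
    = \<omega> * cis (2 * t) ^ n * cplx (hermite_gauss n x)"
  and sq: "square_integrable f" and int: "integrable lborel f"
 shows "AE x in lborel. mehler_op t f x = \<omega> * cis (- t) * rep_L2 (propagator t (L2_of f)) x"
proof -
 define v where "v = mehler_op t f"
 define u where "u = rep_L2 (propagator t (L2_of f))"
 have [measurable]: "f \<in> bmeas" using int by auto
 have [measurable]: "v \<in> bmeas" "u \<in> bmeas"
  by (simp_all add: v_def u_def)
 have sqh: "square_integrable (%x. cplx (hermite_fun n x))" for n
  by (rule square_integrable_hermite)
 have ih: "integrable lborel (%x. cplx (hermite_fun n x))" for n
  using integrable_hermite_fun by simp
 have vb: "norm (v x) <= 1 / sqrt (2 * pi * \<bar>sin (2 * t)\<bar>) * (LBINT y. norm (f y))" for x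
  unfolding v_def by (rule norm_mehler_op_le[OF int])
 have iv: "integrable lborel (%x. g x * v x)" if "integrable lborel g" for g
  by (rule integrable_mult_bounded[OF that _ vb]) measurable
 have iu: "integrable lborel (%x. u x * cplx (g x))" if "square_integrable (%x. cplx (g x))" for g
  using square_integrable_integrable_mult[OF square_integrable_rep that] by (simp add: u_def)
 have "AE x in lborel. v x - \<omega> * cis (- t) * u x = 0"
 proof (rule hermite_complete)
  have ig: "integrable lborel (%x::real. cplx (exp (- (1/4 * x\<^sup>2))))"
   using integrable_poly_gauss[of "1/4" 1] by simp
  have "integrable lborel (%x. cplx (exp (- (1/4 * x\<^sup>2))) * v x
    - \<omega> * cis (- t) * (u x * cplx (exp (- (1/4 * x\<^sup>2)))))"
   by (intro Bochner_Integration.integrable_diff integrable_mult_right iv ig iu square_integrable_gauss) simp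
  then show "integrable lborel (%x. (v x - \<omega> * cis (- t) * u x) * cplx (exp (- (1/4 * x\<^sup>2))))"
   by (simp add: left_diff_distrib mult_ac)
  fix n
  have H': "mehler_op t (%y. cplx (hermite_fun n y)) x
    = \<omega> * cis (2 * t) ^ n * cplx (hermite_fun n x)" for x
   using H[of n x] unfolding mehler_op_def hermite_fun_gauss
   by simp
  have 1: "(LBINT x. v x * cplx (hermite_fun n x))
    = \<omega> * cis (2 * t) ^ n * (LBINT x. f x * cplx (hermite_fun n x))"
   unfolding v_def mehler_adjoint[OF int ih] H' Bochner_Integration.integral_mult_right_zero[symmetric]
   by (simp only: mult_ac)
  have F: "(LBINT x. f x * cplx (hermite_fun n x)) = cinner (L2_of f) (hermite_L2 n)"
   unfolding hermite_L2_def by (subst cinner_L2_of[OF sq sqh]) simp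
  have 2: "(LBINT x. u x * cplx (hermite_fun n x)) = cis (t * (2 * real n + 1)) * cinner (L2_of f) (hermite_L2 n)"
  proof -
   have "(LBINT x. u x * cplx (hermite_fun n x)) = cinner (L2_of u) (hermite_L2 n)"
    unfolding hermite_L2_def u_def by (subst cinner_L2_of[OF square_integrable_rep sqh]) simp
   then show ?thesis by (simp add: u_def cinner_propagator_hermite)
  qed
  have c: "cis (- t) * cis (t * (2 * real n + 1)) = cis (2 * t) ^ n"
   unfolding cis_mult Complex.DeMoivre[of "2 * t" n]
   by (rule arg_cong[where f = cis]) (simp add: algebra_simps)
  have "(LBINT x. (v x - \<omega> * cis (- t) * u x) * cplx (hermite_fun n x))
   = (LBINT x. cplx (hermite_fun n x) * v x - \<omega> * cis (- t) * (u x * cplx (hermite_fun n x)))"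
   by (simp only: left_diff_distrib right_diff_distrib mult_ac)
  also have "... = (LBINT x. cplx (hermite_fun n x) * v x)
    - \<omega> * cis (- t) * (LBINT x. u x * cplx (hermite_fun n x))"
   unfolding Bochner_Integration.integral_mult_right_zero[symmetric]
   by (intro Bochner_Integration.integral_diff iv ih iu sqh integrable_mult_right)
  also have "(LBINT x. cplx (hermite_fun n x) * v x) = (LBINT x. v x * cplx (hermite_fun n x))"
   by (simp only: mult.commute)
  also have "... - \<omega> * cis (- t) * (LBINT x. u x * cplx (hermite_fun n x)) = 0"
   unfolding 1 2 F c[symmetric] by simp
  finally show "(LBINT x. (v x - \<omega> * cis (- t) * u x) * cplx (hermite_fun n x)) = 0" .
 qed measurable
 then show ?thesis unfolding v_def u_def by eventually_elim simp
qed

lemma integrable_hermite_gauss: "integrable lborel (hermite_gauss n)"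
 unfolding hermite_gauss_def[abs_def] by (intro integrable_poly_gauss) simp

lemma square_integrable_hermite_gauss: "square_integrable (%x. cplx (hermite_gauss n x))"
proof -
 have "(%x. cplx (hermite_norm n) * cplx (hermite_fun n x)) = (%x. cplx (hermite_gauss n x))"
  using hermite_norm_pos[of n] by (auto simp: hermite_fun_gauss)
 then show ?thesis using square_integrable_cmult[OF square_integrable_hermite] by metis
qed

text \<open>Plancherel's theorem: at t = pi/4 the kernel is that of the Fourier integral, and
  evaluation at n = 0, x = 0 gives \<omega> as the total mass of the standard normal
  density.\<close>

lemma mehler_isometry_quarter:
 assumes "square_integrable f" "integrable lborel f"
 shows "integrable lborel (%x. (norm (mehler_op (pi/4) f x))\<^sup>2)"
  and "(LBINT x. (norm (mehler_op (pi/4) f x))\<^sup>2) = (LBINT x. (norm (f x))\<^sup>2)"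
proof -
 have "sin (2 * (pi / 4)) \<noteq> 0" by simp
 from mehler_hermite_gauss[OF this] obtain \<omega> where
  H: "\<And>n x. mehler_op (pi/4) (%y. cplx (hermite_gauss n y)) x
    = \<omega> * cis (2 * (pi/4)) ^ n * cplx (hermite_gauss n x)" by blast
 have "\<omega> = mehler_op (pi/4) (%y. cplx (hermite_gauss 0 y)) 0"
  unfolding H by (simp add: hermite_gauss_def)
 also have "... = cplx (LBINT y. 1 / sqrt (2 * pi) * exp (- (1/2 * y\<^sup>2)))"
  unfolding mehler_op_def integral_complex_of_real[symmetric]
  by (simp add: mehler_def hermite_gauss_def)
 also have "(LBINT y. 1 / sqrt (2 * pi) * exp (- (1/2 * y\<^sup>2))) = (LBINT y. normal_density 0 1 y)"
  by (intro Bochner_Integration.integral_cong) (simp_all add: normal_density_def)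
 finally have w: "norm \<omega> = 1" by simp
 define u where "u = rep_L2 (propagator (pi/4) (L2_of f))"
 have ae: "AE x in lborel. norm (u x)^2 = norm (mehler_op (pi/4) f x)^2"
  using mehler_propagator_AE[OF H assms]
  by eventually_elim (simp add: norm_mult w u_def)
 have [measurable]: "u \<in> bmeas" "f \<in> bmeas"
  using assms by (auto simp: u_def)
 have "integrable lborel (%x. (norm (u x))\<^sup>2)"
  using square_integrable_rep[of "propagator (pi/4) (L2_of f)"] by (simp add: u_def square_integrable_def)
 then show "integrable lborel (%x. (norm (mehler_op (pi/4) f x))\<^sup>2)"
  by (subst integrable_cong_AE[OF _ _ ae, symmetric]) auto
 have "(LBINT x. (norm (mehler_op (pi/4) f x))\<^sup>2) = (LBINT x. (norm (u x))\<^sup>2)"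
  by (rule integral_cong_AE) (use ae in auto)
 also have "... = (norm (propagator (pi/4) (L2_of f)))\<^sup>2"
  unfolding norm_L2_rep u_def by simp
 also have "... = (LBINT x. (norm (f x))\<^sup>2)"
  by (simp add: norm_L2_of[OF assms(1)])
 finally show "(LBINT x. (norm (mehler_op (pi/4) f x))\<^sup>2) = (LBINT x. (norm (f x))\<^sup>2)" .
qed

text \<open>Completing the square turns \<open>e\<^sup>i\<^sup>t\<^sup>H\<close> into the Fourier transform (the case \<open>t = \<pi>/4\<close>), conjugated
 by chirps.\<close>

lemma mehler_op_chirp:
 assumes s: "sin (2 * t) \<noteq> 0"
 defines "k \<equiv> cos (2 * t) / sin (2 * t)"
 shows "mehler_op t f x = cplx (1 / sqrt \<bar>sin (2 * t)\<bar>) * cis (- (x\<^sup>2 * k / 2)) *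
   mehler_op (pi/4) (%y. cis (- (y\<^sup>2 * k / 2)) * f y) (x / sin (2 * t))"
proof -
 have eq: "mehler t x y * f y = cplx (1 / sqrt \<bar>sin (2 * t)\<bar>) * cis (- (x\<^sup>2 * k / 2)) *
   (mehler (pi/4) (x / sin (2 * t)) y * (cis (- (y\<^sup>2 * k / 2)) * f y))" for y
 proof -
  have c: "cis (x * y / sin (2 * t) - (x\<^sup>2 + y\<^sup>2) * k / 2) =
   cis (- (x\<^sup>2 * k / 2)) * (cis (x / sin (2 * t) * y) * cis (- (y\<^sup>2 * k / 2)))"
   unfolding cis_mult by (rule arg_cong[where f = cis]) (simp add: field_simps)
  have "mehler t x y = cplx (1 / sqrt (2 * pi * \<bar>sin (2 * t)\<bar>)) *
    cis (x * y / sin (2 * t) - (x\<^sup>2 + y\<^sup>2) * k / 2)"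
   by (simp add: mehler_def k_def)
  also have "cplx (1 / sqrt (2 * pi * \<bar>sin (2 * t)\<bar>)) = cplx (1 / sqrt \<bar>sin (2 * t)\<bar>) * cplx (1 / sqrt (2 * pi))"
   unfolding of_real_mult[symmetric] by (simp add: real_sqrt_mult)
  finally show ?thesis unfolding c by (simp add: mehler_def)
 qed
 show ?thesis
  unfolding mehler_op_def eq Bochner_Integration.integral_mult_right_zero ..
qed

text \<open>At a general time \<omega> is a complex Gaussian integral. Its modulus is found from L^2
  norms instead: the Gaussian is mapped to \<omega> times itself, while chirps and the dilation by
  \<open>sin (2 * t)\<close> reduce the operator to the isometry at t = pi/4.\<close>

lemma mehler_constant_norm:
 assumes s: "sin (2 * t) \<noteq> 0"
  and H: "\<And>n x. mehler_op t (%y. cplx (hermite_gauss n y)) x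
    = \<omega> * cis (2 * t) ^ n * cplx (hermite_gauss n x)"
 shows "norm \<omega> = 1"
proof -
 define k where "k = cos (2 * t) / sin (2 * t)"
 define h where "h y = cplx (hermite_gauss 0 y)" for y
 define F where "F y = cis (- (y\<^sup>2 * k / 2)) * h y" for y
 define N where "N = (LBINT y. (norm (h y))\<^sup>2)"
 have [measurable]: "hermite_gauss 0 \<in> bmeas"
  using integrable_hermite_gauss by (metis borel_measurable_integrable measurable_lborel2)
 have [measurable]: "F \<in> bmeas"
  unfolding F_def[abs_def] h_def by measurable
 have nF: "norm (F y) = norm (h y)" for y by (simp add: F_def norm_mult)
 have ih: "integrable lborel h" using integrable_hermite_gauss by (simp add: h_def[abs_def])
 have sqh: "square_integrable h" using square_integrable_hermite_gauss by (simp add: h_def[abs_def])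
 have iF: "integrable lborel F"
  by (rule Bochner_Integration.integrable_bound[OF ih]) (auto simp: nF)
 have sqF: "square_integrable F"
  using sqh by (auto simp: square_integrable_def nF)
 note iso = mehler_isometry_quarter[OF sqF iF]
 have "norm \<omega>^2 * N = (LBINT x. (norm (mehler_op t h x))\<^sup>2)"
  unfolding h_def H N_def by (simp add: norm_mult power_mult_distrib norm_power)
 also have "... = (LBINT x. 1 / \<bar>sin (2 * t)\<bar> * (norm (mehler_op (pi/4) F (x / sin (2 * t))))\<^sup>2)"
  by (subst mehler_op_chirp[OF s]) (simp add: norm_mult power_mult_distrib F_def[abs_def] k_def power_divide norm_divide)
 also have "... = 1 / \<bar>sin (2 * t)\<bar> * (LBINT x. (norm (mehler_op (pi/4) F (0 + (1 / sin (2 * t)) * x)))\<^sup>2)"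
  by simp
 also have "(LBINT x. (norm (mehler_op (pi/4) F (0 + (1 / sin (2 * t)) * x)))\<^sup>2)
  = \<bar>sin (2 * t)\<bar> * (LBINT x. (norm (mehler_op (pi/4) F x))\<^sup>2)"
  using s by (subst lborel_integral_real_affine[of "1 / sin (2 * t)" "%x. (norm (mehler_op (pi/4) F x))\<^sup>2" 0]) auto
 also have "1 / \<bar>sin (2 * t)\<bar> * ... = N"
  using s unfolding iso(2) by (simp add: nF N_def)
 finally have eq: "norm \<omega>^2 * N = N" .
 have "N \<noteq> 0"
 proof
  assume "N = 0"
  then have "AE y in lborel. (norm (h y))\<^sup>2 = 0"
   using integral_nonneg_eq_0_iff_AE[of lborel "%y. (norm (h y))\<^sup>2"] sqh by (simp add: N_def square_integrable_def)
  then have "AE y::real in lborel. False"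
   by (rule eventually_mono) (simp add: h_def hermite_gauss_def)
  then show False
   by (simp add: eventually_False ae_filter_eq_bot_iff)
 qed
 with eq have "(norm \<omega>)\<^sup>2 = 1" by simp
 then show ?thesis using norm_ge_zero[of \<omega>] by (auto simp: power2_eq_1_iff)
qed

theorem propagator_mehler:
 assumes s: "sin (2 * t) \<noteq> 0"
 shows "\<exists>\<omega>. norm \<omega> = 1 \<and> (\<forall>f. square_integrable f --> integrable lborel f -->
  square_integrable (mehler_op t f) \<and> propagator t (L2_of f) = \<omega> *\<^sub>C L2_of (mehler_op t f))"
proof -
 from mehler_hermite_gauss[OF s] obtain \<omega> where
  H: "\<And>n x. mehler_op t (%y. cplx (hermite_gauss n y)) x
    = \<omega> * cis (2 * t) ^ n * cplx (hermite_gauss n x)" by blast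
 note w = mehler_constant_norm[OF s H]
 have "square_integrable (mehler_op t f)"
  "propagator t (L2_of f) = (cnj \<omega> * cis t) *\<^sub>C L2_of (mehler_op t f)"
  if f: "square_integrable f" "integrable lborel f" for f
 proof -
  have [measurable]: "f \<in> bmeas" using f by auto
  note sq = square_integrable_cmult[OF square_integrable_rep, of "\<omega> * cis (- t)"]
  have ae: "AE x in lborel. \<omega> * cis (- t) * rep_L2 (propagator t (L2_of f)) x = mehler_op t f x"
   using mehler_propagator_AE[OF H f] by eventually_elim simp
  note L = L2_of_AE_cong[OF sq _ ae]
  show "square_integrable (mehler_op t f)" by (rule L) measurable
  have "L2_of (mehler_op t f) = (\<omega> * cis (- t)) *\<^sub>C propagator t (L2_of f)"
   by (subst L(2)[symmetric]) (simp_all add: L2_of_cmult)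
  moreover have "cnj \<omega> * cis t * (\<omega> * cis (- t)) = 1"
  proof -
   have "cnj \<omega> * cis t * (\<omega> * cis (- t)) = (\<omega> * cnj \<omega>) * (cis t * cis (- t))" by (simp only: mult_ac)
   also have "\<omega> * cnj \<omega> = 1" using w by (simp flip: complex_norm_square)
   finally show ?thesis by (simp add: cis_mult)
  qed
  ultimately show "propagator t (L2_of f) = (cnj \<omega> * cis t) *\<^sub>C L2_of (mehler_op t f)"
   by (simp add: scaleC_scaleC)
 qed
 moreover have "norm (cnj \<omega> * cis t) = 1" using w by (simp add: norm_mult)
 ultimately show ?thesis by blast
qed

lemma square_integrable_truncate:
 assumes "square_integrable f" and [measurable]: "A \<in> sets borel"
 shows "square_integrable (%x. indicator A x * f x)"
proof (rule square_integrable_bound)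
 have [measurable]: "f \<in> bmeas" using assms by auto
 show "(%x. indicator A x * f x) \<in> bmeas" by measurable
 show "integrable lborel (%x. (norm (f x))\<^sup>2)" using assms by (simp add: square_integrable_def)
qed (auto simp: indicator_def)

lemma integrable_truncate:
 assumes "square_integrable f" and [measurable]: "A \<in> sets borel" and "emeasure lborel A < \<infinity>"
 shows "integrable lborel (%x. indicator A x * f x)"
proof -
 have "(%x. f x * cnj (indicator A x)) = (%x. indicator A x * f x)"
  by (auto simp: indicator_def)
 then show ?thesis
  using square_integrable_integrable_mult[OF assms(1) square_integrable_indicator[OF assms(2,3)]]
  by simp
qed

text \<open>At t = -pi/4 the Mehler kernel is exactly the kernel of the Fourier integral. The
  truncations in \<open>fourier\<close> are integrable, so Mehler's formula applies to them before
  the limit in L^2 is taken.\<close>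

lemma fourier_propagator: "\<exists>\<omega>. norm \<omega> = 1 \<and> (\<forall>f. fourier f = \<omega> *\<^sub>C propagator (- (pi / 4)) f)"
proof -
 have "sin (2 * (- (pi / 4))) \<noteq> 0" by simp
 from propagator_mehler[OF this] obtain \<omega> where w: "norm \<omega> = 1" and
  U: "\<And>f. square_integrable f ==> integrable lborel f ==>
   square_integrable (mehler_op (- (pi / 4)) f) \<and> propagator (- (pi / 4)) (L2_of f) = \<omega> *\<^sub>C L2_of (mehler_op (- (pi / 4)) f)"
  by blast
 have "fourier f = cnj \<omega> *\<^sub>C propagator (- (pi / 4)) f" for f
 proof -
  define tr where "tr n x = indicator {- real n..real n} x * rep_L2 f x" for n :: nat and x
  have sq: "square_integrable (tr n)" for n
   unfolding tr_def[abs_def] by (intro square_integrable_truncate) auto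
  have int: "integrable lborel (tr n)" for n
   unfolding tr_def[abs_def] by (intro integrable_truncate) (auto simp: emeasure_lborel_Icc_eq)
  have eq: "(%\<xi>. cplx (1 / sqrt (2 * pi)) * (LBINT x = - real n..real n. rep_L2 f x * cis (- (x * \<xi>))))
   = mehler_op (- (pi / 4)) (tr n)" for n
  proof
   fix \<xi>
   have "(LBINT x = - real n..real n. rep_L2 f x * cis (- (x * \<xi>)))
    = (LBINT x. tr n x * cis (- (x * \<xi>)))"
    by (simp add: interval_integral_Icc set_lebesgue_integral_def)
     (rule Bochner_Integration.integral_cong, auto simp: tr_def indicator_def)
   then show "cplx (1 / sqrt (2 * pi)) * (LBINT x = - real n..real n. rep_L2 f x * cis (- (x * \<xi>)))
    = mehler_op (- (pi / 4)) (tr n) \<xi>"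
    unfolding mehler_op_def mehler_def
    by (simp add: mult_ac flip: Bochner_Integration.integral_mult_right_zero)
  qed
  have L: "L2_of (mehler_op (- (pi / 4)) (tr n)) = cnj \<omega> *\<^sub>C propagator (- (pi / 4)) (L2_of (tr n))" for n
   using U[OF sq int, of n] w by (simp add: scaleC_scaleC mult.commute[of "cnj \<omega>"] flip: complex_norm_square)
  have "(%n. L2_of (tr n)) \<longlonglongrightarrow> L2_of (rep_L2 f)"
  proof (rule tendsto_L2_of[OF sq square_integrable_rep square_integrable_rep[of f]])
   show "AE x in lborel. (%n. tr n x) \<longlonglongrightarrow> rep_L2 f x"
   proof (rule AE_I2)
    fix x
    obtain N :: nat where "\<bar>x\<bar> <= real N" using real_arch_simple by blast
    then have "\<forall>\<^sub>F n in sequentially. tr n x = rep_L2 f x"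
     by (intro eventually_mono[OF eventually_ge_at_top[of N]]) (auto simp: tr_def indicator_def)
    then show "(%n. tr n x) \<longlonglongrightarrow> rep_L2 f x" by (rule tendsto_eventually)
   qed
  qed (auto simp: tr_def indicator_def)
  then have "(%n. cnj \<omega> *\<^sub>C propagator (- (pi / 4)) (L2_of (tr n))) \<longlonglongrightarrow> cnj \<omega> *\<^sub>C propagator (- (pi / 4)) f"
   by (simp, intro bounded_linear.tendsto[OF bounded_linear_scaleC] bounded_linear.tendsto[OF bounded_linear_propagator])
  then show ?thesis
   unfolding fourier_def eq L by (rule limI)
 qed
 then show ?thesis using w by (intro exI[of _ "cnj \<omega>"]) auto
qed

section \<open>A Strichartz estimate\<close>

lemma nn_integral_abs_powr_unit:
 assumes "q < 1"
 shows "(NN x. ennreal (indicator {-1..1} x * \<bar>x\<bar> powr (- q))) <= ennreal (2 / (1 - q))"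
proof -
 define h where "h x = x powr (- q) * indicator {0..1} x" for x :: real
 have [measurable]: "h \<in> bmeas" unfolding h_def by measurable
 have h: "(NN x. ennreal (h x)) = ennreal (1 / (1 - q))"
 proof (rule nn_integral_has_integral_lborel)
  have "((%x. x powr (- q)) has_integral (1 powr (- q + 1) / (- q + 1))) {0..1}"
   using assms by (intro has_integral_powr_from_0) auto
  then have "((%x. x powr (- q)) has_integral (1 / (1 - q))) {0..1}" by simp
  then have "((%x. if x \<in> {0..1} then x powr (- q) else 0) has_integral (1 / (1 - q))) UNIV"
   by (simp only: has_integral_restrict_UNIV)
  then show "(h has_integral (1 / (1 - q))) UNIV"
   by (rule has_integral_eq[rotated]) (auto simp: h_def)
 qed (auto simp: h_def)
 have "(NN x. ennreal (indicator {-1..1} x * \<bar>x\<bar> powr (- q)))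
   <= (NN x. ennreal (h x) + ennreal (h (- x)))"
 proof (rule nn_integral_mono)
  fix x :: real
  have "indicator {-1..1} x * \<bar>x\<bar> powr (- q) <= h x + h (- x)"
   by (auto simp: h_def indicator_def)
  moreover have "ennreal (h x) + ennreal (h (- x)) = ennreal (h x + h (- x))"
   by (rule ennreal_plus[symmetric]) (auto simp: h_def)
  ultimately show "ennreal (indicator {-1..1} x * \<bar>x\<bar> powr (- q)) <= ennreal (h x) + ennreal (h (- x))"
   by (simp only: ennreal_leI)
 qed
 also have "... = (NN x. ennreal (h x)) + (NN x. ennreal (h (- x)))"
  by (rule nn_integral_add) auto
 also have "(NN x. ennreal (h (- x))) = (NN x. ennreal (h x))"
  using nn_integral_real_affine[of "%x. ennreal (h x)" "-1" 0] by simp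
 also have "(NN x. ennreal (h x)) + (NN x. ennreal (h x)) = ennreal (2 / (1 - q))"
  unfolding h using assms by (subst ennreal_plus[symmetric]) auto
 finally show ?thesis .
qed

section \<open>The dispersive estimate\<close>

definition L1_norm :: "L2 => real" where
 "L1_norm g = (LBINT x. norm (rep_L2 g x))"

lemma L1_norm_nonneg: "0 <= L1_norm g"
 by (simp add: L1_norm_def)

text \<open>The constant is the modulus of the Mehler kernel. Pairing with an integrable
  \<open>h\<close> stands for the L^\<infinity> norm of \<open>propagator t g\<close>.\<close>

lemma dispersive:
 assumes g: "integrable lborel (rep_L2 g)" and h: "integrable lborel (rep_L2 h)" and s: "sin (2 * t) \<noteq> 0"
 shows "norm (cinner (propagator t g) h) <= 1 / sqrt (2 * pi * \<bar>sin (2 * t)\<bar>) * L1_norm g * L1_norm h"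
proof -
 define D where "D = 1 / sqrt (2 * pi * \<bar>sin (2 * t)\<bar>) * L1_norm g"
 obtain \<omega> where w: "norm \<omega> = 1" and M: "square_integrable (mehler_op t (rep_L2 g))"
  and U: "propagator t g = \<omega> *\<^sub>C L2_of (mehler_op t (rep_L2 g))"
  using propagator_mehler[OF s] g by (metis L2_of_rep square_integrable_rep)
 have bound: "norm (mehler_op t (rep_L2 g) x) <= D" for x
  using norm_mehler_op_le[OF g] by (simp add: L1_norm_def D_def)
 have "norm (cinner (propagator t g) h) = norm (LBINT x. mehler_op t (rep_L2 g) x * cnj (rep_L2 h x))"
  using cinner_L2_of[OF M square_integrable_rep[of h]] by (simp add: U cinner_scaleC_left norm_mult w)
 also have "... <= (LBINT x. norm (mehler_op t (rep_L2 g) x * cnj (rep_L2 h x)))"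
  by (rule integral_norm_bound)
 also have "... <= (LBINT x. D * norm (rep_L2 h x))"
 proof (rule integral_mono)
  show "integrable lborel (%x. norm (mehler_op t (rep_L2 g) x * cnj (rep_L2 h x)))"
   by (intro integrable_norm square_integrable_integrable_mult M square_integrable_rep)
  show "integrable lborel (%x. D * norm (rep_L2 h x))" using h by auto
  show "norm (mehler_op t (rep_L2 g) x * cnj (rep_L2 h x)) <= D * norm (rep_L2 h x)" for x
   using bound by (simp add: norm_mult mult_right_mono)
 qed
 also have "... = D * L1_norm h" by (simp add: L1_norm_def)
 finally show ?thesis by (simp add: D_def)
qed

text \<open>For 0 < t \<le> pi/4 write sin 2t = 2 sin t cos t and sin t = t cos z; both cosines are
  at least cos(pi/4), whose square is 1/2.\<close>

lemma sin_double_ge: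
 assumes "\<bar>t\<bar> <= pi / 4" shows "\<bar>t\<bar> <= \<bar>sin (2 * t)\<bar>"
proof -
 have pos: "t <= sin (2 * t)" if t: "0 < t" "t <= pi / 4" for t
 proof -
  obtain z where z: "0 < z" "z < t" "sin t - sin 0 = (t - 0) * cos z"
   using MVT2[of 0 t sin cos] t by auto
  have "cos (pi / 4) <= cos z" "cos (pi / 4) <= cos t"
   using z t by (intro cos_monotone_0_pi_le; simp)+
  then have "(sqrt 2 / 2) * (sqrt 2 / 2) <= cos z * cos t"
   using order_trans[of 0 "sqrt 2 / 2" "cos z"] by (intro mult_mono) (auto simp: cos_45)
  then have "1 / 2 <= cos z * cos t" by simp
  then have "t * (1 / 2) <= t * (cos z * cos t)" using t by (intro mult_left_mono) auto
  moreover have "sin (2 * t) = 2 * (t * (cos z * cos t))"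
   using z by (simp add: sin_double)
  ultimately show ?thesis by simp
 qed
 consider "t = 0" | "t > 0" | "t < 0" by linarith
 then show ?thesis
 proof cases
  case 2 then show ?thesis using pos[of t] assms by simp
 next
  case 3 then show ?thesis using pos[of "- t"] assms by simp
 qed simp
qed

lemma dispersive_short:
 assumes g: "integrable lborel (rep_L2 g)" "L1_norm g <= 1"
  and h: "integrable lborel (rep_L2 h)" "L1_norm h <= 1" and t: "t \<noteq> 0" "\<bar>t\<bar> <= pi / 4"
 shows "norm (cinner (propagator t g) h) <= \<bar>t\<bar> powr (- (1/2))"
proof -
 have st: "\<bar>t\<bar> <= \<bar>sin (2 * t)\<bar>" by (rule sin_double_ge) fact
 then have s: "sin (2 * t) \<noteq> 0" using t by auto
 have "norm (cinner (propagator t g) h) <= 1 / sqrt (2 * pi * \<bar>sin (2 * t)\<bar>) * L1_norm g * L1_norm h"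
  by (rule dispersive) fact+
 also have "... <= 1 / sqrt (2 * pi * \<bar>sin (2 * t)\<bar>) * 1 * 1"
  by (intro mult_mono mult_nonneg_nonneg g h L1_norm_nonneg) auto
 also have "... <= 1 / sqrt \<bar>t\<bar>"
 proof -
  have "1 * \<bar>t\<bar> <= (2 * pi) * \<bar>sin (2 * t)\<bar>"
   using st pi_gt3 by (intro mult_mono) auto
  then have "sqrt \<bar>t\<bar> <= sqrt (2 * pi * \<bar>sin (2 * t)\<bar>)"
   by (intro real_sqrt_le_mono) simp
  then show ?thesis using t by (simp add: frac_le)
 qed
 also have "... = \<bar>t\<bar> powr (- (1/2))"
  by (subst powr_minus, subst powr_half_sqrt) (simp_all add: inverse_eq_divide)
 finally show ?thesis .
qed

lemma measurable_propagator:
 assumes [measurable]: "a \<in> borel_measurable M" "f \<in> borel_measurable M"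
 shows "(%t. propagator (a t) (f t)) \<in> borel_measurable M"
proof -
 have "case_prod propagator \<in> bmeas"
  by (intro borel_measurable_continuous_onI continuous_propagator_joint)
 moreover have "(%t. (a t, f t)) \<in> borel_measurable M"
  by (intro borel_measurable_Pair assms)
 ultimately have "(%t. case_prod propagator (a t, f t)) \<in> borel_measurable M"
  by (rule measurable_compose[rotated])
 then show ?thesis by simp
qed

lemma measurable_propagator_const [measurable]: "(%t. propagator t f) \<in> bmeas"
 by (intro borel_measurable_continuous_onI continuous_propagator)

lemma measurable_scaleC [measurable]:
 assumes [measurable]: "c \<in> borel_measurable M" "f \<in> borel_measurable M"
 shows "(%t. c t *\<^sub>C f t) \<in> borel_measurable M"
proof -
 have "bounded_bilinear (%c f. c *\<^sub>C f)"
 proof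
  show "\<exists>K. \<forall>a b. norm (a *\<^sub>C b) <= norm a * norm b * K"
   by (intro exI[of _ 1]) (simp add: norm_scaleC)
  show "(a + a') *\<^sub>C b = a *\<^sub>C b + a' *\<^sub>C b" for a a' b
   using scaleC_diff_left[of "a + a'" a' b] by simp
  show "a *\<^sub>C (b + b') = a *\<^sub>C b + a *\<^sub>C b'" for a b b'
   by (rule scaleC_add)
  show "(r *\<^sub>R a) *\<^sub>C b = r *\<^sub>R (a *\<^sub>C b)" for r a b
   by (simp only: scaleR_conv_of_real scaleC_scaleC[symmetric] scaleC_of_real)
  show "a *\<^sub>C (r *\<^sub>R b) = r *\<^sub>R (a *\<^sub>C b)" for r a b
   by (rule linear_scale[OF bounded_linear.linear[OF bounded_linear_scaleC]])
 qed
 then have "continuous_on UNIV (%p::complex \<times> L2. fst p *\<^sub>C snd p)"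
  by (intro bounded_bilinear.continuous_on[of "%c f. c *\<^sub>C f"] continuous_on_fst continuous_on_snd continuous_on_id)
 then have "(%p::complex \<times> L2. fst p *\<^sub>C snd p) \<in> bmeas"
  by (rule borel_measurable_continuous_onI)
 moreover have "(%t. (c t, f t)) \<in> borel_measurable M"
  by (intro borel_measurable_Pair assms)
 ultimately have "(%t. fst (c t, f t) *\<^sub>C snd (c t, f t)) \<in> borel_measurable M"
  by (rule measurable_compose[rotated])
 then show ?thesis by simp
qed

lemma measurable_cinner [measurable]:
 assumes [measurable]: "f \<in> borel_measurable M" "g \<in> borel_measurable M"
 shows "(%t. cinner (f t) (g t)) \<in> borel_measurable M"
proof -
 have "continuous_on UNIV (%p::L2 \<times> L2. cinner (fst p) (snd p))"
  unfolding continuous_on_def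
  by (intro ballI tendsto_intros)
 then have "(%p::L2 \<times> L2. cinner (fst p) (snd p)) \<in> bmeas"
  by (rule borel_measurable_continuous_onI)
 moreover have "(%t. (f t, g t)) \<in> borel_measurable M"
  by (intro borel_measurable_Pair assms)
 ultimately have "(%t. cinner (fst (f t, g t)) (snd (f t, g t))) \<in> borel_measurable M"
  by (rule measurable_compose[rotated])
 then show ?thesis by simp
qed

text \<open>The \<open>T T\<^sup>*\<close> argument, applied to the finitely many functionals \<open>g\<^sub>k\<close>: the function \<open>G\<close> selects
 at each time the functional with the largest value.\<close>

lemma strichartz_finite:
 fixes g :: "nat => L2"
 assumes g: "\<And>k. integrable lborel (rep_L2 (g k))" "\<And>k. L1_norm (g k) <= 1"
 shows "(NN t. ennreal (indicator {0..pi/4} t * (Max ((%k. norm (cinner (propagator t f) (g k))) ` {..K}))\<^sup>2))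
   <= ennreal (4 * (norm f)\<^sup>2)"
proof -
 define c where "c k t = cinner (propagator t f) (g k)" for k t
 define m where "m t = Max ((%k. norm (c k t)) ` {..K})" for t
 define J where "J = {0..pi/4}"
 have [measurable]: "J \<in> sets borel" by (simp add: J_def)
 have [measurable]: "c k \<in> bmeas" for k
  unfolding c_def[abs_def] by measurable
 \<comment> \<open>Ties are broken by the least index, which makes the selection measurable.\<close>
 define P where "P k t \<longleftrightarrow> t \<in> J \<and> norm (c k t) = m t \<and> (\<forall>j<k. norm (c j t) \<noteq> m t)" for k t
 have m_ge: "norm (c k t) <= m t" if "k <= K" for k t
  unfolding m_def using that by (intro Max_ge) auto
 have m0: "0 <= m t" for t by (rule order_trans[OF norm_ge_zero m_ge[of 0 t]]) simp
 have [measurable]: "m \<in> bmeas"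
  unfolding m_def[abs_def] by (intro borel_measurable_Max) auto
 have [measurable]: "Measurable.pred borel (P k)" for k
  unfolding P_def[abs_def] by measurable
 have P_ex: "\<exists>!k. k <= K \<and> P k t" if "t \<in> J" for t
 proof -
  have "m t \<in> (%k. norm (c k t)) ` {..K}" unfolding m_def by (intro Max_in) auto
  then obtain k where k: "k <= K" "norm (c k t) = m t" by auto
  define l where "l = (LEAST k. norm (c k t) = m t)"
  have l: "norm (c l t) = m t" unfolding l_def by (rule LeastI) (rule k(2))
  have ll: "norm (c j t) \<noteq> m t" if "j < l" for j using not_less_Least[OF that[unfolded l_def]] .
  have "l <= k" unfolding l_def by (rule Least_le) (rule k(2))
  show ?thesis
  proof (rule ex1I[of _ l])
   show "l <= K \<and> P l t"
    unfolding P_def using \<open>l <= k\<close> k(1) l ll that by (intro conjI allI impI order_trans[OF \<open>l <= k\<close>])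
   show "k' = l" if "k' <= K \<and> P k' t" for k'
    using that l ll[of k'] by (cases rule: linorder_cases[of k' l]) (auto simp: P_def)
  qed
 qed
 define G where "G t = (\<Sum>k\<le>K. (if P k t then c k t else 0) *\<^sub>C g k)" for t
 have G_eq: "\<exists>k\<le>K. P k t \<and> G t = c k t *\<^sub>C g k" if t: "t \<in> J" for t
 proof -
  have "\<exists>k. (k <= K \<and> P k t) \<and> (\<forall>j. j <= K \<and> P j t --> j = k)"
   using P_ex[OF t] unfolding Ex1_def .
  then obtain k where k: "k <= K" "P k t" and u: "\<forall>j. j <= K \<and> P j t --> j = k"
   by (elim exE conjE)
  have "G t = (\<Sum>j\<in>{k}. (if P j t then c j t else 0) *\<^sub>C g j)"
   unfolding G_def
  proof (rule sum.mono_neutral_right)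
   show "\<forall>i\<in>{..K} - {k}. (if P i t then c i t else 0) *\<^sub>C g i = 0"
    using u by (auto simp: scaleC_of_real[of 0, simplified])
  qed (use k in auto)
  then show ?thesis using k by auto
 qed
 have G0: "G t = 0" if "t \<notin> J" for t
  using that by (simp add: G_def P_def scaleC_of_real[of 0, simplified])
 have [measurable]: "G \<in> bmeas"
  unfolding G_def[abs_def] by measurable
 define Gm where "Gm = Max ((%k. norm (g k)) ` {..K})"
 have Gm: "norm (g k) <= Gm" if "k <= K" for k
  unfolding Gm_def using that by (intro Max_ge) auto
 have Gm0: "0 <= Gm" by (rule order_trans[OF norm_ge_zero Gm[of 0]]) simp
 have m_le: "m t <= norm f * Gm" for t
  unfolding m_def c_def
  by (subst Max_le_iff) (auto intro!: order_trans[OF norm_cinner_le] mult_left_mono Gm)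
 have normG: "norm (G t) <= indicator J t * (norm f * Gm * Gm)" for t
 proof (cases "t \<in> J")
  case True
  then obtain k where k: "k <= K" "P k t" "G t = c k t *\<^sub>C g k" using G_eq True by metis
  have "norm (G t) = m t * norm (g k)" using k by (simp add: norm_scaleC P_def)
  also have "... <= norm f * Gm * Gm" using k m0 Gm0 by (intro mult_mono m_le Gm) auto
  finally show ?thesis using True by simp
 qed (simp add: G0)
 have [measurable]: "(%t. propagator (- t) (G t)) \<in> bmeas"
  by (intro measurable_propagator) measurable
 have intJ: "integrable lborel (%t. indicator J t * C)" for C :: real
  by (intro integrable_mult_left integrable_real_indicator) (auto simp: J_def)
 have intG: "integrable lborel (%t. propagator (- t) (G t))"
  by (rule Bochner_Integration.integrable_bound[OF intJ[of "norm f * Gm * Gm"]])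
   (use normG Gm0 in \<open>auto simp: abs_mult\<close>)
 \<comment> \<open>The adjoint of the space-time map, applied to \<open>G\<close>; its pairing with
   \<open>f\<close> returns the integral of the square of \<open>m\<close>.\<close>
 define \<Phi> where "\<Phi> = (LBINT t. propagator (- t) (G t))"
 have inner_G: "inner f (propagator (- t) (G t)) = indicator J t * (m t)\<^sup>2" for t
 proof (cases "t \<in> J")
  case True
  then obtain k where k: "k <= K" "P k t" "G t = c k t *\<^sub>C g k" using G_eq True by metis
  have "inner f (propagator (- t) (G t)) = Re (cinner (propagator t f) (G t))"
   by (simp add: Re_cinner[symmetric] cinner_propagator_left)
  also have "... = Re (cnj (c k t) * c k t)" by (simp add: k cinner_scaleC_right c_def)
  also have "... = (norm (c k t))\<^sup>2"
   by (simp add: mult.commute[of "cnj _"] flip: complex_norm_square)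
  finally show ?thesis using True k by (simp add: P_def)
 qed (simp add: G0)
 have intm: "integrable lborel (%t. indicator J t * (m t)\<^sup>2)"
 proof (rule Bochner_Integration.integrable_bound[OF intJ[of "(norm f * Gm)\<^sup>2"]])
  show "AE t in lborel. norm (indicator J t * (m t)\<^sup>2) <= norm (indicator J t * (norm f * Gm)\<^sup>2)"
   using m_le m0 by (auto simp: indicator_def intro!: power_mono)
 qed measurable
 define S where "S = (LBINT t. indicator J t * (m t)\<^sup>2)"
 have S0: "0 <= S" unfolding S_def by (intro Bochner_Integration.integral_nonneg) auto
 have nnS: "(NN t. ennreal (indicator J t * (m t)\<^sup>2)) = ennreal S"
  unfolding S_def by (rule nn_integral_eq_integral[OF intm]) auto
 have S_le: "S <= norm f * norm \<Phi>"
 proof -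
  have "S = inner f \<Phi>"
   unfolding S_def \<Phi>_def inner_G[symmetric]
   by (rule integral_inner_right) (use intG in auto)
  then show ?thesis using norm_cauchy_schwarz by simp
 qed
 \<comment> \<open>The decay |s - t|^(-1/2), cut off at |s - t| = 1, which exceeds every difference
   of times in \<open>J\<close>. Its integral is 4.\<close>
 define k where "k \<tau> = ennreal (indicator {-1..1} \<tau> * \<bar>\<tau>\<bar> powr (- (1/2)))" for \<tau> :: real
 have [measurable]: "k \<in> bmeas" unfolding k_def by measurable
 have k4: "(NN \<tau>. k \<tau>) <= 4"
  using nn_integral_abs_powr_unit[of "1/2"] by (simp add: k_def)
 have half: "4 * ennreal x / 2 = 2 * ennreal x" if "0 <= x" for x
 proof -
  have "4 * ennreal x = ennreal (4 * x)" using that by (simp add: ennreal_mult')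
  moreover have "2 * ennreal x = ennreal (2 * x)" using that by (simp add: ennreal_mult')
  ultimately show ?thesis using that by (simp add: ennreal_divide_numeral)
 qed
 have pair: "ennreal (norm (inner (propagator (- t) (G t)) (propagator (- s) (G s))))
   <= k (s - t) * ennreal (indicator J t * (m t)\<^sup>2) / 2 + k (s - t) * ennreal (indicator J s * (m s)\<^sup>2) / 2"
  if "s \<noteq> t" for s t
 proof (cases "s \<in> J \<and> t \<in> J")
  case True
  then obtain j where j: "j <= K" "P j t" "G t = c j t *\<^sub>C g j" using G_eq True by metis
  obtain i where i: "i <= K" "P i s" "G s = c i s *\<^sub>C g i" using G_eq True by metis
  define r where "r = \<bar>s - t\<bar> powr (- (1/2))"
  have st: "\<bar>s - t\<bar> <= pi / 4" using True by (auto simp: J_def abs_if)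
  also have "pi / 4 <= 1" using pi_less_4 by simp
  finally have st1: "\<bar>s - t\<bar> <= 1" .
  have "\<bar>inner (propagator (- t) (G t)) (propagator (- s) (G s))\<bar>
   <= norm (cinner (propagator (- t) (G t)) (propagator (- s) (G s)))"
   unfolding Re_cinner[symmetric] by (rule abs_Re_le_cmod)
  also have "... = norm (cinner (propagator (s - t) (G t)) (G s))"
   using cinner_propagator[of s "propagator (- t) (G t)" "propagator (- s) (G s)"]
   by (simp add: propagator_propagator)
  also have "... = m t * m s * norm (cinner (propagator (s - t) (g j)) (g i))"
   using i j by (simp add: propagator_scaleC cinner_scaleC_left cinner_scaleC_right norm_mult P_def)
  also have "... <= m t * m s * r"
   unfolding r_def using st that m0
   by (intro mult_left_mono dispersive_short g mult_nonneg_nonneg) auto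
  \<comment> \<open>Schur's test for the kernel \<open>k\<close>: the product m(t) m(s) is split
    symmetrically, so that each half can be integrated in the other time.\<close>
  also have "... <= r * (m t)\<^sup>2 / 2 + r * (m s)\<^sup>2 / 2"
   using mult_left_mono[OF sum_squares_bound[of "m t" "m s"], of r]
   by (simp add: r_def algebra_simps)
  finally have "ennreal (norm (inner (propagator (- t) (G t)) (propagator (- s) (G s))))
    <= ennreal (r * (m t)\<^sup>2 / 2 + r * (m s)\<^sup>2 / 2)"
   by (intro ennreal_leI) simp
  also have "... = ennreal r * ennreal ((m t)\<^sup>2) / 2 + ennreal r * ennreal ((m s)\<^sup>2) / 2"
   by (simp add: r_def ennreal_plus[symmetric] ennreal_mult'[symmetric] ennreal_divide_numeral del: ennreal_plus)
  also have "ennreal r = k (s - t)" using st1 by (simp add: k_def r_def abs_le_iff)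
  finally show ?thesis using True by simp
 next
  case False
  then have "G s = 0 \<or> G t = 0" using G0 by metis
  then show ?thesis by auto
 qed
 have "(norm \<Phi>)\<^sup>2 = (LBINT t. inner (propagator (- t) (G t)) \<Phi>)"
  unfolding power2_norm_eq_inner by (subst (1) \<Phi>_def, rule integral_inner_left[symmetric]) (rule intG)
 also have "... = (LBINT t. LBINT s. inner (propagator (- t) (G t)) (propagator (- s) (G s)))"
  unfolding \<Phi>_def by (subst integral_inner_right) (use intG in auto)
 finally have eq: "(norm \<Phi>)\<^sup>2 = ..." .
 have "ennreal ((norm \<Phi>)\<^sup>2) <= ennreal (norm (LBINT t. LBINT s. inner (propagator (- t) (G t)) (propagator (- s) (G s))))"
  unfolding eq by (intro ennreal_leI) simp
 also have "... <= (NN t. ennreal (norm (LBINT s. inner (propagator (- t) (G t)) (propagator (- s) (G s)))))"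
 proof (rule integral_norm_bound_ennreal)
  have "integrable lborel (%t. inner (propagator (- t) (G t)) \<Phi>)" using intG by auto
  then show "integrable lborel (%t. (LBINT s. inner (propagator (- t) (G t)) (propagator (- s) (G s))))"
   unfolding \<Phi>_def by (subst (asm) integral_inner_right[symmetric]) (use intG in auto)
 qed
 also have "... <= (NN t. NN s. ennreal (norm (inner (propagator (- t) (G t)) (propagator (- s) (G s)))))"
  by (intro nn_integral_mono integral_norm_bound_ennreal) (use intG in auto)
 also have "... <= (NN t. NN s. k (s - t) * ennreal (indicator J t * (m t)\<^sup>2) / 2 + k (s - t) * ennreal (indicator J s * (m s)\<^sup>2) / 2)"
 proof (rule nn_integral_mono, rule nn_integral_mono_AE)
  fix t
  show "AE s in lborel. ennreal (norm (inner (propagator (- t) (G t)) (propagator (- s) (G s))))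
    <= k (s - t) * ennreal (indicator J t * (m t)\<^sup>2) / 2 + k (s - t) * ennreal (indicator J s * (m s)\<^sup>2) / 2"
   using AE_lborel_singleton[of t] by eventually_elim (rule pair)
 qed
 also have "... = (NN t. NN s. k (s - t) * ennreal (indicator J t * (m t)\<^sup>2) / 2)
   + (NN t. NN s. k (s - t) * ennreal (indicator J s * (m s)\<^sup>2) / 2)"
  by (simp add: nn_integral_add)
 finally have Phi_le: "ennreal ((norm \<Phi>)\<^sup>2) <= ..." .
 have "(NN t. NN s. k (s - t) * ennreal (indicator J s * (m s)\<^sup>2) / 2)
   = (NN s. NN t. k (s - t) * ennreal (indicator J s * (m s)\<^sup>2) / 2)"
  by (rule lborel_pair.Fubini') measurable
 also have "... <= (NN s. 2 * ennreal (indicator J s * (m s)\<^sup>2))"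
 proof (rule nn_integral_mono)
  fix s
  have "(NN t. k (s - t)) = (NN t. k t)"
   using nn_integral_real_affine[of k "-1" s] by simp
  then have "(NN t. k (s - t) * ennreal (indicator J s * (m s)\<^sup>2) / 2)
    = (NN t. k t) * ennreal (indicator J s * (m s)\<^sup>2) / 2"
   by (simp add: nn_integral_divide nn_integral_multc)
  also have "... <= 4 * ennreal (indicator J s * (m s)\<^sup>2) / 2"
   by (intro divide_right_mono_ennreal mult_right_mono k4) auto
  also have "... = 2 * ennreal (indicator J s * (m s)\<^sup>2)"
   by (rule half) simp
  finally show "(NN t. k (s - t) * ennreal (indicator J s * (m s)\<^sup>2) / 2) <= 2 * ennreal (indicator J s * (m s)\<^sup>2)" .
 qed
 finally have 2: "(NN t. NN s. k (s - t) * ennreal (indicator J s * (m s)\<^sup>2) / 2) <= 2 * ennreal S"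
  by (simp add: nn_integral_cmult nnS)
 have "(NN t. NN s. k (s - t) * ennreal (indicator J t * (m t)\<^sup>2) / 2)
   <= (NN t. 2 * ennreal (indicator J t * (m t)\<^sup>2))"
 proof (rule nn_integral_mono)
  fix t
  have "(NN s. k (s - t)) = (NN s. k s)"
   using nn_integral_real_affine[of k "1" "- t"] by simp
  then have "(NN s. k (s - t) * ennreal (indicator J t * (m t)\<^sup>2) / 2)
    = (NN s. k s) * ennreal (indicator J t * (m t)\<^sup>2) / 2"
   by (simp add: nn_integral_divide nn_integral_multc)
  also have "... <= 4 * ennreal (indicator J t * (m t)\<^sup>2) / 2"
   by (intro divide_right_mono_ennreal mult_right_mono k4) auto
  also have "... = 2 * ennreal (indicator J t * (m t)\<^sup>2)"
   by (rule half) simp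
  finally show "(NN s. k (s - t) * ennreal (indicator J t * (m t)\<^sup>2) / 2) <= 2 * ennreal (indicator J t * (m t)\<^sup>2)" .
 qed
 then have 1: "(NN t. NN s. k (s - t) * ennreal (indicator J t * (m t)\<^sup>2) / 2) <= 2 * ennreal S"
  by (simp add: nn_integral_cmult nnS)
 have "ennreal ((norm \<Phi>)\<^sup>2) <= 2 * ennreal S + 2 * ennreal S"
  by (rule order_trans[OF Phi_le add_mono[OF 1 2]])
 then have "ennreal ((norm \<Phi>)\<^sup>2) <= ennreal (4 * S)"
  using S0 by (simp add: ennreal_mult' flip: distrib_right)
 then have Phi: "(norm \<Phi>)\<^sup>2 <= 4 * S" using S0 by simp
 have "S\<^sup>2 <= (norm f * norm \<Phi>)\<^sup>2" using S_le S0 by (intro power_mono)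
 also have "... <= (norm f)\<^sup>2 * (4 * S)"
  unfolding power_mult_distrib using Phi by (intro mult_left_mono) auto
 finally have "S * S <= S * (4 * (norm f)\<^sup>2)" by (simp add: power2_eq_square mult_ac)
 \<comment> \<open>S^2 \<le> |f|^2 |\<Phi>|^2 \<le> 4 |f|^2 S, and \<open>S\<close> may be
   cancelled: it is finite because \<open>m\<close> is bounded for a finite family and the time
   interval is bounded.\<close>
 then have "S <= 4 * (norm f)\<^sup>2"
  using S0 by (cases "S = 0") (auto simp: mult_le_cancel_left)
 then have "(NN t. ennreal (indicator J t * (m t)\<^sup>2)) <= ennreal (4 * (norm f)\<^sup>2)"
  unfolding nnS by (rule ennreal_leI)
 then show ?thesis by (simp add: J_def m_def c_def)
qed

section \<open>Duality between L^1 and L^\<infinity>, and the Strichartz estimate\<close>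

lemma L1_norm_scaleC: "L1_norm (c *\<^sub>C g) = norm c * L1_norm g"
proof -
 have "L1_norm (c *\<^sub>C g) = (LBINT x. norm c * norm (rep_L2 g x))"
  unfolding L1_norm_def
 proof (rule integral_cong_AE)
  show "AE x in lborel. norm (rep_L2 (c *\<^sub>C g) x) = norm c * norm (rep_L2 g x)"
   using rep_L2_scaleC[of c g] by eventually_elim (simp add: norm_mult)
 qed measurable
 then show ?thesis by (simp add: L1_norm_def)
qed

lemma integrable_rep_scaleC:
 assumes "integrable lborel (rep_L2 g)" shows "integrable lborel (rep_L2 (c *\<^sub>C g))"
proof -
 have "integrable lborel (%x. c * rep_L2 g x)" using assms by simp
 then show ?thesis
  by (subst integrable_cong_AE[where g = "%x. c * rep_L2 g x"]) (simp_all add: rep_L2_scaleC)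
qed

lemma AE_lborel_shift:
 fixes a :: real assumes "AE t in lborel. Q t" shows "AE t in lborel. Q (t - a)"
proof -
 obtain N where N: "{t \<in> space lborel. \<not> Q t} \<subseteq> N" "emeasure lborel N = 0" "N \<in> sets lborel"
  using AE_E[OF assms] by blast
 have "N \<in> null_sets lborel" using N by auto
 then have "AE t in lborel. t \<notin> N" by (rule AE_not_in)
 then have "AE t in lborel. - a + 1 * t \<notin> N"
  by (intro AE_borel_affine) (use N(3) in auto)
 then show ?thesis by eventually_elim (use N(1) in auto)
qed

lemma truncated_L1_le:
 assumes "0 <= r"
 shows "integrable lborel (%x. indicator {-r..r} x * norm (rep_L2 w x))"
  and "(LBINT x. indicator {-r..r} x * norm (rep_L2 w x)) <= sqrt (2 * r) * norm w"
proof -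
 have sq1: "square_integrable (%x. cplx (norm (rep_L2 w x)))"
  using square_integrable_rep[of w] by (simp add: square_integrable_def)
 have sq2: "square_integrable (indicator {-r..r})"
  by (rule square_integrable_indicator) (auto simp: emeasure_lborel_Icc_eq)
 have eq: "(%x. cplx (norm (rep_L2 w x)) * cnj (indicator {-r..r} x)) =
   (%x. cplx (indicator {-r..r} x * norm (rep_L2 w x)))"
  by (auto simp: indicator_def)
 show int: "integrable lborel (%x. indicator {-r..r} x * norm (rep_L2 w x))"
  using square_integrable_integrable_mult[OF sq1 sq2] unfolding eq by (simp only: complex_of_real_integrable_eq)
 have "cplx (LBINT x. indicator {-r..r} x * norm (rep_L2 w x))
   = cinner (L2_of (%x. cplx (norm (rep_L2 w x)))) (L2_of (indicator {-r..r}))"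
  unfolding cinner_L2_of[OF sq1 sq2] eq by (rule integral_complex_of_real[symmetric])
 also have "norm ... <= norm (L2_of (%x. cplx (norm (rep_L2 w x)))) * norm (L2_of (indicator {-r..r} :: real => complex))"
  by (rule norm_cinner_le)
 also have "norm (L2_of (%x. cplx (norm (rep_L2 w x)))) = norm w"
  by (simp add: norm_L2_of[OF sq1] norm_L2_rep[of w])
 also have "norm (L2_of (indicator {-r..r} :: real => complex)) = sqrt (2 * r)"
 proof -
  have "(%x. (norm (indicator {-r..r} x :: complex))\<^sup>2) = indicator {-r..r}"
   by (auto simp: indicator_def)
  then show ?thesis using assms by (simp add: norm_L2_of[OF sq2])
 qed
 finally show "(LBINT x. indicator {-r..r} x * norm (rep_L2 w x)) <= sqrt (2 * r) * norm w"
  by (simp add: mult.commute)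
qed

text \<open>A countable family that detects the norm of \<open>L\<^sup>\<infinity>\<close> by duality with \<open>L\<^sup>1\<close>.\<close>

lemma Linf_dual_family:
 shows "\<exists>g :: nat => L2. (\<forall>k. integrable lborel (rep_L2 (g k)) \<and> L1_norm (g k) <= 1) \<and>
  (\<forall>v M. (\<forall>k. norm (cinner v (g k)) <= M) --> (AE x in lborel. norm (rep_L2 v x) <= M))"
proof -
 obtain D :: "L2 set" where D: "countable D" and dense: "\<And>X. open X ==> X \<noteq> {} ==> \<exists>d\<in>D. d \<in> X"
  by (rule countable_dense_setE) blast
 have Dne: "D \<noteq> {}" using dense[of UNIV] by auto
 define T where "T n d = L2_of (%x. indicator {- real n..real n} x * rep_L2 d x)" for n d
 have sqT: "square_integrable (%x. indicator {- real n..real n} x * rep_L2 d x)" for n d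
  by (rule square_integrable_truncate) auto
 have repT: "AE x in lborel. rep_L2 (T n d) x = indicator {- real n..real n} x * rep_L2 d x" for n d
  unfolding T_def by (rule rep_L2_of[OF sqT])
 have intT: "integrable lborel (rep_L2 (T n d))" for n d
 proof -
  have "integrable lborel (%x. indicator {- real n..real n} x * rep_L2 d x)"
   by (rule integrable_truncate) (auto simp: emeasure_lborel_Icc_eq)
  then show ?thesis
   by (subst integrable_cong_AE[where g = "%x. indicator {- real n..real n} x * rep_L2 d x"])
    (simp_all add: repT)
 qed
 \<comment> \<open>Truncations of a countable dense subset of L^2, normalised in L^1. A truncation
   of L^1 norm zero yields the zero functional, as \<open>inverse 0 = 0\<close>.\<close>
 define g where "g k = (case from_nat_into (UNIV \<times> D) k of (n, d) => cplx (inverse (L1_norm (T n d))) *\<^sub>C T n d)" for k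
 have g_ex: "\<exists>k. g k = cplx (inverse (L1_norm (T n d))) *\<^sub>C T n d" if "d \<in> D" for n d
 proof -
  have "\<exists>k. from_nat_into (UNIV \<times> D) k = (n, d)"
   by (rule from_nat_into_surj) (use D that in auto)
  then obtain k where "from_nat_into (UNIV \<times> D) k = (n, d)" ..
  then show ?thesis by (intro exI[of _ k]) (simp add: g_def)
 qed
 have bound: "norm (cinner v (T n d)) <= M * L1_norm (T n d)"
  if M: "\<And>k. norm (cinner v (g k)) <= M" and d: "d \<in> D" for v M n d
 proof (cases "L1_norm (T n d) = 0")
  case True
  then have "AE x in lborel. norm (rep_L2 (T n d) x) = 0"
   using integral_nonneg_eq_0_iff_AE[of lborel "%x. norm (rep_L2 (T n d) x)"] intT by (simp add: L1_norm_def)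
  then have "AE x in lborel. rep_L2 (T n d) x = 0" by simp
  then have "T n d = L2_of (%_. 0)"
   using L2_of_eq_iff[OF square_integrable_rep square_integrable_zero, of "T n d"] by simp
  also have "... = 0" by (simp add: L2_of_def square_integrable_zero zero_L2.abs_eq)
  finally show ?thesis using True by simp
 next
  case False
  define N where "N = L1_norm (T n d)"
  have N: "N > 0" using False L1_norm_nonneg[of "T n d"] by (simp add: N_def)
  obtain k where k: "g k = cplx (inverse N) *\<^sub>C T n d" using g_ex[OF d] by (auto simp: N_def)
  have "inverse N * norm (cinner v (T n d)) <= M"
   using M[of k] N by (simp add: k cinner_scaleC_right norm_mult norm_inverse)
  then show ?thesis using N by (simp add: N_def[symmetric] field_simps)
 qed
 have "AE x in lborel. norm (rep_L2 v x) <= M" if M: "\<And>k. norm (cinner v (g k)) <= M" for v M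
 proof -
  have M0: "0 <= M" by (rule order_trans[OF norm_ge_zero M[of 0]])
  have null: "AE x in lborel. \<not> (\<bar>x\<bar> <= real j \<and> M + 1 / (real j + 1) < norm (rep_L2 v x))" for j :: nat
  proof -
   define \<delta> where "\<delta> = 1 / (real j + 1)"
   have \<delta>: "\<delta> > 0" by (simp add: \<delta>_def)
   define A where "A = {x. \<bar>x\<bar> <= real j \<and> M + \<delta> < norm (rep_L2 v x)}"
   have Am: "A \<in> sets borel" unfolding A_def by measurable
   have Asub: "A \<subseteq> {- real j..real j}" by (auto simp: A_def)
   have Afin: "emeasure lborel A < \<infinity>"
    using emeasure_mono[OF Asub, of lborel] by (auto simp: emeasure_lborel_Icc_eq intro: order.strict_trans1)
   define a where "a = measure lborel A"
   have inta: "(LBINT x. indicator A x) = a" using Am Afin by (simp add: a_def)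
   \<comment> \<open>On the bad set \<open>A\<close> the phase of \<open>v\<close> is the extremal
     test function. It is approximated by truncations \<open>T j d\<close>, in L^2 and, on the
     bounded interval, in L^1 as well.\<close>
   define g0 where "g0 x = indicator A x * sgn (rep_L2 v x)" for x
   have [measurable]: "(sgn :: complex => complex) \<in> bmeas"
    unfolding sgn_div_norm[abs_def] by measurable
   have g0m: "g0 \<in> bmeas" unfolding g0_def using Am by measurable
   have g0n: "norm (g0 x) <= indicator A x" for x
    by (auto simp: g0_def norm_mult norm_sgn indicator_def)
   have sq0: "square_integrable g0"
   proof (rule square_integrable_bound[OF g0m])
    show "integrable lborel (indicator A :: real => real)" using Am Afin by simp
    show "AE x in lborel. (norm (g0 x))\<^sup>2 <= indicator A x"
     by (auto simp: g0_def norm_mult norm_sgn indicator_def)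
   qed
   define I where "I = (LBINT x. indicator A x * norm (rep_L2 v x))"
   have eqI: "rep_L2 v x * cnj (g0 x) = cplx (indicator A x * norm (rep_L2 v x))" for x
   proof -
    have "z * cnj (sgn z) = cplx (norm z)" for z :: complex
     by (cases "z = 0") (simp_all add: sgn_eq complex_norm_square[symmetric] power2_eq_square)
    then show ?thesis by (simp add: g0_def indicator_def)
   qed
   have cI: "cinner v (L2_of g0) = cplx I"
    using cinner_L2_of[OF square_integrable_rep[of v] sq0]
    unfolding eqI integral_complex_of_real I_def L2_of_rep .
   have intI: "integrable lborel (%x. indicator A x * norm (rep_L2 v x))"
    using square_integrable_integrable_mult[OF square_integrable_rep[of v] sq0] unfolding eqI
    by (simp only: complex_of_real_integrable_eq)
   have ge: "(M + \<delta>) * a <= I"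
   proof -
    have "(LBINT x. (M + \<delta>) * indicator A x) <= I"
     unfolding I_def
    proof (rule integral_mono[OF _ intI])
     show "integrable lborel (%x. (M + \<delta>) * indicator A x)"
      using Am Afin by (intro integrable_mult_right) simp
     show "(M + \<delta>) * indicator A x <= indicator A x * norm (rep_L2 v x)" for x
      by (auto simp: indicator_def A_def)
    qed
    then show ?thesis using inta by simp
   qed
   have step: "I <= M * a + (M * sqrt (2 * real j) + norm v) * e" if e: "0 < e" for e
   proof -
    obtain d where d: "d \<in> D" "dist d (L2_of g0) < e"
     using dense[of "ball (L2_of g0) e"] e by (auto simp: dist_commute)
    define w where "w = d - L2_of g0"
    have w: "norm w < e" using d(2) by (simp add: w_def dist_norm)
    have ae: "AE x in lborel. norm (rep_L2 (T j d) x) <= indicator {- real j..real j} x * norm (rep_L2 w x) + indicator A x"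
     using repT[of j d] rep_L2_diff[of d "L2_of g0"] rep_L2_of[OF sq0]
    proof eventually_elim
     case (elim x)
     have "norm (rep_L2 d x) <= norm (rep_L2 w x) + norm (g0 x)"
      using elim norm_triangle_sub[of "rep_L2 d x" "g0 x"] by (simp add: w_def add.commute)
     then show ?case using elim g0n[of x] by (auto simp: indicator_def norm_mult)
    qed
    have "L1_norm (T j d) <= (LBINT x. indicator {- real j..real j} x * norm (rep_L2 w x) + indicator A x)"
     unfolding L1_norm_def
     by (rule integral_mono_AE[OF _ _ ae])
      (use intT truncated_L1_le(1)[of "real j" w] Am Afin in auto)
    also have "... = (LBINT x. indicator {- real j..real j} x * norm (rep_L2 w x)) + a"
     unfolding inta[symmetric]
     by (rule Bochner_Integration.integral_add) (use truncated_L1_le(1)[of "real j" w] Am Afin in auto)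
    also have "... <= sqrt (2 * real j) * norm w + a"
     using truncated_L1_le(2)[of "real j" w] by simp
    also have "... <= sqrt (2 * real j) * e + a"
     using w by (intro add_mono mult_left_mono) auto
    finally have L1: "L1_norm (T j d) <= sqrt (2 * real j) * e + a" .
    have ae2: "AE x in lborel. norm (rep_L2 (T j d - L2_of g0) x) <= norm (rep_L2 w x)"
     using repT[of j d] rep_L2_diff[of "T j d" "L2_of g0"] rep_L2_diff[of d "L2_of g0"] rep_L2_of[OF sq0]
    proof eventually_elim
     case (elim x)
     then show ?case using Asub by (auto simp: w_def indicator_def g0_def norm_mult)
    qed
    have "(LBINT x. (norm (rep_L2 (T j d - L2_of g0) x))\<^sup>2) <= (LBINT x. (norm (rep_L2 w x))\<^sup>2)"
    proof (rule integral_mono_AE)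
     show "AE x in lborel. (norm (rep_L2 (T j d - L2_of g0) x))\<^sup>2 <= (norm (rep_L2 w x))\<^sup>2"
      using ae2 by eventually_elim (intro power_mono, auto)
    qed (use square_integrable_rep in \<open>auto simp: square_integrable_def\<close>)
    then have nT: "norm (T j d - L2_of g0) <= norm w"
     unfolding norm_L2_rep[of w] norm_L2_rep[of "T j d - L2_of g0"] by (rule real_sqrt_le_mono)
    have "norm (cinner v (L2_of g0)) = I"
     unfolding cI I_def by (simp add: Bochner_Integration.integral_nonneg)
    moreover have "cinner v (L2_of g0) = cinner v (T j d) - cinner v (T j d - L2_of g0)"
     by (simp add: cinner_diff_right)
    ultimately have "I <= norm (cinner v (T j d)) + norm (cinner v (T j d - L2_of g0))"
     using norm_triangle_ineq4 by metis
    also have "... <= M * L1_norm (T j d) + norm v * norm (T j d - L2_of g0)"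
     by (intro add_mono bound M d norm_cinner_le)
    also have "... <= M * (sqrt (2 * real j) * e + a) + norm v * e"
     using nT w by (intro add_mono mult_left_mono L1 M0) auto
    finally show ?thesis by (simp add: algebra_simps)
   qed
   \<comment> \<open>Together with \<open>ge\<close> this reads (M + \<delta>) a \<le> I \<le> M a,
     so \<open>A\<close> is a null set.\<close>
   have "I <= M * a"
   proof (rule field_le_epsilon)
    fix e :: real assume e: "0 < e"
    define c where "c = M * sqrt (2 * real j) + norm v + 1"
    have c: "c > 0" using M0 by (simp add: c_def add_nonneg_pos)
    have "I <= M * a + (c - 1) * (e / c)" using step[of "e / c"] e c by (simp add: c_def)
    also have "... <= M * a + c * (e / c)" using e c by (intro add_left_mono mult_right_mono) auto
    finally show "I <= M * a + e" using c by simp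
   qed
   then have "\<delta> * a <= 0" using ge by (simp add: algebra_simps)
   then have "a <= 0" using \<delta> by (simp add: mult_le_0_iff)
   then have "a = 0" by (simp add: a_def measure_le_0_iff)
   then have "emeasure lborel A = 0" using Afin by (simp add: a_def measure_eq_0_null_sets emeasure_eq_ennreal_measure)
   then have "A \<in> null_sets lborel" using Am by auto
   then have "AE x in lborel. x \<notin> A" by (rule AE_not_in)
   then show ?thesis by (simp add: A_def \<delta>_def)
  qed
  then have "AE x in lborel. \<forall>j::nat. \<not> (\<bar>x\<bar> <= real j \<and> M + 1 / (real j + 1) < norm (rep_L2 v x))"
   by (simp add: AE_all_countable)
  then show ?thesis
  proof eventually_elim
   case (elim x)
   show ?case
   proof (rule ccontr)
    assume "\<not> norm (rep_L2 v x) <= M"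
    then have "0 < norm (rep_L2 v x) - M" by simp
    then obtain n where n: "1 / real (Suc n) < norm (rep_L2 v x) - M" using nat_approx_posE by blast
    obtain k :: nat where k: "\<bar>x\<bar> <= real k" using real_arch_simple by blast
    define j where "j = max n k"
    have "1 / (real j + 1) <= 1 / real (Suc n)" by (intro divide_left_mono) (auto simp: j_def)
    then have "\<bar>x\<bar> <= real j \<and> M + 1 / (real j + 1) < norm (rep_L2 v x)"
     using n k by (auto simp: j_def)
    then show False using elim by blast
   qed
  qed
 qed
 moreover have "integrable lborel (rep_L2 (g k)) \<and> L1_norm (g k) <= 1" for k
 proof -
  obtain n :: nat and d where nd: "from_nat_into (UNIV \<times> D) k = (n, d)" by fastforce
  have "inverse r * r <= 1" for r :: real by (cases "r = 0") (auto simp: left_inverse)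
  then show ?thesis
   by (simp add: nd g_def L1_norm_scaleC norm_inverse L1_norm_nonneg integrable_rep_scaleC intT)
 qed
 ultimately show ?thesis by blast
qed

text \<open>Monotone convergence over growing finite subfamilies; the dual family converts the
  supremum of the functionals into an essential bound in x. The measurable majorant
  \<open>\<beta>\<close> stands for the L^\<infinity> norm.\<close>

lemma strichartz_quarter:
 "\<exists>\<beta>. \<beta> \<in> bmeas \<and> (\<forall>t. 0 <= \<beta> t) \<and>
   (NN t. ennreal (indicator {0..pi/4} t * (\<beta> t)\<^sup>2)) <= ennreal (4 * (norm f)\<^sup>2) \<and>
   (AE t in lborel. t \<in> {0..pi/4} --> (AE x in lborel. norm (rep_L2 (propagator t f) x) <= \<beta> t))"
proof -
 obtain g :: "nat => L2" where g: "\<And>k. integrable lborel (rep_L2 (g k))" "\<And>k. L1_norm (g k) <= 1"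
  and dual: "\<And>v M. (\<And>k. norm (cinner v (g k)) <= M) ==> AE x in lborel. norm (rep_L2 v x) <= M"
  using Linf_dual_family by blast
 define m where "m K t = Max ((%k. norm (cinner (propagator t f) (g k))) ` {..K})" for K t
 have [measurable]: "m K \<in> bmeas" for K
  unfolding m_def[abs_def] by (intro borel_measurable_Max) auto
 have m_ge: "norm (cinner (propagator t f) (g k)) <= m K t" if "k <= K" for k K t
  unfolding m_def using that by (intro Max_ge) auto
 have m0: "0 <= m K t" for K t by (rule order_trans[OF norm_ge_zero m_ge[of 0]]) simp
 have m_mono: "m K t <= m L t" if "K <= L" for K L t
  unfolding m_def using that by (intro Max_mono) auto
 define b where "b t = (SUP K. ennreal (indicator {0..pi/4} t * (m K t)\<^sup>2))" for t
 have [measurable]: "b \<in> bmeas" unfolding b_def[abs_def] by measurable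
 have "(NN t. b t) = (SUP K. (NN t. ennreal (indicator {0..pi/4} t * (m K t)\<^sup>2)))"
  unfolding b_def
  by (rule nn_integral_monotone_convergence_SUP)
   (auto simp: incseq_def le_fun_def intro!: ennreal_leI mult_left_mono power_mono m_mono m0)
 also have "... <= ennreal (4 * (norm f)\<^sup>2)"
  unfolding m_def by (intro SUP_least strichartz_finite g)
 finally have intb: "(NN t. b t) <= ennreal (4 * (norm f)\<^sup>2)" .
 then have "(NN t. b t) \<noteq> \<infinity>" by (auto simp: top_unique)
 then have fin: "AE t in lborel. b t \<noteq> \<infinity>" by (intro nn_integral_PInf_AE) auto
 define \<beta> where "\<beta> t = sqrt (enn2real (b t))" for t
 have "AE t in lborel. t \<in> {0..pi/4} --> (AE x in lborel. norm (rep_L2 (propagator t f) x) <= \<beta> t)"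
  using fin
 proof eventually_elim
  case (elim t)
  show ?case
  proof (intro impI dual)
   fix k assume t: "t \<in> {0..pi/4}"
   have "ennreal ((m k t)\<^sup>2) <= b t"
    unfolding b_def using t by (intro SUP_upper2[of k]) auto
   then have "(m k t)\<^sup>2 <= enn2real (b t)"
    using elim by (metis enn2real_ennreal enn2real_mono less_top infinity_ennreal_def zero_le_power2)
   then have "m k t <= \<beta> t" unfolding \<beta>_def by (rule real_le_rsqrt)
   then show "norm (cinner (propagator t f) (g k)) <= \<beta> t" using m_ge[of k k t] by simp
  qed
 qed
 moreover have "(NN t. ennreal (indicator {0..pi/4} t * (\<beta> t)\<^sup>2)) <= (NN t. b t)"
  using fin
  by (intro nn_integral_mono_AE, eventually_elim)
   (auto simp: \<beta>_def indicator_def less_top)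
 ultimately show ?thesis
  using intb by (intro exI[of _ \<beta>]) (auto simp: \<beta>_def[abs_def] intro: order_trans)
qed

text \<open>Translation in time acts on the data by an isometry, and two intervals of length pi/4
  cover the window of length pi/2 over which the trilinear operator integrates; hence 8 = 4 +
  4.\<close>

theorem strichartz:
 "\<exists>\<beta>. \<beta> \<in> bmeas \<and> (\<forall>t. 0 <= \<beta> t) \<and>
   (NN t. ennreal (indicator {a..a+pi/2} t * (\<beta> t)\<^sup>2)) <= ennreal (8 * (norm f)\<^sup>2) \<and>
   (AE t in lborel. t \<in> {a..a+pi/2} --> (AE x in lborel. norm (rep_L2 (propagator t f) x) <= \<beta> t))"
proof -
 have shift: "\<exists>\<beta>. \<beta> \<in> bmeas \<and> (\<forall>t. 0 <= \<beta> t) \<and>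
   (NN t. ennreal (indicator {a..a+pi/4} t * (\<beta> t)\<^sup>2)) <= ennreal (4 * (norm f)\<^sup>2) \<and>
   (AE t in lborel. t \<in> {a..a+pi/4} --> (AE x in lborel. norm (rep_L2 (propagator t f) x) <= \<beta> t))" for a
 proof -
  obtain \<beta> where [measurable]: "\<beta> \<in> bmeas" and b: "\<And>t. 0 <= \<beta> t"
   "(NN t. ennreal (indicator {0..pi/4} t * (\<beta> t)\<^sup>2)) <= ennreal (4 * (norm (propagator a f))\<^sup>2)"
   "AE t in lborel. t \<in> {0..pi/4} --> (AE x in lborel. norm (rep_L2 (propagator t (propagator a f)) x) <= \<beta> t)"
   using strichartz_quarter[of "propagator a f"] by blast
  have "(NN t. ennreal (indicator {0..pi/4} t * (\<beta> t)\<^sup>2))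
    = (NN t. ennreal (indicator {0..pi/4} (- a + 1 * t) * (\<beta> (- a + 1 * t))\<^sup>2))"
   by (subst nn_integral_real_affine[of _ 1 "- a"]) auto
  also have "... = (NN t. ennreal (indicator {a..a+pi/4} t * (\<beta> (t - a))\<^sup>2))"
   by (intro nn_integral_cong) (auto simp: indicator_def)
  finally have 1: "(NN t. ennreal (indicator {a..a+pi/4} t * (\<beta> (t - a))\<^sup>2)) <= ennreal (4 * (norm f)\<^sup>2)"
   using b(2) by simp
  have 2: "AE t in lborel. t \<in> {a..a+pi/4} --> (AE x in lborel. norm (rep_L2 (propagator t f) x) <= \<beta> (t - a))"
   using AE_lborel_shift[OF b(3), of a] by eventually_elim (auto simp: propagator_propagator)
  show ?thesis using b(1) 1 2 by (intro exI[of _ "%t. \<beta> (t - a)"]) auto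
 qed
 obtain \<beta>1 where [measurable]: "\<beta>1 \<in> bmeas" and b1: "\<And>t. 0 <= \<beta>1 t"
   "(NN t. ennreal (indicator {a..a+pi/4} t * (\<beta>1 t)\<^sup>2)) <= ennreal (4 * (norm f)\<^sup>2)"
   "AE t in lborel. t \<in> {a..a+pi/4} --> (AE x in lborel. norm (rep_L2 (propagator t f) x) <= \<beta>1 t)"
  using shift[of a] by blast
 obtain \<beta>2 where [measurable]: "\<beta>2 \<in> bmeas" and b2: "\<And>t. 0 <= \<beta>2 t"
   "(NN t. ennreal (indicator {a+pi/4..a+pi/4+pi/4} t * (\<beta>2 t)\<^sup>2)) <= ennreal (4 * (norm f)\<^sup>2)"
   "AE t in lborel. t \<in> {a+pi/4..a+pi/4+pi/4} --> (AE x in lborel. norm (rep_L2 (propagator t f) x) <= \<beta>2 t)"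
  using shift[of "a+pi/4"] by blast
 define \<beta> where "\<beta> t = (if t <= a + pi/4 then \<beta>1 t else \<beta>2 t)" for t
 have "(NN t. ennreal (indicator {a..a+pi/2} t * (\<beta> t)\<^sup>2))
  <= (NN t. ennreal (indicator {a..a+pi/4} t * (\<beta>1 t)\<^sup>2) + ennreal (indicator {a+pi/4..a+pi/4+pi/4} t * (\<beta>2 t)\<^sup>2))"
  by (intro nn_integral_mono) (auto simp: \<beta>_def indicator_def)
 also have "... <= ennreal (4 * (norm f)\<^sup>2) + ennreal (4 * (norm f)\<^sup>2)"
  by (subst nn_integral_add) (measurable, rule add_mono[OF b1(2) b2(2)])
 also have "... = ennreal (8 * (norm f)\<^sup>2)"
  by (subst ennreal_plus[symmetric]) auto
 finally have 1: "(NN t. ennreal (indicator {a..a+pi/2} t * (\<beta> t)\<^sup>2)) <= ennreal (8 * (norm f)\<^sup>2)" .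
 have 2: "AE t in lborel. t \<in> {a..a+pi/2} --> (AE x in lborel. norm (rep_L2 (propagator t f) x) <= \<beta> t)"
  using b1(3) b2(3) by eventually_elim (auto simp: \<beta>_def)
 have "\<beta> \<in> bmeas" unfolding \<beta>_def[abs_def] by measurable
 moreover have "0 <= \<beta> t" for t by (simp add: \<beta>_def b1 b2)
 ultimately show ?thesis using 1 2 by blast
qed

section \<open>The trilinear operator on square-integrable functions\<close>

lemma norm_L2_of_le:
 assumes u: "square_integrable u" and le: "AE x in lborel. norm (u x) <= B * norm (rep_L2 w x)" and B: "0 <= B"
 shows "norm (L2_of u) <= B * norm w"
proof -
 have "(LBINT x. (norm (u x))\<^sup>2) <= (LBINT x. B\<^sup>2 * (norm (rep_L2 w x))\<^sup>2)"
 proof (rule integral_mono_AE)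
  show "AE x in lborel. (norm (u x))\<^sup>2 <= B\<^sup>2 * (norm (rep_L2 w x))\<^sup>2"
   using le by eventually_elim (simp add: power_mono flip: power_mult_distrib)
 qed (use u square_integrable_rep[of w] in \<open>auto simp: square_integrable_def\<close>)
 also have "... = B\<^sup>2 * (LBINT x. (norm (rep_L2 w x))\<^sup>2)" by simp
 finally have "norm (L2_of u) <= sqrt (B\<^sup>2 * (LBINT x. (norm (rep_L2 w x))\<^sup>2))"
  unfolding norm_L2_of[OF u] by (rule real_sqrt_le_mono)
 then show ?thesis using B by (simp add: real_sqrt_mult norm_L2_rep[of w])
qed

lemma square_integrable_mult_bounded:
 assumes [measurable]: "k \<in> bmeas" and k: "AE x in lborel. norm (k x) <= B" and f: "square_integrable f"
 shows "square_integrable (%x. f x * k x)"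
proof (rule square_integrable_bound)
 have [measurable]: "f \<in> bmeas" using f by auto
 show "(%x. f x * k x) \<in> bmeas" by measurable
 show "integrable lborel (%x. B\<^sup>2 * (norm (f x))\<^sup>2)" using f by (auto simp: square_integrable_def)
 show "AE x in lborel. (norm (f x * k x))\<^sup>2 <= B\<^sup>2 * (norm (f x))\<^sup>2"
  using k
 proof eventually_elim
  case (elim x)
  then have "(norm (k x))\<^sup>2 <= B\<^sup>2" by (intro power_mono) auto
  then have "(norm (k x))\<^sup>2 * (norm (f x))\<^sup>2 <= B\<^sup>2 * (norm (f x))\<^sup>2" by (rule mult_right_mono) simp
  then show ?case by (simp add: norm_mult power_mult_distrib mult.commute)
 qed
qed

section \<open>Measurability in time of the cubic product\<close>

definition clamp_disc :: "nat => complex => complex" where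
 "clamp_disc n = closest_point (cball 0 (real n))"

lemma clamp_disc_lipschitz: "norm (clamp_disc n z - clamp_disc n w) <= norm (z - w)"
 using closest_point_lipschitz[of "cball (0::complex) (real n)" z w] by (simp add: clamp_disc_def dist_norm)

lemma clamp_disc_eq: "norm z <= real n ==> clamp_disc n z = z"
 by (simp add: clamp_disc_def closest_point_self)

lemma norm_clamp_disc: "norm (clamp_disc n z) <= real n"
 using closest_point_in_set[of "cball (0::complex) (real n)" z] by (simp add: clamp_disc_def)

lemma norm_clamp_disc_le: "norm (clamp_disc n z) <= norm z"
 using clamp_disc_lipschitz[of n z 0] by (simp add: clamp_disc_eq)

lemma measurable_clamp_disc [measurable]: "clamp_disc n \<in> bmeas"
 unfolding clamp_disc_def
 by (intro borel_measurable_continuous_onI continuous_on_closest_point) auto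

definition product3 :: "L2 => L2 => L2 => real => complex" where
 "product3 f g h x = rep_L2 f x * rep_L2 g x * cnj (rep_L2 h x)"

lemma product3_measurable [measurable]: "product3 f g h \<in> bmeas"
 unfolding product3_def[abs_def] by measurable

lemma cubic_product3: "cubic f g h = L2_of (product3 f g h)"
 by (simp add: cubic_def product3_def[abs_def])

text \<open>The pointwise product does not act on all of L^2. With each factor projected to the disc
  of radius n it becomes Lipschitz in L^2, and through this approximation \<open>cubic\<close> is
  measurable along measurable curves.\<close>

definition clamped :: "nat => L2 => L2 => L2 => real => complex" where
 "clamped n f g h x = clamp_disc n (rep_L2 f x) * clamp_disc n (rep_L2 g x) * cnj (clamp_disc n (rep_L2 h x))"

lemma clamped_measurable [measurable]: "clamped n f g h \<in> bmeas"
 unfolding clamped_def[abs_def] by measurable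

lemma square_integrable_clamped: "square_integrable (clamped n f g h)"
proof -
 have "square_integrable (%x. clamp_disc n (rep_L2 f x))"
  by (rule square_integrable_bound[where g = "%x. (norm (rep_L2 f x))\<^sup>2"])
   (use square_integrable_rep[of f] in \<open>auto simp: square_integrable_def intro!: power_mono norm_clamp_disc_le\<close>)
 then have "square_integrable (%x. clamp_disc n (rep_L2 f x) * (clamp_disc n (rep_L2 g x) * cnj (clamp_disc n (rep_L2 h x))))"
  by (rule square_integrable_mult_bounded[rotated 2, where B = "real n * real n"])
   (auto simp: norm_mult intro!: mult_mono norm_clamp_disc)
 then show ?thesis by (simp add: clamped_def[abs_def] mult.assoc)
qed

lemma clamped_lipschitz:
 "norm (L2_of (clamped n f g h) - L2_of (clamped n f' g' h'))
   <= (real n * real n) * norm (f - f') + (real n * real n) * norm (g - g') + (real n * real n) * norm (h - h')"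
proof -
 have bb: "norm a * norm b <= real n * real n" if "norm a <= real n" "norm b <= real n" for a b :: complex
  using that by (intro mult_mono) auto
 have 1: "norm (L2_of (clamped n f g h) - L2_of (clamped n f' g h)) <= (real n * real n) * norm (f - f')"
  unfolding L2_of_diff[OF square_integrable_clamped square_integrable_clamped, symmetric]
 proof (rule norm_L2_of_le[OF square_integrable_diff[OF square_integrable_clamped square_integrable_clamped]])
  show "AE x in lborel. norm (clamped n f g h x - clamped n f' g h x) <= real n * real n * norm (rep_L2 (f - f') x)"
   using rep_L2_diff[of f f']
  proof eventually_elim
   case (elim x)
   have "clamped n f g h x - clamped n f' g h x = (clamp_disc n (rep_L2 f x) - clamp_disc n (rep_L2 f' x)) *
    (clamp_disc n (rep_L2 g x) * cnj (clamp_disc n (rep_L2 h x)))"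
    by (simp add: clamped_def algebra_simps)
   then have "norm (clamped n f g h x - clamped n f' g h x)
    = norm (clamp_disc n (rep_L2 f x) - clamp_disc n (rep_L2 f' x)) * (norm (clamp_disc n (rep_L2 g x)) * norm (clamp_disc n (rep_L2 h x)))"
    by (simp add: norm_mult)
   also have "... <= norm (rep_L2 f x - rep_L2 f' x) * (real n * real n)"
    by (intro mult_mono clamp_disc_lipschitz bb norm_clamp_disc) auto
   finally show ?case using elim by (simp add: mult.commute)
  qed
 qed simp
 have 2: "norm (L2_of (clamped n f' g h) - L2_of (clamped n f' g' h)) <= (real n * real n) * norm (g - g')"
  unfolding L2_of_diff[OF square_integrable_clamped square_integrable_clamped, symmetric]
 proof (rule norm_L2_of_le[OF square_integrable_diff[OF square_integrable_clamped square_integrable_clamped]])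
  show "AE x in lborel. norm (clamped n f' g h x - clamped n f' g' h x) <= real n * real n * norm (rep_L2 (g - g') x)"
   using rep_L2_diff[of g g']
  proof eventually_elim
   case (elim x)
   have "clamped n f' g h x - clamped n f' g' h x = (clamp_disc n (rep_L2 g x) - clamp_disc n (rep_L2 g' x)) *
    (clamp_disc n (rep_L2 f' x) * cnj (clamp_disc n (rep_L2 h x)))"
    by (simp add: clamped_def algebra_simps)
   then have "norm (clamped n f' g h x - clamped n f' g' h x)
    = norm (clamp_disc n (rep_L2 g x) - clamp_disc n (rep_L2 g' x)) * (norm (clamp_disc n (rep_L2 f' x)) * norm (clamp_disc n (rep_L2 h x)))"
    by (simp add: norm_mult)
   also have "... <= norm (rep_L2 g x - rep_L2 g' x) * (real n * real n)"
    by (intro mult_mono clamp_disc_lipschitz bb norm_clamp_disc) auto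
   finally show ?case using elim by (simp add: mult.commute)
  qed
 qed simp
 have 3: "norm (L2_of (clamped n f' g' h) - L2_of (clamped n f' g' h')) <= (real n * real n) * norm (h - h')"
  unfolding L2_of_diff[OF square_integrable_clamped square_integrable_clamped, symmetric]
 proof (rule norm_L2_of_le[OF square_integrable_diff[OF square_integrable_clamped square_integrable_clamped]])
  show "AE x in lborel. norm (clamped n f' g' h x - clamped n f' g' h' x) <= real n * real n * norm (rep_L2 (h - h') x)"
   using rep_L2_diff[of h h']
  proof eventually_elim
   case (elim x)
   have "clamped n f' g' h x - clamped n f' g' h' x = cnj (clamp_disc n (rep_L2 h x) - clamp_disc n (rep_L2 h' x)) *
    (clamp_disc n (rep_L2 f' x) * clamp_disc n (rep_L2 g' x))"
    by (simp add: clamped_def algebra_simps)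
   then have "norm (clamped n f' g' h x - clamped n f' g' h' x)
    = norm (clamp_disc n (rep_L2 h x) - clamp_disc n (rep_L2 h' x)) * (norm (clamp_disc n (rep_L2 f' x)) * norm (clamp_disc n (rep_L2 g' x)))"
    by (simp only: norm_mult complex_mod_cnj)
   also have "... <= norm (rep_L2 h x - rep_L2 h' x) * (real n * real n)"
    by (intro mult_mono clamp_disc_lipschitz bb norm_clamp_disc) auto
   finally show ?case using elim by (simp add: mult.commute)
  qed
 qed simp
 have "L2_of (clamped n f g h) - L2_of (clamped n f' g' h') =
  (L2_of (clamped n f g h) - L2_of (clamped n f' g h)) + (L2_of (clamped n f' g h) - L2_of (clamped n f' g' h))
  + (L2_of (clamped n f' g' h) - L2_of (clamped n f' g' h'))" by simp
 then have "norm (L2_of (clamped n f g h) - L2_of (clamped n f' g' h')) <=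
  (norm (L2_of (clamped n f g h) - L2_of (clamped n f' g h)) + norm (L2_of (clamped n f' g h) - L2_of (clamped n f' g' h)))
  + norm (L2_of (clamped n f' g' h) - L2_of (clamped n f' g' h'))"
  by (metis (no_types, lifting) add_right_mono norm_triangle_ineq order_trans)
 also have "... <= (real n * real n) * norm (f - f') + (real n * real n) * norm (g - g') + (real n * real n) * norm (h - h')"
  by (intro add_mono 1 2 3)
 finally show ?thesis .
qed

lemma measurable_clamped:
 assumes [measurable]: "f \<in> borel_measurable M" "g \<in> borel_measurable M" "h \<in> borel_measurable M"
 shows "(%t. L2_of (clamped n (f t) (g t) (h t))) \<in> borel_measurable M"
proof -
 have "continuous_on UNIV (%p::L2 \<times> L2 \<times> L2. L2_of (clamped n (fst p) (fst (snd p)) (snd (snd p))))"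
  unfolding continuous_on_def
 proof
  fix p :: "L2 \<times> L2 \<times> L2"
  let ?C = "real n * real n"
  have "((%q. ?C * norm (fst q - fst p) + ?C * norm (fst (snd q) - fst (snd p)) + ?C * norm (snd (snd q) - snd (snd p)))
   \<longlongrightarrow> ?C * norm (fst p - fst p) + ?C * norm (fst (snd p) - fst (snd p)) + ?C * norm (snd (snd p) - snd (snd p))) (at p)"
   by (intro tendsto_intros)
  then have z: "((%q. ?C * norm (fst q - fst p) + ?C * norm (fst (snd q) - fst (snd p)) + ?C * norm (snd (snd q) - snd (snd p))) \<longlongrightarrow> 0) (at p)"
   by simp
  show "((%q. L2_of (clamped n (fst q) (fst (snd q)) (snd (snd q)))) \<longlongrightarrow> L2_of (clamped n (fst p) (fst (snd p)) (snd (snd p)))) (at p)"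
   by (rule metric_tendsto_imp_tendsto[OF z], rule always_eventually)
    (auto simp: dist_norm intro!: order_trans[OF clamped_lipschitz])
 qed
 then have "(%p::L2 \<times> L2 \<times> L2. L2_of (clamped n (fst p) (fst (snd p)) (snd (snd p)))) \<in> bmeas"
  by (rule borel_measurable_continuous_onI)
 moreover have "(%t. (f t, g t, h t)) \<in> borel_measurable M"
  by (intro borel_measurable_Pair assms)
 ultimately have "(%t. L2_of (clamped n (fst (f t, g t, h t)) (fst (snd (f t, g t, h t))) (snd (snd (f t, g t, h t))))) \<in> borel_measurable M"
  by (rule measurable_compose[rotated])
 then show ?thesis by simp
qed

lemma clamped_tendsto: "(%n. clamped n f g h x) \<longlonglongrightarrow> product3 f g h x"
proof (rule tendsto_eventually)
 obtain N :: nat where N: "max (norm (rep_L2 f x)) (max (norm (rep_L2 g x)) (norm (rep_L2 h x))) <= real N"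
  using real_arch_simple by blast
 show "\<forall>\<^sub>F n in sequentially. clamped n f g h x = product3 f g h x"
  using eventually_ge_at_top[of N]
 proof eventually_elim
  case (elim n)
  then have "real N <= real n" by simp
  then have "norm (rep_L2 f x) <= real n" "norm (rep_L2 g x) <= real n" "norm (rep_L2 h x) <= real n"
   using N by linarith+
  then show ?case by (simp add: clamped_def product3_def clamp_disc_eq)
 qed
qed

lemma norm_clamped_le: "norm (clamped n f g h x) <= norm (product3 f g h x)"
 unfolding clamped_def product3_def norm_mult complex_mod_cnj
 by (intro mult_mono mult_nonneg_nonneg norm_clamp_disc_le) auto

text \<open>Turns the case distinction in \<open>L2_of\<close> into a condition on countably many
  continuous functions of the factors. The backward direction is Fatou's lemma.\<close>

lemma square_integrable_product3_iff:
 "square_integrable (product3 f g h) \<longleftrightarrow> (SUP n. ennreal ((norm (L2_of (clamped n f g h)))\<^sup>2)) < \<infinity>"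
proof
 assume sq: "square_integrable (product3 f g h)"
 have rp: "AE x in lborel. rep_L2 (L2_of (product3 f g h)) x = product3 f g h x" by (rule rep_L2_of[OF sq])
 have "norm (L2_of (clamped n f g h)) <= 1 * norm (L2_of (product3 f g h))" for n
  by (rule norm_L2_of_le[OF square_integrable_clamped])
   (use rp norm_clamped_le in \<open>auto elim!: eventually_mono\<close>)
 then have "(SUP n. ennreal ((norm (L2_of (clamped n f g h)))\<^sup>2)) <= ennreal ((norm (L2_of (product3 f g h)))\<^sup>2)"
  by (intro SUP_least ennreal_leI power_mono) auto
 also have "... < \<infinity>" by simp
 finally show "(SUP n. ennreal ((norm (L2_of (clamped n f g h)))\<^sup>2)) < \<infinity>" .
next
 assume fin: "(SUP n. ennreal ((norm (L2_of (clamped n f g h)))\<^sup>2)) < \<infinity>"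
 have eqn: "(NN x. ennreal ((norm (clamped n f g h x))\<^sup>2)) = ennreal ((norm (L2_of (clamped n f g h)))\<^sup>2)" for n
  using square_integrable_clamped[of n f g h]
  by (subst nn_integral_eq_integral) (auto simp: norm_L2_of square_integrable_def)
 have "(NN x. ennreal ((norm (product3 f g h x))\<^sup>2))
   = (NN x. liminf (%n. ennreal ((norm (clamped n f g h x))\<^sup>2)))"
 proof (rule nn_integral_cong)
  fix x
  have "(%n. ennreal ((norm (clamped n f g h x))\<^sup>2)) \<longlonglongrightarrow> ennreal ((norm (product3 f g h x))\<^sup>2)"
   by (intro tendsto_intros clamped_tendsto)
  then show "ennreal ((norm (product3 f g h x))\<^sup>2) = liminf (%n. ennreal ((norm (clamped n f g h x))\<^sup>2))"
   by (intro lim_imp_Liminf[symmetric]) auto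
 qed
 also have "... <= liminf (%n. (NN x. ennreal ((norm (clamped n f g h x))\<^sup>2)))"
  by (rule nn_integral_liminf) measurable
 also have "... <= limsup (%n. (NN x. ennreal ((norm (clamped n f g h x))\<^sup>2)))"
  by (rule Liminf_le_Limsup) simp
 also have "... <= (SUP n. ennreal ((norm (L2_of (clamped n f g h)))\<^sup>2))"
  unfolding eqn by (rule Limsup_bounded) (auto intro!: always_eventually SUP_upper)
 also note fin
 finally show "square_integrable (product3 f g h)"
  unfolding square_integrable_def by (auto intro!: integrableI_nonneg)
qed

lemma measurable_cubic:
 assumes [measurable]: "f \<in> borel_measurable M" "g \<in> borel_measurable M" "h \<in> borel_measurable M"
 shows "(%t. cubic (f t) (g t) (h t)) \<in> borel_measurable M"
proof -
 have [measurable]: "(%t. L2_of (clamped n (f t) (g t) (h t))) \<in> borel_measurable M" for n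
  by (rule measurable_clamped) fact+
 have eq: "cubic (f t) (g t) (h t) = (if (SUP n. ennreal ((norm (L2_of (clamped n (f t) (g t) (h t))))\<^sup>2)) < \<infinity>
   then lim (%n. L2_of (clamped n (f t) (g t) (h t))) else 0)" for t
 proof (cases "square_integrable (product3 (f t) (g t) (h t))")
  case True
  have "(%n. L2_of (clamped n (f t) (g t) (h t))) \<longlonglongrightarrow> L2_of (product3 (f t) (g t) (h t))"
   by (rule tendsto_L2_of[OF square_integrable_clamped True True])
    (use clamped_tendsto norm_clamped_le in auto)
  then show ?thesis using True by (simp add: limI square_integrable_product3_iff cubic_product3)
 next
  case False
  then show ?thesis unfolding square_integrable_product3_iff[symmetric] by (simp add: cubic_product3 L2_of_def)
 qed
 show ?thesis unfolding eq by measurable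
qed

definition duhamel_integrand :: "L2 => L2 => L2 => real => L2" where
 "duhamel_integrand f g h t = propagator (- t) (cubic (propagator t f) (propagator t g) (propagator t h))"

text \<open>The start of the window is a parameter because conjugation with the propagator
  translates it.\<close>

definition T_from :: "real => L2 => L2 => L2 => L2" where
 "T_from a f g h = (LBINT t. indicator {a..a+pi/2} t *\<^sub>R duhamel_integrand f g h t)"

lemma T4_T_from: "T4 f g h = (8 / pi) *\<^sub>R T_from (- (pi / 4)) f g h"
proof -
 have "(LBINT t = - pi / 4..pi / 4. duhamel_integrand f g h t) = (LBINT t : {- pi / 4..pi / 4}. duhamel_integrand f g h t)"
  by (rule interval_integral_Icc) simp
 moreover have "{- pi / 4..pi / 4} = {- (pi / 4)..- (pi / 4) + pi / 2}" by simp
 ultimately have "(LBINT t = - pi / 4..pi / 4. duhamel_integrand f g h t) = T_from (- (pi / 4)) f g h"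
  unfolding T_from_def set_lebesgue_integral_def by (simp only:)
 then show ?thesis unfolding T4_def duhamel_integrand_def by (simp only:)
qed

lemma measurable_duhamel_integrand [measurable]: "duhamel_integrand f g h \<in> bmeas"
 unfolding duhamel_integrand_def[abs_def]
 by (intro measurable_propagator measurable_cubic) measurable

lemma ennreal_power2_le_imp_le: "0 <= r ==> z\<^sup>2 <= (ennreal r)\<^sup>2 ==> z <= ennreal r"
proof (cases z)
 case (real a)
 assume "0 <= r" "z\<^sup>2 <= (ennreal r)\<^sup>2"
 then have "a\<^sup>2 <= r\<^sup>2" using real by (simp add: ennreal_power)
 then have "a <= r" using \<open>0 <= r\<close> by (rule power2_le_imp_le)
 then show ?thesis using real by (simp add: ennreal_leI)
next
 case top
 assume "0 <= r" "z\<^sup>2 <= (ennreal r)\<^sup>2"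
 then show ?thesis using top by (simp add: ennreal_power top_unique)
qed

text \<open>Two factors are bounded in x by their Strichartz majorants and the third is kept in L^2;
  Cauchy-Schwarz in time gives 8 = sqrt 8 * sqrt 8. The first conclusion confines the default value
  in \<open>L2_of\<close> to a null set of times.\<close>

lemma duhamel_integrand_bound:
 "AE t in lborel. t \<in> {a..a+pi/2} --> square_integrable (product3 (propagator t f) (propagator t g) (propagator t h))"
 "(NN t. ennreal (norm (indicator {a..a+pi/2} t *\<^sub>R duhamel_integrand f g h t))) <= ennreal (8 * norm f * norm g * norm h)"
proof -
 define I where "I t = (indicator {a..a+pi/2} t :: real)" for t
 have [measurable]: "I \<in> bmeas" unfolding I_def by measurable
 obtain \<beta> where [measurable]: "\<beta> \<in> bmeas" and b: "\<And>t. 0 <= \<beta> t"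
   "(NN t. ennreal (indicator {a..a+pi/2} t * (\<beta> t)\<^sup>2)) <= ennreal (8 * (norm f)\<^sup>2)"
   "AE t in lborel. t \<in> {a..a+pi/2} --> (AE x in lborel. norm (rep_L2 (propagator t f) x) <= \<beta> t)"
  using strichartz[of a f] by blast
 obtain \<gamma> where [measurable]: "\<gamma> \<in> bmeas" and c: "\<And>t. 0 <= \<gamma> t"
   "(NN t. ennreal (indicator {a..a+pi/2} t * (\<gamma> t)\<^sup>2)) <= ennreal (8 * (norm g)\<^sup>2)"
   "AE t in lborel. t \<in> {a..a+pi/2} --> (AE x in lborel. norm (rep_L2 (propagator t g) x) <= \<gamma> t)"
  using strichartz[of a g] by blast
 have key: "AE t in lborel. t \<in> {a..a+pi/2} --> (square_integrable (product3 (propagator t f) (propagator t g) (propagator t h))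
   \<and> norm (duhamel_integrand f g h t) <= \<beta> t * \<gamma> t * norm h)"
  using b(3) c(3)
 proof eventually_elim
  case (elim t)
  show ?case
  proof
   assume t: "t \<in> {a..a+pi/2}"
   have ae: "AE x in lborel. norm (rep_L2 (propagator t f) x * rep_L2 (propagator t g) x) <= \<beta> t * \<gamma> t"
    using elim(1)[rule_format, OF t] elim(2)[rule_format, OF t]
    by eventually_elim (simp add: norm_mult mult_mono b c)
   have sqc: "square_integrable (%x. cnj (rep_L2 (propagator t h) x))"
    using square_integrable_rep[of "propagator t h"] by (auto simp: square_integrable_def)
   have sq: "square_integrable (product3 (propagator t f) (propagator t g) (propagator t h))"
    using square_integrable_mult_bounded[OF _ ae sqc] by (simp add: product3_def[abs_def] mult.commute)
   have "norm (L2_of (product3 (propagator t f) (propagator t g) (propagator t h))) <= (\<beta> t * \<gamma> t) * norm (propagator t h)"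
   proof (rule norm_L2_of_le[OF sq])
    show "AE x in lborel. norm (product3 (propagator t f) (propagator t g) (propagator t h) x)
      <= \<beta> t * \<gamma> t * norm (rep_L2 (propagator t h) x)"
     using ae by eventually_elim (simp add: product3_def norm_mult mult_right_mono)
   qed (simp add: b c)
   then show "square_integrable (product3 (propagator t f) (propagator t g) (propagator t h))
    \<and> norm (duhamel_integrand f g h t) <= \<beta> t * \<gamma> t * norm h"
    using sq by (simp add: duhamel_integrand_def cubic_product3)
  qed
 qed
 then show "AE t in lborel. t \<in> {a..a+pi/2} --> square_integrable (product3 (propagator t f) (propagator t g) (propagator t h))"
  by eventually_elim auto
 have sqI: "ennreal (I t * x)^2 = ennreal (indicator {a..a+pi/2} t * x\<^sup>2)" if "0 <= x" for t x
  using that by (simp add: I_def ennreal_power indicator_def)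
 have "(NN t. ennreal (I t * \<beta> t) * ennreal (I t * \<gamma> t))\<^sup>2
   <= (NN t. (ennreal (I t * \<beta> t))\<^sup>2) * (NN t. (ennreal (I t * \<gamma> t))\<^sup>2)"
  by (rule Cauchy_Schwarz_nn_integral) measurable
 also have "... <= ennreal (8 * (norm f)\<^sup>2) * ennreal (8 * (norm g)\<^sup>2)"
  using b c by (intro mult_mono) (simp_all add: sqI)
 also have "... = (ennreal (8 * norm f * norm g))\<^sup>2"
  by (simp add: ennreal_power flip: ennreal_mult') (simp add: power2_eq_square mult_ac)
 finally have CS: "(NN t. ennreal (I t * \<beta> t) * ennreal (I t * \<gamma> t)) <= ennreal (8 * norm f * norm g)"
  by (rule ennreal_power2_le_imp_le[rotated]) simp
 have "(NN t. ennreal (norm (indicator {a..a+pi/2} t *\<^sub>R duhamel_integrand f g h t)))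
  <= (NN t. (ennreal (I t * \<beta> t) * ennreal (I t * \<gamma> t)) * ennreal (norm h))"
 proof (rule nn_integral_mono_AE)
  show "AE t in lborel. ennreal (norm (indicator {a..a+pi/2} t *\<^sub>R duhamel_integrand f g h t))
   <= (ennreal (I t * \<beta> t) * ennreal (I t * \<gamma> t)) * ennreal (norm h)"
   using key
  proof eventually_elim
   case (elim t)
   have "norm (indicator {a..a+pi/2} t *\<^sub>R duhamel_integrand f g h t) <= (I t * \<beta> t) * (I t * \<gamma> t) * norm h"
    using elim by (auto simp: I_def indicator_def)
   then have "ennreal (norm (indicator {a..a+pi/2} t *\<^sub>R duhamel_integrand f g h t)) <= ennreal ((I t * \<beta> t) * (I t * \<gamma> t) * norm h)"
    by (rule ennreal_leI)
   also have "... = (ennreal (I t * \<beta> t) * ennreal (I t * \<gamma> t)) * ennreal (norm h)"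
    using b c by (simp add: ennreal_mult I_def)
   finally show ?case .
  qed
 qed
 also have "... = (NN t. ennreal (I t * \<beta> t) * ennreal (I t * \<gamma> t)) * ennreal (norm h)"
  by (rule nn_integral_multc) measurable
 also have "... <= ennreal (8 * norm f * norm g) * ennreal (norm h)"
  by (intro mult_right_mono CS) simp
 also have "... = ennreal (8 * norm f * norm g * norm h)"
  by (simp add: ennreal_mult)
 finally show "(NN t. ennreal (norm (indicator {a..a+pi/2} t *\<^sub>R duhamel_integrand f g h t))) <= ennreal (8 * norm f * norm g * norm h)" .
qed

lemma integrable_duhamel_integrand: "integrable lborel (%t. indicator {a..a+pi/2} t *\<^sub>R duhamel_integrand f g h t)"
proof (rule integrableI_bounded)
 show "(NN t. ennreal (norm (indicator {a..a+pi/2} t *\<^sub>R duhamel_integrand f g h t))) < \<infinity>"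
  by (rule order.strict_trans1[OF duhamel_integrand_bound(2)]) simp
qed measurable

lemma norm_T_from: "norm (T_from a f g h) <= 8 * norm f * norm g * norm h"
proof -
 have "ennreal (norm (T_from a f g h)) <= (NN t. ennreal (norm (indicator {a..a+pi/2} t *\<^sub>R duhamel_integrand f g h t)))"
  unfolding T_from_def by (rule integral_norm_bound_ennreal[OF integrable_duhamel_integrand])
 also note duhamel_integrand_bound(2)
 finally show ?thesis by simp
qed

lemma T_from_commute: "T_from a f g h = T_from a g f h"
 by (simp add: T_from_def duhamel_integrand_def cubic_def mult.commute mult.left_commute)

text \<open>At times where a product is not square-integrable \<open>cubic\<close> takes its default
  value and additivity may fail; by \<open>duhamel_integrand_bound\<close> these times form a null
  set.\<close>

lemma T_from_add1: "T_from a (f + f') g h = T_from a f g h + T_from a f' g h"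
proof -
 have "T_from a (f + f') g h = (LBINT t. indicator {a..a+pi/2} t *\<^sub>R duhamel_integrand f g h t
   + indicator {a..a+pi/2} t *\<^sub>R duhamel_integrand f' g h t)"
  unfolding T_from_def
 proof (rule integral_cong_AE)
  show "AE t in lborel. indicator {a..a+pi/2} t *\<^sub>R duhamel_integrand (f + f') g h t =
   indicator {a..a+pi/2} t *\<^sub>R duhamel_integrand f g h t + indicator {a..a+pi/2} t *\<^sub>R duhamel_integrand f' g h t"
   using duhamel_integrand_bound(1)[of a f g h] duhamel_integrand_bound(1)[of a f' g h]
  proof eventually_elim
   case (elim t)
   let ?F = "propagator t f" and ?F' = "propagator t f'" and ?G = "propagator t g" and ?H = "propagator t h"
   have "cubic (?F + ?F') ?G ?H = cubic ?F ?G ?H + cubic ?F' ?G ?H" if t: "t \<in> {a..a+pi/2}"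
   proof -
    have ae: "AE x in lborel. product3 ?F ?G ?H x + product3 ?F' ?G ?H x = product3 (?F + ?F') ?G ?H x"
     using rep_L2_add[of ?F ?F'] by eventually_elim (simp add: product3_def algebra_simps)
    show ?thesis
     unfolding cubic_product3 using elim t
     by (subst L2_of_AE_cong(2)[OF _ _ ae, symmetric]) (auto intro: square_integrable_add L2_of_add)
   qed
   then show ?case
    by (cases "t \<in> {a..a+pi/2}") (auto simp: duhamel_integrand_def propagator_add)
  qed
 qed measurable
 also have "... = T_from a f g h + T_from a f' g h"
  unfolding T_from_def by (intro Bochner_Integration.integral_add integrable_duhamel_integrand)
 finally show ?thesis .
qed

lemma T_from_add2: "T_from a f (g + g') h = T_from a f g h + T_from a f g' h"
 by (simp add: T_from_commute[of a f] T_from_add1)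

lemma T_from_add3: "T_from a f g (h + h') = T_from a f g h + T_from a f g h'"
proof -
 have "T_from a f g (h + h') = (LBINT t. indicator {a..a+pi/2} t *\<^sub>R duhamel_integrand f g h t
   + indicator {a..a+pi/2} t *\<^sub>R duhamel_integrand f g h' t)"
  unfolding T_from_def
 proof (rule integral_cong_AE)
  show "AE t in lborel. indicator {a..a+pi/2} t *\<^sub>R duhamel_integrand f g (h + h') t =
   indicator {a..a+pi/2} t *\<^sub>R duhamel_integrand f g h t + indicator {a..a+pi/2} t *\<^sub>R duhamel_integrand f g h' t"
   using duhamel_integrand_bound(1)[of a f g h] duhamel_integrand_bound(1)[of a f g h']
  proof eventually_elim
   case (elim t)
   let ?F = "propagator t f" and ?G = "propagator t g" and ?H = "propagator t h" and ?H' = "propagator t h'"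
   have "cubic ?F ?G (?H + ?H') = cubic ?F ?G ?H + cubic ?F ?G ?H'" if t: "t \<in> {a..a+pi/2}"
   proof -
    have ae: "AE x in lborel. product3 ?F ?G ?H x + product3 ?F ?G ?H' x = product3 ?F ?G (?H + ?H') x"
     using rep_L2_add[of ?H ?H'] by eventually_elim (simp add: product3_def algebra_simps)
    show ?thesis
     unfolding cubic_product3 using elim t
     by (subst L2_of_AE_cong(2)[OF _ _ ae, symmetric]) (auto intro: square_integrable_add L2_of_add)
   qed
   then show ?case
    by (cases "t \<in> {a..a+pi/2}") (auto simp: duhamel_integrand_def propagator_add)
  qed
 qed measurable
 also have "... = T_from a f g h + T_from a f g h'"
  unfolding T_from_def by (intro Bochner_Integration.integral_add integrable_duhamel_integrand)
 finally show ?thesis .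
qed

lemma T_from_diff:
 "T_from a f g h - T_from a f' g' h' = T_from a (f - f') g h + T_from a f' (g - g') h + T_from a f' g' (h - h')"
 using T_from_add1[of a "f - f'" f' g h] T_from_add2[of a f' "g - g'" g' h] T_from_add3[of a f' g' "h - h'" h']
 by simp

text \<open>By the group law, \<open>propagator b\<close> maps the integrand at time t to the
  integrand of the propagated data at time t - b.\<close>

lemma T_from_propagator:
 "propagator b (T_from a f g h) = T_from (a - b) (propagator b f) (propagator b g) (propagator b h)"
proof -
 let ?G = "%t. indicator {a-b..a-b+pi/2} t *\<^sub>R duhamel_integrand (propagator b f) (propagator b g) (propagator b h) t"
 have "propagator b (T_from a f g h) = (LBINT t. propagator b (indicator {a..a+pi/2} t *\<^sub>R duhamel_integrand f g h t))"
  unfolding T_from_def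
  by (rule integral_bounded_linear[OF bounded_linear_propagator integrable_duhamel_integrand, symmetric])
 also have "... = (LBINT t. ?G (- b + 1 * t))"
 proof (rule Bochner_Integration.integral_cong)
  fix t
  have "indicator {a..a+pi/2} t = (indicator {a-b..a-b+pi/2} (- b + 1 * t) :: real)" by (auto simp: indicator_def)
  moreover have "propagator b (duhamel_integrand f g h t) = duhamel_integrand (propagator b f) (propagator b g) (propagator b h) (- b + 1 * t)"
   by (simp add: duhamel_integrand_def propagator_propagator)
  ultimately show "propagator b (indicator {a..a+pi/2} t *\<^sub>R duhamel_integrand f g h t) = ?G (- b + 1 * t)"
   by (simp only: linear_scale[OF bounded_linear.linear[OF bounded_linear_propagator]])
 qed simp
 also have "... = (LBINT t. ?G t)"
  by (subst (2) lborel_integral_real_affine[of 1 _ "- b"]) auto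
 finally show ?thesis by (simp add: T_from_def)
qed

lemma cinner_T_from:
 "cinner (T_from a f g h) w = (LBINT t. indicator {a..a+pi/2} t *\<^sub>R
   cinner (cubic (propagator t f) (propagator t g) (propagator t h)) (propagator t w))"
 unfolding T_from_def
 by (subst integral_bounded_linear[OF bounded_linear_cinner_left integrable_duhamel_integrand, symmetric])
  (simp add: linear_scale[OF bounded_linear.linear[OF bounded_linear_cinner_left]] duhamel_integrand_def cinner_propagator_left)

text \<open>\<open>\<langle>T(f, f, f), f\<rangle>\<close> is real, being the space-time integral of \<open>|e\<^sup>i\<^sup>t\<^sup>H f|\<^sup>4\<close>; this yields
 conservation of mass.\<close>

lemma Im_cinner_T_from: "Im (cinner (T_from a f f f) f) = 0"
proof -
 have real: "Im (cinner (cubic v v v) v) = 0" for v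
 proof (cases "square_integrable (product3 v v v)")
  case True
  have eq: "product3 v v v x * cnj (rep_L2 v x) = cplx ((norm (rep_L2 v x))\<^sup>2 * (norm (rep_L2 v x))\<^sup>2)" for x
   unfolding product3_def of_real_mult complex_norm_square by (simp only: mult_ac)
  have "cinner (cubic v v v) v = (LBINT x. product3 v v v x * cnj (rep_L2 v x))"
   using cinner_L2_of[OF True square_integrable_rep[of v]] by (simp add: cubic_product3)
  also have "... = cplx (LBINT x. (norm (rep_L2 v x))\<^sup>2 * (norm (rep_L2 v x))\<^sup>2)"
   unfolding eq by (rule integral_complex_of_real)
  finally show ?thesis by simp
 qed (simp add: cubic_product3 L2_of_def)
 define q where "q t = indicator {a..a+pi/2} t *\<^sub>R
   cinner (cubic (propagator t f) (propagator t f) (propagator t f)) (propagator t f)" for t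
 have "q t = cplx (Re (q t))" for t
  by (simp add: complex_eq_iff q_def real)
 then have "(LBINT t. q t) = (LBINT t. cplx (Re (q t)))" by metis
 also have "... = cplx (LBINT t. Re (q t))" by (rule integral_complex_of_real)
 finally show ?thesis unfolding cinner_T_from q_def by simp
qed

section \<open>The space-time integral in physical space\<close>

text \<open>A dense class to which Mehler's formula applies and on which the iterated integrals over
  space converge absolutely.\<close>

definition bounded_supp :: "real => real => (real => complex) => bool" where
 "bounded_supp B R f \<longleftrightarrow> f \<in> bmeas \<and> (\<forall>x. norm (f x) <= B * indicator {-R..R} x)"

lemma bounded_suppD:
 assumes "bounded_supp B R f"
 shows "f \<in> bmeas" "norm (f x) <= B * indicator {-R..R} x" "norm (f x) <= \<bar>B\<bar>"
  "x \<notin> {-R..R} ==> f x = 0"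
  "integrable lborel f" "square_integrable f"
proof -
 show m: "f \<in> bmeas" and b: "norm (f x) <= B * indicator {-R..R} x" for x
  using assms by (auto simp: bounded_supp_def)
 show "norm (f x) <= \<bar>B\<bar>"
  using b[of x] by (cases "x \<in> {-R..R}") (auto intro: order_trans[OF norm_ge_zero])
 show "x \<notin> {-R..R} ==> f x = 0" using b[of x] by auto
 have i: "integrable lborel (%x. c * indicator {-R..R} x)" for c :: real
  by (auto intro!: integrable_mult_right integrable_real_indicator simp: emeasure_lborel_Icc_eq)
 show "integrable lborel f"
  by (rule Bochner_Integration.integrable_bound[OF i[of B]]) (use m b in \<open>auto intro: order_trans[OF b abs_ge_self]\<close>)
 have "(norm (f x))\<^sup>2 <= B\<^sup>2 * indicator {-R..R} x" for x
  using power_mono[OF b[of x] norm_ge_zero, of 2] by (cases "x \<in> {-R..R}") (auto simp: power_mult_distrib)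
 then show "square_integrable f"
  by (intro square_integrable_bound[OF m i[of "B\<^sup>2"]]) auto
qed

definition convol :: "(real => complex) => (real => complex) => real => complex" where
 "convol f g z = (LBINT y. f y * g (z - y))"

lemma bounded_supp_convol:
 assumes f: "bounded_supp B R f" and g: "bounded_supp B' R' g"
 shows "bounded_supp (\<bar>B'\<bar> * (LBINT y. norm (f y))) (R + R') (convol f g)"
proof -
 have [measurable]: "f \<in> bmeas" "g \<in> bmeas"
  using bounded_suppD(1) f g by blast+
 note i = bounded_suppD(5)[OF f]
 have "norm (convol f g z) <= (\<bar>B'\<bar> * (LBINT y. norm (f y))) * indicator {-(R+R')..R+R'} z" for z
 proof (cases "z \<in> {-(R+R')..R+R'}")
  case True
  have "norm (convol f g z) <= (LBINT y. norm (f y * g (z - y)))"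
   unfolding convol_def by (rule integral_norm_bound)
  also have "... <= (LBINT y. \<bar>B'\<bar> * norm (f y))"
  proof (rule integral_mono)
   show "integrable lborel (%y. norm (f y * g (z - y)))"
    using integrable_mult_bounded[OF i, of "%y. g (z - y)" "\<bar>B'\<bar>"] bounded_suppD(3)[OF g] by auto
   show "integrable lborel (%y. \<bar>B'\<bar> * norm (f y))" using i by auto
   show "norm (f y * g (z - y)) <= \<bar>B'\<bar> * norm (f y)" for y
    using mult_right_mono[OF bounded_suppD(3)[OF g, of "z - y"], of "norm (f y)"] by (simp add: norm_mult mult.commute)
  qed
  finally show ?thesis using True by simp
 next
  case False
  have "f y * g (z - y) = 0" for y
  proof (cases "y \<in> {-R..R}")
   case True
   then have "z - y \<notin> {-R'..R'}" using False by auto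
   then show ?thesis using bounded_suppD(4)[OF g] by simp
  qed (use bounded_suppD(4)[OF f] in simp)
  then have "convol f g z = 0" unfolding convol_def by (simp only:) simp
  then show ?thesis using False by simp
 qed
 moreover have "convol f g \<in> bmeas" unfolding convol_def[abs_def] by measurable
 ultimately show ?thesis by (simp add: bounded_supp_def)
qed

lemma mehler_quarter: "mehler (pi/4) x y = cplx (1 / sqrt (2 * pi)) * cis (x * y)"
 by (simp add: mehler_def)

lemma integrable_pair_shift:
 fixes f g :: "real => complex"
 assumes f: "integrable lborel f" and g: "integrable lborel g"
 shows "integrable (lborel \<Otimes>\<^sub>M lborel) (%(y, z). f y * g (z - y))"
proof (rule lborel_pair.Fubini_integrable)
 have [measurable]: "f \<in> bmeas" "g \<in> bmeas" using f g by auto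
 show "(%(y, z). f y * g (z - y)) \<in> borel_measurable (lborel \<Otimes>\<^sub>M lborel)" by measurable
 have shift: "integrable lborel (%z. g (z - y))" for y
  using lborel_integrable_real_affine[OF g, of 1 "- y"] by simp
 have "(LBINT z. norm (f y * g (z - y))) = norm (f y) * (LBINT z. norm (g z))" for y
 proof -
  have "(LBINT z. norm (g z)) = (LBINT z. norm (g (z - y)))"
   by (subst lborel_integral_real_affine[of 1 _ "- y"]) auto
  then show ?thesis by (simp add: norm_mult)
 qed
 then show "integrable lborel (%y. (LBINT z. norm (case (y, z) of (y, z) => f y * g (z - y))))"
  using f by simp
 show "AE y in lborel. integrable lborel (%z. case (y, z) of (y, z) => f y * g (z - y))"
  using shift by simp
qed

lemma mehler_quarter_convol:
 assumes f: "bounded_supp B R f" and g: "bounded_supp B' R' g"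
 shows "mehler_op (pi/4) f \<xi> * mehler_op (pi/4) g \<xi> = cplx (1 / sqrt (2 * pi)) * mehler_op (pi/4) (convol f g) \<xi>"
proof -
 define c where "c = cplx (1 / sqrt (2 * pi))"
 define F where "F y = cis (\<xi> * y) * f y" for y
 define G where "G y = cis (\<xi> * y) * g y" for y
 have [measurable]: "f \<in> bmeas" "g \<in> bmeas"
  using bounded_suppD(1) f g by blast+
 have i: "integrable lborel F" "integrable lborel G"
  unfolding F_def G_def
  by (rule Bochner_Integration.integrable_bound[OF bounded_suppD(5)[OF f]]; simp add: norm_mult)
    (rule Bochner_Integration.integrable_bound[OF bounded_suppD(5)[OF g]]; simp add: norm_mult)
 have M: "mehler_op (pi/4) h \<xi> = c * (LBINT y. cis (\<xi> * y) * h y)" for h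
  unfolding mehler_op_def mehler_quarter c_def Bochner_Integration.integral_mult_right_zero[symmetric]
  by (simp only: mult.assoc)
 have "(LBINT y. F y) * (LBINT z. G z) = (LBINT y. F y * (LBINT z. G z))" by simp
 also have "... = (LBINT y. LBINT z. F y * G (z - y))"
 proof (rule Bochner_Integration.integral_cong[OF refl])
  fix y
  have "(LBINT z. G z) = (LBINT z. G (z - y))"
   by (subst lborel_integral_real_affine[of 1 _ "- y"]) auto
  then show "F y * (LBINT z. G z) = (LBINT z. F y * G (z - y))" by simp
 qed
 also have "... = (LBINT z. LBINT y. F y * G (z - y))"
  using lborel_pair.Fubini_integral[OF integrable_pair_shift[OF i]] by simp
 also have "... = (LBINT z. cis (\<xi> * z) * convol f g z)"
 proof (rule Bochner_Integration.integral_cong[OF refl])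
  fix z
  have "F y * G (z - y) = cis (\<xi> * z) * (f y * g (z - y))" for y
  proof -
   have "cis (\<xi> * y) * cis (\<xi> * (z - y)) = cis (\<xi> * z)" by (simp add: cis_mult algebra_simps)
   then show ?thesis by (simp add: F_def G_def mult_ac)
  qed
  then show "(LBINT y. F y * G (z - y)) = cis (\<xi> * z) * convol f g z"
   by (simp add: convol_def)
 qed
 finally show ?thesis unfolding M by (simp add: F_def G_def c_def)
qed

text \<open>Unitarity of the propagator in polarised form; the constant of modulus one
  cancels.\<close>

lemma mehler_quarter_plancherel:
 assumes "square_integrable f" "integrable lborel f" "square_integrable g" "integrable lborel g"
 shows "(LBINT \<xi>. mehler_op (pi/4) f \<xi> * cnj (mehler_op (pi/4) g \<xi>)) = (LBINT x. f x * cnj (g x))"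
proof -
 have "sin (2 * (pi / 4)) \<noteq> 0" by simp
 from propagator_mehler[OF this] obtain \<omega> where w: "norm \<omega> = 1"
  and U: "\<And>f. square_integrable f ==> integrable lborel f ==>
   square_integrable (mehler_op (pi/4) f) \<and> propagator (pi/4) (L2_of f) = \<omega> *\<^sub>C L2_of (mehler_op (pi/4) f)" by blast
 have ww: "\<omega> * cnj \<omega> = 1" using w by (simp flip: complex_norm_square)
 have "cinner (propagator (pi/4) (L2_of f)) (propagator (pi/4) (L2_of g)) = cinner (L2_of (mehler_op (pi/4) f)) (L2_of (mehler_op (pi/4) g))"
  using U assms ww by (simp add: cinner_scaleC_left cinner_scaleC_right mult.assoc[symmetric] mult.commute[of "cnj \<omega>"])
 then have "cinner (L2_of (mehler_op (pi/4) f)) (L2_of (mehler_op (pi/4) g)) = cinner (L2_of f) (L2_of g)"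
  by (simp add: cinner_propagator)
 then show ?thesis using U assms by (simp add: cinner_L2_of)
qed

lemma convol_inner:
 assumes f: "bounded_supp B1 R1 f1" "bounded_supp B2 R2 f2" "bounded_supp B3 R3 f3" "bounded_supp B4 R4 f4"
 shows "(LBINT z. convol f1 f2 z * cnj (convol f4 f3 z))
  = (LBINT x. cnj (f4 x) * (LBINT w. cnj (f3 w) * (LBINT y. f1 y * f2 (x + w - y))))"
proof -
 note D = bounded_suppD(1)[OF f(1)] bounded_suppD(1)[OF f(2)] bounded_suppD(1)[OF f(3)] bounded_suppD(1)[OF f(4)]
 note D[measurable]
 note c12 = bounded_supp_convol[OF f(1,2)]
 have [measurable]: "convol f1 f2 \<in> bmeas" using bounded_suppD(1)[OF c12] .
 have int: "integrable (lborel \<Otimes>\<^sub>M lborel) (%(x, z). cnj (f4 x) * cnj (f3 (z - x)) * convol f1 f2 z)"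
 proof (rule Bochner_Integration.integrable_bound)
  define C where "C = \<bar>\<bar>B2\<bar> * (LBINT y. norm (f1 y))\<bar>"
  have "integrable (lborel \<Otimes>\<^sub>M lborel) (%(x, z). f4 x * f3 (z - x))"
   by (rule integrable_pair_shift) (use f bounded_suppD(5) in blast)+
  then show "integrable (lborel \<Otimes>\<^sub>M lborel) (%p. C * norm (case p of (x, z) => f4 x * f3 (z - x)))"
   by auto
  show "AE p in lborel \<Otimes>\<^sub>M lborel. norm (case p of (x, z) => cnj (f4 x) * cnj (f3 (z - x)) * convol f1 f2 z)
    <= norm (C * norm (case p of (x, z) => f4 x * f3 (z - x)))"
   using bounded_suppD(3)[OF c12]
   by (auto intro!: AE_I2 mult_left_mono simp: norm_mult C_def abs_mult mult.commute[of "\<bar>B2\<bar> * _"])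
 qed measurable
 have "(LBINT z. convol f1 f2 z * cnj (convol f4 f3 z))
   = (LBINT z. LBINT x. cnj (f4 x) * cnj (f3 (z - x)) * convol f1 f2 z)"
  unfolding convol_def[of f4 f3] Bochner_Integration.integral_cnj[symmetric]
  by (simp add: mult.commute[of "convol f1 f2 _"])
 also have "... = (LBINT x. LBINT z. cnj (f4 x) * cnj (f3 (z - x)) * convol f1 f2 z)"
  using lborel_pair.Fubini_integral[OF int] by simp
 also have "... = (LBINT x. cnj (f4 x) * (LBINT w. cnj (f3 w) * (LBINT y. f1 y * f2 (x + w - y))))"
 proof (rule Bochner_Integration.integral_cong[OF refl])
  fix x
  have "(LBINT z. cnj (f4 x) * cnj (f3 (z - x)) * convol f1 f2 z)
   = cnj (f4 x) * (LBINT z. cnj (f3 (z - x)) * convol f1 f2 z)"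
   by (simp add: mult.assoc)
  also have "(LBINT z. cnj (f3 (z - x)) * convol f1 f2 z) = (LBINT w. cnj (f3 w) * convol f1 f2 (x + w))"
   by (subst lborel_integral_real_affine[of 1 _ x]) auto
  finally show "(LBINT z. cnj (f4 x) * cnj (f3 (z - x)) * convol f1 f2 z)
   = cnj (f4 x) * (LBINT w. cnj (f3 w) * (LBINT y. f1 y * f2 (x + w - y)))"
   by (simp add: convol_def)
 qed
 finally show ?thesis .
qed

lemma bounded_supp_chirp:
 assumes "bounded_supp B R f" shows "bounded_supp B R (%y. cis (- (y\<^sup>2 * k / 2)) * f y)"
proof -
 have [measurable]: "f \<in> bmeas" using bounded_suppD(1)[OF assms] .
 have "(%y. cis (- (y\<^sup>2 * k / 2)) * f y) \<in> bmeas" by measurable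
 then show ?thesis using assms by (simp add: bounded_supp_def norm_mult)
qed

text \<open>By \<open>mehler_op_chirp\<close> the four factors are Fourier transforms of chirped
  functions at x / sin 2t. Products of two transforms are transforms of convolutions, and
  Plancherel's theorem leaves an integral over quadruples with y + v = x + w, where v = x + w - y.
  There the chirps combine, since x^2 + w^2 - y^2 - v^2 = 2 (y - x) (w - y). The amplitude collects
  |sin 2t|^(-2) from the four factors, |sin 2t| from the dilation and 1/(2 pi) from the two
  convolutions.\<close>

lemma quartic_fixed_time:
 assumes s: "sin (2 * t) \<noteq> 0"
  and f: "bounded_supp B1 R1 f1" "bounded_supp B2 R2 f2" "bounded_supp B3 R3 f3" "bounded_supp B4 R4 f4"
 shows "cinner (cubic (propagator t (L2_of f1)) (propagator t (L2_of f2)) (propagator t (L2_of f3))) (propagator t (L2_of f4))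
  = cplx (1 / (2 * pi * \<bar>sin (2 * t)\<bar>)) *
   (LBINT x. LBINT w. LBINT y. cis (cos (2 * t) / sin (2 * t) * ((y - x) * (w - y))) *
     (f1 y * f2 (x + w - y) * cnj (f3 w) * cnj (f4 x)))"
proof -
 define S where "S = sin (2 * t)"
 define k where "k = cos (2 * t) / S"
 define M where "M = mehler_op t"
 define ch where "ch f y = cis (- (y\<^sup>2 * k / 2)) * f y" for f :: "real => complex" and y
 define N where "N = mehler_op (pi/4)"
 have S0: "S \<noteq> 0" using s by (simp add: S_def)
 obtain \<omega> where w: "norm \<omega> = 1"
  and U: "\<And>f. square_integrable f ==> integrable lborel f ==>
   square_integrable (M f) \<and> propagator t (L2_of f) = \<omega> *\<^sub>C L2_of (M f)"
  using propagator_mehler[OF s] unfolding M_def by blast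
 have ww: "\<omega> * cnj \<omega> = 1" using w by (simp flip: complex_norm_square)
 have rep: "AE x in lborel. rep_L2 (propagator t (L2_of g)) x = \<omega> * M g x" if g: "bounded_supp B R g" for g B R
 proof -
  have u: "propagator t (L2_of g) = \<omega> *\<^sub>C L2_of (M g)" and sq: "square_integrable (M g)"
   using U bounded_suppD(5,6)[OF g] by auto
  show ?thesis
   unfolding u using rep_L2_scaleC[of \<omega> "L2_of (M g)"] rep_L2_of[OF sq] by eventually_elim simp
 qed
 have bdd: "norm (M g x) <= 1 / sqrt (2 * pi * \<bar>sin (2 * t)\<bar>) * (LBINT y. norm (g y))" if "bounded_supp B R g" for g B R x
  unfolding M_def by (rule norm_mehler_op_le[OF bounded_suppD(5)[OF that]])
 have Mm: "M g \<in> bmeas" if "bounded_supp B R g" for g B R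
  unfolding M_def by (rule mehler_op_measurable[OF bounded_suppD(1)[OF that]])
 note [measurable] = Mm[OF f(1)] Mm[OF f(2)] Mm[OF f(3)] Mm[OF f(4)]
 define m where "m x = \<omega> * M f1 x * (\<omega> * M f2 x) * cnj (\<omega> * M f3 x)" for x
 have [measurable]: "m \<in> bmeas" unfolding m_def[abs_def] by measurable
 have ae: "AE x in lborel. m x = product3 (propagator t (L2_of f1)) (propagator t (L2_of f2)) (propagator t (L2_of f3)) x"
  using rep[OF f(1)] rep[OF f(2)] rep[OF f(3)] by eventually_elim (simp add: product3_def m_def)
 have sqm: "square_integrable m"
 proof -
  define C where "C g = 1 / sqrt (2 * pi * \<bar>sin (2 * t)\<bar>) * (LBINT y. norm (g y))" for g :: "real => complex"
  have sq1: "square_integrable (%x. \<omega> * M f1 x)"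
   using U bounded_suppD(5,6)[OF f(1)] by (intro square_integrable_cmult) auto
  have "square_integrable (%x. \<omega> * M f1 x * (\<omega> * M f2 x * cnj (\<omega> * M f3 x)))"
  proof (rule square_integrable_mult_bounded[OF _ _ sq1, where B = "C f2 * C f3"])
   have C0: "0 <= C g" for g by (simp add: C_def)
   show "AE x in lborel. norm (\<omega> * M f2 x * cnj (\<omega> * M f3 x)) <= C f2 * C f3"
   proof (rule AE_I2)
    fix x
    have "norm (M f2 x) * norm (M f3 x) <= C f2 * C f3"
     using bdd[OF f(2), of x] bdd[OF f(3), of x] C0 unfolding C_def[symmetric] by (intro mult_mono) auto
    then show "norm (\<omega> * M f2 x * cnj (\<omega> * M f3 x)) <= C f2 * C f3"
     using w by (simp add: norm_mult)
   qed
  qed measurable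
  then show ?thesis by (simp add: m_def[abs_def] mult.assoc)
 qed
 have cub: "cubic (propagator t (L2_of f1)) (propagator t (L2_of f2)) (propagator t (L2_of f3)) = L2_of m"
  unfolding cubic_product3 by (rule L2_of_AE_cong(2)[OF sqm _ ae, symmetric]) measurable
 have sq4: "square_integrable (%x. \<omega> * M f4 x)"
  using U bounded_suppD(5,6)[OF f(4)] by (intro square_integrable_cmult) auto
 have u4: "propagator t (L2_of f4) = L2_of (%x. \<omega> * M f4 x)"
  using U bounded_suppD(5,6)[OF f(4)] by (simp add: L2_of_cmult)
 have "cinner (cubic (propagator t (L2_of f1)) (propagator t (L2_of f2)) (propagator t (L2_of f3))) (propagator t (L2_of f4))
   = (LBINT x. m x * cnj (\<omega> * M f4 x))"
  unfolding cub unfolding u4 by (rule cinner_L2_of[OF sqm sq4])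
 also have "... = (LBINT x. cplx (1 / S\<^sup>2) * (N (ch f1) (x / S) * N (ch f2) (x / S) * cnj (N (ch f3) (x / S)) * cnj (N (ch f4) (x / S))))"
 proof (rule Bochner_Integration.integral_cong[OF refl])
  fix x
  define q where "q = cplx (1 / sqrt \<bar>S\<bar>) * cis (- (x\<^sup>2 * k / 2))"
  have Mq: "M g x = q * N (ch g) (x / S)" for g
   unfolding M_def N_def q_def ch_def S_def k_def by (rule mehler_op_chirp[OF s])
  have "m x * cnj (\<omega> * M f4 x) = (\<omega> * cnj \<omega>) * (\<omega> * cnj \<omega>) * (M f1 x * M f2 x * cnj (M f3 x) * cnj (M f4 x))"
   by (simp add: m_def mult_ac)
  also have "... = (q * cnj q) * (q * cnj q) * (N (ch f1) (x / S) * N (ch f2) (x / S) * cnj (N (ch f3) (x / S)) * cnj (N (ch f4) (x / S)))"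
   unfolding ww Mq by (simp add: mult_ac)
  also have "(q * cnj q) * (q * cnj q) = cplx (1 / S\<^sup>2)"
  proof -
   have "q * cnj q = cplx (1 / \<bar>S\<bar>)"
    unfolding complex_norm_square[symmetric] using S0
    by (simp add: q_def norm_mult power_mult_distrib norm_divide power_divide)
   then have "(q * cnj q) * (q * cnj q) = cplx (1 / \<bar>S\<bar> * (1 / \<bar>S\<bar>))"
    by (simp only: of_real_mult)
   also have "1 / \<bar>S\<bar> * (1 / \<bar>S\<bar>) = 1 / S\<^sup>2" by (simp add: power2_eq_square)
   finally show ?thesis .
  qed
  finally show "m x * cnj (\<omega> * M f4 x) = cplx (1 / S\<^sup>2) *
   (N (ch f1) (x / S) * N (ch f2) (x / S) * cnj (N (ch f3) (x / S)) * cnj (N (ch f4) (x / S)))" .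
 qed
 also have "... = cplx (1 / S\<^sup>2) * (LBINT x. N (ch f1) (0 + 1 / S * x) * N (ch f2) (0 + 1 / S * x) * cnj (N (ch f3) (0 + 1 / S * x)) * cnj (N (ch f4) (0 + 1 / S * x)))"
  by simp
 also have "(LBINT x. N (ch f1) (0 + 1 / S * x) * N (ch f2) (0 + 1 / S * x) * cnj (N (ch f3) (0 + 1 / S * x)) * cnj (N (ch f4) (0 + 1 / S * x)))
   = cplx \<bar>S\<bar> * (LBINT \<xi>. N (ch f1) \<xi> * N (ch f2) \<xi> * cnj (N (ch f3) \<xi>) * cnj (N (ch f4) \<xi>))"
  using S0 by (subst (2) lborel_integral_real_affine[of "1 / S" _ 0]) (auto simp: scaleR_conv_of_real)
 also have "(LBINT \<xi>. N (ch f1) \<xi> * N (ch f2) \<xi> * cnj (N (ch f3) \<xi>) * cnj (N (ch f4) \<xi>))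
   = cplx (1 / (2 * pi)) * (LBINT z. convol (ch f1) (ch f2) z * cnj (convol (ch f4) (ch f3) z))"
 proof -
  note c = bounded_supp_chirp[OF f(1), of k, folded ch_def] bounded_supp_chirp[OF f(2), of k, folded ch_def]
   bounded_supp_chirp[OF f(3), of k, folded ch_def] bounded_supp_chirp[OF f(4), of k, folded ch_def]
  note v = bounded_supp_convol[OF c(1,2)] bounded_supp_convol[OF c(4,3)]
  have "N (ch f1) \<xi> * N (ch f2) \<xi> * cnj (N (ch f3) \<xi>) * cnj (N (ch f4) \<xi>)
    = cplx (1 / (2 * pi)) * (N (convol (ch f1) (ch f2)) \<xi> * cnj (N (convol (ch f4) (ch f3)) \<xi>))" for \<xi>
  proof -
   have "N (ch f1) \<xi> * N (ch f2) \<xi> * cnj (N (ch f3) \<xi>) * cnj (N (ch f4) \<xi>)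
    = (N (ch f1) \<xi> * N (ch f2) \<xi>) * cnj (N (ch f4) \<xi> * N (ch f3) \<xi>)" by simp
   also have "... = (cplx (1 / sqrt (2 * pi)) * cplx (1 / sqrt (2 * pi))) *
     (N (convol (ch f1) (ch f2)) \<xi> * cnj (N (convol (ch f4) (ch f3)) \<xi>))"
    unfolding N_def mehler_quarter_convol[OF c(1,2)] mehler_quarter_convol[OF c(4,3)] by simp
   also have "cplx (1 / sqrt (2 * pi)) * cplx (1 / sqrt (2 * pi)) = cplx (1 / (2 * pi))"
    unfolding of_real_mult[symmetric] by simp
   finally show ?thesis .
  qed
  then have "(LBINT \<xi>. N (ch f1) \<xi> * N (ch f2) \<xi> * cnj (N (ch f3) \<xi>) * cnj (N (ch f4) \<xi>))
   = cplx (1 / (2 * pi)) * (LBINT \<xi>. N (convol (ch f1) (ch f2)) \<xi> * cnj (N (convol (ch f4) (ch f3)) \<xi>))"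
   by simp
  then show ?thesis
   unfolding N_def using mehler_quarter_plancherel bounded_suppD(5,6)[OF v(1)] bounded_suppD(5,6)[OF v(2)] by simp
 qed
 also have "(LBINT z. convol (ch f1) (ch f2) z * cnj (convol (ch f4) (ch f3) z))
  = (LBINT x. cnj (ch f4 x) * (LBINT w. cnj (ch f3 w) * (LBINT y. ch f1 y * ch f2 (x + w - y))))"
  by (rule convol_inner[OF bounded_supp_chirp[OF f(1), of k, folded ch_def] bounded_supp_chirp[OF f(2), of k, folded ch_def]
    bounded_supp_chirp[OF f(3), of k, folded ch_def] bounded_supp_chirp[OF f(4), of k, folded ch_def]])
 also have "... = (LBINT x. LBINT w. LBINT y. cis (k * ((y - x) * (w - y))) *
     (f1 y * f2 (x + w - y) * cnj (f3 w) * cnj (f4 x)))"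
 proof -
  have "cnj (ch f4 x) * (cnj (ch f3 w) * (ch f1 y * ch f2 (x + w - y)))
    = cis (k * ((y - x) * (w - y))) * (f1 y * f2 (x + w - y) * cnj (f3 w) * cnj (f4 x))" for x w y
  proof -
   have "cis (k * ((y - x) * (w - y))) = cis (x\<^sup>2 * k / 2) * cis (w\<^sup>2 * k / 2) * cis (- (y\<^sup>2 * k / 2)) * cis (- ((x + w - y)\<^sup>2 * k / 2))"
    unfolding cis_mult
    by (rule arg_cong[where f = cis]) (simp add: power2_eq_square algebra_simps add_divide_distrib diff_divide_distrib)
   then show ?thesis by (simp add: ch_def cis_cnj mult_ac)
  qed
  then show ?thesis
   by (simp flip: Bochner_Integration.integral_mult_right_zero)
 qed
 finally show ?thesis
 proof -
  have "1 / S\<^sup>2 * (\<bar>S\<bar> * (1 / (2 * pi))) = 1 / (2 * pi * \<bar>S\<bar>)"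
   using S0 by (cases "S > 0") (simp_all add: field_simps power2_eq_square)
  then have "cplx (1 / S\<^sup>2) * (cplx \<bar>S\<bar> * (cplx (1 / (2 * pi)) * z)) = cplx (1 / (2 * pi * \<bar>S\<bar>)) * z" for z
   by (simp only: mult.assoc[symmetric] of_real_mult[symmetric])
  then show ?thesis if "cinner (cubic (propagator t (L2_of f1)) (propagator t (L2_of f2)) (propagator t (L2_of f3))) (propagator t (L2_of f4))
    = cplx (1 / S\<^sup>2) * (cplx \<bar>S\<bar> * (cplx (1 / (2 * pi)) *
    (LBINT x. LBINT w. LBINT y. cis (k * ((y - x) * (w - y))) * (f1 y * f2 (x + w - y) * cnj (f3 w) * cnj (f4 x)))))"
   using that by (simp only: S_def k_def)
 qed
qed

section \<open>The oscillatory time integral\<close>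

lemma inverse_powr_half_ge:
 fixes z :: real
 assumes "0 < \<bar>z\<bar>"
 shows "ln (1 / \<bar>z\<bar>) <= 2 * \<bar>z\<bar> powr (- (1/2))" "\<bar>z\<bar> <= 1 ==> 1 <= \<bar>z\<bar> powr (- (1/2))"
  "1 <= \<bar>z\<bar> ==> 1 / \<bar>z\<bar> <= \<bar>z\<bar> powr (- (1/2))"
proof -
 have "ln (\<bar>z\<bar> powr (- (1/2))) <= \<bar>z\<bar> powr (- (1/2))"
  using assms ln_le_minus_one[of "\<bar>z\<bar> powr (- (1/2))"] by simp
 then show "ln (1 / \<bar>z\<bar>) <= 2 * \<bar>z\<bar> powr (- (1/2))"
  using assms by (simp add: ln_powr ln_div)
 show "\<bar>z\<bar> <= 1 ==> 1 <= \<bar>z\<bar> powr (- (1/2))"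
  using assms powr_mono2'[of "- (1/2)" "\<bar>z\<bar>" 1] by simp
 show "1 <= \<bar>z\<bar> ==> 1 / \<bar>z\<bar> <= \<bar>z\<bar> powr (- (1/2))"
  using powr_mono[of "-1" "- (1/2)" "\<bar>z\<bar>"] assms by (simp add: powr_minus_divide)
qed

text \<open>The time-dependent factor of the quartic form, up to 1/(2 pi), for positive times;
  \<open>z\<close> stands for the product (y - x) (w - y).\<close>

definition osc :: "real => real => complex" where
 "osc z t = cis (cos (2 * t) / sin (2 * t) * z) / cplx (sin (2 * t))"

lemma sin_double_pos: "0 < t ==> t < pi / 2 ==> 0 < sin (2 * t)"
 by (intro sin_gt_zero) auto

lemma measurable_osc [measurable (raw)]:
 assumes [measurable]: "f \<in> borel_measurable M" "g \<in> borel_measurable M"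
 shows "(%x. osc (f x) (g x)) \<in> borel_measurable M"
 unfolding osc_def by measurable

lemma continuous_osc:
 assumes "0 < \<alpha>" "\<beta> < pi / 2" shows "continuous_on {\<alpha>..\<beta>} (osc z)"
proof -
 have "sin (2 * t) \<noteq> 0" if "t \<in> {\<alpha>..\<beta>}" for t
  using sin_double_pos[of t] that assms by auto
 then show ?thesis unfolding osc_def[abs_def] cis_conv_exp by (intro continuous_intros) auto
qed

lemma norm_osc: "0 < sin (2 * t) ==> norm (osc z t) = 1 / sin (2 * t)"
 by (simp add: osc_def norm_divide)

text \<open>Integration by parts: \<open>osc z\<close> is \<open>(\<i> / 2 z) sin 2t\<close> times the derivative of
 \<open>cis (z cot 2t)\<close>.\<close>

lemma osc_integral_parts:
 assumes z: "z \<noteq> 0" and ab: "0 < \<alpha>" "\<alpha> <= \<beta>" "\<beta> <= pi / 4"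
 shows "norm (integral {\<alpha>..\<beta>} (osc z)) <= 2 * \<beta> / \<bar>z\<bar>"
proof -
 define E where "E t = cis (cos (2 * t) / sin (2 * t) * z)" for t
 define F where "F t = \<i> / (2 * z) * (cplx (sin (2 * t)) * E t)" for t
 define Q where "Q t = \<i> / z * (cplx (cos (2 * t)) * E t)" for t
 have pos: "0 < sin (2 * t)" if "t \<in> {\<alpha>..\<beta>}" for t
  using sin_double_pos[of t] that ab pi_gt_zero by auto
 have "((%t. Q t + osc z t) has_integral F \<beta> - F \<alpha>) {\<alpha>..\<beta>}"
 proof (rule fundamental_theorem_of_calculus[OF ab(2)])
  fix t assume t: "t \<in> {\<alpha>..\<beta>}"
  have s: "sin (2 * t) \<noteq> 0" using pos[OF t] by simp
  have ct: "((%t. cos (2 * t) / sin (2 * t) * z) has_real_derivative (- 2 / (sin (2 * t))\<^sup>2 * z)) (at t)"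
  proof -
   have "(- 2 * sin (2 * t) * sin (2 * t) - 2 * cos (2 * t) * cos (2 * t)) = - 2 * ((sin (2 * t))\<^sup>2 + (cos (2 * t))\<^sup>2)"
    by (simp add: power2_eq_square)
   then have e: "- 2 * sin (2 * t) * sin (2 * t) - 2 * cos (2 * t) * cos (2 * t) = - 2" by simp
   have "((%t. cos (2 * t) / sin (2 * t)) has_real_derivative
     (- 2 * sin (2 * t) * sin (2 * t) - 2 * cos (2 * t) * cos (2 * t)) / (sin (2 * t))\<^sup>2) (at t)"
    using s by (auto intro!: derivative_eq_intros simp: power2_eq_square)
   then show ?thesis unfolding e by (intro DERIV_cmult_right)
  qed
  have cd: "(cis has_vector_derivative \<i> * cis x) (at x)" for x
  proof -
   have "((%z. exp (\<i> * z)) has_field_derivative \<i> * exp (\<i> * z)) (at z)" for z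
    by (auto intro!: derivative_eq_intros)
   from has_vector_derivative_real_field[OF this] show ?thesis by (simp add: cis_conv_exp[abs_def])
  qed
  have "((cis \<circ> (%t. cos (2 * t) / sin (2 * t) * z)) has_vector_derivative
    (- 2 / (sin (2 * t))\<^sup>2 * z) *\<^sub>R (\<i> * cis (cos (2 * t) / sin (2 * t) * z))) (at t)"
   by (intro vector_diff_chain_at) (use ct cd in \<open>auto simp: has_real_derivative_iff_has_vector_derivative\<close>)
  then have E': "(E has_vector_derivative (- 2 / (sin (2 * t))\<^sup>2 * z) *\<^sub>R (\<i> * E t)) (at t)"
   by (simp add: E_def[abs_def] o_def)
  have "((%t. sin (2 * t)) has_real_derivative 2 * cos (2 * t)) (at t)"
   by (auto intro!: derivative_eq_intros)
  from has_vector_derivative_of_real[OF this]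
  have S': "((%t. cplx (sin (2 * t))) has_vector_derivative cplx (2 * cos (2 * t))) (at t)" .
  have "(F has_vector_derivative \<i> / (2 * z) * (cplx (sin (2 * t)) * ((- 2 / (sin (2 * t))\<^sup>2 * z) *\<^sub>R (\<i> * E t))
    + cplx (2 * cos (2 * t)) * E t)) (at t)"
   unfolding F_def[abs_def] by (intro has_vector_derivative_mult_right has_vector_derivative_mult[OF S' E'])
  also have "\<i> / (2 * z) * (cplx (sin (2 * t)) * ((- 2 / (sin (2 * t))\<^sup>2 * z) *\<^sub>R (\<i> * E t))
    + cplx (2 * cos (2 * t)) * E t) = Q t + osc z t"
   using s z unfolding Q_def osc_def E_def[symmetric]
   by (simp add: scaleR_conv_of_real field_simps power2_eq_square)
  finally show "(F has_vector_derivative Q t + osc z t) (at t within {\<alpha>..\<beta>})"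
   by (rule has_vector_derivative_at_within)
 qed
 then have "integral {\<alpha>..\<beta>} (%t. Q t + osc z t) = F \<beta> - F \<alpha>"
  by (rule integral_unique)
 moreover have oi: "osc z integrable_on {\<alpha>..\<beta>}"
  using continuous_osc[of \<alpha> \<beta> z] ab pi_gt_zero by (intro integrable_continuous_real) auto
 moreover have Qi: "Q integrable_on {\<alpha>..\<beta>}"
 proof (rule integrable_continuous_real)
  have "sin (2 * t) \<noteq> 0" if "t \<in> {\<alpha>..\<beta>}" for t
   using pos[OF that] by simp
  then show "continuous_on {\<alpha>..\<beta>} Q"
   unfolding Q_def[abs_def] E_def cis_conv_exp by (intro continuous_intros) auto
 qed
 ultimately have eq: "integral {\<alpha>..\<beta>} (osc z) = F \<beta> - F \<alpha> - integral {\<alpha>..\<beta>} Q"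
  using Henstock_Kurzweil_Integration.integral_add[OF Qi oi] by (simp add: eq_diff_eq add.commute)
 have nE: "norm (E t) = 1" for t by (simp add: E_def)
 have nF: "norm (F t) <= t / \<bar>z\<bar>" if "t \<in> {\<alpha>..\<beta>}" for t
  using that ab pos[OF that] sin_x_le_x[of "2 * t"] z
   divide_right_mono[of "sin (2 * t)" "2 * t" "2 * \<bar>z\<bar>"]
  by (simp add: F_def norm_mult norm_divide nE)
 have nQ: "norm (Q t) <= 1 / \<bar>z\<bar>" for t
  using z by (simp add: Q_def norm_mult norm_divide nE divide_right_mono)
 have "norm (integral {\<alpha>..\<beta>} Q) <= 1 / \<bar>z\<bar> * (\<beta> - \<alpha>)"
  using has_integral_bound[OF _ integrable_integral[OF Qi, folded cbox_interval], of "1 / \<bar>z\<bar>"] nQ ab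
  by (simp add: cbox_interval)
 then have "norm (F \<beta> - F \<alpha> - integral {\<alpha>..\<beta>} Q) <= \<beta> / \<bar>z\<bar> + \<alpha> / \<bar>z\<bar> + 1 / \<bar>z\<bar> * (\<beta> - \<alpha>)"
  using nF[of \<beta>] nF[of \<alpha>] ab norm_triangle_ineq4[of "F \<beta> - F \<alpha>" "integral {\<alpha>..\<beta>} Q"] norm_triangle_ineq4[of "F \<beta>" "F \<alpha>"]
  by simp
 also have "... = 2 * \<beta> / \<bar>z\<bar>" by (simp add: diff_divide_distrib)
 finally show ?thesis unfolding eq .
qed

text \<open>Without cancellation: \<open>osc z t\<close> has modulus 1 / sin 2t \<le> 1 / t.\<close>

lemma osc_integral_log:
 assumes ab: "0 < \<alpha>" "\<alpha> <= \<beta>" "\<beta> <= pi / 4"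
 shows "norm (integral {\<alpha>..\<beta>} (osc z)) <= ln \<beta> - ln \<alpha>"
proof -
 have li: "((%t. 1 / t) has_integral ln \<beta> - ln \<alpha>) {\<alpha>..\<beta>}"
  by (rule fundamental_theorem_of_calculus)
   (use ab in \<open>auto intro!: derivative_eq_intros simp flip: has_real_derivative_iff_has_vector_derivative\<close>)
 have "norm (integral {\<alpha>..\<beta>} (osc z)) <= integral {\<alpha>..\<beta>} (%t. 1 / t)"
 proof (rule integral_norm_bound_integral)
  show "osc z integrable_on {\<alpha>..\<beta>}"
   using continuous_osc[of \<alpha> \<beta> z] ab pi_gt_zero by (intro integrable_continuous_real) auto
  show "(%t. 1 / t) integrable_on {\<alpha>..\<beta>}" using li by blast
  fix t assume t: "t \<in> {\<alpha>..\<beta>}"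
  then have "0 < sin (2 * t)" using ab pi_gt_zero by (intro sin_double_pos) auto
  moreover have "t <= sin (2 * t)" using sin_double_ge[of t] t ab calculation by simp
  ultimately show "norm (osc z t) <= 1 / t" using t ab by (simp add: norm_osc frac_le)
 qed
 then show ?thesis using integral_unique[OF li] by simp
qed

text \<open>For t below |z| the phase z cot 2t oscillates fast and integration by parts costs a
  constant; for t above |z| the absolute bound costs ln(1 / |z|). Both are at most a multiple of
  |z|^(-1/2). If |z| lies outside the interval, one of the two bounds is enough.\<close>

lemma osc_integral_small:
 assumes z: "z \<noteq> 0" and ab: "0 < \<alpha>" "\<alpha> <= \<beta>" "\<beta> <= pi / 4"
 shows "norm (integral {\<alpha>..\<beta>} (osc z)) <= 4 * \<bar>z\<bar> powr (- (1/2))"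
proof -
 define r where "r = \<bar>z\<bar> powr (- (1/2))"
 have z0: "0 < \<bar>z\<bar>" using z by simp
 note L = inverse_powr_half_ge[OF z0, folded r_def]
 have b1: "\<beta> <= 1" using ab pi_less_4 by simp
 have r0: "0 <= r" by (simp add: r_def)
 have lb: "ln \<beta> <= 0" using b1 ab by simp
 consider "\<beta> <= \<bar>z\<bar>" | "\<bar>z\<bar> <= \<alpha>" | "\<alpha> < \<bar>z\<bar>" "\<bar>z\<bar> < \<beta>" by linarith
 then have "norm (integral {\<alpha>..\<beta>} (osc z)) <= 4 * r"
 proof cases
  case 1
  have "2 * \<beta> / \<bar>z\<bar> <= 2 * r"
  proof (cases "\<bar>z\<bar> <= 1")
   case True
   have "2 * \<beta> / \<bar>z\<bar> <= 2" using 1 z0 by (simp add: field_simps)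
   then show ?thesis using L(2)[OF True] by simp
  next
   case False
   have "2 * \<beta> / \<bar>z\<bar> <= 2 * (1 / \<bar>z\<bar>)" using b1 z0 by (simp add: divide_right_mono)
   then show ?thesis using L(3) False by simp
  qed
  then show ?thesis using osc_integral_parts[OF z ab] r0 by simp
 next
  case 2
  have "ln \<bar>z\<bar> <= ln \<alpha>" using 2 z0 by simp
  then have "ln \<beta> - ln \<alpha> <= ln (1 / \<bar>z\<bar>)" using lb z0 by (simp add: ln_div)
  then show ?thesis using osc_integral_log[OF ab, of z] L(1) r0 by simp
 next
  case 3
  have "osc z integrable_on {\<alpha>..\<beta>}"
   using continuous_osc[of \<alpha> \<beta> z] ab pi_gt_zero by (intro integrable_continuous_real) auto
  then have "integral {\<alpha>..\<beta>} (osc z) = integral {\<alpha>..\<bar>z\<bar>} (osc z) + integral {\<bar>z\<bar>..\<beta>} (osc z)"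
   using 3 by (intro Henstock_Kurzweil_Integration.integral_combine[symmetric]) auto
  then have "norm (integral {\<alpha>..\<beta>} (osc z)) <= norm (integral {\<alpha>..\<bar>z\<bar>} (osc z)) + norm (integral {\<bar>z\<bar>..\<beta>} (osc z))"
   by (simp add: norm_triangle_ineq)
  also have "... <= 2 * \<bar>z\<bar> / \<bar>z\<bar> + (ln \<beta> - ln \<bar>z\<bar>)"
   using 3 ab z0 by (intro add_mono osc_integral_parts osc_integral_log z) auto
  also have "... <= 2 + ln (1 / \<bar>z\<bar>)" using z0 lb by (simp add: ln_div)
  also have "... <= 2 * r + 2 * r"
   using L(2) 3 b1 by (intro add_mono L(1)) simp
  also have "... = 4 * r" by simp
  finally show ?thesis .
 qed
 then show ?thesis by (simp add: r_def)
qed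

lemma osc_set_integrable: "0 < \<alpha> ==> \<beta> < pi / 2 ==> integrable lborel (%t. indicator {\<alpha>..\<beta>} t *\<^sub>R osc z t)"
 using borel_integrable_atLeastAtMost'[OF continuous_osc[of \<alpha> \<beta> z]] by (simp add: set_integrable_def)

lemma osc_lebesgue: "0 < \<alpha> ==> \<beta> < pi / 2 ==> (LBINT t. indicator {\<alpha>..\<beta>} t *\<^sub>R osc z t) = integral {\<alpha>..\<beta>} (osc z)"
 using set_borel_integral_eq_integral(2)[OF borel_integrable_atLeastAtMost'[OF continuous_osc[of \<alpha> \<beta> z]]]
 by (simp add: set_lebesgue_integral_def)

lemma osc_reflect: "osc z (pi / 2 - t) = osc (- z) t"
proof -
 have "2 * (pi / 2 - t) = pi - 2 * t" by simp
 then show ?thesis unfolding osc_def by (simp add: sin_diff cos_diff)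
qed

text \<open>The substitution t -> pi/2 - t flips the sign of the phase and reduces the half near
  pi/2 to the half near 0, so 8 = 4 + 4. The bound is uniform in the endpoints, which stay away from
  0 and pi/2, where 1 / sin 2t is not integrable.\<close>

lemma osc_integral_bound:
 assumes z: "z \<noteq> 0" and ab: "0 < \<alpha>" "\<alpha> <= \<beta>" "\<beta> < pi / 2"
 shows "norm (LBINT t. indicator {\<alpha>..\<beta>} t *\<^sub>R osc z t) <= 8 * \<bar>z\<bar> powr (- (1/2))"
proof -
 have large: "norm (integral {\<alpha>..\<beta>} (osc z)) <= 4 * \<bar>z\<bar> powr (- (1/2))"
  if "pi / 4 <= \<alpha>" "\<alpha> <= \<beta>" "\<beta> < pi / 2" for \<alpha> \<beta>
 proof -
  have "(LBINT t. indicator {\<alpha>..\<beta>} t *\<^sub>R osc z t)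
   = (LBINT t. indicator {\<alpha>..\<beta>} (pi/2 + -1 * t) *\<^sub>R osc z (pi/2 + -1 * t))"
   by (subst lborel_integral_real_affine[of "-1" _ "pi/2"]) auto
  also have "... = (LBINT t. indicator {pi/2-\<beta>..pi/2-\<alpha>} t *\<^sub>R osc (- z) t)"
   using osc_reflect[of z] by (intro Bochner_Integration.integral_cong) (auto simp: indicator_def)
  finally have "integral {\<alpha>..\<beta>} (osc z) = integral {pi/2-\<beta>..pi/2-\<alpha>} (osc (- z))"
   using that pi_gt_zero by (simp add: osc_lebesgue)
  then show ?thesis using osc_integral_small[of "- z" "pi/2-\<beta>" "pi/2-\<alpha>"] z that by simp
 qed
 have r0: "0 <= \<bar>z\<bar> powr (- (1/2))" by simp
 consider "\<beta> <= pi / 4" | "pi / 4 <= \<alpha>" | "\<alpha> < pi / 4" "pi / 4 < \<beta>" by linarith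
 then have "norm (integral {\<alpha>..\<beta>} (osc z)) <= 8 * \<bar>z\<bar> powr (- (1/2))"
 proof cases
  case 1 then show ?thesis using osc_integral_small[OF z ab(1,2)] r0 by linarith
 next
  case 2 then show ?thesis using large[of \<alpha> \<beta>] ab r0 by linarith
 next
  case 3
  have "osc z integrable_on {\<alpha>..\<beta>}"
   using continuous_osc[of \<alpha> \<beta> z] ab by (intro integrable_continuous_real) auto
  then have "integral {\<alpha>..\<beta>} (osc z) = integral {\<alpha>..pi/4} (osc z) + integral {pi/4..\<beta>} (osc z)"
   using 3 by (intro Henstock_Kurzweil_Integration.integral_combine[symmetric]) auto
  then have "norm (integral {\<alpha>..\<beta>} (osc z)) <= norm (integral {\<alpha>..pi/4} (osc z)) + norm (integral {pi/4..\<beta>} (osc z))"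
   by (simp add: norm_triangle_ineq)
  also have "... <= 4 * \<bar>z\<bar> powr (- (1/2)) + 4 * \<bar>z\<bar> powr (- (1/2))"
   using 3 ab by (intro add_mono osc_integral_small z large) auto
  finally show ?thesis by simp
 qed
 then show ?thesis using ab by (simp add: osc_lebesgue)
qed

section \<open>Domination by a positive operator\<close>

text \<open>The value at 0 is infinite so that the domination also covers y = x and w = y: there the
  phase vanishes, and the time integrals are unbounded as the endpoints approach 0 or pi/2.\<close>

definition kern :: "real => ennreal" where
 "kern u = (if u = 0 then \<top> else ennreal (\<bar>u\<bar> powr (- (1/2))))"

text \<open>In the coordinates \<open>a = y - x\<close>, \<open>b = w - y\<close> this is the integral of
 \<open>|a|\<^sup>-\<^sup>1\<^sup>/\<^sup>2 |b|\<^sup>-\<^sup>1\<^sup>/\<^sup>2 F(x + a) G(x + b) H(x + a + b)\<close>.\<close>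

definition Tplus :: "(real => ennreal) => (real => ennreal) => (real => ennreal) => real => ennreal" where
 "Tplus F G H x = (NN w. NN y. kern (y - x) * kern (w - y) * (F y * G (x + w - y) * H w))"

lemma measurable_kern [measurable]: "kern \<in> bmeas"
 unfolding kern_def[abs_def] by measurable

lemma measurable_Tplus [measurable]:
 assumes [measurable]: "F \<in> bmeas" "G \<in> bmeas" "H \<in> bmeas"
 shows "Tplus F G H \<in> bmeas"
 unfolding Tplus_def[abs_def] by measurable

lemma integral_norm_bound_ennreal': "ennreal (norm (integral\<^sup>L M f)) <= (\<integral>\<^sup>+x. ennreal (norm (f x)) \<partial>M)"
 for f :: "'a => 'b::{banach, second_countable_topology}"
 by (cases "integrable M f") (simp_all add: integral_norm_bound_ennreal not_integrable_integral_eq)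

lemma (in pair_sigma_finite) integrable_prod_mult:
 fixes f :: "'a => real" and g :: "'b => real"
 assumes f: "integrable M1 f" and g: "integrable M2 g"
 shows "integrable (M1 \<Otimes>\<^sub>M M2) (%(x, y). f x * g y)"
proof (rule Fubini_integrable)
 have [measurable]: "f \<in> borel_measurable M1" "g \<in> borel_measurable M2" using f g by auto
 show "(%(x, y). f x * g y) \<in> borel_measurable (M1 \<Otimes>\<^sub>M M2)" by measurable
 show "integrable M1 (%x. \<integral>y. norm (case (x, y) of (x, y) => f x * g y) \<partial>M2)"
  using f by (simp add: abs_mult)
 show "AE x in M1. integrable M2 (%y. case (x, y) of (x, y) => f x * g y)"
  using g by simp
qed

text \<open>Away from 0 and pi/2 the factor 1 / sin 2t is bounded, so Fubini's theorem allows the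
  time integral to be taken first, where the oscillation is used. The sign \<sigma> covers negative
  times, cot being odd.\<close>

lemma quartic_interval:
 assumes f: "bounded_supp B1 R1 f1" "bounded_supp B2 R2 f2" "bounded_supp B3 R3 f3" "bounded_supp B4 R4 f4"
  and ab: "0 < \<alpha>" "\<alpha> <= \<beta>" "\<beta> < pi / 2" and \<sigma>: "\<sigma> = 1 \<or> \<sigma> = - 1"
 defines "q \<equiv> %t. cinner (cubic (propagator t (L2_of f1)) (propagator t (L2_of f2)) (propagator t (L2_of f3))) (propagator t (L2_of f4))"
 shows "ennreal (norm (LBINT t. indicator {\<alpha>..\<beta>} t *\<^sub>R q (\<sigma> * t)))
  <= 2 * (NN x. ennreal (norm (f4 x)) * Tplus (%y. ennreal (norm (f1 y))) (%y. ennreal (norm (f2 y))) (%y. ennreal (norm (f3 y))) x)"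
proof -
 define P where "P = (lborel :: real measure) \<Otimes>\<^sub>M (lborel :: real measure) \<Otimes>\<^sub>M (lborel :: real measure)"
 have s2: "sigma_finite_measure ((lborel :: real measure) \<Otimes>\<^sub>M (lborel :: real measure))"
  by (intro sigma_finite_pair_measure lborel.sigma_finite_measure_axioms)
 interpret LL: pair_sigma_finite "lborel :: real measure" "(lborel :: real measure) \<Otimes>\<^sub>M (lborel :: real measure)"
  by (intro pair_sigma_finite.intro lborel.sigma_finite_measure_axioms s2)
 have sP: "sigma_finite_measure P"
  unfolding P_def by (intro sigma_finite_pair_measure lborel.sigma_finite_measure_axioms)
 interpret LP: pair_sigma_finite "lborel :: real measure" P
  by (intro pair_sigma_finite.intro lborel.sigma_finite_measure_axioms sP)
 note D = bounded_suppD(1)[OF f(1)] bounded_suppD(1)[OF f(2)] bounded_suppD(1)[OF f(3)] bounded_suppD(1)[OF f(4)]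
 note D[measurable]
 define H where "H x w y = f1 y * f2 (x + w - y) * cnj (f3 w) * cnj (f4 x)" for x w y
 define Hp where "Hp p = (case p of (x, w, y) => H x w y)" for p
 define z where "z p = (case p of (x, w, y) => \<sigma> * ((y - x) * (w - y)))" for p :: "real \<times> real \<times> real"
 have [measurable]: "Hp \<in> borel_measurable P" unfolding Hp_def[abs_def] H_def P_def by measurable
 have [measurable]: "z \<in> borel_measurable P" unfolding z_def[abs_def] P_def by measurable

 have Hle: "norm (H x w y) <= \<bar>B2\<bar> * (norm (f4 x) * (norm (f3 w) * norm (f1 y)))" for x w y
  using mult_right_mono[OF bounded_suppD(3)[OF f(2), of "x + w - y"], of "norm (f4 x) * (norm (f3 w) * norm (f1 y))"]
  by (simp add: H_def norm_mult mult_ac)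
 have i31: "integrable (lborel \<Otimes>\<^sub>M lborel) (%(w, y). norm (f3 w) * norm (f1 y))"
  by (rule lborel_pair.integrable_prod_mult) (use f bounded_suppD(5) in auto)
 have intH: "integrable P Hp"
 proof (rule Bochner_Integration.integrable_bound)
  have "integrable P (%(x, p). norm (f4 x) * (case p of (w, y) => norm (f3 w) * norm (f1 y)))"
   unfolding P_def by (rule LL.integrable_prod_mult[OF _ i31]) (use f bounded_suppD(5) in auto)
  then show "integrable P (%p. \<bar>B2\<bar> * (case p of (x, p) => norm (f4 x) * (case p of (w, y) => norm (f3 w) * norm (f1 y))))"
   by (rule integrable_mult_right)
  show "AE p in P. norm (Hp p) <= norm (\<bar>B2\<bar> * (case p of (x, p) => norm (f4 x) * (case p of (w, y) => norm (f3 w) * norm (f1 y))))"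
   using Hle by (intro AE_I2) (auto simp: Hp_def abs_mult)
 qed measurable
 have intHx: "integrable (lborel \<Otimes>\<^sub>M lborel) (%(w, y). cis (c * ((y - x) * (w - y))) * H x w y)" for c x
 proof (rule Bochner_Integration.integrable_bound)
  show "integrable (lborel \<Otimes>\<^sub>M lborel) (%p. \<bar>B2\<bar> * norm (f4 x) * (case p of (w, y) => norm (f3 w) * norm (f1 y)))"
   using i31 by (rule integrable_mult_right)
  show "(%(w, y). cis (c * ((y - x) * (w - y))) * H x w y) \<in> borel_measurable (lborel \<Otimes>\<^sub>M lborel)"
   unfolding H_def by measurable
  show "AE p in lborel \<Otimes>\<^sub>M lborel. norm (case p of (w, y) => cis (c * ((y - x) * (w - y))) * H x w y)
    <= norm (\<bar>B2\<bar> * norm (f4 x) * (case p of (w, y) => norm (f3 w) * norm (f1 y)))"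
   using Hle[of x] by (intro AE_I2) (auto simp: norm_mult abs_mult mult.assoc)
 qed
 have intHc: "integrable P (%p. cis (c * z p) * Hp p)" for c
  by (rule Bochner_Integration.integrable_bound[OF intH]) (auto simp: norm_mult)
 have qt: "q (\<sigma> * t) = cplx (1 / (2 * pi)) * (\<integral>p. osc (z p) t * Hp p \<partial>P)" if t: "t \<in> {\<alpha>..\<beta>}" for t
 proof -
  have s: "0 < sin (2 * t)" using t ab by (intro sin_double_pos) auto
  have s\<sigma>: "sin (2 * (\<sigma> * t)) \<noteq> 0" "\<bar>sin (2 * (\<sigma> * t))\<bar> = sin (2 * t)"
   "cos (2 * (\<sigma> * t)) / sin (2 * (\<sigma> * t)) = cos (2 * t) / sin (2 * t) * \<sigma>"
   using \<sigma> s by auto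
  define k where "k = cos (2 * t) / sin (2 * t)"
  have "q (\<sigma> * t) = cplx (1 / (2 * pi * sin (2 * t))) *
   (LBINT x. LBINT w. LBINT y. cis (k * \<sigma> * ((y - x) * (w - y))) * H x w y)"
   unfolding q_def quartic_fixed_time[OF s\<sigma>(1) f] s\<sigma>(2,3) k_def H_def ..
  also have "(LBINT x. LBINT w. LBINT y. cis (k * \<sigma> * ((y - x) * (w - y))) * H x w y)
   = (LBINT x. (\<integral>p. (case p of (w, y) => cis (k * \<sigma> * ((y - x) * (w - y))) * H x w y) \<partial>(lborel \<Otimes>\<^sub>M lborel)))"
   using lborel_pair.integral_fst'[OF intHx] by simp
  also have "... = (LBINT x. (\<integral>p. cis (k * z (x, p)) * Hp (x, p) \<partial>(lborel \<Otimes>\<^sub>M lborel)))"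
   by (intro Bochner_Integration.integral_cong refl) (auto simp: z_def Hp_def mult_ac)
  also have "... = (\<integral>p. cis (k * z p) * Hp p \<partial>P)"
   unfolding P_def by (rule LL.integral_fst') (use intHc[of k] in \<open>simp add: P_def\<close>)
  also have "cplx (1 / (2 * pi * sin (2 * t))) * ... = cplx (1 / (2 * pi)) * (\<integral>p. osc (z p) t * Hp p \<partial>P)"
  proof -
   have "osc (z p) t * Hp p = cplx (1 / sin (2 * t)) * (cis (k * z p) * Hp p)" for p
    by (simp add: osc_def k_def)
   then have "(\<integral>p. osc (z p) t * Hp p \<partial>P) = cplx (1 / sin (2 * t)) * (\<integral>p. cis (k * z p) * Hp p \<partial>P)"
    by (simp only: Bochner_Integration.integral_mult_right_zero)
   then show ?thesis by simp
  qed
  finally show ?thesis .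
 qed
 have intT: "integrable (lborel \<Otimes>\<^sub>M P) (%(t, p). indicator {\<alpha>..\<beta>} t *\<^sub>R (osc (z p) t * Hp p))"
 proof (rule Bochner_Integration.integrable_bound)
  have "integrable lborel (%t. norm (indicator {\<alpha>..\<beta>} t *\<^sub>R osc 0 t))"
   by (intro integrable_norm osc_set_integrable ab)
  then show "integrable (lborel \<Otimes>\<^sub>M P) (%(t, p). norm (indicator {\<alpha>..\<beta>} t *\<^sub>R osc 0 t) * norm (Hp p))"
   by (rule LP.integrable_prod_mult) (use intH in auto)
  show "AE x in lborel \<Otimes>\<^sub>M P. norm (case x of (t, p) => indicator {\<alpha>..\<beta>} t *\<^sub>R (osc (z p) t * Hp p))
   <= norm (case x of (t, p) => norm (indicator {\<alpha>..\<beta>} t *\<^sub>R osc 0 t) * norm (Hp p))"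
   by (intro AE_I2) (auto simp: norm_mult osc_def norm_divide)
 qed measurable
 have "(LBINT t. indicator {\<alpha>..\<beta>} t *\<^sub>R q (\<sigma> * t))
   = (LBINT t. cplx (1 / (2 * pi)) * (\<integral>p. indicator {\<alpha>..\<beta>} t *\<^sub>R (osc (z p) t * Hp p) \<partial>P))"
 proof (rule Bochner_Integration.integral_cong[OF refl])
  fix t
  show "indicator {\<alpha>..\<beta>} t *\<^sub>R q (\<sigma> * t) = cplx (1 / (2 * pi)) * (\<integral>p. indicator {\<alpha>..\<beta>} t *\<^sub>R (osc (z p) t * Hp p) \<partial>P)"
   by (cases "t \<in> {\<alpha>..\<beta>}") (simp_all add: qt)
 qed
 also have "... = cplx (1 / (2 * pi)) * (\<integral>p. (LBINT t. indicator {\<alpha>..\<beta>} t *\<^sub>R (osc (z p) t * Hp p)) \<partial>P)"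
  using LP.Fubini_integral[OF intT] by (simp only: prod.case Bochner_Integration.integral_mult_right_zero)
 also have "(\<integral>p. (LBINT t. indicator {\<alpha>..\<beta>} t *\<^sub>R (osc (z p) t * Hp p)) \<partial>P)
   = (\<integral>p. (LBINT t. indicator {\<alpha>..\<beta>} t *\<^sub>R osc (z p) t) * Hp p \<partial>P)"
 proof (rule Bochner_Integration.integral_cong[OF refl])
  fix p
  show "(LBINT t. indicator {\<alpha>..\<beta>} t *\<^sub>R (osc (z p) t * Hp p)) = (LBINT t. indicator {\<alpha>..\<beta>} t *\<^sub>R osc (z p) t) * Hp p"
   by (subst Bochner_Integration.integral_mult_left_zero[symmetric]) simp
 qed
 finally have eq: "(LBINT t. indicator {\<alpha>..\<beta>} t *\<^sub>R q (\<sigma> * t))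
  = cplx (1 / (2 * pi)) * (\<integral>p. (LBINT t. indicator {\<alpha>..\<beta>} t *\<^sub>R osc (z p) t) * Hp p \<partial>P)" .
 have pt: "ennreal (norm ((LBINT t. indicator {\<alpha>..\<beta>} t *\<^sub>R osc (z (x, w, y)) t) * Hp (x, w, y)))
  <= 8 * (ennreal (norm (f4 x)) * (kern (y - x) * kern (w - y) * (ennreal (norm (f1 y)) * ennreal (norm (f2 (x + w - y))) * ennreal (norm (f3 w)))))"
  for x w y
 proof -
  have Hn: "ennreal (norm (Hp (x, w, y))) = ennreal (norm (f4 x)) * (ennreal (norm (f1 y)) * ennreal (norm (f2 (x + w - y))) * ennreal (norm (f3 w)))"
   by (simp add: Hp_def H_def norm_mult mult_ac flip: ennreal_mult)
  have K: "ennreal (norm (LBINT t. indicator {\<alpha>..\<beta>} t *\<^sub>R osc (z (x, w, y)) t)) <= 8 * (kern (y - x) * kern (w - y))"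
  proof (cases "y = x \<or> w = y")
   case True
   have k0: "kern u \<noteq> 0" for u by (auto simp: kern_def)
   have "kern (y - x) * kern (w - y) = \<top>"
    using True k0 by (auto simp: kern_def ennreal_mult_eq_top_iff ennreal_top_mult ennreal_mult_top)
   then show ?thesis by (simp add: ennreal_mult_top)
  next
   case False
   then have z0: "z (x, w, y) \<noteq> 0" using \<sigma> by (auto simp: z_def)
   have "\<bar>z (x, w, y)\<bar> powr (- (1/2)) = \<bar>y - x\<bar> powr (- (1/2)) * \<bar>w - y\<bar> powr (- (1/2))"
    using \<sigma> by (auto simp: z_def abs_mult powr_mult)
   then have "norm (LBINT t. indicator {\<alpha>..\<beta>} t *\<^sub>R osc (z (x, w, y)) t) <= 8 * (\<bar>y - x\<bar> powr (- (1/2)) * \<bar>w - y\<bar> powr (- (1/2)))"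
    using osc_integral_bound[OF z0 ab] by simp
   then have "ennreal (norm (LBINT t. indicator {\<alpha>..\<beta>} t *\<^sub>R osc (z (x, w, y)) t)) <= ennreal (8 * (\<bar>y - x\<bar> powr (- (1/2)) * \<bar>w - y\<bar> powr (- (1/2))))"
    by (rule ennreal_leI)
   then show ?thesis using False by (simp add: kern_def ennreal_mult)
  qed
  have "ennreal (norm ((LBINT t. indicator {\<alpha>..\<beta>} t *\<^sub>R osc (z (x, w, y)) t) * Hp (x, w, y)))
   = ennreal (norm (LBINT t. indicator {\<alpha>..\<beta>} t *\<^sub>R osc (z (x, w, y)) t)) * ennreal (norm (Hp (x, w, y)))"
   by (simp add: norm_mult ennreal_mult)
  also have "... <= 8 * (kern (y - x) * kern (w - y)) * ennreal (norm (Hp (x, w, y)))"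
   by (intro mult_right_mono K) simp
  finally show ?thesis unfolding Hn by (simp add: mult_ac)
 qed
 define gP where "gP p = (case p of (x, w, y) => ennreal (norm (f4 x)) * (kern (y - x) * kern (w - y) * (ennreal (norm (f1 y)) * ennreal (norm (f2 (x + w - y))) * ennreal (norm (f3 w)))))" for p
 have [measurable]: "gP \<in> borel_measurable P" unfolding gP_def[abs_def] P_def by measurable
 have "ennreal (norm (LBINT t. indicator {\<alpha>..\<beta>} t *\<^sub>R q (\<sigma> * t)))
  = ennreal (1 / (2 * pi)) * ennreal (norm (\<integral>p. (LBINT t. indicator {\<alpha>..\<beta>} t *\<^sub>R osc (z p) t) * Hp p \<partial>P))"
  unfolding eq norm_mult by (subst ennreal_mult) (auto simp: norm_divide)
 \<comment> \<open>The bound 1/(2 pi) \<le> 1/4, together with the factor 8 of the oscillatory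
   integral, gives the constant 2.\<close>
 also have "... <= ennreal (1 / 4) * (\<integral>\<^sup>+p. ennreal (norm ((LBINT t. indicator {\<alpha>..\<beta>} t *\<^sub>R osc (z p) t) * Hp p)) \<partial>P)"
  using pi_ge_two by (intro mult_mono ennreal_leI integral_norm_bound_ennreal') (auto simp: field_simps)
 also have "... <= ennreal (1 / 4) * (\<integral>\<^sup>+p. 8 * gP p \<partial>P)"
  by (intro mult_left_mono nn_integral_mono) (auto simp: gP_def intro: pt)
 also have "(\<integral>\<^sup>+p. 8 * gP p \<partial>P) = 8 * (\<integral>\<^sup>+p. gP p \<partial>P)"
  by (rule nn_integral_cmult) measurable
 also have "(\<integral>\<^sup>+p. gP p \<partial>P) = (NN x. \<integral>\<^sup>+p. gP (x, p) \<partial>(lborel \<Otimes>\<^sub>M lborel))"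
  unfolding P_def by (rule sigma_finite_measure.nn_integral_fst[OF s2, symmetric]) (simp flip: P_def)
 also have "... = (NN x. NN w. NN y. gP (x, w, y))"
 proof (rule nn_integral_cong)
  fix x :: real
  have "(%p. gP (x, p)) \<in> borel_measurable (lborel \<Otimes>\<^sub>M lborel)"
   by (rule measurable_Pair2[of gP lborel]) (simp_all flip: P_def)
  from lborel.nn_integral_fst[OF this]
  show "(\<integral>\<^sup>+p. gP (x, p) \<partial>(lborel \<Otimes>\<^sub>M lborel)) = (NN w. NN y. gP (x, w, y))"
   by simp
 qed
 also have "... = (NN x. ennreal (norm (f4 x)) * Tplus (%y. ennreal (norm (f1 y))) (%y. ennreal (norm (f2 y))) (%y. ennreal (norm (f3 y))) x)"
  unfolding gP_def Tplus_def by (simp add: nn_integral_cmult)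
 also have "ennreal (1 / 4) * (8 * r) = 2 * r" for r :: ennreal
 proof -
  have "ennreal (1 / 4) * 8 = 2"
   by (simp add: ennreal_mult[symmetric] flip: ennreal_numeral)
  then show ?thesis by (simp only: mult.assoc[symmetric])
 qed
 finally show ?thesis .
qed

text \<open>The bound on interior intervals is uniform, so the interval may be exhausted; dominated
  convergence uses the integrability hypothesis, which the Strichartz estimate provides.\<close>

lemma quartic_half:
 assumes f: "bounded_supp B1 R1 f1" "bounded_supp B2 R2 f2" "bounded_supp B3 R3 f3" "bounded_supp B4 R4 f4"
  and ab: "0 <= a" "a < b" "b <= pi / 2" and \<sigma>: "\<sigma> = 1 \<or> \<sigma> = - 1"
 defines "q \<equiv> %t. cinner (cubic (propagator t (L2_of f1)) (propagator t (L2_of f2)) (propagator t (L2_of f3))) (propagator t (L2_of f4))"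
 assumes int: "integrable lborel (%t. indicator {a..b} t *\<^sub>R q (\<sigma> * t))"
 shows "ennreal (norm (LBINT t. indicator {a..b} t *\<^sub>R q (\<sigma> * t)))
  <= 2 * (NN x. ennreal (norm (f4 x)) * Tplus (%y. ennreal (norm (f1 y))) (%y. ennreal (norm (f2 y))) (%y. ennreal (norm (f3 y))) x)"
proof -
 \<comment> \<open>The shift by 2 keeps \<open>e n\<close> at most half of the length, so that
   \<open>\<alpha> n \<le> \<beta> n\<close> from n = 0 on.\<close>
 define e where "e n = (b - a) / real (n + 2)" for n :: nat
 define \<alpha> where "\<alpha> n = a + e n" for n
 define \<beta> where "\<beta> n = b - e n" for n
 have frac: "0 < e n" "e n <= (b - a) / 2" for n
  unfolding e_def using ab by simp (intro divide_left_mono, use ab in auto)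
 have ord: "0 < \<alpha> n" "\<alpha> n <= \<beta> n" "\<beta> n < pi / 2" "a < \<alpha> n" "\<beta> n < b" for n
  using frac(1)[of n] frac(2)[of n] ab by (simp_all add: \<alpha>_def \<beta>_def)
 define h where "h t = indicator {a..b} t *\<^sub>R q (\<sigma> * t)" for t
 have [measurable]: "h \<in> bmeas" using int by (simp add: h_def[abs_def])
 have lim0: "e \<longlonglongrightarrow> 0" unfolding e_def[abs_def] by real_asymp
 have lim: "(%n. (LBINT t. indicator {\<alpha> n..\<beta> n} t *\<^sub>R h t)) \<longlonglongrightarrow> (LBINT t. h t)"
 proof (rule integral_dominated_convergence)
  show "integrable lborel (%t. norm (h t))" unfolding h_def by (rule integrable_norm[OF int])
  show "AE t in lborel. (%n. indicator {\<alpha> n..\<beta> n} t *\<^sub>R h t) \<longlonglongrightarrow> h t"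
   using AE_lborel_singleton[of a] AE_lborel_singleton[of b]
  proof eventually_elim
   case (elim t)
   show ?case
   proof (cases "t \<in> {a..b}")
    case True
    then have "0 < t - a" "0 < b - t" using elim by auto
    then have "\<forall>\<^sub>F n in sequentially. e n < t - a" "\<forall>\<^sub>F n in sequentially. e n < b - t"
     using order_tendstoD(2)[OF lim0] by auto
    then have "\<forall>\<^sub>F n in sequentially. indicator {\<alpha> n..\<beta> n} t *\<^sub>R h t = h t"
     by eventually_elim (simp add: \<alpha>_def \<beta>_def)
    then show ?thesis by (rule tendsto_eventually)
   next
    case False
    then have "h t = 0" by (simp add: h_def)
    then show ?thesis by simp
   qed
  qed
 qed (auto simp: indicator_def)
 have eq: "indicator {\<alpha> n..\<beta> n} t *\<^sub>R h t = indicator {\<alpha> n..\<beta> n} t *\<^sub>R q (\<sigma> * t)" for n t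
  using ord(4,5)[of n] by (auto simp: h_def indicator_def)
 have "(%n. ennreal (norm (LBINT t. indicator {\<alpha> n..\<beta> n} t *\<^sub>R h t))) \<longlonglongrightarrow> ennreal (norm (LBINT t. h t))"
  by (intro tendsto_intros lim)
 then show ?thesis
  unfolding h_def[symmetric]
  by (rule LIMSEQ_le_const2)
   (auto simp: eq q_def intro!: quartic_interval[OF f ord(1-3) \<sigma>])
qed

definition quartic_form :: "L2 => L2 => L2 => L2 => ennreal" where
 "quartic_form f g h w = (NN x. ennreal (norm (rep_L2 w x)) *
   Tplus (%y. ennreal (norm (rep_L2 f y))) (%y. ennreal (norm (rep_L2 g y))) (%y. ennreal (norm (rep_L2 h y))) x)"

definition cutoff :: "nat => (real => complex) => real => complex" where
 "cutoff n f x = (if \<bar>x\<bar> <= real n \<and> norm (f x) <= real n then f x else 0)"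

lemma bounded_supp_cutoff: "f \<in> bmeas ==> bounded_supp (real n) (real n) (cutoff n f)"
 unfolding bounded_supp_def cutoff_def[abs_def] by (auto simp: indicator_def)

lemma norm_cutoff_le: "norm (cutoff n f x) <= norm (f x)"
 by (simp add: cutoff_def)

lemma cutoff_tendsto: "(%n. L2_of (cutoff n (rep_L2 f))) \<longlonglongrightarrow> f"
proof -
 have "(%n. L2_of (cutoff n (rep_L2 f))) \<longlonglongrightarrow> L2_of (rep_L2 f)"
 proof (rule tendsto_L2_of[OF _ square_integrable_rep square_integrable_rep[of f]])
  show "square_integrable (cutoff n (rep_L2 f))" for n
   by (rule bounded_suppD(6)[OF bounded_supp_cutoff]) measurable
  show "AE x in lborel. (%n. cutoff n (rep_L2 f) x) \<longlonglongrightarrow> rep_L2 f x"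
  proof (rule AE_I2)
   fix x
   obtain N :: nat where N: "max \<bar>x\<bar> (norm (rep_L2 f x)) <= real N" using real_arch_simple by blast
   then have "\<forall>\<^sub>F n in sequentially. cutoff n (rep_L2 f) x = rep_L2 f x"
    by (intro eventually_mono[OF eventually_ge_at_top[of N]]) (auto simp: cutoff_def)
   then show "(%n. cutoff n (rep_L2 f) x) \<longlonglongrightarrow> rep_L2 f x" by (rule tendsto_eventually)
  qed
 qed (simp add: norm_cutoff_le)
 then show ?thesis by simp
qed

lemma Tplus_mono:
 assumes "\<And>y. F y <= F' y" "\<And>y. G y <= G' y" "\<And>y. H y <= H' y"
 shows "Tplus F G H x <= Tplus F' G' H' x"
 unfolding Tplus_def by (intro nn_integral_mono mult_mono assms) auto

text \<open>The window that starts at -pi/4 contains the singular time 0 in its interior. It is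
  split there, the negative half is reflected, and each half contributes a factor 2.\<close>

lemma cinner_T_from_bounded:
 assumes f: "bounded_supp B1 R1 f1" "bounded_supp B2 R2 f2" "bounded_supp B3 R3 f3" "bounded_supp B4 R4 f4"
  and a: "a = 0 \<or> a = - (pi / 4)"
 shows "ennreal (norm (cinner (T_from a (L2_of f1) (L2_of f2) (L2_of f3)) (L2_of f4)))
  <= 4 * (NN x. ennreal (norm (f4 x)) * Tplus (%y. ennreal (norm (f1 y))) (%y. ennreal (norm (f2 y))) (%y. ennreal (norm (f3 y))) x)"
  (is "_ <= 4 * ?D")
proof -
 define q where "q t = cinner (cubic (propagator t (L2_of f1)) (propagator t (L2_of f2)) (propagator t (L2_of f3))) (propagator t (L2_of f4))" for t
 have qm [measurable]: "q \<in> bmeas"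
  unfolding q_def[abs_def] by (intro measurable_cinner measurable_cubic) measurable
 have T: "cinner (T_from a (L2_of f1) (L2_of f2) (L2_of f3)) (L2_of f4) = (LBINT t. indicator {a..a+pi/2} t *\<^sub>R q t)"
  unfolding cinner_T_from q_def ..
 have "integrable lborel (%t. cinner (indicator {a..a+pi/2} t *\<^sub>R duhamel_integrand (L2_of f1) (L2_of f2) (L2_of f3) t) (L2_of f4))"
  by (rule integrable_bounded_linear[OF bounded_linear_cinner_left integrable_duhamel_integrand])
 then have int: "integrable lborel (%t. indicator {a..a+pi/2} t *\<^sub>R q t)"
  by (simp add: linear_scale[OF bounded_linear.linear[OF bounded_linear_cinner_left]] duhamel_integrand_def cinner_propagator_left q_def)
 from a show ?thesis
 proof
  assume a: "a = 0"
  have "ennreal (norm (LBINT t. indicator {0..pi/2} t *\<^sub>R q (1 * t))) <= 2 * ?D"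
   unfolding q_def by (rule quartic_half[OF f]) (use int in \<open>auto simp: a q_def\<close>)
  also have "... <= 4 * ?D" by (intro mult_right_mono) auto
  finally show ?thesis unfolding T by (simp add: a)
 next
  assume a: "a = - (pi / 4)"
  have sub: "integrable lborel (%t. indicator S t *\<^sub>R q t)" if "S \<in> sets borel" "S \<subseteq> {- (pi/4)..pi/4}" for S
  proof (rule Bochner_Integration.integrable_bound[OF int])
   show "AE t in lborel. norm (indicator S t *\<^sub>R q t) <= norm (indicator {a..a + pi / 2} t *\<^sub>R q t)"
    using that(2) by (intro AE_I2) (auto simp: indicator_def a)
  qed (use that(1) in measurable)
  have i1: "integrable lborel (%t. indicator {0..pi/4} t *\<^sub>R q (1 * t))"
   using sub[of "{0..pi/4}"] by simp
  have i2': "integrable lborel (%t. indicator {-(pi/4)..0} t *\<^sub>R q t)"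
   using sub[of "{-(pi/4)..0}"] by simp
  have e2: "indicator {-(pi/4)..0} (0 + - 1 * t) *\<^sub>R q (0 + - 1 * t) = indicator {0..pi/4} t *\<^sub>R q (- 1 * t)" for t
   by (auto simp: indicator_def)
  have i2: "integrable lborel (%t. indicator {0..pi/4} t *\<^sub>R q (- 1 * t))"
   using lborel_integrable_real_affine[OF i2', of "-1" 0] unfolding e2 by simp
  have "(LBINT t. indicator {a..a+pi/2} t *\<^sub>R q t)
   = (LBINT t. indicator {0..pi/4} t *\<^sub>R q (1 * t) + indicator {-(pi/4)..0} t *\<^sub>R q t)"
  proof (rule integral_cong_AE)
   show "AE t in lborel. indicator {a..a+pi/2} t *\<^sub>R q t = indicator {0..pi/4} t *\<^sub>R q (1 * t) + indicator {-(pi/4)..0} t *\<^sub>R q t"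
    using AE_lborel_singleton[of 0] by eventually_elim (auto simp: indicator_def a)
  qed measurable
  also have "... = (LBINT t. indicator {0..pi/4} t *\<^sub>R q (1 * t)) + (LBINT t. indicator {-(pi/4)..0} t *\<^sub>R q t)"
   by (rule Bochner_Integration.integral_add[OF i1 i2'])
  also have "(LBINT t. indicator {-(pi/4)..0} t *\<^sub>R q t) = (LBINT t. indicator {0..pi/4} t *\<^sub>R q (- 1 * t))"
   by (subst lborel_integral_real_affine[of "-1" _ 0]) (simp_all only: e2, simp_all)
  finally have "ennreal (norm (LBINT t. indicator {a..a+pi/2} t *\<^sub>R q t))
   <= ennreal (norm (LBINT t. indicator {0..pi/4} t *\<^sub>R q (1 * t)) + norm (LBINT t. indicator {0..pi/4} t *\<^sub>R q (- 1 * t)))"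
   by (intro ennreal_leI) (simp add: norm_triangle_ineq)
  also have "... = ennreal (norm (LBINT t. indicator {0..pi/4} t *\<^sub>R q (1 * t))) + ennreal (norm (LBINT t. indicator {0..pi/4} t *\<^sub>R q (- 1 * t)))"
   by (rule ennreal_plus) auto
  also have "... <= 2 * ?D + 2 * ?D"
   unfolding q_def by (intro add_mono quartic_half[OF f]) (use i1 i2 in \<open>auto simp: q_def\<close>)
  also have "... = 4 * ?D" by (simp flip: distrib_right)
  finally show ?thesis unfolding T .
 qed
qed

text \<open>The left side is continuous on L^2 and the right side monotone in the absolute values,
  so the bound passes from cutoffs to all functions.\<close>

lemma cinner_T_from_le:
 assumes a: "a = 0 \<or> a = - (pi / 4)"
 shows "ennreal (norm (cinner (T_from a f g h) w)) <= 4 * quartic_form f g h w"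
proof -
 define c where "c n f = L2_of (cutoff n (rep_L2 f))" for n f
 have cl: "(%n. c n f) \<longlonglongrightarrow> f" for f unfolding c_def by (rule cutoff_tendsto)
 have "(%n. T_from a (c n f) (c n g) (c n h)) \<longlonglongrightarrow> T_from a f g h"
 proof (rule LIM_zero_cancel, rule Lim_null_comparison)
  show "\<forall>\<^sub>F n in sequentially. norm (T_from a (c n f) (c n g) (c n h) - T_from a f g h)
   <= 8 * norm (c n f - f) * norm (c n g) * norm (c n h) + 8 * norm f * norm (c n g - g) * norm (c n h) + 8 * norm f * norm g * norm (c n h - h)"
   unfolding T_from_diff
   by (intro always_eventually allI order_trans[OF norm_triangle_ineq] add_mono norm_T_from)
  have "(%n. 8 * norm (c n f - f) * norm (c n g) * norm (c n h) + 8 * norm f * norm (c n g - g) * norm (c n h) + 8 * norm f * norm g * norm (c n h - h))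
   \<longlonglongrightarrow> 8 * norm (f - f) * norm g * norm h + 8 * norm f * norm (g - g) * norm h + 8 * norm f * norm g * norm (h - h)"
   by (intro tendsto_intros cl)
  then show "(%n. 8 * norm (c n f - f) * norm (c n g) * norm (c n h) + 8 * norm f * norm (c n g - g) * norm (c n h) + 8 * norm f * norm g * norm (c n h - h)) \<longlonglongrightarrow> 0"
   by simp
 qed
 then have "(%n. ennreal (norm (cinner (T_from a (c n f) (c n g) (c n h)) (c n w)))) \<longlonglongrightarrow> ennreal (norm (cinner (T_from a f g h) w))"
  by (intro tendsto_intros cl)
 then show ?thesis
 proof (rule LIMSEQ_le_const2, intro exI allI impI)
  fix n :: nat
  note b = bounded_supp_cutoff[OF rep_L2_measurable, of n]
  have "ennreal (norm (cinner (T_from a (c n f) (c n g) (c n h)) (c n w)))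
   <= 4 * (NN x. ennreal (norm (cutoff n (rep_L2 w) x)) * Tplus (%y. ennreal (norm (cutoff n (rep_L2 f) y))) (%y. ennreal (norm (cutoff n (rep_L2 g) y))) (%y. ennreal (norm (cutoff n (rep_L2 h) y))) x)"
   unfolding c_def by (rule cinner_T_from_bounded[OF b b b b a])
  also have "... <= 4 * quartic_form f g h w"
   unfolding quartic_form_def
   by (intro mult_left_mono nn_integral_mono mult_mono Tplus_mono ennreal_leI norm_cutoff_le) auto
  finally show "ennreal (norm (cinner (T_from a (c n f) (c n g) (c n h)) (c n w))) <= 4 * quartic_form f g h w" .
 qed
qed

text \<open>Duality. The test function is the phase of \<open>T_from a f g h\<close> on the part
  within [-n, n] of the set where the claim fails. On that set the integrated inequality is opposed
  to the pointwise one while the integrals are finite, so the set is null.\<close>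

lemma T_from_pointwise:
 assumes a: "a = 0 \<or> a = - (pi / 4)"
 shows "AE x in lborel. ennreal (norm (rep_L2 (T_from a f g h) x)) <=
  4 * Tplus (%y. ennreal (norm (rep_L2 f y))) (%y. ennreal (norm (rep_L2 g y))) (%y. ennreal (norm (rep_L2 h y))) x"
proof -
 define v where "v = rep_L2 (T_from a f g h)"
 define S where "S = Tplus (%y. ennreal (norm (rep_L2 f y))) (%y. ennreal (norm (rep_L2 g y))) (%y. ennreal (norm (rep_L2 h y)))"
 have [measurable]: "v \<in> bmeas" "S \<in> bmeas"
  unfolding v_def S_def by measurable
 have [measurable]: "(sgn :: complex => complex) \<in> bmeas"
  unfolding sgn_div_norm[abs_def] by measurable
 have "AE x in lborel. \<not> (\<bar>x\<bar> <= real n \<and> 4 * S x < ennreal (norm (v x)))" for n :: nat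
 proof -
  define A where "A = {x. \<bar>x\<bar> <= real n \<and> 4 * S x < ennreal (norm (v x))}"
  have [measurable]: "A \<in> sets borel" unfolding A_def by measurable
  have fin: "emeasure lborel A < \<infinity>"
  proof -
   have "A \<subseteq> {- real n..real n}" by (auto simp: A_def)
   from emeasure_mono[OF this, of lborel] show ?thesis
    by (auto simp: emeasure_lborel_Icc_eq intro: order.strict_trans1)
  qed
  define w where "w x = indicator A x * sgn (v x)" for x
  have [measurable]: "w \<in> bmeas" unfolding w_def[abs_def] by measurable
  have nw: "norm (w x) <= indicator A x" for x by (auto simp: w_def norm_mult norm_sgn indicator_def)
  have sqw: "square_integrable w"
  proof (rule square_integrable_bound)
   show "integrable lborel (indicator A :: real => real)" using fin by simp
   show "AE x in lborel. (norm (w x))\<^sup>2 <= indicator A x"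
    by (auto simp: w_def norm_mult norm_sgn indicator_def)
  qed measurable
  have z: "z * cnj (sgn z) = cplx (norm z)" for z :: complex
   by (cases "z = 0") (simp_all add: sgn_eq complex_norm_square[symmetric] power2_eq_square)
  have vw: "v x * cnj (w x) = cplx (indicator A x * norm (v x))" for x
   by (simp add: w_def z indicator_def)
  have int: "integrable lborel (%x. indicator A x * norm (v x))"
   using square_integrable_integrable_mult[OF square_integrable_rep[of "T_from a f g h"] sqw] unfolding v_def[symmetric] vw
   by (simp only: complex_of_real_integrable_eq)
  have "cinner (T_from a f g h) (L2_of w) = cplx (LBINT x. indicator A x * norm (v x))"
   using cinner_L2_of[OF square_integrable_rep[of "T_from a f g h"] sqw]
   unfolding v_def[symmetric] vw integral_complex_of_real unfolding v_def L2_of_rep .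
  then have "ennreal (norm (cinner (T_from a f g h) (L2_of w))) = ennreal (LBINT x. indicator A x * norm (v x))"
   by (simp add: Bochner_Integration.integral_nonneg)
  also have "... = (NN x. ennreal (indicator A x * norm (v x)))"
   by (rule nn_integral_eq_integral[symmetric, OF int]) auto
  finally have 1: "(NN x. ennreal (indicator A x * norm (v x))) <= 4 * quartic_form f g h (L2_of w)"
   using cinner_T_from_le[OF a, of f g h "L2_of w"] by simp
  have "quartic_form f g h (L2_of w) = (NN x. ennreal (norm (rep_L2 (L2_of w) x)) * S x)"
   by (simp add: quartic_form_def S_def)
  also have "... <= (NN x. indicator A x * S x)"
  proof (rule nn_integral_mono_AE)
   show "AE x in lborel. ennreal (norm (rep_L2 (L2_of w) x)) * S x <= indicator A x * S x"
    using rep_L2_of[OF sqw]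
   proof eventually_elim
    case (elim x)
    have "ennreal (norm (w x)) <= ennreal (indicator A x)" by (rule ennreal_leI[OF nw])
    then show ?case using elim by (auto intro!: mult_right_mono simp: ennreal_indicator)
   qed
  qed
  finally have "4 * quartic_form f g h (L2_of w) <= 4 * (NN x. indicator A x * S x)"
   by (intro mult_left_mono) auto
  also have "... = (NN x. indicator A x * (4 * S x))"
   by (subst nn_integral_cmult[symmetric]) (auto simp: mult_ac)
  finally have 2: "(NN x. ennreal (indicator A x * norm (v x))) <= (NN x. indicator A x * (4 * S x))"
   using 1 by simp
  have le: "indicator A x * (4 * S x) <= ennreal (indicator A x * norm (v x))" for x
   by (auto simp: indicator_def A_def)
  have finv: "(NN x. ennreal (indicator A x * norm (v x))) < \<infinity>"
   by (subst nn_integral_eq_integral[OF int]) auto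
  have "(NN x. indicator A x * (4 * S x)) <= (NN x. ennreal (indicator A x * norm (v x)))"
   by (intro nn_integral_mono le)
  then have "(NN x. ennreal (indicator A x * norm (v x)) - indicator A x * (4 * S x)) = 0"
   using 2 finv by (subst nn_integral_diff) (auto intro: le simp: less_top[symmetric])
  then have "AE x in lborel. ennreal (indicator A x * norm (v x)) - indicator A x * (4 * S x) = 0"
   by (subst (asm) nn_integral_0_iff_AE) auto
  then show ?thesis
  proof eventually_elim
   case (elim x)
   show ?case
   proof
    assume "\<bar>x\<bar> <= real n \<and> 4 * S x < ennreal (norm (v x))"
    then have "x \<in> A" "4 * S x < ennreal (norm (v x))" by (auto simp: A_def)
    then show False using elim by (simp add: diff_eq_0_iff_ennreal)
   qed
  qed
 qed
 then have "AE x in lborel. \<forall>n::nat. \<not> (\<bar>x\<bar> <= real n \<and> 4 * S x < ennreal (norm (v x)))"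
  unfolding AE_all_countable by (intro allI)
 then show ?thesis
 proof eventually_elim
  case (elim x)
  obtain n :: nat where "\<bar>x\<bar> <= real n" using real_arch_simple by blast
  then show ?case using elim by (auto simp: v_def S_def not_less)
 qed
qed

section \<open>Bounds for the positive operator\<close>

lemma kern_minus: "kern (- u) = kern u"
 by (simp add: kern_def)

lemma kern_commute: "kern (u - v) = kern (v - u)"
 using kern_minus[of "u - v"] by simp

lemma nn_integral_shift:
 fixes F :: "real => ennreal"
 assumes [measurable]: "F \<in> bmeas"
 shows "(NN x. F (x + c)) = (NN x. F x)"
 using nn_integral_real_affine[of F 1 c] by (simp add: add.commute)

lemma nn_integral_reflect:
 fixes F :: "real => ennreal"
 assumes [measurable]: "F \<in> bmeas"
 shows "(NN x. F (c - x)) = (NN x. F x)"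
 using nn_integral_real_affine[of F "-1" c] by simp

text \<open>The reflection y -> x + w - y exchanges both the two kernels and the first two
  functions.\<close>

lemma Tplus_commute:
 assumes [measurable]: "F \<in> bmeas" "G \<in> bmeas" "H \<in> bmeas"
 shows "Tplus F G H x = Tplus G F H x"
 unfolding Tplus_def
proof (rule nn_integral_cong)
 fix w
 have "(NN y. kern (y - x) * kern (w - y) * (F y * G (x + w - y) * H w))
  = (NN y. kern ((x + w - y) - x) * kern (w - (x + w - y)) * (F (x + w - y) * G (x + w - (x + w - y)) * H w))"
  by (rule nn_integral_reflect[symmetric]) measurable
 also have "... = (NN y. kern (y - x) * kern (w - y) * (G y * F (x + w - y) * H w))"
  using kern_commute[of _ x] by (intro nn_integral_cong) (simp add: algebra_simps mult_ac)
 finally show "(NN y. kern (y - x) * kern (w - y) * (F y * G (x + w - y) * H w))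
  = (NN y. kern (y - x) * kern (w - y) * (G y * F (x + w - y) * H w))" .
qed

text \<open>The largest value of the potential of \<open>F\<close> with kernel |u|^(-1/2): a factor
  of finite Kato norm can be integrated out against one of the two kernels.\<close>

definition Kato :: "(real => ennreal) => ennreal" where
 "Kato F = (SUP x. (NN y. kern (y - x) * F y))"

lemma Kato_le: "(NN y. kern (y - x) * F y) <= Kato F" "(NN y. kern (x - y) * F y) <= Kato F"
proof -
 show 1: "(NN y. kern (y - x) * F y) <= Kato F" unfolding Kato_def by (rule SUP_upper) simp
 then show "(NN y. kern (x - y) * F y) <= Kato F" by (simp add: kern_commute[of x])
qed

lemma Kato_shift_le:
 assumes [measurable]: "F \<in> bmeas"
 shows "(NN y. kern (y - x) * F (y + c)) <= Kato F" "(NN y. kern (x - y) * F (c - y)) <= Kato F"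
proof -
 have "(NN y. kern (y - x) * F (y + c)) = (NN y. kern ((y + c) - (x + c)) * F (y + c))" by simp
 also have "... = (NN y. kern (y - (x + c)) * F y)" by (rule nn_integral_shift) measurable
 finally show "(NN y. kern (y - x) * F (y + c)) <= Kato F" using Kato_le(1)[of "x + c" F] by simp
 have "(NN y. kern (x - y) * F (c - y)) = (NN y. kern ((c - y) - (c - x)) * F (c - y))" by simp
 also have "... = (NN y. kern (y - (c - x)) * F y)" by (rule nn_integral_reflect) measurable
 finally show "(NN y. kern (x - y) * F (c - y)) <= Kato F" using Kato_le(1)[of "c - x" F] by simp
qed

text \<open>The constant in the second slot decouples the variables: for fixed y the w-integral is
  at most \<open>Kato H\<close>, and then the y-integral at most \<open>Kato F\<close>.\<close>

lemma Kato_Tplus2: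
 assumes [measurable]: "F \<in> bmeas" "H \<in> bmeas"
 shows "Tplus F (%_. 1) H x <= Kato F * Kato H"
proof -
 have "Tplus F (%_. 1) H x = (NN y. NN w. kern (y - x) * kern (w - y) * (F y * 1 * H w))"
  unfolding Tplus_def by (rule lborel_pair.Fubini') measurable
 also have "... = (NN y. (kern (y - x) * F y) * (NN w. kern (w - y) * H w))"
  by (subst nn_integral_cmult[symmetric]) (auto simp: mult_ac)
 also have "... <= (NN y. (kern (y - x) * F y) * Kato H)"
  by (intro nn_integral_mono mult_left_mono Kato_le) auto
 also have "... = (NN y. kern (y - x) * F y) * Kato H"
  by (rule nn_integral_multc) measurable
 also have "... <= Kato F * Kato H" by (intro mult_right_mono Kato_le) auto
 finally show ?thesis .
qed

lemma Kato_Tplus3: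
 assumes [measurable]: "F \<in> bmeas" "G \<in> bmeas"
 shows "Tplus F G (%_. 1) x <= Kato F * Kato G"
proof -
 have "Tplus F G (%_. 1) x = (NN y. NN w. kern (y - x) * kern (w - y) * (F y * G (x + w - y) * 1))"
  unfolding Tplus_def by (rule lborel_pair.Fubini') measurable
 also have "... = (NN y. (kern (y - x) * F y) * (NN w. kern (w - y) * G (w + (x - y))))"
  by (subst nn_integral_cmult[symmetric]) (auto simp: mult_ac algebra_simps)
 also have "... <= (NN y. (kern (y - x) * F y) * Kato G)"
  by (intro nn_integral_mono mult_left_mono Kato_shift_le) auto
 also have "... = (NN y. kern (y - x) * F y) * Kato G"
  by (rule nn_integral_multc) measurable
 also have "... <= Kato F * Kato G" by (intro mult_right_mono Kato_le) auto
 finally show ?thesis .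
qed

text \<open>With v = x + w - y in place of x the kernel at y - x becomes the kernel at w - v. Then
  \<open>F\<close> is integrated out in y, \<open>H\<close> in w, and the integral of
  \<open>G\<close> in v remains.\<close>

lemma Tplus_integral2:
 assumes [measurable]: "F \<in> bmeas" "G \<in> bmeas" "H \<in> bmeas"
 shows "(NN x. Tplus F G H x) <= Kato F * Kato H * (NN x. G x)"
proof -
 have "(NN x. Tplus F G H x)
   = (NN w. NN x. NN y. kern (y - x) * kern (w - y) * (F y * G (x + w - y) * H w))"
  unfolding Tplus_def by (rule lborel_pair.Fubini') measurable
 also have "... = (NN w. NN y. NN x. kern (y - x) * kern (w - y) * (F y * G (x + w - y) * H w))"
  by (intro nn_integral_cong lborel_pair.Fubini') measurable
 also have "... = (NN w. NN y. NN v. kern (w - v) * kern (w - y) * (F y * G v * H w))"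
 proof (rule nn_integral_cong, rule nn_integral_cong)
  fix w y
  have "(NN x. kern (y - x) * kern (w - y) * (F y * G (x + w - y) * H w))
   = (NN x. kern (w - (x + (w - y))) * kern (w - y) * (F y * G (x + (w - y)) * H w))"
   by (intro nn_integral_cong) (simp add: algebra_simps)
  also have "... = (NN v. kern (w - v) * kern (w - y) * (F y * G v * H w))"
   by (rule nn_integral_shift) measurable
  finally show "(NN x. kern (y - x) * kern (w - y) * (F y * G (x + w - y) * H w))
   = (NN v. kern (w - v) * kern (w - y) * (F y * G v * H w))" .
 qed
 also have "... = (NN w. NN v. NN y. kern (w - v) * kern (w - y) * (F y * G v * H w))"
  by (intro nn_integral_cong lborel_pair.Fubini') measurable
 also have "... = (NN v. NN w. NN y. kern (w - v) * kern (w - y) * (F y * G v * H w))"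
  by (rule lborel_pair.Fubini') measurable
 also have "... <= (NN v. G v * (Kato F * Kato H))"
 proof (rule nn_integral_mono)
  fix v
  have "(NN w. NN y. kern (w - v) * kern (w - y) * (F y * G v * H w))
    = (NN w. (kern (w - v) * H w * G v) * (NN y. kern (w - y) * F y))"
   by (subst nn_integral_cmult[symmetric]) (auto simp: mult_ac)
  also have "... <= (NN w. (kern (w - v) * H w) * (G v * Kato F))"
   by (intro nn_integral_mono) (auto simp: mult.assoc intro!: mult_left_mono Kato_le)
  also have "... = (NN w. kern (w - v) * H w) * (G v * Kato F)"
   by (rule nn_integral_multc) measurable
  also have "... <= Kato H * (G v * Kato F)" by (intro mult_right_mono Kato_le) auto
  finally show "(NN w. NN y. kern (w - v) * kern (w - y) * (F y * G v * H w)) <= G v * (Kato F * Kato H)"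
   by (simp add: mult_ac)
 qed
 also have "... = (NN v. G v) * (Kato F * Kato H)"
  by (rule nn_integral_multc) measurable
 finally show ?thesis by (simp add: mult_ac)
qed

lemma Tplus_integral3:
 assumes [measurable]: "F \<in> bmeas" "G \<in> bmeas" "H \<in> bmeas"
 shows "(NN x. Tplus F G H x) <= Kato F * Kato G * (NN x. H x)"
proof -
 have "(NN x. Tplus F G H x)
   = (NN w. NN x. NN y. kern (y - x) * kern (w - y) * (F y * G (x + w - y) * H w))"
  unfolding Tplus_def by (rule lborel_pair.Fubini') measurable
 also have "... = (NN w. NN y. NN x. kern (y - x) * kern (w - y) * (F y * G (x + w - y) * H w))"
  by (intro nn_integral_cong lborel_pair.Fubini') measurable
 also have "... <= (NN w. H w * (Kato F * Kato G))"
 proof (rule nn_integral_mono)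
  fix w
  have "(NN y. NN x. kern (y - x) * kern (w - y) * (F y * G (x + w - y) * H w))
    = (NN y. (kern (w - y) * F y * H w) * (NN x. kern (x - y) * G (x + (w - y))))"
   by (subst nn_integral_cmult[symmetric]) (auto simp: mult_ac algebra_simps kern_commute[of _ "_ :: real"] intro!: nn_integral_cong)
  also have "... <= (NN y. (kern (w - y) * F y) * (H w * Kato G))"
   by (intro nn_integral_mono) (auto simp: mult.assoc intro!: mult_left_mono Kato_shift_le)
  also have "... = (NN y. kern (w - y) * F y) * (H w * Kato G)"
   by (rule nn_integral_multc) measurable
  also have "... <= Kato F * (H w * Kato G)" by (intro mult_right_mono Kato_le) auto
  finally show "(NN y. NN x. kern (y - x) * kern (w - y) * (F y * G (x + w - y) * H w)) <= H w * (Kato F * Kato G)"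
   by (simp add: mult_ac)
 qed
 also have "... = (NN w. H w) * (Kato F * Kato G)"
  by (rule nn_integral_multc) measurable
 finally show ?thesis by (simp add: mult_ac)
qed

text \<open>Above the level l one has g^p \<ge> l^(p-1) g. The level is free and gets optimised in
  \<open>jensen_crude\<close>.\<close>

lemma powr_split_le:
 fixes g l p :: real
 assumes "0 <= g" "0 < l" "1 <= p"
 shows "g <= l powr (1 - p) * g powr p + l"
proof (cases "g <= l")
 case True
 then show ?thesis using assms by (simp add: add_increasing)
next
 case False
 have "g powr (1 - p) <= l powr (1 - p)" using False assms by (intro powr_mono2') auto
 then have "g powr p * g powr (1 - p) <= g powr p * l powr (1 - p)" by (rule mult_left_mono) simp
 moreover have "g powr p * g powr (1 - p) = g" using False assms by (simp flip: powr_add)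
 ultimately show ?thesis using assms by (simp add: mult.commute)
qed

text \<open>A crude form of Jensen's inequality; \<open>I\<close> stands for \<open>Tplus\<close> as a function of one argument.\<close>

lemma jensen_crude:
 fixes \<I> :: "(real => ennreal) => ennreal" and g :: "real => real"
 assumes mono: "\<And>G G'. G \<in> bmeas ==> G' \<in> bmeas ==> (\<And>y. G y <= G' y) ==> \<I> G <= \<I> G'"
  and add: "\<And>c d G. G \<in> bmeas ==> \<I> (%y. c * G y + d) = c * \<I> G + d * \<I> (%_. 1)"
  and one: "\<I> (%_. 1) <= ennreal A" and A: "0 < A" and p: "1 <= p"
  and [measurable]: "g \<in> bmeas" and g: "\<And>y. 0 <= g y"
  and J: "\<I> (%y. ennreal (g y powr p)) <= ennreal J" "0 < J"
 shows "\<I> (%y. ennreal (g y)) <= ennreal (2 * A powr (1 - 1 / p) * J powr (1 / p))"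
proof -
 \<comment> \<open>This level makes the two terms l^(1-p) J and l A equal.\<close>
 define l where "l = (J / A) powr (1 / p)"
 have l: "0 < l" using A J by (simp add: l_def)
 have lp: "l powr p = J / A" using A J p by (simp add: l_def powr_powr)
 have "\<I> (%y. ennreal (g y)) <= \<I> (%y. ennreal (l powr (1 - p)) * ennreal (g y powr p) + ennreal l)"
 proof (rule mono)
  fix y
  have "ennreal (g y) <= ennreal (l powr (1 - p) * g y powr p + l)"
   by (intro ennreal_leI powr_split_le g l p)
  also have "... = ennreal (l powr (1 - p)) * ennreal (g y powr p) + ennreal l"
   using l by (simp add: ennreal_plus ennreal_mult)
  finally show "ennreal (g y) <= ennreal (l powr (1 - p)) * ennreal (g y powr p) + ennreal l" .
 qed measurable
 also have "... = ennreal (l powr (1 - p)) * \<I> (%y. ennreal (g y powr p)) + ennreal l * \<I> (%_. 1)"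
  by (rule add) measurable
 also have "... <= ennreal (l powr (1 - p)) * ennreal J + ennreal l * ennreal A"
  by (intro add_mono mult_left_mono J one) auto
 also have "... = ennreal (l powr (1 - p) * J + l * A)"
  using l A J by (simp add: ennreal_plus ennreal_mult)
 also have "l powr (1 - p) * J + l * A = 2 * (A * l)"
 proof -
  have "l powr (1 - p) = l / (J / A)" using l lp by (simp add: powr_diff)
  then show ?thesis using A J by (simp add: field_simps)
 qed
 also have "A * l = A powr (1 - 1 / p) * J powr (1 / p)"
  using A J by (simp add: l_def powr_divide powr_diff)
 finally show ?thesis by (simp add: mult.assoc)
qed

lemma Tplus_affine2:
 assumes [measurable]: "F \<in> bmeas" "G \<in> bmeas" "H \<in> bmeas"
 shows "Tplus F (%y. c * G y + d) H x = c * Tplus F G H x + d * Tplus F (%_. 1) H x"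
proof -
 have "Tplus F (%y. c * G y + d) H x = (NN w. NN y. c * (kern (y - x) * kern (w - y) * (F y * G (x + w - y) * H w))
   + d * (kern (y - x) * kern (w - y) * (F y * 1 * H w)))"
  unfolding Tplus_def by (intro nn_integral_cong) (simp add: algebra_simps)
 also have "... = c * Tplus F G H x + d * Tplus F (%_. 1) H x"
  unfolding Tplus_def by (simp add: nn_integral_add nn_integral_cmult)
 finally show ?thesis .
qed

lemma Tplus_affine3:
 assumes [measurable]: "F \<in> bmeas" "G \<in> bmeas" "H \<in> bmeas"
 shows "Tplus F G (%y. c * H y + d) x = c * Tplus F G H x + d * Tplus F G (%_. 1) x"
proof -
 have "Tplus F G (%y. c * H y + d) x = (NN w. NN y. c * (kern (y - x) * kern (w - y) * (F y * G (x + w - y) * H w))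
   + d * (kern (y - x) * kern (w - y) * (F y * G (x + w - y) * 1)))"
  unfolding Tplus_def by (intro nn_integral_cong) (simp add: algebra_simps)
 also have "... = c * Tplus F G H x + d * Tplus F G (%_. 1) x"
  unfolding Tplus_def by (simp add: nn_integral_add nn_integral_cmult)
 finally show ?thesis .
qed

text \<open>Schur's test, with the given function in the second or third slot.\<close>

lemma schur_Tplus:
 fixes g :: "real => real"
 assumes [measurable]: "F \<in> bmeas" "H \<in> bmeas" "g \<in> bmeas"
  and g: "\<And>y. 0 <= g y" and p: "1 <= p" and A: "Kato F * Kato H <= ennreal A" "0 < A"
  and P: "(NN x. ennreal (g x powr p)) <= ennreal N" "0 <= N"
  and \<I>: "\<I> = (%G. Tplus F G H) \<or> \<I> = (%G. Tplus F H G)"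
 shows "\<exists>u. u \<in> bmeas \<and> (\<forall>x. 0 <= u x) \<and> (AE x in lborel. \<I> (%y. ennreal (g y)) x <= ennreal (u x)) \<and>
   (NN x. ennreal (u x powr p)) <= ennreal ((2 * A) powr p * N)"
proof -
 define J where "J = \<I> (%y. ennreal (g y powr p))"
 have Jm [measurable]: "J \<in> bmeas" using \<I> by (auto simp: J_def)
 have intJ: "(NN x. J x) <= ennreal (A * N)"
 proof -
  have "(NN x. J x) <= Kato F * Kato H * (NN x. ennreal (g x powr p))"
   using \<I> unfolding J_def by (auto intro!: Tplus_integral2 Tplus_integral3)
  also have "... <= ennreal A * ennreal N" by (intro mult_mono A P) auto
  finally show ?thesis using A P by (simp add: ennreal_mult)
 qed
 then have "(NN x. J x) \<noteq> \<infinity>" by (auto simp: top_unique)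
 then have fin: "AE x in lborel. J x \<noteq> \<infinity>" by (intro nn_integral_PInf_AE) measurable
 have one: "\<I> (%_. 1) x <= ennreal A" for x
  using \<I> Kato_Tplus2[of F H x] Kato_Tplus3[of F H x] A(1) by (auto intro: order_trans)
 define u where "u x = 2 * A powr (1 - 1 / p) * (enn2real (J x)) powr (1 / p)" for x
 have um: "u \<in> bmeas" unfolding u_def[abs_def] by measurable
 have u0: "0 <= u x" for x by (simp add: u_def)
 have le: "\<I> (%y. ennreal (g y)) x <= ennreal (u x)" if "J x \<noteq> \<infinity>" for x
 proof -
  define j where "j = enn2real (J x)"
  have j: "J x = ennreal j" "0 <= j" using that by (auto simp: j_def less_top)
  \<comment> \<open>\<open>jensen_crude\<close> asks for a positive bound, so \<open>j + e\<close>
    is used and e is sent to 0 afterwards.\<close>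
  have bd: "\<I> (%y. ennreal (g y)) x <= ennreal (2 * A powr (1 - 1 / p) * (j + e) powr (1 / p))" if e: "0 < e" for e
  proof (rule jensen_crude[where \<I> = "%G. \<I> G x"])
   show "\<I> G x <= \<I> G' x" if "\<And>y. G y <= G' y" for G G' using \<I> that by (auto intro!: Tplus_mono)
   show "\<I> (%y. c * G y + d) x = c * \<I> G x + d * \<I> (%_. 1) x" if "G \<in> bmeas" for c d G
    using \<I> that by (auto intro!: Tplus_affine2 Tplus_affine3)
   show "\<I> (%y. ennreal (g y powr p)) x <= ennreal (j + e)"
    using j e by (simp add: J_def[symmetric] ennreal_leI)
  qed (use one A p g j e in auto)
  have lim: "((%e. ennreal (2 * A powr (1 - 1 / p) * (j + e) powr (1 / p))) \<longlongrightarrow> ennreal (2 * A powr (1 - 1 / p) * (j + 0) powr (1 / p))) (at_right 0)"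
  proof -
   have "eventually (%e. 0 <= j + e) (at_right 0)"
    by (rule eventually_at_rightI[of 0 1]) (use j in auto)
   then show ?thesis
    using p by (intro tendsto_ennrealI tendsto_mult tendsto_const tendsto_powr' tendsto_add tendsto_ident_at) auto
  qed
  have "\<forall>\<^sub>F e in at_right 0. \<I> (%y. ennreal (g y)) x <= ennreal (2 * A powr (1 - 1 / p) * (j + e) powr (1 / p))"
   by (rule eventually_at_rightI[of 0 1]) (use bd in auto)
  then have "\<I> (%y. ennreal (g y)) x <= ennreal (2 * A powr (1 - 1 / p) * (j + 0) powr (1 / p))"
   by (rule tendsto_lowerbound[OF lim]) simp
  then show ?thesis by (simp add: u_def j_def)
 qed
 have "(NN x. ennreal (u x powr p)) = (NN x. ennreal (2 powr p * A powr (p - 1)) * ennreal (enn2real (J x)))"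
 proof (rule nn_integral_cong)
  fix x
  have "u x powr p = 2 powr p * A powr (p - 1) * enn2real (J x)"
   using p A by (simp add: u_def powr_mult powr_powr algebra_simps)
  then show "ennreal (u x powr p) = ennreal (2 powr p * A powr (p - 1)) * ennreal (enn2real (J x))"
   by (simp add: ennreal_mult)
 qed
 also have "... <= ennreal (2 powr p * A powr (p - 1)) * (NN x. J x)"
  by (subst nn_integral_cmult[symmetric]) (auto intro!: nn_integral_mono mult_left_mono simp: enn2real_le_iff ennreal_enn2real_if)
 also have "... <= ennreal (2 powr p * A powr (p - 1)) * ennreal (A * N)"
  by (intro mult_left_mono intJ) auto
 also have "... = ennreal (2 powr p * A powr (p - 1) * (A * N))"
  using A P by (simp add: ennreal_mult)
 also have "2 powr p * A powr (p - 1) * (A * N) = (2 * A) powr p * N"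
  using A by (simp add: powr_mult powr_diff)
 finally have "(NN x. ennreal (u x powr p)) <= ennreal ((2 * A) powr p * N)" .
 moreover have "AE x in lborel. \<I> (%y. ennreal (g y)) x <= ennreal (u x)"
  using fin by eventually_elim (rule le)
 ultimately show ?thesis using um u0 by blast
qed

section \<open>The weighted Cauchy-Schwarz inequality for three square-integrable factors\<close>

definition Psi :: "real => real => real" where
 "Psi a b = \<bar>a\<bar> powr (- (1/2)) * \<bar>b\<bar> powr (- (1/2)) * \<bar>a + b\<bar> powr (1/2) * \<bar>a - b\<bar> powr (- (1/2))"

lemma Psi_nonneg: "0 <= Psi a b" by (simp add: Psi_def)

lemma measurable_Psi [measurable (raw)]:
 assumes [measurable]: "f \<in> borel_measurable M" "g \<in> borel_measurable M"
 shows "(%x. Psi (f x) (g x)) \<in> borel_measurable M"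
 unfolding Psi_def by measurable

text \<open>\<open>Psi a b\<close> is |a b|^(-1/2) times the weight (|a + b| / |a - b|)^(1/2) and is
  homogeneous of degree -1. Its integral along a line a + b = S is therefore the same for all S
  \<noteq> 0, and S = 1 is taken.\<close>

definition Psi_const :: ennreal where
 "Psi_const = (NN a. ennreal (Psi a (1 - a)))"

text \<open>The integrand has singularities of order 1/2 at 0, 1 and 1/2, and it decays with order
  3/2 thanks to the weight; |a|^(-1/2) |1 - a|^(-1/2) alone decays only like 1 / |a|. Where one of
  \<open>d0\<close>, \<open>d1\<close>, \<open>dh\<close> is below 1/4, the other two contribute at
  most 2 each; elsewhere all three are at least \<open>bracket a / 9\<close>, whence 27 =
  3^3.\<close>

lemma Psi_const_finite: "Psi_const < \<infinity>"
proof -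
 define k where "k u = indicator {-1..1} u * \<bar>u\<bar> powr (- (1/2))" for u :: real
 have k0: "0 <= k u" for u by (simp add: k_def)
 have [measurable]: "k \<in> bmeas" unfolding k_def[abs_def] by measurable
 have ik: "(NN u. ennreal (k u)) <= ennreal 4"
  using nn_integral_abs_powr_unit[of "1/2"] by (simp add: k_def)
 have two: "u powr (- (1/2)) <= 2" if "1 / 4 <= u" for u :: real
 proof -
  have "u powr (- (1/2)) <= (1/4) powr (- (1/2))" using that by (intro powr_mono2') auto
  also have "... = 2" by (simp add: powr_minus powr_half_sqrt real_sqrt_divide)
  finally show ?thesis .
 qed
 have pt: "Psi a (1 - a) <= 4 * k a + 4 * k (1 - a) + 4 * k (- 1 + 2 * a) + 27 * bracket a powr (- (3/2))" for a
 proof -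
  define d0 d1 dh where "d0 = \<bar>a\<bar>" and "d1 = \<bar>1 - a\<bar>" and "dh = \<bar>a - (1 - a)\<bar>"
  have P: "Psi a (1 - a) = d0 powr (- (1/2)) * d1 powr (- (1/2)) * dh powr (- (1/2))"
   by (simp add: Psi_def d0_def d1_def dh_def)
  have b0: "0 <= bracket a powr (- (3/2))" by simp
  consider "d0 < 1/4" | "d1 < 1/4" | "dh < 1/4" | "1/4 <= d0" "1/4 <= d1" "1/4 <= dh" by linarith
  then show ?thesis
  proof cases
   case 1
   then have g: "1/4 <= d1" "1/4 <= dh" "k a = d0 powr (- (1/2))" by (auto simp: d0_def d1_def dh_def k_def abs_if split: if_splits)
   have "Psi a (1 - a) <= d0 powr (- (1/2)) * 2 * 2"
    unfolding P by (intro mult_mono two g) auto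
   then have "Psi a (1 - a) <= 4 * k a" unfolding g(3) by simp
   then show ?thesis using k0[of "1 - a"] k0[of "- 1 + 2 * a"] b0 by linarith
  next
   case 2
   then have g: "1/4 <= d0" "1/4 <= dh" "k (1 - a) = d1 powr (- (1/2))" by (auto simp: d0_def d1_def dh_def k_def abs_if split: if_splits)
   have "Psi a (1 - a) <= 2 * d1 powr (- (1/2)) * 2"
    unfolding P by (intro mult_mono two g) auto
   then have "Psi a (1 - a) <= 4 * k (1 - a)" unfolding g(3) by simp
   then show ?thesis using k0[of a] k0[of "- 1 + 2 * a"] b0 by linarith
  next
   case 3
   have e: "a - (1 - a) = - 1 + 2 * a" by simp
   have g: "1/4 <= d0" "1/4 <= d1" "k (- 1 + 2 * a) = dh powr (- (1/2))"
    using 3 unfolding dh_def e by (auto simp: d0_def d1_def k_def abs_if split: if_splits)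
   have "Psi a (1 - a) <= 2 * 2 * dh powr (- (1/2))"
    unfolding P by (intro mult_mono two g) auto
   then have "Psi a (1 - a) <= 4 * k (- 1 + 2 * a)" unfolding g(3) by simp
   then show ?thesis using k0[of a] k0[of "1 - a"] b0 by linarith
  next
   case 4
   have "bracket a <= 1 + \<bar>a\<bar>"
    unfolding bracket_def by (intro real_le_lsqrt) (auto simp: power2_sum)
   then have g: "bracket a / 9 <= d0" "bracket a / 9 <= d1" "bracket a / 9 <= dh"
    using 4 by (auto simp: d0_def d1_def dh_def abs_if split: if_splits)
   have three: "d powr (- (1/2)) <= 3 * bracket a powr (- (1/2))" if "bracket a / 9 <= d" for d
   proof -
    have "d powr (- (1/2)) <= (bracket a / 9) powr (- (1/2))"
     using that bracket_pos[of a] by (intro powr_mono2') auto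
    also have "... = 3 * bracket a powr (- (1/2))"
     using bracket_pos[of a] by (simp add: powr_divide powr_minus powr_half_sqrt) (simp only: divide_inverse)
    finally show ?thesis .
   qed
   have "Psi a (1 - a) <= (3 * bracket a powr (- (1/2))) * (3 * bracket a powr (- (1/2))) * (3 * bracket a powr (- (1/2)))"
    unfolding P by (intro mult_mono three g) auto
   also have "... = 27 * (bracket a powr (- (1/2)) * bracket a powr (- (1/2)) * bracket a powr (- (1/2)))" by simp
   also have "bracket a powr (- (1/2)) * bracket a powr (- (1/2)) * bracket a powr (- (1/2)) = bracket a powr (- (3/2))"
    unfolding powr_add[symmetric] by (rule arg_cong2[where f = "(powr)"]) simp_all
   finally show ?thesis using k0[of a] k0[of "1 - a"] k0[of "- 1 + 2 * a"] by linarith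
  qed
 qed
 have "Psi_const <= (NN a. 4 * ennreal (k a) + 4 * ennreal (k (1 - a)) + 4 * ennreal (k (- 1 + 2 * a)) + 27 * ennreal (bracket a powr (- (3/2))))"
  unfolding Psi_const_def
 proof (rule nn_integral_mono)
  fix a
  have "ennreal (Psi a (1 - a)) <= ennreal (4 * k a + 4 * k (1 - a) + 4 * k (- 1 + 2 * a) + 27 * bracket a powr (- (3/2)))"
   by (rule ennreal_leI[OF pt])
  also have "... = 4 * ennreal (k a) + 4 * ennreal (k (1 - a)) + 4 * ennreal (k (- 1 + 2 * a)) + 27 * ennreal (bracket a powr (- (3/2)))"
   using k0 by (simp add: ennreal_plus ennreal_mult)
  finally show "ennreal (Psi a (1 - a)) <= 4 * ennreal (k a) + 4 * ennreal (k (1 - a)) + 4 * ennreal (k (- 1 + 2 * a)) + 27 * ennreal (bracket a powr (- (3/2)))" .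
 qed
 also have "... = 4 * (NN a. ennreal (k a)) + 4 * (NN a. ennreal (k (1 - a)))
   + 4 * (NN a. ennreal (k (- 1 + 2 * a))) + 27 * (NN a. ennreal (bracket a powr (- (3/2))))"
  by (simp add: nn_integral_add nn_integral_cmult)
 also have "... < \<infinity>"
 proof -
  have 1: "(NN a. ennreal (k a)) < \<infinity>" using ik by (rule order.strict_trans1) simp
  have 2: "(NN a. ennreal (k (1 - a))) < \<infinity>"
   using 1 nn_integral_reflect[of "%a. ennreal (k a)" 1] by simp
  have "(NN a. ennreal (k a)) = 2 * (NN a. ennreal (k (- 1 + 2 * a)))"
   by (subst nn_integral_real_affine[of _ 2 "- 1"]) auto
  then have 3: "(NN a. ennreal (k (- 1 + 2 * a))) < \<infinity>"
   using 1 by (auto simp: ennreal_mult_less_top less_top[symmetric] ennreal_mult_eq_top_iff)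
  have 4: "(NN a. ennreal (bracket a powr (- (3/2)))) < \<infinity>"
   by (subst nn_integral_eq_integral[OF integrable_bracket_powr]) auto
  show ?thesis using 1 2 3 4 by (simp add: ennreal_mult_less_top ennreal_add_less_top)
 qed
 finally show ?thesis .
qed

lemma Psi_scale: "\<bar>S\<bar> * Psi (S * a) (S * b) = (if S = 0 then 0 else Psi a b)"
proof (cases "S = 0")
 case False
 have "Psi (S * a) (S * b) = (\<bar>S\<bar> powr (- (1/2)) * \<bar>S\<bar> powr (- (1/2)) * \<bar>S\<bar> powr (1/2) * \<bar>S\<bar> powr (- (1/2))) * Psi a b"
  unfolding Psi_def by (simp add: abs_mult powr_mult mult_ac flip: distrib_left right_diff_distrib)
 also have "\<bar>S\<bar> powr (- (1/2)) * \<bar>S\<bar> powr (- (1/2)) * \<bar>S\<bar> powr (1/2) * \<bar>S\<bar> powr (- (1/2)) = \<bar>S\<bar> powr (-1)"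
  by (simp flip: powr_add)
 finally show ?thesis using False by (simp add: powr_minus)
qed simp

lemma Psi_integral: "(NN a. ennreal (Psi a (S - a))) <= Psi_const"
proof (cases "S = 0")
 case True
 then show ?thesis by (simp add: Psi_def)
next
 case False
 have "(NN a. ennreal (Psi a (S - a))) = ennreal \<bar>S\<bar> * (NN a. ennreal (Psi (S * a) (S - S * a)))"
  using False by (subst nn_integral_real_affine[of _ S 0]) auto
 also have "... = (NN a. ennreal \<bar>S\<bar> * ennreal (Psi (S * a) (S * (1 - a))))"
  by (simp add: nn_integral_cmult right_diff_distrib)
 also have "... = Psi_const"
  unfolding Psi_const_def using False
  by (intro nn_integral_cong) (simp add: Psi_nonneg Psi_scale flip: ennreal_mult)
 finally show ?thesis by simp
qed

text \<open>The Cauchy--Schwarz inequality with the weights \<open>(|a + b| / |a - b|)\<^sup>1\<^sup>/\<^sup>2\<close> and its inverse; they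
 make the two resulting kernels integrable at infinity as well.\<close>

lemma Tplus_CS:
 assumes [measurable]: "F \<in> bmeas" "G \<in> bmeas" "H \<in> bmeas"
 shows "(Tplus F G H x)\<^sup>2 <= (NN w. NN y. ennreal (Psi (y - x) (y - w)) * ((F y)\<^sup>2 * (G (x + w - y))\<^sup>2))
  * (Psi_const * (NN w. (H w)\<^sup>2))"
proof -
 define P where "P p = ennreal (sqrt (Psi (snd p - x) (snd p - fst p))) * (F (snd p) * G (x + fst p - snd p))" for p :: "real \<times> real"
 define R where "R p = ennreal (sqrt (Psi (snd p - x) (fst p - snd p))) * H (fst p)" for p :: "real \<times> real"
 have [measurable]: "P \<in> borel_measurable (lborel \<Otimes>\<^sub>M lborel)" "R \<in> borel_measurable (lborel \<Otimes>\<^sub>M lborel)"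
  unfolding P_def[abs_def] R_def[abs_def] by measurable
 have sq: "(ennreal (sqrt (Psi a b)))\<^sup>2 = ennreal (Psi a b)" for a b
  by (simp add: ennreal_power Psi_nonneg)
 \<comment> \<open>The two weights are inverse to each other: a change of sign of b exchanges |a +
   b| and |a - b|.\<close>
 have kk: "kern a * kern b = ennreal (sqrt (Psi a (- b))) * ennreal (sqrt (Psi a b))"
  if "a \<noteq> 0" "b \<noteq> 0" "a + b \<noteq> 0" "a - b \<noteq> 0" for a b
 proof -
  have "Psi a (- b) * Psi a b = (\<bar>a\<bar> powr (- (1/2)) * \<bar>a\<bar> powr (- (1/2))) * (\<bar>b\<bar> powr (- (1/2)) * \<bar>b\<bar> powr (- (1/2)))
    * (\<bar>a + b\<bar> powr (1/2) * \<bar>a + b\<bar> powr (- (1/2))) * (\<bar>a - b\<bar> powr (1/2) * \<bar>a - b\<bar> powr (- (1/2)))"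
   by (simp add: Psi_def mult_ac)
  also have "... = (\<bar>a\<bar> powr (- (1/2)) * \<bar>b\<bar> powr (- (1/2)))\<^sup>2"
   using that by (simp add: power2_eq_square mult_ac flip: powr_add)
  finally have "sqrt (Psi a (- b) * Psi a b) = \<bar>a\<bar> powr (- (1/2)) * \<bar>b\<bar> powr (- (1/2))" by simp
  then have "sqrt (Psi a (- b)) * sqrt (Psi a b) = \<bar>a\<bar> powr (- (1/2)) * \<bar>b\<bar> powr (- (1/2))"
   by (simp add: real_sqrt_mult)
  then show ?thesis using that
   by (simp add: kern_def Psi_nonneg flip: ennreal_mult)
 qed
 have "Tplus F G H x = (NN w. NN y. P (w, y) * R (w, y))"
  unfolding Tplus_def
 proof (rule nn_integral_cong_AE)
  show "AE w in lborel. (NN y. kern (y - x) * kern (w - y) * (F y * G (x + w - y) * H w)) = (NN y. P (w, y) * R (w, y))"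
   using AE_lborel_singleton[of x]
  proof eventually_elim
   case (elim w)
   show ?case
   proof (rule nn_integral_cong_AE)
    show "AE y in lborel. kern (y - x) * kern (w - y) * (F y * G (x + w - y) * H w) = P (w, y) * R (w, y)"
     using AE_lborel_singleton[of x] AE_lborel_singleton[of w] AE_lborel_singleton[of "(x + w) / 2"]
    proof eventually_elim
     case (elim y)
     have "kern (y - x) * kern (w - y) = ennreal (sqrt (Psi (y - x) (- (w - y)))) * ennreal (sqrt (Psi (y - x) (w - y)))"
      by (rule kk) (use elim \<open>w \<noteq> x\<close> in \<open>auto simp: field_simps\<close>)
     then show ?case by (simp add: P_def R_def mult_ac)
    qed
   qed
  qed
 qed
 also have "... = (\<integral>\<^sup>+p. P p * R p \<partial>(lborel \<Otimes>\<^sub>M lborel))"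
  by (rule lborel.nn_integral_fst) measurable
 finally have "(Tplus F G H x)\<^sup>2 = (\<integral>\<^sup>+p. P p * R p \<partial>(lborel \<Otimes>\<^sub>M lborel))\<^sup>2" by simp
 also have "... <= (\<integral>\<^sup>+p. (P p)\<^sup>2 \<partial>(lborel \<Otimes>\<^sub>M lborel)) * (\<integral>\<^sup>+p. (R p)\<^sup>2 \<partial>(lborel \<Otimes>\<^sub>M lborel))"
  by (rule Cauchy_Schwarz_nn_integral) measurable
 also have "(\<integral>\<^sup>+p. (P p)\<^sup>2 \<partial>(lborel \<Otimes>\<^sub>M lborel)) = (NN w. NN y. (P (w, y))\<^sup>2)"
  by (rule lborel.nn_integral_fst[symmetric]) measurable
 also have "... = (NN w. NN y. ennreal (Psi (y - x) (y - w)) * ((F y)\<^sup>2 * (G (x + w - y))\<^sup>2))"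
  by (simp add: P_def power_mult_distrib sq)
 also have "(\<integral>\<^sup>+p. (R p)\<^sup>2 \<partial>(lborel \<Otimes>\<^sub>M lborel)) = (NN w. NN y. (R (w, y))\<^sup>2)"
  by (rule lborel.nn_integral_fst[symmetric]) measurable
 also have "... = (NN w. (NN y. ennreal (Psi (y - x) (w - y))) * (H w)\<^sup>2)"
  by (simp add: R_def power_mult_distrib sq nn_integral_multc)
 finally have 1: "(Tplus F G H x)\<^sup>2 <= (NN w. NN y. ennreal (Psi (y - x) (y - w)) * ((F y)\<^sup>2 * (G (x + w - y))\<^sup>2))
   * (NN w. (NN y. ennreal (Psi (y - x) (w - y))) * (H w)\<^sup>2)" .
 \<comment> \<open>The arguments of \<open>Psi\<close> have the sum w - x, which is independent of
   y, so \<open>Psi_integral\<close> applies.\<close>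
 have "(NN w. (NN y. ennreal (Psi (y - x) (w - y))) * (H w)\<^sup>2) <= (NN w. Psi_const * (H w)\<^sup>2)"
 proof (intro nn_integral_mono mult_right_mono)
  fix w
  have "(NN y. ennreal (Psi (y - x) (w - y))) = (NN y. ennreal (Psi (y + - x) (w - x - (y + - x))))" by simp
  also have "... = (NN a. ennreal (Psi a (w - x - a)))" by (rule nn_integral_shift) measurable
  also have "... <= Psi_const" by (rule Psi_integral)
  finally show "(NN y. ennreal (Psi (y - x) (w - y))) <= Psi_const" .
 qed simp
 also have "... = Psi_const * (NN w. (H w)\<^sup>2)" by (rule nn_integral_cmult) measurable
 finally show ?thesis
  by (intro order_trans[OF 1] mult_left_mono) auto
qed

text \<open>\<open>Tplus_CS\<close> leaves \<open>F\<close> and \<open>G\<close> with the kernel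
  \<open>Psi (y - x) (y - w)\<close>. With v = x + w - y it becomes
  \<open>Psi (y - x) (x - v)\<close>, whose arguments have the sum y - v; the x-integral is at most
  \<open>Psi_const\<close> and the squares separate.\<close>

lemma Tplus_L2:
 assumes [measurable]: "F \<in> bmeas" "G \<in> bmeas" "H \<in> bmeas"
 shows "(NN x. (Tplus F G H x)\<^sup>2)
  <= Psi_const\<^sup>2 * ((NN x. (F x)\<^sup>2) * (NN x. (G x)\<^sup>2) * (NN x. (H x)\<^sup>2))"
proof -
 let ?K = "Psi_const * (NN w. (H w)\<^sup>2)"
 have "(NN x. NN w. NN y. ennreal (Psi (y - x) (y - w)) * ((F y)\<^sup>2 * (G (x + w - y))\<^sup>2))
  = (NN x. NN y. NN w. ennreal (Psi (y - x) (y - w)) * ((F y)\<^sup>2 * (G (x + w - y))\<^sup>2))"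
  by (intro nn_integral_cong lborel_pair.Fubini') measurable
 also have "... = (NN x. NN y. NN v. ennreal (Psi (y - x) (x - v)) * ((F y)\<^sup>2 * (G v)\<^sup>2))"
 proof (rule nn_integral_cong, rule nn_integral_cong)
  fix x y
  have "(NN w. ennreal (Psi (y - x) (y - w)) * ((F y)\<^sup>2 * (G (x + w - y))\<^sup>2))
   = (NN w. ennreal (Psi (y - x) (x - (w + (x - y)))) * ((F y)\<^sup>2 * (G (w + (x - y)))\<^sup>2))"
   by (intro nn_integral_cong) (simp add: algebra_simps)
  also have "... = (NN v. ennreal (Psi (y - x) (x - v)) * ((F y)\<^sup>2 * (G v)\<^sup>2))"
   by (rule nn_integral_shift) measurable
  finally show "(NN w. ennreal (Psi (y - x) (y - w)) * ((F y)\<^sup>2 * (G (x + w - y))\<^sup>2))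
   = (NN v. ennreal (Psi (y - x) (x - v)) * ((F y)\<^sup>2 * (G v)\<^sup>2))" .
 qed
 also have "... = (NN y. NN x. NN v. ennreal (Psi (y - x) (x - v)) * ((F y)\<^sup>2 * (G v)\<^sup>2))"
  by (rule lborel_pair.Fubini') measurable
 also have "... = (NN y. NN v. NN x. ennreal (Psi (y - x) (x - v)) * ((F y)\<^sup>2 * (G v)\<^sup>2))"
  by (intro nn_integral_cong lborel_pair.Fubini') measurable
 also have "... = (NN y. NN v. (NN x. ennreal (Psi (y - x) (x - v))) * ((F y)\<^sup>2 * (G v)\<^sup>2))"
  by (simp add: nn_integral_multc)
 also have "... <= (NN y. NN v. Psi_const * ((F y)\<^sup>2 * (G v)\<^sup>2))"
 proof (intro nn_integral_mono mult_right_mono)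
  fix y v
  have "(NN x. ennreal (Psi (y - x) (x - v))) = (NN x. ennreal (Psi (y - x) (y - v - (y - x))))" by simp
  also have "... = (NN a. ennreal (Psi a (y - v - a)))" by (rule nn_integral_reflect) measurable
  also have "... <= Psi_const" by (rule Psi_integral)
  finally show "(NN x. ennreal (Psi (y - x) (x - v))) <= Psi_const" .
 qed simp
 also have "... = Psi_const * ((NN x. (F x)\<^sup>2) * (NN x. (G x)\<^sup>2))"
  by (simp add: nn_integral_cmult nn_integral_multc)
 finally have "(NN x. NN w. NN y. ennreal (Psi (y - x) (y - w)) * ((F y)\<^sup>2 * (G (x + w - y))\<^sup>2))
  <= Psi_const * ((NN x. (F x)\<^sup>2) * (NN x. (G x)\<^sup>2))" .
 then have "(NN x. NN w. NN y. ennreal (Psi (y - x) (y - w)) * ((F y)\<^sup>2 * (G (x + w - y))\<^sup>2)) * ?K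
  <= Psi_const * ((NN x. (F x)\<^sup>2) * (NN x. (G x)\<^sup>2)) * ?K"
  by (rule mult_right_mono) simp
 then have *: "(NN x. NN w. NN y. ennreal (Psi (y - x) (y - w)) * ((F y)\<^sup>2 * (G (x + w - y))\<^sup>2)) * ?K
  <= Psi_const\<^sup>2 * ((NN x. (F x)\<^sup>2) * (NN x. (G x)\<^sup>2) * (NN x. (H x)\<^sup>2))"
  by (simp add: power2_eq_square mult_ac)
 have "(NN x. (Tplus F G H x)\<^sup>2)
   <= (NN x. (NN w. NN y. ennreal (Psi (y - x) (y - w)) * ((F y)\<^sup>2 * (G (x + w - y))\<^sup>2)) * ?K)"
  by (intro nn_integral_mono Tplus_CS) measurable
 also have "... = (NN x. NN w. NN y. ennreal (Psi (y - x) (y - w)) * ((F y)\<^sup>2 * (G (x + w - y))\<^sup>2)) * ?K"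
  by (rule nn_integral_multc) measurable
 also note *
 finally show ?thesis .
qed

section \<open>Weights\<close>

lemma bracket_add_le: "bracket (a + b) <= bracket a + bracket b"
proof -
 have "bracket (a + b) <= sqrt ((1 + 1)\<^sup>2 + (a + b)\<^sup>2)"
  unfolding bracket_def by (intro real_sqrt_le_mono) simp
 also have "... <= sqrt (1\<^sup>2 + a\<^sup>2) + sqrt (1\<^sup>2 + b\<^sup>2)"
  by (rule real_sqrt_sum_squares_triangle_ineq)
 finally show ?thesis by (simp add: bracket_def)
qed

text \<open>As x = y + (x + w - y) - w, one of these three points has a bracket of at least a third
  of \<open>bracket x\<close>.\<close>

lemma bracket_powr_sum_le:
 assumes "0 <= \<sigma>"
 shows "bracket x powr \<sigma> <= 3 powr \<sigma> * (bracket y powr \<sigma> + bracket (x + w - y) powr \<sigma> + bracket w powr \<sigma>)"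
proof -
 define m where "m = max (bracket y) (max (bracket (x + w - y)) (bracket w))"
 have m: "0 < m" "m powr \<sigma> <= bracket y powr \<sigma> + bracket (x + w - y) powr \<sigma> + bracket w powr \<sigma>"
  using bracket_pos[of y] by (auto simp: m_def max_def)
 have "bracket x <= bracket y + bracket (x + w - y) + bracket (- w)"
  using bracket_add_le[of y "(x + w - y) + - w"] bracket_add_le[of "x + w - y" "- w"] by simp
 also have "bracket (- w) = bracket w" by (simp add: bracket_def)
 also have "bracket y + bracket (x + w - y) + bracket w <= 3 * m" by (simp add: m_def)
 finally have "bracket x powr \<sigma> <= (3 * m) powr \<sigma>"
  using bracket_pos[of x] assms by (intro powr_mono2) auto
 also have "... = 3 powr \<sigma> * m powr \<sigma>" using m by (simp add: powr_mult)
 also have "... <= 3 powr \<sigma> * (bracket y powr \<sigma> + bracket (x + w - y) powr \<sigma> + bracket w powr \<sigma>)"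
  by (intro mult_left_mono m) simp
 finally show ?thesis .
qed

lemma Tplus_weight:
 fixes F G H :: "real => ennreal"
 assumes [measurable]: "F \<in> bmeas" "G \<in> bmeas" "H \<in> bmeas"
  and \<sigma>: "0 <= \<sigma>"
 defines "W \<equiv> %x. ennreal (bracket x powr \<sigma>)"
 shows "W x * Tplus F G H x <= ennreal (3 powr \<sigma>) *
   (Tplus (%y. W y * F y) G H x + Tplus F (%y. W y * G y) H x + Tplus F G (%y. W y * H y) x)"
proof -
 have [measurable]: "W \<in> bmeas" unfolding W_def by measurable
 have W: "W x <= ennreal (3 powr \<sigma>) * (W y + W (x + w - y) + W w)" for y w
 proof -
  have "W x <= ennreal (3 powr \<sigma> * (bracket y powr \<sigma> + bracket (x + w - y) powr \<sigma> + bracket w powr \<sigma>))"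
   unfolding W_def by (intro ennreal_leI bracket_powr_sum_le \<sigma>)
  then show ?thesis by (simp add: W_def ennreal_mult ennreal_plus)
 qed
 have "W x * Tplus F G H x = (NN w. NN y. W x * (kern (y - x) * kern (w - y) * (F y * G (x + w - y) * H w)))"
  unfolding Tplus_def by (simp add: nn_integral_cmult)
 also have "... <= (NN w. NN y. (ennreal (3 powr \<sigma>) * (W y + W (x + w - y) + W w)) * (kern (y - x) * kern (w - y) * (F y * G (x + w - y) * H w)))"
  by (intro nn_integral_mono mult_right_mono W) simp
 also have "... = (NN w. NN y. ennreal (3 powr \<sigma>) * ((kern (y - x) * kern (w - y) * (W y * F y * G (x + w - y) * H w)
   + kern (y - x) * kern (w - y) * (F y * (W (x + w - y) * G (x + w - y)) * H w))
   + kern (y - x) * kern (w - y) * (F y * G (x + w - y) * (W w * H w))))"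
  by (intro nn_integral_cong) (simp add: algebra_simps)
 also have "... = ennreal (3 powr \<sigma>) *
   (Tplus (%y. W y * F y) G H x + Tplus F (%y. W y * G y) H x + Tplus F G (%y. W y * H y) x)"
  unfolding Tplus_def by (simp add: nn_integral_cmult nn_integral_add)
 finally show ?thesis .
qed

text \<open>Near y = x the singularity is integrable because q < 2. At infinity the two decays add
  up to the order r > 1: their product is at most the sum of the powers -r of the brackets of y - x
  and of y. The constant 2^(q/4) comes from \<open>bracket u\<close> \<le> sqrt 2 |u| for |u| \<ge>
  1.\<close>

lemma kern_bracket_integral:
 assumes q: "1 <= q" "q < 2" and \<beta>: "0 < \<beta>" "1 < q / 2 + \<beta>"
 shows "\<exists>M>0. \<forall>x. (NN y. ennreal (\<bar>y - x\<bar> powr (- (q/2)) * bracket y powr (- \<beta>))) <= ennreal M"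
proof -
 define r where "r = q / 2 + \<beta>"
 define B where "B = (LBINT x. bracket x powr (- r))"
 have B: "(NN x. ennreal (bracket x powr (- r))) = ennreal B" "0 <= B"
 proof -
  have "integrable lborel (%x. bracket x powr (- r))" by (rule integrable_bracket_powr) (use \<beta> in \<open>simp add: r_def\<close>)
  then show "(NN x. ennreal (bracket x powr (- r))) = ennreal B"
   unfolding B_def by (intro nn_integral_eq_integral) auto
  show "0 <= B" unfolding B_def by simp
 qed
 define c where "c = (2::real) powr (q / 4)"
 define M where "M = 2 / (1 - q / 2) + c * (B + B)"
 have M: "0 < M" using q B by (simp add: M_def c_def add_pos_nonneg)
 have pt: "\<bar>u\<bar> powr (- (q/2)) * bracket y powr (- \<beta>) <= indicator {-1..1} u * \<bar>u\<bar> powr (- (q/2)) + c * (bracket u powr (- r) + bracket y powr (- r))" for u y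
 proof (cases "\<bar>u\<bar> <= 1")
  case True
  have "bracket y powr (- \<beta>) <= 1" using bracket_ge_1[of y] \<beta> powr_mono2'[of "- \<beta>" 1 "bracket y"] by simp
  then have "\<bar>u\<bar> powr (- (q/2)) * bracket y powr (- \<beta>) <= \<bar>u\<bar> powr (- (q/2)) * 1" by (intro mult_left_mono) auto
  moreover have "0 <= c * (bracket u powr (- r) + bracket y powr (- r))" by (simp add: c_def)
  moreover have "indicator {-1..1} u = (1::real)" using True by (auto simp: indicator_def)
  ultimately show ?thesis by simp
 next
  case False
  then have "1 + u\<^sup>2 <= 2 * u\<^sup>2" using abs_le_square_iff[of 1 u] by simp
  then have "bracket u <= sqrt (2 * u\<^sup>2)" unfolding bracket_def by (rule real_sqrt_le_mono)
  then have "bracket u / sqrt 2 <= \<bar>u\<bar>" by (simp add: real_sqrt_mult field_simps)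
  then have "\<bar>u\<bar> powr (- (q/2)) <= (bracket u / sqrt 2) powr (- (q/2))"
   using q bracket_pos[of u] by (intro powr_mono2') auto
  also have "... = c * bracket u powr (- (q/2))"
   using bracket_pos[of u] by (simp add: powr_divide powr_minus powr_half_sqrt[symmetric] powr_powr c_def field_simps)
  finally have "\<bar>u\<bar> powr (- (q/2)) * bracket y powr (- \<beta>) <= c * bracket u powr (- (q/2)) * bracket y powr (- \<beta>)"
   by (rule mult_right_mono) simp
  moreover have "bracket u powr (- (q/2)) * bracket y powr (- \<beta>) <= bracket u powr (- r) + bracket y powr (- r)"
  proof (cases "bracket u <= bracket y")
   case True
   have "bracket y powr (- \<beta>) <= bracket u powr (- \<beta>)" using True \<beta> bracket_pos[of u] by (intro powr_mono2') auto
   then have "bracket u powr (- (q/2)) * bracket y powr (- \<beta>) <= bracket u powr (- (q/2)) * bracket u powr (- \<beta>)"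
    by (intro mult_left_mono) auto
   also have "... = bracket u powr (- r)" by (simp add: r_def flip: powr_add)
   finally show ?thesis by (simp add: add_increasing2)
  next
   case False
   have "bracket u powr (- (q/2)) <= bracket y powr (- (q/2))" using False q bracket_pos[of y] by (intro powr_mono2') auto
   then have "bracket u powr (- (q/2)) * bracket y powr (- \<beta>) <= bracket y powr (- (q/2)) * bracket y powr (- \<beta>)"
    by (intro mult_right_mono) auto
   also have "... = bracket y powr (- r)" by (simp add: r_def flip: powr_add)
   finally show ?thesis by (simp add: add_increasing)
  qed
  then have "c * (bracket u powr (- (q/2)) * bracket y powr (- \<beta>)) <= c * (bracket u powr (- r) + bracket y powr (- r))"
   by (rule mult_left_mono) (simp add: c_def)
  moreover have "0 <= indicator {-1..1} u * \<bar>u\<bar> powr (- (q/2))" by simp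
  ultimately show ?thesis unfolding mult.assoc by linarith
 qed
 have "(NN y. ennreal (\<bar>y - x\<bar> powr (- (q/2)) * bracket y powr (- \<beta>))) <= ennreal M" for x
 proof -
  have "(NN y. ennreal (\<bar>y - x\<bar> powr (- (q/2)) * bracket y powr (- \<beta>)))
   <= (NN y. ennreal (indicator {-1..1} (y + - x) * \<bar>y + - x\<bar> powr (- (q/2)))
     + ennreal c * (ennreal (bracket (y + - x) powr (- r)) + ennreal (bracket y powr (- r))))"
  proof (rule nn_integral_mono)
   fix y
   have "ennreal (\<bar>y - x\<bar> powr (- (q/2)) * bracket y powr (- \<beta>)) <= ennreal (indicator {-1..1} (y - x) * \<bar>y - x\<bar> powr (- (q/2)) + c * (bracket (y - x) powr (- r) + bracket y powr (- r)))"
    by (rule ennreal_leI[OF pt])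
   then show "ennreal (\<bar>y - x\<bar> powr (- (q/2)) * bracket y powr (- \<beta>)) <= ennreal (indicator {-1..1} (y + - x) * \<bar>y + - x\<bar> powr (- (q/2)))
     + ennreal c * (ennreal (bracket (y + - x) powr (- r)) + ennreal (bracket y powr (- r)))"
    by (simp add: c_def ennreal_plus ennreal_mult)
  qed
  also have "... = (NN y. ennreal (indicator {-1..1} (y + - x) * \<bar>y + - x\<bar> powr (- (q/2))))
    + ennreal c * ((NN y. ennreal (bracket (y + - x) powr (- r))) + (NN y. ennreal (bracket y powr (- r))))"
   by (simp add: nn_integral_add nn_integral_cmult)
  also have "(NN y. ennreal (indicator {-1..1} (y + - x) * \<bar>y + - x\<bar> powr (- (q/2))))
    = (NN y. ennreal (indicator {-1..1} y * \<bar>y\<bar> powr (- (q/2))))"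
   by (rule nn_integral_shift[of "%y. ennreal (indicator {-1..1} y * \<bar>y\<bar> powr (- (q/2)))"]) measurable
  also have "(NN y. ennreal (bracket (y + - x) powr (- r))) = (NN y. ennreal (bracket y powr (- r)))"
   by (rule nn_integral_shift[of "%y. ennreal (bracket y powr (- r))"]) measurable
  also have "(NN y. ennreal (indicator {-1..1} y * \<bar>y\<bar> powr (- (q/2))))
    + ennreal c * ((NN y. ennreal (bracket y powr (- r))) + (NN y. ennreal (bracket y powr (- r))))
    <= ennreal (2 / (1 - q / 2)) + ennreal c * (ennreal B + ennreal B)"
   unfolding B using q by (intro add_mono nn_integral_abs_powr_unit) auto
  also have "... = ennreal M"
   using B q unfolding M_def by (simp add: c_def flip: ennreal_plus ennreal_mult)
  finally show ?thesis .
 qed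
 then show ?thesis using M by blast
qed

lemma Kato_leI:
 assumes "\<And>x. (NN y. ennreal (\<bar>y - x\<bar> powr (- (1/2)) * f y)) <= C" and f: "\<And>y. 0 <= f y"
 shows "Kato (%y. ennreal (f y)) <= C"
 unfolding Kato_def
proof (rule SUP_least)
 fix x
 have "(NN y. kern (y - x) * ennreal (f y)) = (NN y. ennreal (\<bar>y - x\<bar> powr (- (1/2)) * f y))"
 proof (rule nn_integral_cong_AE)
  show "AE y in lborel. kern (y - x) * ennreal (f y) = ennreal (\<bar>y - x\<bar> powr (- (1/2)) * f y)"
   using AE_lborel_singleton[of x] by eventually_elim (simp add: kern_def ennreal_mult f)
 qed
 then show "(NN y. kern (y - x) * ennreal (f y)) <= C" using assms(1)[of x] by simp
qed

lemma Kato_Linf: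
 assumes s: "1 / 2 < s"
 shows "\<exists>C>0. \<forall>f N. f \<in> bmeas --> (\<forall>y. 0 <= f y) --> 0 <= N -->
  (AE y in lborel. bracket y powr s * f y <= N) --> Kato (%y. ennreal (f y)) <= ennreal (C * N)"
proof -
 obtain M where M: "0 < M" "\<And>x. (NN y. ennreal (\<bar>y - x\<bar> powr (- (1/2)) * bracket y powr (- s))) <= ennreal M"
  using kern_bracket_integral[of 1 s] s by auto
 have "Kato (%y. ennreal (f y)) <= ennreal (M * N)"
  if f: "f \<in> bmeas" "\<And>y. 0 <= f y" "0 <= N" "AE y in lborel. bracket y powr s * f y <= N" for f N
 proof (rule Kato_leI[OF _ f(2)])
  fix x
  have "(NN y. ennreal (\<bar>y - x\<bar> powr (- (1/2)) * f y)) <= (NN y. ennreal (\<bar>y - x\<bar> powr (- (1/2)) * bracket y powr (- s)) * ennreal N)"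
  proof (rule nn_integral_mono_AE)
   show "AE y in lborel. ennreal (\<bar>y - x\<bar> powr (- (1/2)) * f y) <= ennreal (\<bar>y - x\<bar> powr (- (1/2)) * bracket y powr (- s)) * ennreal N"
    using f(4)
   proof eventually_elim
    case (elim y)
    have "f y <= bracket y powr (- s) * N"
     using elim bracket_pos[of y] by (simp add: powr_minus field_simps)
    then have "\<bar>y - x\<bar> powr (- (1/2)) * f y <= \<bar>y - x\<bar> powr (- (1/2)) * (bracket y powr (- s) * N)"
     by (rule mult_left_mono) simp
    then have "ennreal (\<bar>y - x\<bar> powr (- (1/2)) * f y) <= ennreal (\<bar>y - x\<bar> powr (- (1/2)) * bracket y powr (- s) * N)"
     by (intro ennreal_leI) (simp add: mult.assoc)
    then show ?case using f(3) by (simp add: ennreal_mult)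
   qed
  qed
  also have "... = (NN y. ennreal (\<bar>y - x\<bar> powr (- (1/2)) * bracket y powr (- s))) * ennreal N"
   by (rule nn_integral_multc) measurable
  also have "... <= ennreal M * ennreal N" by (intro mult_right_mono M) simp
  also have "... = ennreal (M * N)" using M f(3) by (simp add: ennreal_mult)
  finally show "(NN y. ennreal (\<bar>y - x\<bar> powr (- (1/2)) * f y)) <= ennreal (M * N)" .
 qed
 then show ?thesis using M(1) by blast
qed

text \<open>Hoelder's inequality with the dual exponent q, written as Young's inequality at the
  scale \<open>N\<close>. The kernel times bracket^(-s) is bounded in L^q uniformly in x when q < 2,
  that is p > 2, and q/2 + s q > 1, that is s > 1/2 - 1/p.\<close>

lemma Kato_Lp:
 assumes p: "2 < p" and s: "1 / 2 - 1 / p < s"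
 shows "\<exists>C>0. \<forall>f N. f \<in> bmeas --> (\<forall>y. 0 <= f y) --> 0 < N -->
  (NN y. ennreal ((bracket y powr s * f y) powr p)) <= ennreal (N powr p) --> Kato (%y. ennreal (f y)) <= ennreal (C * N)"
proof -
 define q where "q = p / (p - 1)"
 have q: "1 < q" "q < 2" "1 / p + 1 / q = 1" using p by (auto simp: q_def field_simps)
 have s0: "0 < s" using s p by (smt (verit) divide_strict_left_mono zero_less_mult_iff)
 have "1 / q < 1 / 2 + s" using q(3) s by simp
 then have "1 < q / 2 + s * q" using q(1) by (simp add: field_simps)
 then obtain M where M: "0 < M" "\<And>x. (NN y. ennreal (\<bar>y - x\<bar> powr (- (q/2)) * bracket y powr (- (s * q)))) <= ennreal M"
  using kern_bracket_integral[of q "s * q"] q s0 by auto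
 have "Kato (%y. ennreal (f y)) <= ennreal ((M + 1) * N)"
  if [measurable]: "f \<in> bmeas" and f: "\<And>y. 0 <= f y" and N: "0 < N"
   and I: "(NN y. ennreal ((bracket y powr s * f y) powr p)) <= ennreal (N powr p)" for f N
 proof (rule Kato_leI[OF _ f])
  fix x
  have pt: "\<bar>y - x\<bar> powr (- (1/2)) * f y <= N * (\<bar>y - x\<bar> powr (- (q/2)) * bracket y powr (- (s * q))) + N powr (1 - p) * (bracket y powr s * f y) powr p" for y
  proof -
   define U where "U = \<bar>y - x\<bar> powr (- (1/2)) * bracket y powr (- s)"
   define V where "V = bracket y powr s * f y / N"
   have UV: "0 <= U" "0 <= V" using f N by (auto simp: U_def V_def)
   have "U * V <= U powr q / q + V powr p / p"
    by (rule Youngs_inequality) (use UV q p in \<open>auto simp: add.commute\<close>)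
   also have "... <= U powr q + V powr p"
   proof -
    have d: "x / c <= x" if "0 <= x" "1 <= c" for x c :: real
     using that mult_left_mono[of 1 c x] by (simp add: divide_le_eq)
    show ?thesis using q p by (intro add_mono d) auto
   qed
   finally have "N * (U * V) <= N * U powr q + N * V powr p" using N by (simp flip: distrib_left)
   moreover have "N * (U * V) = \<bar>y - x\<bar> powr (- (1/2)) * f y"
    using N bracket_pos[of y] by (simp add: U_def V_def powr_minus field_simps)
   moreover have "U powr q = \<bar>y - x\<bar> powr (- (q/2)) * bracket y powr (- (s * q))"
    by (simp add: U_def powr_mult powr_powr)
   moreover have "N * V powr p = N powr (1 - p) * (bracket y powr s * f y) powr p"
    using N f[of y] by (simp add: V_def powr_divide powr_diff)
   ultimately show ?thesis by simp
  qed
  have "(NN y. ennreal (\<bar>y - x\<bar> powr (- (1/2)) * f y))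
   <= (NN y. ennreal N * ennreal (\<bar>y - x\<bar> powr (- (q/2)) * bracket y powr (- (s * q))) + ennreal (N powr (1 - p)) * ennreal ((bracket y powr s * f y) powr p))"
  proof (rule nn_integral_mono)
   fix y
   have "ennreal (\<bar>y - x\<bar> powr (- (1/2)) * f y) <= ennreal (N * (\<bar>y - x\<bar> powr (- (q/2)) * bracket y powr (- (s * q))) + N powr (1 - p) * (bracket y powr s * f y) powr p)"
    by (rule ennreal_leI[OF pt])
   then show "ennreal (\<bar>y - x\<bar> powr (- (1/2)) * f y) <= ennreal N * ennreal (\<bar>y - x\<bar> powr (- (q/2)) * bracket y powr (- (s * q))) + ennreal (N powr (1 - p)) * ennreal ((bracket y powr s * f y) powr p)"
    using N by (simp add: ennreal_plus ennreal_mult)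
  qed
  also have "... = ennreal N * (NN y. ennreal (\<bar>y - x\<bar> powr (- (q/2)) * bracket y powr (- (s * q))))
    + ennreal (N powr (1 - p)) * (NN y. ennreal ((bracket y powr s * f y) powr p))"
   by (simp add: nn_integral_add nn_integral_cmult)
  also have "... <= ennreal N * ennreal M + ennreal (N powr (1 - p)) * ennreal (N powr p)"
   by (intro add_mono mult_left_mono M I) auto
  also have "... = ennreal ((M + 1) * N)"
   using N M by (simp add: algebra_simps flip: ennreal_mult ennreal_plus powr_add)
  finally show "(NN y. ennreal (\<bar>y - x\<bar> powr (- (1/2)) * f y)) <= ennreal ((M + 1) * N)" .
 qed
 then show ?thesis using M(1) by (intro exI[of _ "M + 1"]) auto
qed

section \<open>The function spaces\<close>

text \<open>What the Cauchy theory uses of a space. Limits and integrals are taken in L^2, and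
  \<open>closed\<close> brings the bounds back to \<open>X\<close>, in the role usually played by
  completeness. Nonnegativity of \<open>N\<close> follows from \<open>embedding\<close>.\<close>

locale solution_space =
 fixes X :: "L2 set" and N :: "L2 => real" and C :: real
 assumes C_pos: "0 < C"
  and add: "f \<in> X ==> g \<in> X ==> f + g \<in> X \<and> N (f + g) <= N f + N g"
  and scaleC: "f \<in> X ==> c *\<^sub>C f \<in> X \<and> N (c *\<^sub>C f) <= norm c * N f"
  and embedding: "f \<in> X ==> norm f <= C * N f"
  and closed: "(\<And>n. F n \<in> X \<and> N (F n) <= r) ==> F \<longlonglongrightarrow> f ==> f \<in> X \<and> N f <= r"
  and T4_bound: "f \<in> X ==> g \<in> X ==> h \<in> X ==> T4 f g h \<in> X \<and> N (T4 f g h) <= C * N f * N g * N h"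

text \<open>Spaces are described by their closed balls of positive radius.\<close>

locale ball_space =
 fixes B :: "real => L2 => bool" and C :: real
 assumes C_pos: "0 < C"
  and ball_add: "0 < r ==> 0 < r' ==> B r f ==> B r' g ==> B (r + r') (f + g)"
  and ball_scaleC: "0 < r ==> 0 < r' ==> norm c * r <= r' ==> B r f ==> B r' (c *\<^sub>C f)"
  and ball_embedding: "0 < r ==> B r f ==> norm f <= C * r"
  and ball_closed: "0 < r ==> (\<And>n. B r (F n)) ==> F \<longlonglongrightarrow> f ==> B r f"
  and ball_T: "0 < r ==> 0 < r' ==> 0 < r'' ==> B r f ==> B r' g ==> B r'' h ==>
   B (C * r * r' * r'') (T_from (- (pi / 4)) f g h)"

text \<open>The radii are positive, so each norm bound is proved with a margin e that tends to 0.
  The factor 8 / pi is that of \<open>T4\<close>; the sum of the two constants serves the embedding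
  and the trilinear bound at once.\<close>

lemma (in ball_space) solution_space_balls:
 assumes X: "\<And>r f. 0 < r ==> f \<in> X \<and> N f <= r \<longleftrightarrow> B r f" and N0: "\<And>f. f \<in> X ==> 0 <= N f"
 shows "solution_space X N (8 / pi * C + C)"
proof
 have C8: "0 < 8 / pi * C" using C_pos by simp
 then show "0 < 8 / pi * C + C" using C_pos by linarith
 have B: "B (N f + e) f" if "f \<in> X" "0 < e" for f e
  using X[of "N f + e" f] N0[OF that(1)] that by simp
 fix f g h
 show "f + g \<in> X \<and> N (f + g) <= N f + N g" if fg: "f \<in> X" "g \<in> X"
 proof -
  have *: "f + g \<in> X \<and> N (f + g) <= N f + N g + e" if e: "0 < e" for e
  proof -
   have "B ((N f + e / 2) + (N g + e / 2)) (f + g)"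
    using N0[OF fg(1)] N0[OF fg(2)] e by (intro ball_add B fg) auto
   then show ?thesis using X[of "(N f + e / 2) + (N g + e / 2)" "f + g"] N0[OF fg(1)] N0[OF fg(2)] e by simp
  qed
  show ?thesis
  proof
   show "f + g \<in> X" using *[of 1] by simp
   show "N (f + g) <= N f + N g" by (rule field_le_epsilon) (use * in blast)
  qed
 qed
 show "c *\<^sub>C f \<in> X \<and> N (c *\<^sub>C f) <= norm c * N f" if f: "f \<in> X" for c
 proof -
  have *: "c *\<^sub>C f \<in> X \<and> N (c *\<^sub>C f) <= norm c * N f + e" if e: "0 < e" for e
  proof -
   define d where "d = e / (norm c + 1)"
   have p: "0 < norm c + 1" using norm_ge_zero[of c] by linarith
   have d: "0 < d" "norm c * d <= e"
   proof -
    show d0: "0 < d" using e p by (simp add: d_def)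
    have "norm c * d <= (norm c + 1) * d" using d0 by (intro mult_right_mono) auto
    also have "... = e" using p by (simp add: d_def)
    finally show "norm c * d <= e" .
   qed
   have pos: "0 < norm c * N f + e" using N0[OF f] e by (simp add: add_nonneg_pos)
   have "B (norm c * N f + e) (c *\<^sub>C f)"
    by (rule ball_scaleC[OF _ pos _ B[OF f d(1)]]) (use N0[OF f] d in \<open>auto simp: distrib_left add_nonneg_pos\<close>)
   then show ?thesis using X[OF pos] by simp
  qed
  show ?thesis
  proof
   show "c *\<^sub>C f \<in> X" using *[of 1] by simp
   show "N (c *\<^sub>C f) <= norm c * N f" by (rule field_le_epsilon) (use * in blast)
  qed
 qed
 show "norm f <= (8 / pi * C + C) * N f" if f: "f \<in> X"
 proof -
  have "norm f <= C * N f"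
  proof (rule field_le_epsilon)
   fix e :: real assume e: "0 < e"
   have "norm f <= C * (N f + e / C)"
    using ball_embedding[OF _ B[OF f, of "e / C"]] N0[OF f] e C_pos by (simp add: add_nonneg_pos)
   then show "norm f <= C * N f + e" using C_pos by (simp add: distrib_left)
  qed
  also have "... <= (8 / pi * C + C) * N f" by (intro mult_right_mono N0 f) (use C8 in linarith)
  finally show ?thesis .
 qed
 show "f \<in> X \<and> N f <= r" if F: "\<And>n. F n \<in> X \<and> N (F n) <= r" "F \<longlonglongrightarrow> f" for F r
 proof -
  have r0: "0 <= r" using F(1)[of 0] N0[of "F 0"] by linarith
  have *: "f \<in> X \<and> N f <= r + e" if e: "0 < e" for e
  proof -
   have Bn: "B (r + e) (F n)" for n using F(1)[of n] X[of "r + e" "F n"] r0 e by auto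
   have "B (r + e) f" by (rule ball_closed[OF _ Bn F(2)]) (use r0 e in simp)
   then show ?thesis using X[of "r + e" f] r0 e by simp
  qed
  show ?thesis
  proof
   show "f \<in> X" using *[of 1] by simp
   show "N f <= r" by (rule field_le_epsilon) (use * in blast)
  qed
 qed
 show "T4 f g h \<in> X \<and> N (T4 f g h) <= (8 / pi * C + C) * N f * N g * N h" if fgh: "f \<in> X" "g \<in> X" "h \<in> X"
 proof -
  define K where "K e = 8 / pi * (C * (N f + e) * (N g + e) * (N h + e))" for e
  have *: "T4 f g h \<in> X \<and> N (T4 f g h) <= K e" if e: "0 < e" for e
  proof -
   have p: "0 < N f + e" "0 < N g + e" "0 < N h + e" using N0[OF fgh(1)] N0[OF fgh(2)] N0[OF fgh(3)] e by auto
   have q: "0 < C * (N f + e) * (N g + e) * (N h + e)" using p C_pos by simp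
   then have Kp: "0 < K e" unfolding K_def by simp
   have "B (K e) (cplx (8 / pi) *\<^sub>C T_from (- (pi / 4)) f g h)"
    by (rule ball_scaleC[OF q Kp _ ball_T]) (use p e fgh B in \<open>auto simp: K_def norm_divide\<close>)
   then have "B (K e) (T4 f g h)" by (simp only: T4_T_from scaleC_of_real)
   then show ?thesis using X[OF Kp] by simp
  qed
  have "(K \<longlongrightarrow> K 0) (at_right 0)"
   unfolding K_def by (auto intro!: tendsto_eq_intros)
  moreover have "\<forall>\<^sub>F e in at_right 0. N (T4 f g h) <= K e"
   using * by (auto simp: eventually_at_filter intro: eventually_mono)
  ultimately have "N (T4 f g h) <= K 0"
   by (rule tendsto_lowerbound) simp
  also have "... = 8 / pi * C * (N f * N g * N h)" by (simp add: K_def)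
  also have "... <= (8 / pi * C + C) * (N f * N g * N h)"
   using N0[OF fgh(1)] N0[OF fgh(2)] N0[OF fgh(3)] C_pos by (intro mult_right_mono) auto
  finally show ?thesis using *[of 1] by (simp add: mult.assoc)
 qed
qed

lemma L2_tendsto_AE_subseq:
 assumes "F \<longlonglongrightarrow> f"
 shows "\<exists>r::nat => nat. strict_mono r \<and> (AE x in lborel. (%n. rep_L2 (F (r n)) x) \<longlonglongrightarrow> rep_L2 f x)"
proof -
 define u where "u n x = (norm (rep_L2 (F n - f) x))\<^sup>2" for n x
 have iu: "integrable lborel (u n)" for n
  using square_integrable_rep[of "F n - f"] by (simp add: u_def[abs_def] square_integrable_def)
 have "(%n. norm (F n - f)) \<longlonglongrightarrow> 0" using assms by (intro tendsto_norm_zero LIM_zero)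
 then have "(%n. (norm (F n - f))\<^sup>2) \<longlonglongrightarrow> 0\<^sup>2" by (rule tendsto_power)
 moreover have "(norm (F n - f))\<^sup>2 = (LBINT x. norm (u n x))" for n
  unfolding norm_L2_rep by (subst real_sqrt_pow2) (simp_all add: u_def)
 ultimately have "(%n. (LBINT x. norm (u n x))) \<longlonglongrightarrow> 0" by simp
 from tendsto_L1_AE_subseq[OF iu this] obtain r :: "nat => nat"
  where r: "strict_mono r" "AE x in lborel. (%n. u (r n) x) \<longlonglongrightarrow> 0" by blast
 have "AE x in lborel. \<forall>n. rep_L2 (F (r n) - f) x = rep_L2 (F (r n)) x - rep_L2 f x"
  by (subst AE_all_countable) (intro allI rep_L2_diff)
 with r(2) have "AE x in lborel. (%n. rep_L2 (F (r n)) x) \<longlonglongrightarrow> rep_L2 f x"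
 proof eventually_elim
  case (elim x)
  have "(%n. sqrt (u (r n) x)) \<longlonglongrightarrow> sqrt 0" using elim(1) by (rule tendsto_real_sqrt)
  then have "(%n. norm (rep_L2 (F (r n)) x - rep_L2 f x)) \<longlonglongrightarrow> 0" using elim(2) by (simp add: u_def)
  then have "(%n. rep_L2 (F (r n)) x - rep_L2 f x) \<longlonglongrightarrow> 0" by (rule tendsto_norm_zero_cancel)
  then show ?case by (rule LIM_zero_cancel)
 qed
 with r(1) show ?thesis by blast
qed

section \<open>Weighted L^p spaces\<close>

definition ball_Lp :: "real => real => real => L2 => bool" where
 "ball_Lp p s r f \<longleftrightarrow> (NN x. ennreal ((bracket x powr s * norm (rep_L2 f x)) powr p)) <= ennreal (r powr p)"

lemma ball_Lp_iff:
 assumes p: "1 <= p" and r: "0 < r"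
 shows "f \<in> Lp_space p s \<and> Lp_norm p s f <= r \<longleftrightarrow> ball_Lp p s r f"
proof -
 define W where "W x = (bracket x powr s * norm (rep_L2 f x)) powr p" for x
 have [measurable]: "W \<in> bmeas" unfolding W_def[abs_def] by measurable
 have W0: "0 <= W x" for x by (simp add: W_def)
 have X: "f \<in> Lp_space p s \<longleftrightarrow> integrable lborel W" by (simp add: Lp_space_def weighted_Lp_def W_def[abs_def])
 have N: "Lp_norm p s f = (LBINT x. W x) powr (1 / p)" by (simp add: Lp_norm_def weighted_Lp_norm_def W_def)
 have *: "(LBINT x. W x) powr (1 / p) <= r \<longleftrightarrow> (LBINT x. W x) <= r powr p"
 proof -
  have I0: "0 <= (LBINT x. W x)" using W0 by simp
  have e: "(t powr (1 / p)) powr p = t" "(t powr p) powr (1 / p) = t" if "0 <= t" for t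
   using p that by (simp_all add: powr_powr)
  have rp: "0 <= r" "0 <= r powr p" "0 <= p" "0 <= 1 / p" using p r by simp_all
  show ?thesis
   using powr_mono2[of p "(LBINT x. W x) powr (1 / p)" r] powr_mono2[of "1 / p" "(LBINT x. W x)" "r powr p"]
    e[OF I0] e[OF rp(1)] rp I0 by auto
 qed
 show ?thesis
 proof
  assume a: "f \<in> Lp_space p s \<and> Lp_norm p s f <= r"
  then have "(NN x. ennreal (W x)) = ennreal (LBINT x. W x)"
   using X W0 by (intro nn_integral_eq_integral) auto
  then show "ball_Lp p s r f" using a * N by (simp add: ball_Lp_def W_def ennreal_leI)
 next
  assume b: "ball_Lp p s r f"
  then have le: "(NN x. ennreal (W x)) <= ennreal (r powr p)" by (simp add: ball_Lp_def W_def)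
  then have "(NN x. ennreal (W x)) < \<infinity>" by (rule order.strict_trans1) simp
  then have i: "integrable lborel W" using W0 by (intro integrableI_nonneg) auto
  then have "ennreal (LBINT x. W x) <= ennreal (r powr p)" using le W0 by (simp add: nn_integral_eq_integral)
  then have "(LBINT x. W x) <= r powr p" by simp
  then show "f \<in> Lp_space p s \<and> Lp_norm p s f <= r" using X i N * by simp
 qed
qed

text \<open>Convexity of t^p with weights proportional to a and b. Integrated, it is Minkowski's
  inequality for balls of radii a and b.\<close>

lemma powr_add_le:
 fixes p :: real
 assumes "1 <= p" "0 <= u" "0 <= v" "0 < a" "0 < b"
 shows "((u + v) / (a + b)) powr p <= a / (a + b) * (u / a) powr p + b / (a + b) * (v / b) powr p"
proof (cases "u = 0 \<or> v = 0")
 \<comment> \<open>The convexity argument runs on the open half-line; when u or v vanishes, t^p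
   \<le> t on [0, 1] takes its place.\<close>
 case True
 have le: "t powr p <= t" if "0 <= t" "t <= 1" for t
  using powr_mono'[of 1 p t] that assms(1) by simp
 have *: "(u / (a + b)) powr p <= a / (a + b) * (u / a) powr p" if "0 <= u" "0 < a" "0 < b" for u a b
 proof -
  have "(u / (a + b)) powr p = (a / (a + b)) powr p * (u / a) powr p"
   using that by (simp flip: powr_mult)
  also have "... <= a / (a + b) * (u / a) powr p"
   using that by (intro mult_right_mono le) auto
  finally show ?thesis .
 qed
 have p0: "p \<noteq> 0" using assms(1) by simp
 show ?thesis using True
 proof
  assume u: "u = 0"
  show ?thesis using *[of v b a] assms p0 by (simp add: u add.commute)
 next
  assume v: "v = 0"
  show ?thesis using *[of u a b] assms p0 by (simp add: v)
 qed
next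
 case False
 have c: "convex_on {0<..} (%x. x powr p)" by (rule powr_convex) fact
 have "((1 - b / (a + b)) *\<^sub>R (u / a) + (b / (a + b)) *\<^sub>R (v / b)) powr p <= (1 - b / (a + b)) * (u / a) powr p + b / (a + b) * (v / b) powr p"
  by (rule convex_onD[OF c]) (use assms False in auto)
 moreover have "1 - b / (a + b) = a / (a + b)" using assms by (simp add: field_simps)
 moreover have "(a / (a + b)) *\<^sub>R (u / a) + (b / (a + b)) *\<^sub>R (v / b) = (u + v) / (a + b)"
  using assms by (simp add: add_divide_distrib)
 ultimately show ?thesis by simp
qed

lemma ball_Lp_mono_AE:
 assumes "AE x in lborel. norm (rep_L2 g x) <= c * norm (rep_L2 f x)" "0 <= c" "ball_Lp p s r f" "0 < r" "c * r <= r'" "0 < p"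
 shows "ball_Lp p s r' g"
proof -
 have "(NN x. ennreal ((bracket x powr s * norm (rep_L2 g x)) powr p))
  <= (NN x. ennreal (c powr p) * ennreal ((bracket x powr s * norm (rep_L2 f x)) powr p))"
 proof (rule nn_integral_mono_AE)
  show "AE x in lborel. ennreal ((bracket x powr s * norm (rep_L2 g x)) powr p)
   <= ennreal (c powr p) * ennreal ((bracket x powr s * norm (rep_L2 f x)) powr p)"
   using assms(1)
  proof eventually_elim
   case (elim x)
   have "bracket x powr s * norm (rep_L2 g x) <= bracket x powr s * (c * norm (rep_L2 f x))"
    using elim by (intro mult_left_mono) auto
   then have "bracket x powr s * norm (rep_L2 g x) <= c * (bracket x powr s * norm (rep_L2 f x))" by (simp add: ac_simps)
   then have "(bracket x powr s * norm (rep_L2 g x)) powr p <= (c * (bracket x powr s * norm (rep_L2 f x))) powr p"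
    using assms by (intro powr_mono2) auto
   also have "... = c powr p * (bracket x powr s * norm (rep_L2 f x)) powr p" by (rule powr_mult)
   finally show ?case by (simp add: ennreal_leI flip: ennreal_mult)
  qed
 qed
 also have "... = ennreal (c powr p) * (NN x. ennreal ((bracket x powr s * norm (rep_L2 f x)) powr p))"
  by (rule nn_integral_cmult) measurable
 also have "... <= ennreal (c powr p) * ennreal (r powr p)"
  using assms(3) unfolding ball_Lp_def by (rule mult_left_mono) simp
 also have "... = ennreal ((c * r) powr p)" using assms by (simp add: powr_mult flip: ennreal_mult)
 also have "... <= ennreal (r' powr p)" using assms by (intro ennreal_leI powr_mono2) auto
 finally show ?thesis unfolding ball_Lp_def .
qed

lemma ball_Lp_add:
 assumes p: "1 <= p" and r: "0 < a" "0 < b" and B: "ball_Lp p s a f" "ball_Lp p s b g"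
 shows "ball_Lp p s (a + b) (f + g)"
proof -
 define U where "U h x = bracket x powr s * norm (rep_L2 h x)" for h x
 have U0: "0 <= U h x" for h x by (simp add: U_def)
 have [measurable]: "U h \<in> bmeas" for h unfolding U_def[abs_def] by measurable
 define A where "A = (a + b) powr p * (a / (a + b)) / a powr p"
 define D where "D = (a + b) powr p * (b / (a + b)) / b powr p"
 have AD: "0 <= A" "0 <= D" using r by (simp_all add: A_def D_def)
 have "(NN x. ennreal (U (f + g) x powr p)) <= (NN x. ennreal A * ennreal (U f x powr p) + ennreal D * ennreal (U g x powr p))"
 proof (rule nn_integral_mono_AE)
  show "AE x in lborel. ennreal (U (f + g) x powr p) <= ennreal A * ennreal (U f x powr p) + ennreal D * ennreal (U g x powr p)"
   using rep_L2_add[of f g]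
  proof eventually_elim
   case (elim x)
   have "U (f + g) x <= bracket x powr s * (norm (rep_L2 f x) + norm (rep_L2 g x))"
    unfolding U_def elim by (intro mult_left_mono norm_triangle_ineq) simp
   then have "U (f + g) x <= U f x + U g x" by (simp add: U_def distrib_left)
   then have "U (f + g) x powr p <= (U f x + U g x) powr p" using p U0 by (intro powr_mono2) auto
   also have "... = (a + b) powr p * ((U f x + U g x) / (a + b)) powr p" using r U0 by (simp add: powr_divide)
   also have "... <= (a + b) powr p * (a / (a + b) * (U f x / a) powr p + b / (a + b) * (U g x / b) powr p)"
    by (intro mult_left_mono powr_add_le p r U0) simp
   also have "... = A * U f x powr p + D * U g x powr p"
    using r U0[of f x] U0[of g x] by (simp add: A_def D_def powr_divide distrib_left)
   finally show ?case using AD by (simp add: ennreal_leI flip: ennreal_mult ennreal_plus)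
  qed
 qed
 also have "... = ennreal A * (NN x. ennreal (U f x powr p)) + ennreal D * (NN x. ennreal (U g x powr p))"
  by (simp add: nn_integral_add nn_integral_cmult)
 also have "... <= ennreal A * ennreal (a powr p) + ennreal D * ennreal (b powr p)"
  using B unfolding ball_Lp_def U_def[symmetric] by (intro add_mono mult_left_mono) auto
 also have "... = ennreal (A * a powr p + D * b powr p)" using AD by (simp flip: ennreal_mult ennreal_plus)
 also have "A * a powr p + D * b powr p = (a + b) powr p * ((a + b) / (a + b))"
  using r by (simp add: A_def D_def add_divide_distrib distrib_left del: divide_self_if)
 finally show ?thesis using r unfolding ball_Lp_def U_def by simp
qed

text \<open>Fatou's lemma along a subsequence that converges almost everywhere.\<close>

lemma ball_Lp_closed:
 assumes p: "0 < p" and B: "\<And>n. ball_Lp p s r (F n)" and F: "F \<longlonglongrightarrow> f"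
 shows "ball_Lp p s r f"
proof -
 obtain k :: "nat => nat" where k: "AE x in lborel. (%n. rep_L2 (F (k n)) x) \<longlonglongrightarrow> rep_L2 f x"
  using L2_tendsto_AE_subseq[OF F] by blast
 define U where "U h x = ennreal ((bracket x powr s * norm (rep_L2 h x)) powr p)" for h x
 have [measurable]: "U h \<in> bmeas" for h unfolding U_def[abs_def] by measurable
 have "(NN x. U f x) = (NN x. liminf (%n. U (F (k n)) x))"
 proof (rule nn_integral_cong_AE)
  show "AE x in lborel. U f x = liminf (%n. U (F (k n)) x)"
   using k
  proof eventually_elim
   case (elim x)
   have "(%n. (bracket x powr s * norm (rep_L2 (F (k n)) x)) powr p) \<longlonglongrightarrow> (bracket x powr s * norm (rep_L2 f x)) powr p"
    by (rule tendsto_powr') (use p in \<open>auto intro!: tendsto_intros elim\<close>)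
   then have "(%n. U (F (k n)) x) \<longlonglongrightarrow> U f x" unfolding U_def by (rule tendsto_ennrealI)
   then show ?case by (simp add: lim_imp_Liminf)
  qed
 qed
 also have "... <= liminf (%n. (NN x. U (F (k n)) x))" by (rule nn_integral_liminf) measurable
 also have "... <= liminf (%n. ennreal (r powr p))"
  using B unfolding ball_Lp_def U_def by (intro Liminf_mono always_eventually) auto
 also have "... = ennreal (r powr p)" by (simp add: Liminf_const)
 finally show ?thesis unfolding ball_Lp_def U_def .
qed

lemma norm_powr2: "ball_Lp 2 0 r f \<longleftrightarrow> norm f <= r" if "0 < r"
proof -
 have n: "Lp_norm 2 0 f = norm f"
  unfolding Lp_norm_def weighted_Lp_norm_def norm_L2_rep
  using bracket_pos by (simp add: powr_half_sqrt less_imp_neq[symmetric])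
 have "f \<in> Lp_space 2 0"
  using square_integrable_rep[of f] bracket_pos
  by (simp add: Lp_space_def weighted_Lp_def square_integrable_def less_imp_neq[symmetric])
 then show ?thesis using ball_Lp_iff[of 2 r f 0] that n by simp
qed

text \<open>Up to r^2, the square of |f| is V^2 times bracket^(-2s). Young's inequality with
  exponents p/2 and p/(p - 2) separates the two, and m = 2 s p / (p - 2) > 1 is the condition s >
  1/2 - 1/p.\<close>

lemma ball_Lp_embedding:
 assumes p: "2 <= p" and s: "1 / 2 - 1 / p < s \<or> (p = 2 \<and> 0 <= s)"
 shows "\<exists>C>0. \<forall>r>0. \<forall>f. ball_Lp p s r f --> norm f <= C * r"
proof (cases "p = 2")
 case True
 have s0: "0 <= s" using s True by auto
 have "norm f <= r" if r: "0 < r" and B: "ball_Lp p s r f" for r f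
 proof -
  have "(NN x. ennreal ((bracket x powr 0 * norm (rep_L2 f x)) powr 2)) <= (NN x. ennreal ((bracket x powr s * norm (rep_L2 f x)) powr 2))"
   using s0 bracket_ge_1 by (intro nn_integral_mono ennreal_leI powr_mono2 mult_right_mono powr_mono) auto
  then have "ball_Lp 2 0 r f" using B unfolding ball_Lp_def True by (rule order_trans)
  then show ?thesis using norm_powr2[OF r] by simp
 qed
 then show ?thesis by (intro exI[of _ 1]) auto
next
 case False
 then have p2: "2 < p" using p by simp
 then have s: "1 / 2 - 1 / p < s" using s by auto
 define m where "m = 2 * s * p / (p - 2)"
 have m: "1 < m"
 proof -
  have "p * (1 / 2 - 1 / p) < p * s" using s p2 by (intro mult_strict_left_mono) auto
  moreover have "p * (1 / 2 - 1 / p) = p / 2 - 1" using p2 by (simp add: right_diff_distrib)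
  ultimately have "p - 2 < 2 * s * p" by (simp add: algebra_simps)
  then show ?thesis using p2 by (simp add: m_def)
 qed
 define M where "M = (LBINT x. bracket x powr (- m))"
 have M: "(NN x. ennreal (bracket x powr (- m))) = ennreal M" "0 <= M"
 proof -
  show "(NN x. ennreal (bracket x powr (- m))) = ennreal M"
   unfolding M_def using integrable_bracket_powr[OF m] by (intro nn_integral_eq_integral) auto
  show "0 <= M" unfolding M_def by simp
 qed
 have "norm f <= (M + 1) * r" if r: "0 < r" and B: "ball_Lp p s r f" for r f
 proof -
  define V where "V x = bracket x powr s * norm (rep_L2 f x) / r" for x
  have V0: "0 <= V x" for x using r by (simp add: V_def)
  have [measurable]: "V \<in> bmeas" unfolding V_def[abs_def] by measurable
  have pt: "(bracket x powr 0 * norm (rep_L2 f x)) powr 2 <= r\<^sup>2 * (V x powr p + bracket x powr (- m))" for x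
  proof -
   have "(V x)\<^sup>2 * bracket x powr (- (2 * s)) <= ((V x)\<^sup>2) powr (p / 2) / (p / 2) + (bracket x powr (- (2 * s))) powr (p / (p - 2)) / (p / (p - 2))"
    by (rule Youngs_inequality) (use p2 in \<open>auto simp: field_simps\<close>)
   also have "... <= ((V x)\<^sup>2) powr (p / 2) + (bracket x powr (- (2 * s))) powr (p / (p - 2))"
   proof -
    have d: "x / c <= x" if "0 <= x" "1 <= c" for x c :: real
     using that mult_left_mono[of 1 c x] by (simp add: divide_le_eq)
    show ?thesis using p2 by (intro add_mono d) auto
   qed
   also have "((V x)\<^sup>2) powr (p / 2) = V x powr p"
    using V0[of x] by (simp add: powr_powr flip: powr_numeral)
   also have "(bracket x powr (- (2 * s))) powr (p / (p - 2)) = bracket x powr (- m)"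
    by (simp add: powr_powr m_def)
   finally have "r\<^sup>2 * ((V x)\<^sup>2 * bracket x powr (- (2 * s))) <= r\<^sup>2 * (V x powr p + bracket x powr (- m))"
    by (rule mult_left_mono) simp
   moreover have "bracket x powr (- (2 * s)) = 1 / (bracket x powr s)\<^sup>2"
    by (simp add: powr_minus_divide power2_eq_square flip: powr_add)
   moreover have "r\<^sup>2 * ((V x)\<^sup>2 * (1 / (bracket x powr s)\<^sup>2)) = (norm (rep_L2 f x))\<^sup>2"
    using r bracket_pos[of x] by (simp add: V_def power_divide power_mult_distrib)
   ultimately show ?thesis using bracket_pos[of x] by (simp add: less_imp_neq[symmetric])
  qed
  have VI: "(NN x. ennreal (V x powr p)) <= 1"
  proof -
   have "(NN x. ennreal (V x powr p)) = (NN x. ennreal (1 / r powr p) * ennreal ((bracket x powr s * norm (rep_L2 f x)) powr p))"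
    using r by (intro nn_integral_cong) (simp add: V_def powr_divide flip: ennreal_mult)
   also have "... = ennreal (1 / r powr p) * (NN x. ennreal ((bracket x powr s * norm (rep_L2 f x)) powr p))"
    by (rule nn_integral_cmult) measurable
   also have "... <= ennreal (1 / r powr p) * ennreal (r powr p)"
    using B unfolding ball_Lp_def by (rule mult_left_mono) simp
   also have "... = 1" using r by (simp flip: ennreal_mult)
   finally show ?thesis .
  qed
  have "(NN x. ennreal ((bracket x powr 0 * norm (rep_L2 f x)) powr 2))
    <= (NN x. ennreal (r\<^sup>2) * (ennreal (V x powr p) + ennreal (bracket x powr (- m))))"
  proof (rule nn_integral_mono)
   fix x
   have "ennreal ((bracket x powr 0 * norm (rep_L2 f x)) powr 2) <= ennreal (r\<^sup>2 * (V x powr p + bracket x powr (- m)))"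
    by (rule ennreal_leI[OF pt])
   then show "ennreal ((bracket x powr 0 * norm (rep_L2 f x)) powr 2) <= ennreal (r\<^sup>2) * (ennreal (V x powr p) + ennreal (bracket x powr (- m)))"
    by (simp add: ennreal_mult ennreal_plus)
  qed
  also have "... = ennreal (r\<^sup>2) * ((NN x. ennreal (V x powr p)) + (NN x. ennreal (bracket x powr (- m))))"
   by (simp add: nn_integral_add nn_integral_cmult)
  also have "... <= ennreal (r\<^sup>2) * (ennreal 1 + ennreal M)"
   unfolding M using VI by (intro mult_left_mono add_mono) auto
  also have "... = ennreal (r\<^sup>2 * (1 + M))" using M by (simp add: ennreal_mult ennreal_plus)
  also have "... <= ennreal (((M + 1) * r) powr 2)"
  proof (rule ennreal_leI)
   have "1 + M <= (M + 1)\<^sup>2" using M(2) mult_nonneg_nonneg[OF M(2) M(2)] by (simp add: power2_eq_square algebra_simps)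
   then have "r\<^sup>2 * (1 + M) <= r\<^sup>2 * (M + 1)\<^sup>2" by (rule mult_left_mono) simp
   then show "r\<^sup>2 * (1 + M) <= ((M + 1) * r) powr 2" using M r by (simp add: power_mult_distrib ac_simps)
  qed
  finally have "ball_Lp 2 0 ((M + 1) * r) f" unfolding ball_Lp_def .
  then show ?thesis using norm_powr2[of "(M + 1) * r"] M r by (simp add: add_nonneg_pos)
 qed
 then show ?thesis using M(2) by (intro exI[of _ "M + 1"]) auto
qed

definition weighted_abs :: "real => L2 => real => ennreal" where
 "weighted_abs s f x = ennreal (bracket x powr s * norm (rep_L2 f x))"

lemma measurable_weighted_abs [measurable]: "weighted_abs s f \<in> bmeas"
 unfolding weighted_abs_def[abs_def] by measurable

lemma weighted_abs_0: "weighted_abs 0 f = (%x. ennreal (norm (rep_L2 f x)))"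
 using bracket_pos by (simp add: weighted_abs_def fun_eq_iff less_imp_neq[symmetric])

lemma weighted_T_bound:
 assumes a: "a = 0 \<or> a = - (pi / 4)" and s: "0 <= s"
 shows "AE x in lborel. weighted_abs s (T_from a f g h) x <= ennreal (4 * 3 powr s) *
  (Tplus (weighted_abs s f) (weighted_abs 0 g) (weighted_abs 0 h) x
   + Tplus (weighted_abs 0 f) (weighted_abs s g) (weighted_abs 0 h) x
   + Tplus (weighted_abs 0 f) (weighted_abs 0 g) (weighted_abs s h) x)"
 using T_from_pointwise[OF a, of f g h]
proof eventually_elim
 case (elim x)
 have W: "(%y. ennreal (bracket y powr s) * weighted_abs 0 f y) = weighted_abs s f" for f
  by (simp add: weighted_abs_0 fun_eq_iff) (simp add: weighted_abs_def ennreal_mult)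
 have "weighted_abs s (T_from a f g h) x = ennreal (bracket x powr s) * ennreal (norm (rep_L2 (T_from a f g h) x))"
  by (simp add: weighted_abs_def ennreal_mult)
 also have "... <= ennreal (bracket x powr s) * (4 * Tplus (weighted_abs 0 f) (weighted_abs 0 g) (weighted_abs 0 h) x)"
  using elim unfolding weighted_abs_0 by (rule mult_left_mono) simp
 also have "... = 4 * (ennreal (bracket x powr s) * Tplus (weighted_abs 0 f) (weighted_abs 0 g) (weighted_abs 0 h) x)"
  by (simp only: mult.left_commute)
 also have "... <= 4 * (ennreal (3 powr s) * (Tplus (weighted_abs s f) (weighted_abs 0 g) (weighted_abs 0 h) x
   + Tplus (weighted_abs 0 f) (weighted_abs s g) (weighted_abs 0 h) x
   + Tplus (weighted_abs 0 f) (weighted_abs 0 g) (weighted_abs s h) x))"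
  using Tplus_weight[of "weighted_abs 0 f" "weighted_abs 0 g" "weighted_abs 0 h" s x] s
  unfolding W by (intro mult_left_mono) auto
 finally show ?case by (simp add: ennreal_mult mult.assoc)
qed

text \<open>\<open>Tplus\<close> takes extended values and may be infinite on a null set; the real
  majorant u carries the p-th power.\<close>

definition Lp_dominated :: "real => real => (real => ennreal) => bool" where
 "Lp_dominated p d F \<longleftrightarrow> 0 <= d \<and> (\<exists>u. u \<in> bmeas \<and> (\<forall>x. 0 <= u x) \<and>
   (AE x in lborel. F x <= ennreal (u x)) \<and> (NN x. ennreal (u x powr p)) <= ennreal (d powr p))"

text \<open>Origin of the 9: one factor 3 bounds the sum of three majorants by their maximum, the
  other, through 3 \<le> 3^p, bounds the sum of three p-th powers.\<close>

lemma ball_Lp_of_dominated: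
 assumes p: "1 <= p" and c: "0 <= c"
  and le: "AE x in lborel. weighted_abs s f x <= ennreal c * (F1 x + F2 x + F3 x)"
  and F: "Lp_dominated p d1 F1" "Lp_dominated p d2 F2" "Lp_dominated p d3 F3"
 shows "ball_Lp p s (9 * c * (d1 + d2 + d3)) f"
proof -
 obtain u1 where u1: "u1 \<in> bmeas" "\<And>x. 0 <= u1 x" "AE x in lborel. F1 x <= ennreal (u1 x)"
  "(NN x. ennreal (u1 x powr p)) <= ennreal (d1 powr p)" "0 <= d1"
  using F(1) by (auto simp: Lp_dominated_def)
 obtain u2 where u2: "u2 \<in> bmeas" "\<And>x. 0 <= u2 x" "AE x in lborel. F2 x <= ennreal (u2 x)"
  "(NN x. ennreal (u2 x powr p)) <= ennreal (d2 powr p)" "0 <= d2"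
  using F(2) by (auto simp: Lp_dominated_def)
 obtain u3 where u3: "u3 \<in> bmeas" "\<And>x. 0 <= u3 x" "AE x in lborel. F3 x <= ennreal (u3 x)"
  "(NN x. ennreal (u3 x powr p)) <= ennreal (d3 powr p)" "0 <= d3"
  using F(3) by (auto simp: Lp_dominated_def)
 note [measurable] = u1(1) u2(1) u3(1)
 define D where "D = d1 + d2 + d3"
 have "(NN x. ennreal ((bracket x powr s * norm (rep_L2 f x)) powr p))
  <= (NN x. ennreal ((3 * c) powr p) * (ennreal (u1 x powr p) + ennreal (u2 x powr p) + ennreal (u3 x powr p)))"
 proof (rule nn_integral_mono_AE)
  show "AE x in lborel. ennreal ((bracket x powr s * norm (rep_L2 f x)) powr p)
   <= ennreal ((3 * c) powr p) * (ennreal (u1 x powr p) + ennreal (u2 x powr p) + ennreal (u3 x powr p))"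
   using le u1(3) u2(3) u3(3)
  proof eventually_elim
   case (elim x)
   define m where "m = max (u1 x) (max (u2 x) (u3 x))"
   have m: "0 <= m" "u1 x + u2 x + u3 x <= 3 * m" "m powr p <= u1 x powr p + u2 x powr p + u3 x powr p"
    using u1(2)[of x] by (auto simp: m_def max_def)
   have "weighted_abs s f x <= ennreal c * (ennreal (u1 x) + ennreal (u2 x) + ennreal (u3 x))"
    using elim by (intro order_trans[OF elim(1)] mult_left_mono add_mono) auto
   also have "... = ennreal (c * (u1 x + u2 x + u3 x))"
    using c u1(2) u2(2) u3(2) by (simp add: ennreal_mult)
   finally have "bracket x powr s * norm (rep_L2 f x) <= c * (u1 x + u2 x + u3 x)"
    unfolding weighted_abs_def using c u1(2)[of x] u2(2)[of x] u3(2)[of x] by (subst (asm) ennreal_le_iff) auto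
   also have "... <= c * (3 * m)" by (rule mult_left_mono[OF m(2) c])
   finally have "(bracket x powr s * norm (rep_L2 f x)) powr p <= (3 * c * m) powr p"
    using p by (intro powr_mono2) (auto simp: ac_simps)
   also have "... = (3 * c) powr p * m powr p" by (rule powr_mult)
   also have "... <= (3 * c) powr p * (u1 x powr p + u2 x powr p + u3 x powr p)" by (intro mult_left_mono m) simp
   finally show ?case by (simp add: ennreal_leI flip: ennreal_mult ennreal_plus)
  qed
 qed
 also have "... = ennreal ((3 * c) powr p) * ((NN x. ennreal (u1 x powr p)) + (NN x. ennreal (u2 x powr p)) + (NN x. ennreal (u3 x powr p)))"
  by (simp add: nn_integral_add nn_integral_cmult)
 also have "... <= ennreal ((3 * c) powr p) * (ennreal (D powr p) + ennreal (D powr p) + ennreal (D powr p))"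
 proof (intro mult_left_mono add_mono)
  have le: "ennreal (d powr p) <= ennreal (D powr p)" if "0 <= d" "d <= D" for d
   using that p by (intro ennreal_leI powr_mono2) auto
  show "(NN x. ennreal (u1 x powr p)) <= ennreal (D powr p)"
   by (rule order_trans[OF u1(4) le]) (use u1(5) u2(5) u3(5) in \<open>auto simp: D_def\<close>)
  show "(NN x. ennreal (u2 x powr p)) <= ennreal (D powr p)"
   by (rule order_trans[OF u2(4) le]) (use u1(5) u2(5) u3(5) in \<open>auto simp: D_def\<close>)
  show "(NN x. ennreal (u3 x powr p)) <= ennreal (D powr p)"
   by (rule order_trans[OF u3(4) le]) (use u1(5) u2(5) u3(5) in \<open>auto simp: D_def\<close>)
 qed simp
 also have "... = ennreal ((3 * c) powr p * (3 * D powr p))"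
  by (simp flip: ennreal_mult ennreal_plus)
 also have "... <= ennreal ((9 * c * D) powr p)"
 proof (rule ennreal_leI)
  have "(3::real) powr 1 <= 3 powr p" using p by (intro powr_mono) auto
  then have "(3 * c) powr p * (3 * D powr p) <= (3 * c) powr p * (3 powr p * D powr p)"
   by (intro mult_left_mono mult_right_mono) auto
  also have "... = (9 * c * D) powr p" by (simp add: mult.assoc flip: powr_mult)
  finally show "(3 * c) powr p * (3 * D powr p) <= (9 * c * D) powr p" .
 qed
 finally show ?thesis unfolding ball_Lp_def D_def .
qed

lemma Lp_dominated_square:
 assumes [measurable]: "F \<in> bmeas" and F: "(NN x. (F x)\<^sup>2) <= ennreal (d\<^sup>2)" and d: "0 <= d"
 shows "Lp_dominated 2 d F"
proof -
 have "AE x in lborel. (F x)\<^sup>2 \<noteq> \<infinity>"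
  by (rule nn_integral_PInf_AE) (use F in \<open>auto simp: top_unique\<close>)
 then have ae: "AE x in lborel. F x = ennreal (enn2real (F x))"
  by eventually_elim (auto simp: ennreal_enn2real_if ennreal_top_mult power2_eq_square)
 have "(NN x. ennreal (enn2real (F x) powr 2)) = (NN x. (F x)\<^sup>2)"
 proof (rule nn_integral_cong_AE)
  show "AE x in lborel. ennreal (enn2real (F x) powr 2) = (F x)\<^sup>2"
   using ae
  proof eventually_elim
   case (elim x)
   have "ennreal (enn2real (F x) powr 2) = (ennreal (enn2real (F x)))\<^sup>2" by (simp add: ennreal_power)
   then show ?case using elim by simp
  qed
 qed
 then show ?thesis unfolding Lp_dominated_def using F d ae
  by (intro conjI exI[of _ "%x. enn2real (F x)"]) (auto elim!: eventually_mono)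
qed

lemma weighted_abs_square:
 assumes "ball_Lp 2 s r f" "0 < r"
 shows "(NN x. (weighted_abs s f x)\<^sup>2) <= ennreal (r\<^sup>2)"
 using assms by (simp add: ball_Lp_def weighted_abs_def ennreal_power)

text \<open>\<open>Tplus_L2\<close> asks for L^2 in each slot, so the weight falls on one factor at
  a time and the other two are measured in L^2. Linearity in the weighted radii is what persistence
  of regularity requires. The windows starting at -pi/4 and at 0 serve the weighted and the Sobolev
  spaces respectively.\<close>

lemma ball_L2_T_tame:
 assumes s: "0 <= s"
 shows "\<exists>C>0. \<forall>f g h r r' r'' \<rho> \<rho>' \<rho>'' a. 0 < r --> 0 < r' --> 0 < r'' --> 0 < \<rho> --> 0 < \<rho>' --> 0 < \<rho>'' -->
  ball_Lp 2 s r f --> ball_Lp 2 s r' g --> ball_Lp 2 s r'' h --> norm f <= \<rho> --> norm g <= \<rho>' --> norm h <= \<rho>'' -->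
  a = 0 \<or> a = - (pi / 4) --> ball_Lp 2 s (C * (r * \<rho>' * \<rho>'' + \<rho> * r' * \<rho>'' + \<rho> * \<rho>' * r'')) (T_from a f g h)"
proof -
 obtain P where P: "Psi_const = ennreal P" "0 <= P" using Psi_const_finite by (cases Psi_const) auto
 have dom: "Lp_dominated 2 (P * (r * r' * r'')) (Tplus F G H)"
  if [measurable]: "F \<in> bmeas" "G \<in> bmeas" "H \<in> bmeas"
  and "(NN x. (F x)\<^sup>2) <= ennreal (r\<^sup>2)" "(NN x. (G x)\<^sup>2) <= ennreal (r'\<^sup>2)"
   "(NN x. (H x)\<^sup>2) <= ennreal (r''\<^sup>2)" "0 < r" "0 < r'" "0 < r''" for F G H r r' r''
 proof (rule Lp_dominated_square)
  have "(NN x. (Tplus F G H x)\<^sup>2) <= Psi_const\<^sup>2 * ((NN x. (F x)\<^sup>2) * (NN x. (G x)\<^sup>2) * (NN x. (H x)\<^sup>2))"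
   by (rule Tplus_L2) measurable
  also have "... <= (ennreal P)\<^sup>2 * (ennreal (r\<^sup>2) * ennreal (r'\<^sup>2) * ennreal (r''\<^sup>2))"
   unfolding P(1) using that by (intro mult_left_mono mult_mono) auto
  also have "... = ennreal ((P * (r * r' * r''))\<^sup>2)"
   using P(2) by (simp add: ennreal_power power_mult_distrib flip: ennreal_mult)
  finally show "(NN x. (Tplus F G H x)\<^sup>2) <= ennreal ((P * (r * r' * r''))\<^sup>2)" .
  show "0 <= P * (r * r' * r'')" using that P by simp
 qed measurable
 define C where "C = 9 * (4 * 3 powr s) * (P + 1)"
 have C: "0 < C" using P by (simp add: C_def)
 have "ball_Lp 2 s (C * (r * \<rho>' * \<rho>'' + \<rho> * r' * \<rho>'' + \<rho> * \<rho>' * r'')) (T_from a f g h)"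
  if pos: "0 < r" "0 < r'" "0 < r''" "0 < \<rho>" "0 < \<rho>'" "0 < \<rho>''"
  and B: "ball_Lp 2 s r f" "ball_Lp 2 s r' g" "ball_Lp 2 s r'' h" "norm f <= \<rho>" "norm g <= \<rho>'" "norm h <= \<rho>''"
  and a: "a = 0 \<or> a = - (pi / 4)" for f g h r r' r'' \<rho> \<rho>' \<rho>'' a
 proof -
  have B0: "ball_Lp 2 0 \<rho> f" "ball_Lp 2 0 \<rho>' g" "ball_Lp 2 0 \<rho>'' h" using B pos by (simp_all add: norm_powr2)
  note W = weighted_abs_square[OF B(1) pos(1)] weighted_abs_square[OF B(2) pos(2)] weighted_abs_square[OF B(3) pos(3)]
  note W0 = weighted_abs_square[OF B0(1) pos(4)] weighted_abs_square[OF B0(2) pos(5)] weighted_abs_square[OF B0(3) pos(6)]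
  let ?S = "P * (r * \<rho>' * \<rho>'') + P * (\<rho> * r' * \<rho>'') + P * (\<rho> * \<rho>' * r'')"
  have b: "ball_Lp 2 s (9 * (4 * 3 powr s) * ?S) (T_from a f g h)"
  proof (rule ball_Lp_of_dominated[OF _ _ weighted_T_bound[OF a s]])
   show "Lp_dominated 2 (P * (r * \<rho>' * \<rho>'')) (Tplus (weighted_abs s f) (weighted_abs 0 g) (weighted_abs 0 h))"
    by (rule dom[OF _ _ _ W(1) W0(2,3) pos(1,5,6)]) measurable
   show "Lp_dominated 2 (P * (\<rho> * r' * \<rho>'')) (Tplus (weighted_abs 0 f) (weighted_abs s g) (weighted_abs 0 h))"
    by (rule dom[OF _ _ _ W0(1) W(2) W0(3) pos(4,2,6)]) measurable
   show "Lp_dominated 2 (P * (\<rho> * \<rho>' * r'')) (Tplus (weighted_abs 0 f) (weighted_abs 0 g) (weighted_abs s h))"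
    by (rule dom[OF _ _ _ W0(1,2) W(3) pos(4,5,3)]) measurable
  qed auto
  define E where "E = r * \<rho>' * \<rho>'' + \<rho> * r' * \<rho>'' + \<rho> * \<rho>' * r''"
  have E: "0 <= E" using pos by (simp add: E_def)
  have "?S = P * E" by (simp add: E_def distrib_left)
  then have le: "9 * (4 * 3 powr s) * ?S <= C * E" "0 <= 9 * (4 * 3 powr s) * ?S"
   using P E by (simp_all add: C_def mult_right_mono)
  show ?thesis unfolding E_def[symmetric] using b unfolding ball_Lp_def
   by (rule order_trans) (intro ennreal_leI powr_mono2 le, simp)
 qed
 note main = this
 show ?thesis by (rule exI[of _ C], intro conjI allI impI C, rule main, assumption+)
qed

text \<open>The weighted factor takes the slot of Schur's test, and the other two are measured in
  the Kato norm, finite by \<open>Kato_Lp\<close>. A weighted first factor is moved to the second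
  slot by \<open>Tplus_commute\<close>.\<close>

lemma ball_Lp_T:
 assumes p: "2 < p" and s: "1 / 2 - 1 / p < s"
 shows "\<exists>C>0. \<forall>f g h r r' r'' a. 0 < r --> 0 < r' --> 0 < r'' -->
  ball_Lp p s r f --> ball_Lp p s r' g --> ball_Lp p s r'' h -->
  a = 0 \<or> a = - (pi / 4) --> ball_Lp p s (C * r * r' * r'') (T_from a f g h)"
proof -
 have "1 / p < 1 / 2" using p by (intro divide_strict_left_mono) auto
 then have s0: "0 <= s" using s by linarith
 obtain K where K0: "0 < K" and K1: "\<forall>f N. f \<in> bmeas --> (\<forall>y. 0 <= f y) --> 0 < N -->
  (NN y. ennreal ((bracket y powr s * f y) powr p)) <= ennreal (N powr p) --> Kato (%y. ennreal (f y)) <= ennreal (K * N)"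
  using Kato_Lp[OF p s] by blast
 have K: "Kato (weighted_abs 0 f) <= ennreal (K * r)" if "0 < r" "ball_Lp p s r f" for f r
  unfolding weighted_abs_0 using that K1[rule_format, of "%x. norm (rep_L2 f x)" r] by (simp add: ball_Lp_def)
 have KK: "Kato (weighted_abs 0 f) * Kato (weighted_abs 0 g) <= ennreal (K * r * (K * r'))"
  if "0 < r" "ball_Lp p s r f" "0 < r'" "ball_Lp p s r' g" for f g r r'
 proof -
  have "Kato (weighted_abs 0 f) * Kato (weighted_abs 0 g) <= ennreal (K * r) * ennreal (K * r')"
   by (intro mult_mono K that) auto
  then show ?thesis using K0 that by (simp add: ennreal_mult)
 qed
 have dom: "Lp_dominated p (2 * K\<^sup>2 * (r * r' * r'')) (\<I> (weighted_abs s f))"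
  if pos: "0 < r" "0 < r'" "0 < r''" and B: "ball_Lp p s r f" "ball_Lp p s r' g" "ball_Lp p s r'' h"
  and \<I>: "\<I> = (%G. Tplus (weighted_abs 0 g) G (weighted_abs 0 h)) \<or> \<I> = (%G. Tplus (weighted_abs 0 g) (weighted_abs 0 h) G)"
  for f g h r r' r'' \<I>
 proof -
  have A: "0 < K * r' * (K * r'')" using pos K0 by simp
  have W: "weighted_abs s f = (%x. ennreal (bracket x powr s * norm (rep_L2 f x)))"
   by (simp add: weighted_abs_def fun_eq_iff)
  have e: "(2 * (K * r' * (K * r''))) powr p * r powr p = (2 * K\<^sup>2 * (r * r' * r'')) powr p"
   unfolding powr_mult[symmetric] by (simp add: power2_eq_square ac_simps)
  have "0 <= 2 * K\<^sup>2 * (r * r' * r'')" using pos by simp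
  moreover have "\<exists>u. u \<in> bmeas \<and> (\<forall>x. 0 <= u x) \<and>
    (AE x in lborel. \<I> (%x. ennreal (bracket x powr s * norm (rep_L2 f x))) x <= ennreal (u x)) \<and>
    (NN x. ennreal (u x powr p)) <= ennreal ((2 * (K * r' * (K * r''))) powr p * r powr p)"
   by (rule schur_Tplus[OF _ _ _ _ _ KK[OF pos(2) B(2) pos(3) B(3)] A _ _ \<I>])
    (use p B(1) in \<open>auto simp: ball_Lp_def\<close>)
  ultimately show ?thesis unfolding Lp_dominated_def W e by blast
 qed
 define C where "C = 9 * (4 * 3 powr s) * (3 * (2 * K\<^sup>2))"
 have C: "0 < C" using K0 by (simp add: C_def)
 have "ball_Lp p s (C * r * r' * r'') (T_from a f g h)"
  if pos: "0 < r" "0 < r'" "0 < r''" and B: "ball_Lp p s r f" "ball_Lp p s r' g" "ball_Lp p s r'' h"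
  and a: "a = 0 \<or> a = - (pi / 4)" for f g h r r' r'' a
 proof -
  let ?d = "2 * K\<^sup>2 * (r * r' * r'')"
  have 1: "Lp_dominated p ?d (Tplus (weighted_abs s f) (weighted_abs 0 g) (weighted_abs 0 h))"
  proof -
   have "Tplus (weighted_abs s f) (weighted_abs 0 g) (weighted_abs 0 h) = Tplus (weighted_abs 0 g) (weighted_abs s f) (weighted_abs 0 h)"
    by (intro ext Tplus_commute) measurable
   then show ?thesis using dom[OF pos B, of "%G. Tplus (weighted_abs 0 g) G (weighted_abs 0 h)"] by simp
  qed
  have 2: "Lp_dominated p ?d (Tplus (weighted_abs 0 f) (weighted_abs s g) (weighted_abs 0 h))"
   using dom[OF pos(2,1,3) B(2,1,3), of "%G. Tplus (weighted_abs 0 f) G (weighted_abs 0 h)"] by (simp add: ac_simps)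
  have 3: "Lp_dominated p ?d (Tplus (weighted_abs 0 f) (weighted_abs 0 g) (weighted_abs s h))"
   using dom[OF pos(3,1,2) B(3,1,2), of "%G. Tplus (weighted_abs 0 f) (weighted_abs 0 g) G"] by (simp add: ac_simps)
  have "ball_Lp p s (9 * (4 * 3 powr s) * (?d + ?d + ?d)) (T_from a f g h)"
   by (rule ball_Lp_of_dominated[OF _ _ weighted_T_bound[OF a s0] 1 2 3]) (use p in auto)
  moreover have "9 * (4 * 3 powr s) * (?d + ?d + ?d) = C * r * r' * r''" by (simp add: C_def)
  ultimately show ?thesis by (simp only:)
 qed
 note main = this
 show ?thesis by (rule exI[of _ C], intro conjI allI impI C, rule main, assumption+)
qed

section \<open>Weighted spaces of bounded functions\<close>

lemma Tplus_mono_AE1: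
 assumes "AE y in lborel. F y <= F' y" shows "Tplus F G H x <= Tplus F' G H x"
 unfolding Tplus_def
proof (rule nn_integral_mono)
 fix w
 show "(NN y. kern (y - x) * kern (w - y) * (F y * G (x + w - y) * H w)) <= (NN y. kern (y - x) * kern (w - y) * (F' y * G (x + w - y) * H w))"
  by (rule nn_integral_mono_AE) (use assms in \<open>auto intro!: mult_mono elim!: eventually_mono\<close>)
qed

lemma Tplus_mono_AE3:
 assumes "AE y in lborel. H y <= H' y" shows "Tplus F G H x <= Tplus F G H' x"
 unfolding Tplus_def
 by (rule nn_integral_mono_AE) (use assms in \<open>auto intro!: nn_integral_mono mult_mono elim!: eventually_mono\<close>)

definition ball_Linf :: "real => real => L2 => bool" where
 "ball_Linf s r f \<longleftrightarrow> (AE x in lborel. bracket x powr s * norm (rep_L2 f x) <= r)"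

lemma weighted_esssup_nonneg: "0 <= weighted_esssup s f"
proof -
 have "esssup lborel (%_::real. 0::ereal) = 0" by (rule esssup_const) simp
 moreover have "esssup lborel (%_::real. 0::ereal) <= weighted_esssup s f"
  unfolding weighted_esssup_def by (rule esssup_mono) auto
 ultimately show ?thesis by simp
qed

lemma ball_Linf_iff: "f \<in> Linf_space s \<and> Linf_norm s f <= r \<longleftrightarrow> ball_Linf s r f"
proof
 assume a: "f \<in> Linf_space s \<and> Linf_norm s f <= r"
 have "weighted_esssup s (rep_L2 f) <= ereal r"
  using a weighted_esssup_nonneg[of s "rep_L2 f"]
  by (cases "weighted_esssup s (rep_L2 f)") (auto simp: Linf_space_def weighted_Linf_def Linf_norm_def)
 moreover have "AE x in lborel. ereal (bracket x powr s * norm (rep_L2 f x)) <= weighted_esssup s (rep_L2 f)"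
  unfolding weighted_esssup_def by (rule esssup_AE)
 ultimately show "ball_Linf s r f"
  unfolding ball_Linf_def by (auto elim!: eventually_mono) (metis ereal_less_eq(3) order_trans)
next
 assume "ball_Linf s r f"
 then have "weighted_esssup s (rep_L2 f) <= ereal r"
  unfolding weighted_esssup_def ball_Linf_def by (intro esssup_I) auto
 then show "f \<in> Linf_space s \<and> Linf_norm s f <= r"
  using weighted_esssup_nonneg[of s "rep_L2 f"]
  by (cases "weighted_esssup s (rep_L2 f)") (auto simp: Linf_space_def weighted_Linf_def Linf_norm_def)
qed

lemma ball_Linf_embedding:
 assumes s: "1 / 2 < s"
 shows "\<exists>C>0. \<forall>r>0. \<forall>f. ball_Linf s r f --> norm f <= C * r"
proof -
 define M where "M = (LBINT x. bracket x powr (- (2 * s)))"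
 have M: "(NN x. ennreal (bracket x powr (- (2 * s)))) = ennreal M" "0 <= M"
 proof -
  have "integrable lborel (%x. bracket x powr (- (2 * s)))" by (rule integrable_bracket_powr) (use s in simp)
  then show "(NN x. ennreal (bracket x powr (- (2 * s)))) = ennreal M"
   unfolding M_def by (intro nn_integral_eq_integral) auto
  show "0 <= M" unfolding M_def by simp
 qed
 have "norm f <= (M + 1) * r" if r: "0 < r" and B: "ball_Linf s r f" for r f
 proof -
  have "(NN x. ennreal ((bracket x powr 0 * norm (rep_L2 f x)) powr 2)) <= (NN x. ennreal (r\<^sup>2) * ennreal (bracket x powr (- (2 * s))))"
  proof (rule nn_integral_mono_AE)
   show "AE x in lborel. ennreal ((bracket x powr 0 * norm (rep_L2 f x)) powr 2) <= ennreal (r\<^sup>2) * ennreal (bracket x powr (- (2 * s)))"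
    using B unfolding ball_Linf_def
   proof eventually_elim
    case (elim x)
    have b: "bracket x powr (- (2 * s)) = 1 / (bracket x powr s)\<^sup>2"
     by (simp add: powr_minus_divide power2_eq_square flip: powr_add)
    have "(bracket x powr s * norm (rep_L2 f x))\<^sup>2 <= r\<^sup>2" using elim by (intro power_mono) auto
    then have "(norm (rep_L2 f x))\<^sup>2 <= r\<^sup>2 * bracket x powr (- (2 * s))"
     unfolding b using bracket_pos[of x] by (simp add: power_mult_distrib field_simps)
    then show ?case using bracket_pos[of x] by (simp add: less_imp_neq[symmetric] ennreal_leI flip: ennreal_mult)
   qed
  qed
  also have "... = ennreal (r\<^sup>2) * ennreal M" unfolding M(1)[symmetric] by (rule nn_integral_cmult) measurable
  also have "... = ennreal (r\<^sup>2 * M)" using M by (simp add: ennreal_mult)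
  also have "... <= ennreal (((M + 1) * r) powr 2)"
  proof (rule ennreal_leI)
   have "M <= (M + 1)\<^sup>2" using M(2) mult_nonneg_nonneg[OF M(2) M(2)] by (simp add: power2_eq_square algebra_simps)
   then have "r\<^sup>2 * M <= r\<^sup>2 * (M + 1)\<^sup>2" by (rule mult_left_mono) simp
   then show "r\<^sup>2 * M <= ((M + 1) * r) powr 2" using M r by (simp add: power_mult_distrib ac_simps)
  qed
  finally have "ball_Lp 2 0 ((M + 1) * r) f" unfolding ball_Lp_def .
  then show ?thesis using norm_powr2[of "(M + 1) * r"] M r by (simp add: add_nonneg_pos)
 qed
 then show ?thesis using M(2) by (intro exI[of _ "M + 1"]) auto
qed

text \<open>The weighted factor is replaced by its essential bound, a constant; what remains is
  controlled by a product of two Kato norms.\<close>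

lemma ball_Linf_T:
 assumes s: "1 / 2 < s"
 shows "\<exists>C>0. \<forall>f g h r r' r''. 0 < r --> 0 < r' --> 0 < r'' -->
  ball_Linf s r f --> ball_Linf s r' g --> ball_Linf s r'' h --> ball_Linf s (C * r * r' * r'') (T_from (- (pi / 4)) f g h)"
proof -
 obtain K where K0: "0 < K" and K1: "\<forall>f N. f \<in> bmeas --> (\<forall>y. 0 <= f y) --> 0 <= N -->
  (AE y in lborel. bracket y powr s * f y <= N) --> Kato (%y. ennreal (f y)) <= ennreal (K * N)"
  using Kato_Linf[OF s] by blast
 have KK: "ennreal c * (Kato (weighted_abs 0 f) * Kato (weighted_abs 0 g)) <= ennreal (K\<^sup>2 * (c * r * r'))"
  if "0 < r" "ball_Linf s r f" "0 < r'" "ball_Linf s r' g" "0 < c" for f g r r' c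
 proof -
  have "Kato (weighted_abs 0 f) <= ennreal (K * r)" if "0 < r" "ball_Linf s r f" for f r
   unfolding weighted_abs_0 using that K1[rule_format, of "%x. norm (rep_L2 f x)" r] by (simp add: ball_Linf_def)
  then have "ennreal c * (Kato (weighted_abs 0 f) * Kato (weighted_abs 0 g)) <= ennreal c * (ennreal (K * r) * ennreal (K * r'))"
   using that by (intro mult_mono mult_left_mono) auto
  also have "... = ennreal (K\<^sup>2 * (c * r * r'))"
   using K0 that by (simp add: power2_eq_square ac_simps flip: ennreal_mult)
  finally show ?thesis .
 qed
 have W: "AE y in lborel. weighted_abs s f y <= ennreal c * 1" if "ball_Linf s c f" for f c
  using that unfolding ball_Linf_def weighted_abs_def by (auto intro: ennreal_leI elim!: eventually_mono)
 have scale1: "Tplus (%_. ennreal c * 1) F G x = ennreal c * Tplus F (%_. 1) G x"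
  if [measurable]: "F \<in> bmeas" "G \<in> bmeas" for F G c x
 proof -
  have "Tplus (%_. ennreal c * 1) F G x = Tplus F (%_. ennreal c * 1) G x" by (rule Tplus_commute) measurable
  also have "... = ennreal c * Tplus F (%_. 1) G x"
   unfolding Tplus_def by (subst nn_integral_cmult[symmetric], measurable)+ (simp add: ac_simps)
  finally show ?thesis .
 qed
 have scale3: "Tplus F G (%_. ennreal c * 1) x = ennreal c * Tplus F G (%_. 1) x"
  if [measurable]: "F \<in> bmeas" "G \<in> bmeas" for F G c x
  unfolding Tplus_def by (subst nn_integral_cmult[symmetric], measurable)+ (simp add: ac_simps)
 define C where "C = 4 * 3 powr s * (3 * K\<^sup>2)"
 have C: "0 < C" using K0 by (simp add: C_def)
 have "ball_Linf s (C * r * r' * r'') (T_from (- (pi / 4)) f g h)"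
  if pos: "0 < r" "0 < r'" "0 < r''" and B: "ball_Linf s r f" "ball_Linf s r' g" "ball_Linf s r'' h" for f g h r r' r''
 proof -
  let ?m = "K\<^sup>2 * (r * r' * r'')"
  have 1: "Tplus (weighted_abs s f) (weighted_abs 0 g) (weighted_abs 0 h) x <= ennreal ?m" for x
  proof -
   have "Tplus (weighted_abs s f) (weighted_abs 0 g) (weighted_abs 0 h) x <= Tplus (%_. ennreal r * 1) (weighted_abs 0 g) (weighted_abs 0 h) x"
    by (rule Tplus_mono_AE1[OF W[OF B(1)]])
   also have "... <= ennreal r * (Kato (weighted_abs 0 g) * Kato (weighted_abs 0 h))"
    by (subst scale1) (auto intro!: mult_left_mono Kato_Tplus2)
   also have "... <= ennreal ?m" by (rule KK) (use pos B in auto)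
   finally show ?thesis .
  qed
  have 2: "Tplus (weighted_abs 0 f) (weighted_abs s g) (weighted_abs 0 h) x <= ennreal ?m" for x
  proof -
   have "Tplus (weighted_abs 0 f) (weighted_abs s g) (weighted_abs 0 h) x = Tplus (weighted_abs s g) (weighted_abs 0 f) (weighted_abs 0 h) x"
    by (rule Tplus_commute) measurable
   also have "... <= Tplus (%_. ennreal r' * 1) (weighted_abs 0 f) (weighted_abs 0 h) x"
    by (rule Tplus_mono_AE1[OF W[OF B(2)]])
   also have "... <= ennreal r' * (Kato (weighted_abs 0 f) * Kato (weighted_abs 0 h))"
    by (subst scale1) (auto intro!: mult_left_mono Kato_Tplus2)
   also have "... <= ennreal (K\<^sup>2 * (r' * r * r''))" by (rule KK) (use pos B in auto)
   finally show ?thesis by (simp add: ac_simps)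
  qed
  have 3: "Tplus (weighted_abs 0 f) (weighted_abs 0 g) (weighted_abs s h) x <= ennreal ?m" for x
  proof -
   have "Tplus (weighted_abs 0 f) (weighted_abs 0 g) (weighted_abs s h) x <= Tplus (weighted_abs 0 f) (weighted_abs 0 g) (%_. ennreal r'' * 1) x"
    by (rule Tplus_mono_AE3[OF W[OF B(3)]])
   also have "... <= ennreal r'' * (Kato (weighted_abs 0 f) * Kato (weighted_abs 0 g))"
    by (subst scale3) (auto intro!: mult_left_mono Kato_Tplus3)
   also have "... <= ennreal (K\<^sup>2 * (r'' * r * r'))" by (rule KK) (use pos B in auto)
   finally show ?thesis by (simp add: ac_simps)
  qed
  have s0: "0 <= s" using s by simp
  have m0: "0 <= ?m" using pos by simp
  show ?thesis
   unfolding ball_Linf_def using weighted_T_bound[OF disjI2[OF refl] s0, of f g h]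
  proof eventually_elim
   case (elim x)
   have "weighted_abs s (T_from (- (pi / 4)) f g h) x <= ennreal (4 * 3 powr s) * (ennreal ?m + ennreal ?m + ennreal ?m)"
    by (rule order_trans[OF elim]) (intro mult_left_mono add_mono 1 2 3, simp)
   also have "... = ennreal (4 * 3 powr s * (?m + ?m + ?m))" using m0 by (simp only: ennreal_mult ennreal_plus add_nonneg_nonneg powr_ge_zero mult_nonneg_nonneg zero_le_numeral)
   also have "4 * 3 powr s * (?m + ?m + ?m) = C * r * r' * r''" by (simp add: C_def)
   finally show ?case unfolding weighted_abs_def using C pos by (subst (asm) ennreal_le_iff) auto
  qed
 qed
 note main = this
 show ?thesis by (rule exI[of _ C], intro conjI allI impI C, rule main, assumption+)
qed

section \<open>The concrete spaces as instances of the abstract scheme\<close>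

definition L2_const :: real where "L2_const = 8 / pi * 8 + 8"

text \<open>The trilinear bound is \<open>norm_T_from\<close>, that is, the Strichartz
  estimate.\<close>

lemma solution_space_L2: "solution_space UNIV norm L2_const"
proof -
 interpret ball_space "%r f. norm f <= r" 8
 proof
  show "norm (T_from (- (pi / 4)) f g h) <= 8 * r * r' * r''"
   if "0 < r" "0 < r'" "0 < r''" "norm f <= r" "norm g <= r'" "norm h <= r''" for f g h r r' r''
   using that by (intro order_trans[OF norm_T_from] mult_mono mult_left_mono) auto
  show "norm f <= r" if "\<And>n. norm (F n) <= r" "F \<longlonglongrightarrow> f" for F f r
   using tendsto_norm[OF that(2)] that(1) by (intro LIMSEQ_le_const2) auto
  show "norm (c *\<^sub>C f) <= r'" if "norm c * r <= r'" "norm f <= r" for c f r r'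
   using that mult_left_mono[OF that(2), of "norm c"] by (simp add: norm_scaleC)
 qed (auto intro: norm_triangle_mono)
 show ?thesis unfolding L2_const_def by (rule solution_space_balls) auto
qed

lemma ball_Lp_ball_space:
 assumes p: "2 <= p" and s: "1 / 2 - 1 / p < s \<or> (p = 2 \<and> 0 <= s)"
  and T: "\<exists>C>0. \<forall>f g h r r' r''. 0 < r --> 0 < r' --> 0 < r'' -->
   ball_Lp p s r f --> ball_Lp p s r' g --> ball_Lp p s r'' h --> ball_Lp p s (C * r * r' * r'') (T_from a f g h)"
 shows "\<exists>C>0. (\<forall>r>0. \<forall>f. ball_Lp p s r f --> norm f <= C * r) \<and> (\<forall>f g h r r' r''. 0 < r --> 0 < r' --> 0 < r'' -->
   ball_Lp p s r f --> ball_Lp p s r' g --> ball_Lp p s r'' h --> ball_Lp p s (C * r * r' * r'') (T_from a f g h))"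
proof -
 obtain C1 where C1: "0 < C1" "\<And>r f. 0 < r ==> ball_Lp p s r f ==> norm f <= C1 * r"
  using ball_Lp_embedding[OF p s] by blast
 obtain C2 where C2: "0 < C2" "\<forall>f g h r r' r''. 0 < r --> 0 < r' --> 0 < r'' -->
   ball_Lp p s r f --> ball_Lp p s r' g --> ball_Lp p s r'' h --> ball_Lp p s (C2 * r * r' * r'') (T_from a f g h)"
  using T by (elim exE conjE)
 show ?thesis
 proof (intro exI[of _ "C1 + C2"] conjI allI impI)
  show "0 < C1 + C2" using C1 C2 by simp
  show "norm f <= (C1 + C2) * r" if "0 < r" "ball_Lp p s r f" for r f
   using C1(2)[OF that] mult_right_mono[of C1 "C1 + C2" r] that C2(1) by linarith
  fix f g h and r r' r'' :: real
  assume pos: "0 < r" "0 < r'" "0 < r''" and B: "ball_Lp p s r f" "ball_Lp p s r' g" "ball_Lp p s r'' h"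
  have b: "ball_Lp p s (C2 * r * r' * r'') (T_from a f g h)" using C2(2) pos B by simp
  have le: "C2 * r * r' * r'' <= (C1 + C2) * r * r' * r''" "0 < C2 * r * r' * r''"
   using pos C1(1) C2(1) by (auto intro!: mult_right_mono)
  show "ball_Lp p s ((C1 + C2) * r * r' * r'') (T_from a f g h)"
   by (rule ball_Lp_mono_AE[OF _ _ b le(2), of _ 1]) (use p le in auto)
 qed
qed

lemma ball_L2_T:
 assumes s: "0 <= s" and a: "a = 0 \<or> a = - (pi / 4)"
 shows "\<exists>C>0. \<forall>f g h r r' r''. 0 < r --> 0 < r' --> 0 < r'' -->
  ball_Lp 2 s r f --> ball_Lp 2 s r' g --> ball_Lp 2 s r'' h --> ball_Lp 2 s (C * r * r' * r'') (T_from a f g h)"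
proof -
 obtain E where E: "0 < E" "\<And>r f. 0 < r ==> ball_Lp 2 s r f ==> norm f <= E * r"
  using ball_Lp_embedding[of 2 s] s by auto
 obtain C where C: "0 < C" "\<forall>f g h r r' r'' \<rho> \<rho>' \<rho>'' a. 0 < r --> 0 < r' --> 0 < r'' --> 0 < \<rho> --> 0 < \<rho>' --> 0 < \<rho>'' -->
  ball_Lp 2 s r f --> ball_Lp 2 s r' g --> ball_Lp 2 s r'' h --> norm f <= \<rho> --> norm g <= \<rho>' --> norm h <= \<rho>'' -->
  a = 0 \<or> a = - (pi / 4) --> ball_Lp 2 s (C * (r * \<rho>' * \<rho>'' + \<rho> * r' * \<rho>'' + \<rho> * \<rho>' * r'')) (T_from a f g h)"
  using ball_L2_T_tame[OF s] by (elim exE conjE)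
 show ?thesis
 proof (intro exI[of _ "3 * C * E\<^sup>2"] conjI allI impI)
  show "0 < 3 * C * E\<^sup>2" using C E by simp
  fix f g h and r r' r'' :: real
  assume pos: "0 < r" "0 < r'" "0 < r''" and B: "ball_Lp 2 s r f" "ball_Lp 2 s r' g" "ball_Lp 2 s r'' h"
  have "ball_Lp 2 s (C * (r * (E * r') * (E * r'') + (E * r) * r' * (E * r'') + (E * r) * (E * r') * r'')) (T_from a f g h)"
   by (rule C(2)[rule_format]) (use pos B E a in auto)
  moreover have "C * (r * (E * r') * (E * r'') + (E * r) * r' * (E * r'') + (E * r) * (E * r') * r'') = 3 * C * E\<^sup>2 * r * r' * r''"
   by (simp add: power2_eq_square algebra_simps)
  ultimately show "ball_Lp 2 s (3 * C * E\<^sup>2 * r * r' * r'') (T_from a f g h)" by (simp only:)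
 qed
qed

lemma Lp_norm_nonneg: "0 <= Lp_norm p s f" by (simp add: Lp_norm_def weighted_Lp_norm_def)

lemma ex_solution_space_Lp:
 assumes p: "2 <= p" and s: "1 / 2 - 1 / p < s \<or> (p = 2 \<and> 0 <= s)"
 shows "\<exists>C. solution_space (Lp_space p s) (Lp_norm p s) C"
proof -
 have T: "\<exists>C>0. \<forall>f g h r r' r''. 0 < r --> 0 < r' --> 0 < r'' -->
   ball_Lp p s r f --> ball_Lp p s r' g --> ball_Lp p s r'' h --> ball_Lp p s (C * r * r' * r'') (T_from (- (pi / 4)) f g h)"
 proof (cases "p = 2")
  case True
  then have "0 <= s" using s by auto
  then show ?thesis unfolding True by (rule ball_L2_T) simp
 next
  case False
  then obtain C where C: "0 < C" "\<forall>f g h r r' r'' a. 0 < r --> 0 < r' --> 0 < r'' -->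
   ball_Lp p s r f --> ball_Lp p s r' g --> ball_Lp p s r'' h -->
   a = 0 \<or> a = - (pi / 4) --> ball_Lp p s (C * r * r' * r'') (T_from a f g h)"
   using ball_Lp_T[of p s] p s by (elim exE conjE disjE) auto
  show ?thesis by (rule exI[of _ C]) (use C in simp)
 qed
 obtain C where C: "0 < C" "\<forall>r>0. \<forall>f. ball_Lp p s r f --> norm f <= C * r" "\<forall>f g h r r' r''. 0 < r --> 0 < r' --> 0 < r'' -->
   ball_Lp p s r f --> ball_Lp p s r' g --> ball_Lp p s r'' h --> ball_Lp p s (C * r * r' * r'') (T_from (- (pi / 4)) f g h)"
  using ball_Lp_ball_space[OF p s T] by (elim exE conjE)
 interpret ball_space "ball_Lp p s" C
 proof
  show "ball_Lp p s r' (c *\<^sub>C f)" if "0 < r" "norm c * r <= r'" "ball_Lp p s r f" for r r' c f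
  proof (rule ball_Lp_mono_AE[OF _ _ that(3,1,2)])
   show "AE x in lborel. norm (rep_L2 (c *\<^sub>C f) x) <= norm c * norm (rep_L2 f x)"
    using rep_L2_scaleC[of c f] by eventually_elim (simp add: norm_mult)
  qed (use p in auto)
  show "ball_Lp p s r f" if "\<And>n. ball_Lp p s r (F n)" "F \<longlonglongrightarrow> f" for r F f
   by (rule ball_Lp_closed[OF _ that]) (use p in simp)
  show "ball_Lp p s (r + r') (f + g)" if "0 < r" "0 < r'" "ball_Lp p s r f" "ball_Lp p s r' g" for r r' f g
   by (rule ball_Lp_add[OF _ that]) (use p in simp)
 qed (use C in auto)
 show ?thesis
  by (rule exI, rule solution_space_balls, rule ball_Lp_iff, use p in simp, assumption, rule Lp_norm_nonneg)
qed

lemma ex_solution_space_Linf: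
 assumes s: "1 / 2 < s"
 shows "\<exists>C. solution_space (Linf_space s) (Linf_norm s) C"
proof -
 obtain C1 where C1: "0 < C1" "\<And>r f. 0 < r ==> ball_Linf s r f ==> norm f <= C1 * r"
  using ball_Linf_embedding[OF s] by blast
 obtain C2 where C2: "0 < C2" "\<forall>f g h r r' r''. 0 < r --> 0 < r' --> 0 < r'' -->
  ball_Linf s r f --> ball_Linf s r' g --> ball_Linf s r'' h --> ball_Linf s (C2 * r * r' * r'') (T_from (- (pi / 4)) f g h)"
  using ball_Linf_T[OF s] by (elim exE conjE)
 interpret ball_space "ball_Linf s" "C1 + C2"
 proof
  show "0 < C1 + C2" using C1 C2 by simp
  show "norm f <= (C1 + C2) * r" if "0 < r" "ball_Linf s r f" for r f
   using C1(2)[OF that] mult_right_mono[of C1 "C1 + C2" r] that C2(1) by linarith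
  show "ball_Linf s ((C1 + C2) * r * r' * r'') (T_from (- (pi / 4)) f g h)"
   if pos: "0 < r" "0 < r'" "0 < r''" and B: "ball_Linf s r f" "ball_Linf s r' g" "ball_Linf s r'' h" for r r' r'' f g h
  proof -
   have "ball_Linf s (C2 * r * r' * r'') (T_from (- (pi / 4)) f g h)" using C2(2) pos B by simp
   moreover have "C2 * r * r' * r'' <= (C1 + C2) * r * r' * r''"
    using pos C1(1) C2(1) by (auto intro!: mult_right_mono)
   ultimately show ?thesis unfolding ball_Linf_def by (auto elim!: eventually_mono)
  qed
  show "ball_Linf s (r + r') (f + g)" if "ball_Linf s r f" "ball_Linf s r' g" for r r' f g
   using that rep_L2_add[of f g] unfolding ball_Linf_def
  proof eventually_elim
   case (elim x)
   have "bracket x powr s * norm (rep_L2 (f + g) x) <= bracket x powr s * (norm (rep_L2 f x) + norm (rep_L2 g x))"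
    unfolding elim(3) by (intro mult_left_mono norm_triangle_ineq) simp
   then show ?case using elim(1,2) by (simp add: distrib_left)
  qed
  show "ball_Linf s r' (c *\<^sub>C f)" if "norm c * r <= r'" "ball_Linf s r f" for r r' c f
   using that(2) rep_L2_scaleC[of c f] unfolding ball_Linf_def
  proof eventually_elim
   case (elim x)
   have "norm c * (bracket x powr s * norm (rep_L2 f x)) <= norm c * r" by (rule mult_left_mono[OF elim(1)]) simp
   then show ?case using that(1) elim(2) by (simp add: norm_mult ac_simps)
  qed
  show "ball_Linf s r f" if B: "\<And>n. ball_Linf s r (F n)" and F: "F \<longlonglongrightarrow> f" for r F f
  proof -
   obtain k :: "nat => nat" where k: "AE x in lborel. (%n. rep_L2 (F (k n)) x) \<longlonglongrightarrow> rep_L2 f x"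
    using L2_tendsto_AE_subseq[OF F] by blast
   have "AE x in lborel. \<forall>n. bracket x powr s * norm (rep_L2 (F (k n)) x) <= r"
    using B unfolding ball_Linf_def by (simp add: AE_all_countable)
   with k show ?thesis unfolding ball_Linf_def
   proof eventually_elim
    case (elim x)
    show ?case
     by (rule LIMSEQ_le_const2[of "%n. bracket x powr s * norm (rep_L2 (F (k n)) x)"])
      (use elim in \<open>auto intro!: tendsto_intros\<close>)
   qed
  qed
 qed
 have N0: "0 <= Linf_norm s f" for f
  unfolding Linf_norm_def by (intro real_of_ereal_pos weighted_esssup_nonneg)
 show ?thesis by (rule exI, rule solution_space_balls, rule ball_Linf_iff, rule N0)
qed

section \<open>Sobolev spaces\<close>

abbreviation half_fourier :: "L2 => L2" where "half_fourier \<equiv> propagator (- (pi / 4))"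

lemma half_fourier_T_from:
 "half_fourier (T_from (- (pi / 4)) f g h) = T_from 0 (half_fourier f) (half_fourier g) (half_fourier h)"
 by (simp add: T_from_propagator)

lemma sobolev_ball_iff:
 assumes "0 < r" shows "f \<in> sobolev s \<and> sobolev_norm s f <= r \<longleftrightarrow> ball_Lp 2 s r (half_fourier f)"
proof -
 obtain \<omega> where \<omega>: "norm \<omega> = 1" "\<And>f. fourier f = \<omega> *\<^sub>C half_fourier f"
  using fourier_propagator by auto
 have ae: "AE x in lborel. norm (rep_L2 (fourier f) x) = norm (rep_L2 (half_fourier f) x)"
  using rep_L2_scaleC[of \<omega> "half_fourier f"] unfolding \<omega>(2) by eventually_elim (simp add: norm_mult \<omega>(1))
 have "ball_Lp 2 s r (fourier f) \<longleftrightarrow> ball_Lp 2 s r (half_fourier f)"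
 proof
  have "AE x in lborel. norm (rep_L2 (half_fourier f) x) <= 1 * norm (rep_L2 (fourier f) x)"
   "AE x in lborel. norm (rep_L2 (fourier f) x) <= 1 * norm (rep_L2 (half_fourier f) x)"
   using ae by (auto elim!: eventually_mono)
  note le = this
  show "ball_Lp 2 s r (half_fourier f)" if "ball_Lp 2 s r (fourier f)"
   by (rule ball_Lp_mono_AE[OF le(1) _ that assms]) auto
  show "ball_Lp 2 s r (fourier f)" if "ball_Lp 2 s r (half_fourier f)"
   by (rule ball_Lp_mono_AE[OF le(2) _ that assms]) auto
 qed
 then show ?thesis using ball_Lp_iff[of 2 r "fourier f" s] assms by (simp add: sobolev_def sobolev_norm_def)
qed

text \<open>The balls are those of weighted L^2 pulled back by \<open>half_fourier\<close>; they
  remain closed because \<open>half_fourier\<close> is continuous on L^2.\<close>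

lemma ex_solution_space_sobolev:
 assumes s: "0 <= s"
 shows "\<exists>C. solution_space (sobolev s) (sobolev_norm s) C"
proof -
 obtain C where C: "0 < C" "\<forall>r>0. \<forall>f. ball_Lp 2 s r f --> norm f <= C * r" "\<forall>f g h r r' r''. 0 < r --> 0 < r' --> 0 < r'' -->
   ball_Lp 2 s r f --> ball_Lp 2 s r' g --> ball_Lp 2 s r'' h --> ball_Lp 2 s (C * r * r' * r'') (T_from 0 f g h)"
  using ball_Lp_ball_space[OF order_refl disjI2[OF conjI[OF refl s]] ball_L2_T[OF s disjI1[OF refl]]]
  by (elim exE conjE)
 interpret ball_space "%r f. ball_Lp 2 s r (half_fourier f)" C
 proof
  show "ball_Lp 2 s r' (half_fourier (c *\<^sub>C f))" if "0 < r" "norm c * r <= r'" "ball_Lp 2 s r (half_fourier f)" for r r' c f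
  proof (rule ball_Lp_mono_AE[OF _ _ that(3,1,2)])
   show "AE x in lborel. norm (rep_L2 (half_fourier (c *\<^sub>C f)) x) <= norm c * norm (rep_L2 (half_fourier f) x)"
    using rep_L2_scaleC[of c "half_fourier f"] by eventually_elim (simp add: propagator_scaleC norm_mult)
  qed auto
  show "ball_Lp 2 s r (half_fourier f)" if "\<And>n. ball_Lp 2 s r (half_fourier (F n))" "F \<longlonglongrightarrow> f" for r F f
   by (rule ball_Lp_closed[OF _ that(1) bounded_linear.tendsto[OF bounded_linear_propagator that(2)]]) simp
  show "ball_Lp 2 s (r + r') (half_fourier (f + g))"
   if "0 < r" "0 < r'" "ball_Lp 2 s r (half_fourier f)" "ball_Lp 2 s r' (half_fourier g)" for r r' f g
   unfolding propagator_add by (rule ball_Lp_add[OF _ that]) simp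
  show "norm f <= C * r" if "0 < r" "ball_Lp 2 s r (half_fourier f)" for r f
   using C(2)[rule_format, OF that] by simp
  show "ball_Lp 2 s (C * r * r' * r'') (half_fourier (T_from (- (pi / 4)) f g h))"
   if "0 < r" "0 < r'" "0 < r''" "ball_Lp 2 s r (half_fourier f)" "ball_Lp 2 s r' (half_fourier g)" "ball_Lp 2 s r'' (half_fourier h)" for r r' r'' f g h
   unfolding half_fourier_T_from using C(3) that by simp
 qed (use C in auto)
 show ?thesis
  by (rule exI, rule solution_space_balls, erule sobolev_ball_iff) (simp add: sobolev_norm_def Lp_norm_nonneg)
qed

text \<open>The tame bound with three equal arguments: its three terms and the factor 8 / pi of
  \<open>T4\<close> give 24 / pi.\<close>

lemma sobolev_T4_tame:
 assumes s: "0 <= s"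
 shows "\<exists>D>0. \<forall>u R. u \<in> sobolev s --> 0 < R --> norm u <= R --> sobolev_norm s (T4 u u u) <= D * R\<^sup>2 * sobolev_norm s u"
proof -
 obtain C where C: "0 < C" "\<forall>f g h r r' r'' \<rho> \<rho>' \<rho>'' a. 0 < r --> 0 < r' --> 0 < r'' --> 0 < \<rho> --> 0 < \<rho>' --> 0 < \<rho>'' -->
  ball_Lp 2 s r f --> ball_Lp 2 s r' g --> ball_Lp 2 s r'' h --> norm f <= \<rho> --> norm g <= \<rho>' --> norm h <= \<rho>'' -->
  a = 0 \<or> a = - (pi / 4) --> ball_Lp 2 s (C * (r * \<rho>' * \<rho>'' + \<rho> * r' * \<rho>'' + \<rho> * \<rho>' * r'')) (T_from a f g h)"
  using ball_L2_T_tame[OF s] by (elim exE conjE)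
 have "sobolev_norm s (T4 u u u) <= 24 / pi * C * R\<^sup>2 * sobolev_norm s u" if u: "u \<in> sobolev s" and R: "0 < R" "norm u <= R" for u R
 proof (rule field_le_epsilon)
  fix e :: real assume e: "0 < e"
  define K where "K = 24 / pi * C * R\<^sup>2"
  have K: "0 < K" using C(1) R by (simp add: K_def)
  define r where "r = sobolev_norm s u + e / K"
  have r: "0 < r" using e K Lp_norm_nonneg[of 2 s "fourier u"] by (simp add: r_def sobolev_norm_def add_nonneg_pos)
  have B: "ball_Lp 2 s r (half_fourier u)" using sobolev_ball_iff[OF r, of u s] u e K by (simp add: r_def)
  have "ball_Lp 2 s (C * (r * R * R + R * r * R + R * R * r)) (T_from 0 (half_fourier u) (half_fourier u) (half_fourier u))"
   by (rule C(2)[rule_format]) (use r R B in auto)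
  then have "ball_Lp 2 s (C * (r * R * R + R * r * R + R * R * r)) (half_fourier (T_from (- (pi / 4)) u u u))"
   unfolding half_fourier_T_from .
  then have "ball_Lp 2 s (K * r) (half_fourier (T4 u u u))"
  proof (rule ball_Lp_mono_AE[rotated 2])
   have "half_fourier (T4 u u u) = cplx (8 / pi) *\<^sub>C half_fourier (T_from (- (pi / 4)) u u u)"
    unfolding T4_T_from scaleC_of_real[symmetric] by (rule propagator_scaleC)
   then show "AE x in lborel. norm (rep_L2 (half_fourier (T4 u u u)) x) <= 8 / pi * norm (rep_L2 (half_fourier (T_from (- (pi / 4)) u u u)) x)"
    using rep_L2_scaleC[of "cplx (8 / pi)" "half_fourier (T_from (- (pi / 4)) u u u)"]
    by (auto simp: norm_mult norm_divide elim!: eventually_mono)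
   show "0 < C * (r * R * R + R * r * R + R * R * r)" using C(1) r R by (simp add: add_pos_pos)
   show "8 / pi * (C * (r * R * R + R * r * R + R * R * r)) <= K * r"
    by (simp add: K_def power2_eq_square algebra_simps)
  qed auto
  then have "sobolev_norm s (T4 u u u) <= K * r" using sobolev_ball_iff[of "K * r" "T4 u u u" s] K r by simp
  then show "sobolev_norm s (T4 u u u) <= 24 / pi * C * R\<^sup>2 * sobolev_norm s u + e"
   unfolding K_def[symmetric] using K by (simp add: r_def distrib_left)
 qed
 note main = this
 show ?thesis by (rule exI[of _ "24 / pi * C"], intro conjI allI impI, use C(1) in simp, rule main, assumption+)
qed

section \<open>Integrals of continuous curves\<close>

interpretation L2: solution_space UNIV norm L2_const by (rule solution_space_L2)

lemma scaleC_diff: "c *\<^sub>C (f - g) = c *\<^sub>C f - c *\<^sub>C g"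
 by (rule linear_diff[OF bounded_linear.linear[OF bounded_linear_scaleC]])

context solution_space
begin

lemma N_nonneg: "f \<in> X ==> 0 <= N f"
 using embedding[of f] norm_ge_zero[of f] C_pos zero_le_mult_iff[of C "N f"] by linarith

lemma scaleR: "f \<in> X ==> a *\<^sub>R f \<in> X \<and> N (a *\<^sub>R f) <= \<bar>a\<bar> * N f"
 using scaleC[of f "cplx a"] by (simp add: scaleC_of_real)

lemma zero: "f \<in> X ==> 0 \<in> X \<and> N 0 = 0"
 using scaleR[of f 0] N_nonneg[of 0] by simp

lemma diff: "f \<in> X ==> g \<in> X ==> f - g \<in> X \<and> N (f - g) <= N f + N g"
 using add[of f "(-1) *\<^sub>R g"] scaleR[of g "-1"] by auto

lemma minus_commute: "f \<in> X ==> g \<in> X ==> N (f - g) = N (g - f)"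
 using scaleR[of "f - g" "-1"] scaleR[of "g - f" "-1"] diff[of f g] diff[of g f] by auto

text \<open>A Riemann sum is a finite combination of values in \<open>X\<close> with nonnegative
  coefficients, so it lies in \<open>X\<close> with norm at most the Riemann sum of \<phi>, and
  \<open>closed\<close> passes to the limit. The gauge integral is used for the sake of this
  argument.\<close>

lemma has_integral_bound:
 assumes ab: "a <= b" and V: "(V has_integral y) {a..b}" and \<phi>: "(\<phi> has_integral \<Phi>) {a..b::real}"
  and le: "\<And>r. r \<in> {a..b} ==> V r \<in> X \<and> N (V r) <= \<phi> r"
 shows "y \<in> X \<and> N y <= \<Phi>"
proof -
 have X0: "0 \<in> X" "N 0 = 0" using zero[of "V a"] le[of a] ab by auto
 have *: "y \<in> X \<and> N y <= \<Phi> + e" if e: "0 < e" for e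
 proof -
  have "\<exists>S. S \<in> X \<and> N S <= \<Phi> + e \<and> norm (S - y) < 1 / real (Suc n)" for n
  proof -
   obtain \<gamma> where \<gamma>: "gauge \<gamma>" "\<And>\<D>. \<D> tagged_division_of {a..b} ==> \<gamma> fine \<D> ==>
     norm ((\<Sum>(x, k)\<in>\<D>. measure lborel k *\<^sub>R V x) - y) < 1 / real (Suc n)"
    using V[unfolded has_integral_real, rule_format, of "1 / real (Suc n)"] by auto
   obtain \<gamma>' where \<gamma>': "gauge \<gamma>'" "\<And>\<D>. \<D> tagged_division_of {a..b} ==> \<gamma>' fine \<D> ==>
     norm ((\<Sum>(x, k)\<in>\<D>. measure lborel k *\<^sub>R \<phi> x) - \<Phi>) < e"
    using \<phi>[unfolded has_integral_real, rule_format, OF e] by auto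
   \<comment> \<open>One division fine for both gauges, so that the same tags serve both
     integrals.\<close>
   obtain \<D> where \<D>: "\<D> tagged_division_of {a..b}" "(%x. \<gamma> x \<inter> \<gamma>' x) fine \<D>"
    using fine_division_exists_real[OF gauge_Int[OF \<gamma>(1) \<gamma>'(1)]] by blast
   have "(\<Sum>(x, k)\<in>E. measure lborel k *\<^sub>R V x) \<in> X \<and> N (\<Sum>(x, k)\<in>E. measure lborel k *\<^sub>R V x) <= (\<Sum>(x, k)\<in>E. measure lborel k *\<^sub>R \<phi> x)"
    if "E \<subseteq> \<D>" for E
    using finite_subset[OF that tagged_division_of_finite[OF \<D>(1)]] that
   proof (induction E rule: finite_induct)
    case empty
    then show ?case using X0 by simp
   next
    case (insert p E)
    obtain x k where p: "p = (x, k)" by (cases p)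
    have "x \<in> {a..b}" using tagged_division_ofD(2,3)[OF \<D>(1), of x k] insert.prems p by auto
    then have v: "V x \<in> X" "N (V x) <= \<phi> x" using le by auto
    have s: "measure lborel k *\<^sub>R V x \<in> X" "N (measure lborel k *\<^sub>R V x) <= measure lborel k * \<phi> x"
     using scaleR[OF v(1), of "measure lborel k"] mult_left_mono[OF v(2), of "measure lborel k"] by auto
    have IH: "(\<Sum>(x, k)\<in>E. measure lborel k *\<^sub>R V x) \<in> X" "N (\<Sum>(x, k)\<in>E. measure lborel k *\<^sub>R V x) <= (\<Sum>(x, k)\<in>E. measure lborel k *\<^sub>R \<phi> x)"
     using insert by auto
    show ?case using add[OF s(1) IH(1)] s(2) IH(2) insert.hyps p by auto
   qed
   from this[OF order_refl] \<gamma>(2)[OF \<D>(1)] \<gamma>'(2)[OF \<D>(1)] \<D>(2) show ?thesis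
    by (intro exI[of _ "\<Sum>(x, k)\<in>\<D>. measure lborel k *\<^sub>R V x"]) (auto simp: fine_Int)
  qed
  then obtain S where S: "\<And>n. S n \<in> X \<and> N (S n) <= \<Phi> + e" "\<And>n. norm (S n - y) < 1 / real (Suc n)" by metis
  have "(%n. S n - y) \<longlonglongrightarrow> 0"
   by (rule Lim_null_comparison[OF _ LIMSEQ_Suc[OF lim_1_over_n]]) (intro always_eventually allI less_imp_le S(2))
  then have "S \<longlonglongrightarrow> y" by (rule LIM_zero_cancel)
  with S(1) show ?thesis by (rule closed)
 qed
 show ?thesis
 proof
  show "y \<in> X" using *[of 1] by simp
  show "N y <= \<Phi>" by (rule field_le_epsilon) (use * in blast)
 qed
qed

end

text \<open>Identifies the gauge integral with the Bochner integral of the Duhamel formula; pairing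
  with each g reduces this to real-valued functions.\<close>

lemma has_integral_LBINT:
 fixes V :: "real => L2"
 assumes ab: "a <= b" and V: "continuous_on {a..b} V"
 shows "(V has_integral (LBINT s=a..b. V s)) {a..b}"
proof -
 have si: "set_integrable lborel {a..b} V" by (rule borel_integrable_atLeastAtMost'[OF V])
 have HK: "(V has_integral integral {a..b} V) {a..b}"
  by (rule integrable_integral[OF integrable_continuous_real[OF V]])
 have "integral {a..b} V \<bullet> g = (LBINT s=a..b. V s) \<bullet> g" for g
 proof -
  have c: "continuous_on {a..b} (%s. V s \<bullet> g)" by (intro continuous_intros V)
  have "((%s. V s \<bullet> g) has_integral integral {a..b} V \<bullet> g) {a..b}"
   using has_integral_linear[OF HK bounded_linear_inner_left[of g]] by (simp add: o_def)
  then have "integral {a..b} V \<bullet> g = (LBINT s:{a..b}. V s \<bullet> g)"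
   using set_borel_integral_eq_integral(2)[OF borel_integrable_atLeastAtMost'[OF c]] by (simp add: integral_unique)
  also have "... = (LBINT s. (indicator {a..b} s *\<^sub>R V s) \<bullet> g)"
   unfolding set_lebesgue_integral_def by simp
  also have "... = (LBINT s. indicator {a..b} s *\<^sub>R V s) \<bullet> g"
   by (rule integral_inner_left) (use si in \<open>simp add: set_integrable_def\<close>)
  also have "(LBINT s. indicator {a..b} s *\<^sub>R V s) = (LBINT s=a..b. V s)"
   using ab by (simp add: interval_integral_Icc set_lebesgue_integral_def)
  finally show ?thesis .
 qed
 moreover have "x = y" if "\<And>g. x \<bullet> g = y \<bullet> g" for x y :: L2
  using vector_eq_rdot[of x y] that by blast
 ultimately have "integral {a..b} V = (LBINT s=a..b. V s)" by blast
 with HK show ?thesis by (simp only:)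
qed

abbreviation prim :: "(real => L2) => real => L2" where
 "prim V t \<equiv> (LBINT s=0..t. V s)"

lemma segment_0: "closed_segment 0 t = (if 0 <= t then {0..t} else {t..0})" for t :: real
 by (simp add: closed_segment_eq_real_ivl)

lemma has_integral_prim:
 assumes V: "continuous_on (closed_segment 0 t) V"
 shows "0 <= t ==> (V has_integral prim V t) {0..t}" "t < 0 ==> (V has_integral - prim V t) {t..0}"
proof -
 show "(V has_integral prim V t) {0..t}" if "0 <= t"
  using has_integral_LBINT[of 0 t V] V that by (simp add: segment_0 zero_ereal_def)
 show "(V has_integral - prim V t) {t..0}" if "t < 0"
  using has_integral_LBINT[of t 0 V] V that interval_integral_endpoints_reverse[of 0 "ereal t" V]
  by (simp add: segment_0 zero_ereal_def)
qed

lemma has_integral_prim_diff: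
 assumes I: "is_interval I" "0 \<in> I" and V: "continuous_on I V" and ab: "a \<in> I" "b \<in> I" "a <= b"
 shows "(V has_integral (prim V b - prim V a)) {a..b}"
proof -
 have seg: "closed_segment 0 t \<subseteq> I" if "t \<in> I" for t
  using I that by (simp add: closed_segment_subset is_interval_convex)
 have "closed_segment a b \<subseteq> I"
  using I ab by (simp add: closed_segment_subset is_interval_convex)
 then have "{a..b} \<subseteq> I" using ab by (simp add: closed_segment_eq_real_ivl)
 then have y: "(V has_integral integral {a..b} V) {a..b}"
  by (intro integrable_integral integrable_continuous_real continuous_on_subset[OF V])
 note A = has_integral_prim[OF continuous_on_subset[OF V seg[OF ab(1)]]]
 note B = has_integral_prim[OF continuous_on_subset[OF V seg[OF ab(2)]]]
 consider "0 <= a" | "a < 0" "0 <= b" | "b < 0" by linarith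
 then have "integral {a..b} V = prim V b - prim V a"
 proof cases
  case 1
  have "(V has_integral prim V a + integral {a..b} V) {0..b}"
   by (rule has_integral_combine[OF 1 ab(3) A(1)[OF 1] y])
  moreover have "(V has_integral prim V b) {0..b}" using B(1) 1 ab by simp
  ultimately have "prim V a + integral {a..b} V = prim V b" by (rule has_integral_unique)
  then show ?thesis by (simp add: algebra_simps)
 next
  case 2
  have "(V has_integral - prim V a + prim V b) {a..b}"
   by (rule has_integral_combine[of a 0 b]) (use 2 A(2) B(1) in auto)
  with y have "integral {a..b} V = - prim V a + prim V b" by (rule has_integral_unique)
  then show ?thesis by simp
 next
  case 3
  have "(V has_integral integral {a..b} V + - prim V b) {a..0}"
   by (rule has_integral_combine[of a b 0]) (use 3 ab y B(2) in auto)
  moreover have "(V has_integral - prim V a) {a..0}" using A(2) 3 ab by simp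
  ultimately have "integral {a..b} V + - prim V b = - prim V a" by (rule has_integral_unique)
  then show ?thesis by (simp add: algebra_simps)
 qed
 with y show ?thesis by simp
qed

lemma prim_diff:
 assumes V: "continuous_on (closed_segment 0 t) V" and W: "continuous_on (closed_segment 0 t) W"
 shows "prim V t - prim W t = prim (%s. V s - W s) t"
proof (cases "0 <= t")
 case True
 show ?thesis
  by (rule has_integral_unique[OF has_integral_diff[OF has_integral_prim(1)[OF V True] has_integral_prim(1)[OF W True]]
   has_integral_prim(1)[OF continuous_on_diff[OF V W] True]])
next
 case False
 then have t: "t < 0" by simp
 have "- prim V t - - prim W t = - prim (%s. V s - W s) t"
  by (rule has_integral_unique[OF has_integral_diff[OF has_integral_prim(2)[OF V t] has_integral_prim(2)[OF W t]]
   has_integral_prim(2)[OF continuous_on_diff[OF V W] t]])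
 then show ?thesis by (simp add: algebra_simps)
qed

context solution_space
begin

lemma prim_increment:
 assumes I: "is_interval I" "0 \<in> I" and V: "continuous_on I V" and ab: "a \<in> I" "b \<in> I"
  and le: "\<And>r. r \<in> closed_segment a b ==> V r \<in> X \<and> N (V r) <= M"
 shows "prim V b - prim V a \<in> X \<and> N (prim V b - prim V a) <= M * \<bar>b - a\<bar>"
proof -
 have *: "prim V b - prim V a \<in> X \<and> N (prim V b - prim V a) <= M * \<bar>b - a\<bar>"
  if "a <= b" "a \<in> I" "b \<in> I" "\<And>r. r \<in> {a..b} ==> V r \<in> X \<and> N (V r) <= M" for a b
  using has_integral_bound[OF that(1) has_integral_prim_diff[OF I V that(2,3,1)] has_integral_const_real[of M a b]] that
  by (simp add: mult.commute)
 show ?thesis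
 proof (cases "a <= b")
  case True
  then show ?thesis using * ab le by (simp add: closed_segment_eq_real_ivl)
 next
  case False
  then have "prim V a - prim V b \<in> X \<and> N (prim V a - prim V b) <= M * \<bar>a - b\<bar>"
   using *[of b a] ab le by (simp add: closed_segment_eq_real_ivl)
  then show ?thesis using scaleR[of "prim V a - prim V b" "-1"] by (auto simp: abs_minus_commute)
 qed
qed

text \<open>The weight exp(\<kappa> |r|) gains a factor 1 / \<kappa> upon integration from 0. With
  \<kappa> twice a Lipschitz constant the Duhamel term gains 1/2 on time intervals of any
  length.\<close>

lemma prim_exp:
 assumes V: "continuous_on (closed_segment 0 t) V" and \<kappa>: "0 < \<kappa>" and c: "0 <= c"
  and le: "\<And>r. r \<in> closed_segment 0 t ==> V r \<in> X \<and> N (V r) <= c * exp (\<kappa> * \<bar>r\<bar>)"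
 shows "prim V t \<in> X \<and> N (prim V t) <= c * exp (\<kappa> * \<bar>t\<bar>) / \<kappa>"
proof (cases "0 <= t")
 case True
 have "((%r. c * exp (\<kappa> * r)) has_integral (c * exp (\<kappa> * t) / \<kappa> - c * exp (\<kappa> * 0) / \<kappa>)) {0..t}"
  by (rule fundamental_theorem_of_calculus[OF True])
   (use \<kappa> in \<open>auto intro!: derivative_eq_intros simp flip: has_real_derivative_iff_has_vector_derivative\<close>)
 from has_integral_bound[OF True has_integral_prim(1)[OF V True] this] le True
 have "prim V t \<in> X \<and> N (prim V t) <= c * exp (\<kappa> * t) / \<kappa> - c * exp (\<kappa> * 0) / \<kappa>" by (simp add: segment_0)
 moreover have "0 <= c * exp (\<kappa> * 0) / \<kappa>" using c \<kappa> by simp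
 ultimately show ?thesis using True by (simp del: mult_zero_right)
next
 case False
 then have t: "t <= 0" "t < 0" by auto
 have "((%r. c * exp (- (\<kappa> * r))) has_integral (- (c * exp (- (\<kappa> * 0)) / \<kappa>) - - (c * exp (- (\<kappa> * t)) / \<kappa>))) {t..0}"
  by (rule fundamental_theorem_of_calculus[OF t(1)])
   (use \<kappa> in \<open>auto intro!: derivative_eq_intros simp flip: has_real_derivative_iff_has_vector_derivative\<close>)
 from has_integral_bound[OF t(1) has_integral_prim(2)[OF V t(2)] this] le False
 have "- prim V t \<in> X \<and> N (- prim V t) <= c * exp (- (\<kappa> * t)) / \<kappa> - c * exp (- (\<kappa> * 0)) / \<kappa>" by (simp add: segment_0)
 moreover have "0 <= c * exp (- (\<kappa> * 0)) / \<kappa>" using c \<kappa> by simp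
 ultimately have "- prim V t \<in> X \<and> N (- prim V t) <= c * exp (\<kappa> * \<bar>t\<bar>) / \<kappa>" using t by (simp del: mult_zero_right)
 then show ?thesis using scaleR[of "- prim V t" "-1"] by auto
qed

end

section \<open>Uniqueness and stability\<close>

text \<open>The maximum of w(s) exp(-2 K |s|) on the segment is taken as \<open>m\<close> in
  \<open>step\<close>; half of it is then absorbed on the left.\<close>

lemma gronwall:
 fixes w :: "real => real"
 assumes w: "continuous_on (closed_segment 0 t) w" "\<And>s. s \<in> closed_segment 0 t ==> 0 <= w s" and a: "0 <= a" and K: "0 < K"
  and step: "\<And>s m. s \<in> closed_segment 0 t ==> 0 <= m ==>
   (\<And>r. r \<in> closed_segment 0 s ==> w r <= m * exp (2 * K * \<bar>r\<bar>)) ==> w s <= a + m * exp (2 * K * \<bar>s\<bar>) / 2"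
 shows "w t <= 2 * a * exp (2 * K * \<bar>t\<bar>)"
proof -
 define f where "f s = w s * exp (- (2 * K * \<bar>s\<bar>))" for s
 have "continuous_on (closed_segment 0 t) f" unfolding f_def by (intro continuous_intros w)
 then obtain s where s: "s \<in> closed_segment 0 t" "\<And>r. r \<in> closed_segment 0 t ==> f r <= f s"
  using continuous_attains_sup[of "closed_segment 0 t" f] by auto
 have w_f: "w r = f r * exp (2 * K * \<bar>r\<bar>)" for r by (simp add: f_def exp_minus)
 have f0: "0 <= f s" using w(2)[OF s(1)] by (simp add: f_def)
 have sub: "closed_segment 0 s \<subseteq> closed_segment 0 t" using s(1) by (simp add: subset_closed_segment)
 have "w s <= a + f s * exp (2 * K * \<bar>s\<bar>) / 2"
 proof (rule step[OF s(1) f0])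
  show "w r <= f s * exp (2 * K * \<bar>r\<bar>)" if "r \<in> closed_segment 0 s" for r
   unfolding w_f using s(2) sub that by (intro mult_right_mono) auto
 qed
 then have "f s * exp (2 * K * \<bar>s\<bar>) <= 2 * a" unfolding w_f[of s] by simp
 moreover have "f s * 1 <= f s * exp (2 * K * \<bar>s\<bar>)" using f0 K by (intro mult_left_mono) auto
 ultimately have "f t <= 2 * a" using s(2)[of t] by simp
 then show ?thesis unfolding w_f[of t] by (intro mult_right_mono) auto
qed

lemma T4_diff:
 "T4 f g h - T4 f' g' h' = T4 (f - f') g h + T4 f' (g - g') h + T4 f' g' (h - h')"
 unfolding T4_T_from scaleR_right_diff_distrib[symmetric] scaleR_add_right[symmetric] T_from_diff ..

lemma continuous_on_T4:
 assumes u: "continuous_on I u" shows "continuous_on I (%s. T4 (u s) (u s) (u s))"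
 unfolding continuous_on_def
proof
 fix t assume t: "t \<in> I"
 have ut: "(u \<longlongrightarrow> u t) (at t within I)" using u t by (simp add: continuous_on_def)
 define D where "D s = norm (u s - u t)" for s
 have D: "(D \<longlongrightarrow> 0) (at t within I)" unfolding D_def by (intro tendsto_norm_zero LIM_zero ut)
 have "((%s. T4 (u s) (u s) (u s) - T4 (u t) (u t) (u t)) \<longlongrightarrow> 0) (at t within I)"
 proof (rule Lim_null_comparison)
  show "\<forall>\<^sub>F s in at t within I. norm (T4 (u s) (u s) (u s) - T4 (u t) (u t) (u t)) <=
    L2_const * D s * norm (u s) * norm (u s) + L2_const * norm (u t) * D s * norm (u s) + L2_const * norm (u t) * norm (u t) * D s"
   unfolding T4_diff D_def
   by (intro always_eventually allI norm_triangle_mono) (use L2.T4_bound in auto)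
  show "((%s. L2_const * D s * norm (u s) * norm (u s) + L2_const * norm (u t) * D s * norm (u s) + L2_const * norm (u t) * norm (u t) * D s) \<longlongrightarrow> 0) (at t within I)"
   by (rule tendsto_eq_intros D ut refl | simp)+
 qed
 then show "((%s. T4 (u s) (u s) (u s)) \<longlongrightarrow> T4 (u t) (u t) (u t)) (at t within I)" by (rule LIM_zero_cancel)
qed

context solution_space
begin

lemma T4_lipschitz:
 assumes u: "u \<in> X" "N u <= m" and v: "v \<in> X" "N v <= m"
 shows "T4 u u u - T4 v v v \<in> X \<and> N (T4 u u u - T4 v v v) <= 3 * C * m\<^sup>2 * N (u - v)"
proof -
 have d: "u - v \<in> X" "0 <= N (u - v)" using diff[OF u(1) v(1)] N_nonneg by auto
 have m: "0 <= m" "0 <= N u" "0 <= N v" using N_nonneg[OF u(1)] N_nonneg[OF v(1)] u(2) by auto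
 have mm: "C * a * b * c <= C * a' * b' * c'" if "0 <= a" "a <= a'" "0 <= b" "b <= b'" "0 <= c" "c <= c'" for a a' b b' c c'
  using that C_pos by (intro mult_mono) auto
 note B1 = T4_bound[OF d(1) u(1) u(1)] and B2 = T4_bound[OF v(1) d(1) u(1)] and B3 = T4_bound[OF v(1) v(1) d(1)]
 have 1: "T4 (u - v) u u \<in> X" "N (T4 (u - v) u u) <= C * N (u - v) * m * m"
  by (rule conjunct1[OF B1], rule order_trans[OF conjunct2[OF B1] mm]) (use d m u v in auto)
 have 2: "T4 v (u - v) u \<in> X" "N (T4 v (u - v) u) <= C * m * N (u - v) * m"
  by (rule conjunct1[OF B2], rule order_trans[OF conjunct2[OF B2] mm]) (use d m u v in auto)
 have 3: "T4 v v (u - v) \<in> X" "N (T4 v v (u - v)) <= C * m * m * N (u - v)"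
  by (rule conjunct1[OF B3], rule order_trans[OF conjunct2[OF B3] mm]) (use d m u v in auto)
 have "N (T4 (u - v) u u + T4 v (u - v) u + T4 v v (u - v)) <= N (T4 (u - v) u u) + N (T4 v (u - v) u) + N (T4 v v (u - v))"
  using add[OF 1(1) 2(1)] add[OF conjunct1[OF add[OF 1(1) 2(1)]] 3(1)] by linarith
 moreover have "C * N (u - v) * m * m + C * m * N (u - v) * m + C * m * m * N (u - v) = 3 * C * m\<^sup>2 * N (u - v)"
  by (simp add: power2_eq_square)
 ultimately have "N (T4 (u - v) u u + T4 v (u - v) u + T4 v v (u - v)) <= 3 * C * m\<^sup>2 * N (u - v)"
  using 1(2) 2(2) 3(2) by linarith
 then show ?thesis unfolding T4_diff using 1(1) 2(1) 3(1) add by blast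
qed

text \<open>The embedding turns a solution in \<open>X\<close> into a solution in L^2, where
  uniqueness is decided.\<close>

lemma solution_L2:
 assumes "solution X N I u\<^sub>0 u" shows "solution UNIV norm I u\<^sub>0 u" "continuous_on I u"
proof -
 have *: "((%s. norm (u s - u t)) \<longlongrightarrow> 0) (at t within I)" if t: "t \<in> I" for t
 proof (rule Lim_null_comparison)
  have "norm (norm (u s - u t)) <= C * N (u s - u t)" if "s \<in> I" for s
  proof -
   have "u s \<in> X" "u t \<in> X" using assms t that unfolding solution_def by blast+
   then show ?thesis using embedding[of "u s - u t"] diff[of "u s" "u t"] by simp
  qed
  then show "\<forall>\<^sub>F s in at t within I. norm (norm (u s - u t)) <= C * N (u s - u t)"
   unfolding eventually_at_filter by (intro always_eventually) blast
  have "((%s. N (u s - u t)) \<longlongrightarrow> 0) (at t within I)" using assms t unfolding solution_def by blast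
  then show "((%s. C * N (u s - u t)) \<longlongrightarrow> 0) (at t within I)" by (rule tendsto_mult_right_zero)
 qed
 then show "solution UNIV norm I u\<^sub>0 u" using assms unfolding solution_def by blast
 show "continuous_on I u"
  unfolding continuous_on_def using * by (auto intro: LIM_zero_cancel tendsto_norm_zero_cancel)
qed

text \<open>On the ball of radius m the nonlinearity has Lipschitz constant 3 C m^2. Taking \<kappa>
  as twice this constant, \<open>prim_exp\<close> yields the factor 1/2 that \<open>gronwall\<close>
  absorbs.\<close>

lemma stability:
 assumes I: "is_interval I" "0 \<in> I" and u: "solution X N I u\<^sub>0 u" and v: "solution X N I v\<^sub>0 v" and X0: "u\<^sub>0 \<in> X" "v\<^sub>0 \<in> X"
  and t: "t \<in> I" and m: "0 < m" "\<And>s. s \<in> closed_segment 0 t ==> N (u s) <= m" "\<And>s. s \<in> closed_segment 0 t ==> N (v s) <= m"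
 shows "N (u t - v t) <= 2 * N (u\<^sub>0 - v\<^sub>0) * exp (2 * (3 * C * m\<^sup>2) * \<bar>t\<bar>)"
proof (rule gronwall[of t "%t. N (u t - v t)"])
 have seg: "closed_segment 0 t \<subseteq> I" if "t \<in> I" for t
  using I that by (simp add: closed_segment_subset is_interval_convex)
 have X: "u s \<in> X" "v s \<in> X" if "s \<in> I" for s using u v that unfolding solution_def by blast+
 note Xd = diff[OF X(1) X(2), THEN conjunct1]
 show K: "0 < 3 * C * m\<^sup>2" using C_pos m by simp
 show "0 <= N (u\<^sub>0 - v\<^sub>0)" using diff[OF X0] N_nonneg by blast
 show "0 <= N (u s - v s)" if "s \<in> closed_segment 0 t" for s using Xd N_nonneg seg[OF t] that by blast
 have "continuous_on I (%t. N (u t - v t))"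
  unfolding continuous_on_def
 proof
  fix t assume t: "t \<in> I"
  have "((%s. N (u s - v s) - N (u t - v t)) \<longlongrightarrow> 0) (at t within I)"
  proof (rule Lim_null_comparison)
   have le: "\<bar>N (u s - v s) - N (u t - v t)\<bar> <= N (u s - u t) + N (v s - v t)" if s: "s \<in> I" for s
   proof -
    have d: "(u s - u t) - (v s - v t) \<in> X" "N ((u s - u t) - (v s - v t)) <= N (u s - u t) + N (v s - v t)"
     using diff[of "u s - u t" "v s - v t"] diff X s t by auto
    have d': "(u t - u s) - (v t - v s) \<in> X" "N ((u t - u s) - (v t - v s)) <= N (u s - u t) + N (v s - v t)"
     using diff[of "u t - u s" "v t - v s"] diff X s t minus_commute[of "u t" "u s"] minus_commute[of "v t" "v s"] by auto
    have "N (u s - v s) <= N ((u s - u t) - (v s - v t)) + N (u t - v t)"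
     using add[OF d(1) Xd[OF t t]] by (simp add: algebra_simps)
    moreover have "N (u t - v t) <= N ((u t - u s) - (v t - v s)) + N (u s - v s)"
     using add[OF d'(1) Xd[OF s s]] by (simp add: algebra_simps)
    ultimately show ?thesis using d(2) d'(2) by linarith
   qed
   then show "\<forall>\<^sub>F s in at t within I. norm (N (u s - v s) - N (u t - v t)) <= N (u s - u t) + N (v s - v t)"
    by (auto simp: eventually_at_filter)
   show "((%s. N (u s - u t) + N (v s - v t)) \<longlongrightarrow> 0) (at t within I)"
    by (intro tendsto_add_zero) (use u v t in \<open>unfold solution_def, blast+\<close>)
  qed
  then show "((%s. N (u s - v s)) \<longlongrightarrow> N (u t - v t)) (at t within I)" by (rule LIM_zero_cancel)
 qed
 then show "continuous_on (closed_segment 0 t) (%t. N (u t - v t))" by (rule continuous_on_subset[OF _ seg[OF t]])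
 fix s c
 assume s: "s \<in> closed_segment 0 t" and c: "0 <= c"
  and le: "\<And>r. r \<in> closed_segment 0 s ==> N (u r - v r) <= c * exp (2 * (3 * C * m\<^sup>2) * \<bar>r\<bar>)"
 have sI: "s \<in> I" using s seg[OF t] by blast
 have sub: "closed_segment 0 s \<subseteq> closed_segment 0 t" using s by (simp add: subset_closed_segment)
 have cu: "continuous_on (closed_segment 0 s) (%s. T4 (u s) (u s) (u s))" "continuous_on (closed_segment 0 s) (%s. T4 (v s) (v s) (v s))"
  using solution_L2(2)[OF u] solution_L2(2)[OF v] by (auto intro!: continuous_on_T4 intro: continuous_on_subset[OF _ seg[OF sI]])
 define E where "E = prim (%s. T4 (u s) (u s) (u s) - T4 (v s) (v s) (v s)) s"
 have "E \<in> X \<and> N E <= (3 * C * m\<^sup>2 * c) * exp (2 * (3 * C * m\<^sup>2) * \<bar>s\<bar>) / (2 * (3 * C * m\<^sup>2))"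
  unfolding E_def
 proof (rule prim_exp[OF continuous_on_diff[OF cu]])
  fix r assume r: "r \<in> closed_segment 0 s"
  then have rI: "r \<in> I" "r \<in> closed_segment 0 t" using sub seg[OF t] by auto
  have "T4 (u r) (u r) (u r) - T4 (v r) (v r) (v r) \<in> X \<and>
    N (T4 (u r) (u r) (u r) - T4 (v r) (v r) (v r)) <= 3 * C * m\<^sup>2 * N (u r - v r)"
   by (rule T4_lipschitz) (use X rI m in auto)
  moreover have "3 * C * m\<^sup>2 * N (u r - v r) <= 3 * C * m\<^sup>2 * (c * exp (2 * (3 * C * m\<^sup>2) * \<bar>r\<bar>))"
   by (rule mult_left_mono[OF le[OF r]]) (use K in simp)
  ultimately show "T4 (u r) (u r) (u r) - T4 (v r) (v r) (v r) \<in> X \<and>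
    N (T4 (u r) (u r) (u r) - T4 (v r) (v r) (v r)) <= 3 * C * m\<^sup>2 * c * exp (2 * (3 * C * m\<^sup>2) * \<bar>r\<bar>)"
   unfolding mult.assoc by (meson order_trans)
 qed (use K c in auto)
 moreover have "(3 * C * m\<^sup>2 * c) * exp (2 * (3 * C * m\<^sup>2) * \<bar>s\<bar>) / (2 * (3 * C * m\<^sup>2)) = c * exp (2 * (3 * C * m\<^sup>2) * \<bar>s\<bar>) / 2"
  using C_pos m by simp
 ultimately have E: "E \<in> X" "N E <= c * exp (2 * (3 * C * m\<^sup>2) * \<bar>s\<bar>) / 2" by auto
 have "u s - v s = (u\<^sub>0 - v\<^sub>0) - \<i> *\<^sub>C (prim (%s. T4 (u s) (u s) (u s)) s - prim (%s. T4 (v s) (v s) (v s)) s)"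
 proof -
  have "u s = u\<^sub>0 - \<i> *\<^sub>C prim (%s. T4 (u s) (u s) (u s)) s" "v s = v\<^sub>0 - \<i> *\<^sub>C prim (%s. T4 (v s) (v s) (v s)) s"
   using u v sI unfolding solution_def by blast+
  then have "u s - v s = (u\<^sub>0 - \<i> *\<^sub>C prim (%s. T4 (u s) (u s) (u s)) s) - (v\<^sub>0 - \<i> *\<^sub>C prim (%s. T4 (v s) (v s) (v s)) s)"
   by (rule arg_cong2)
  then show ?thesis unfolding scaleC_diff by (simp only: algebra_simps)
 qed
 also have "... = (u\<^sub>0 - v\<^sub>0) - \<i> *\<^sub>C E" unfolding E_def prim_diff[OF cu] ..
 finally have e: "u s - v s = (u\<^sub>0 - v\<^sub>0) - \<i> *\<^sub>C E" .
 have "N (\<i> *\<^sub>C E) <= N E" "\<i> *\<^sub>C E \<in> X" using scaleC[OF E(1), of \<i>] by auto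
 then show "N (u s - v s) <= N (u\<^sub>0 - v\<^sub>0) + c * exp (2 * (3 * C * m\<^sup>2) * \<bar>s\<bar>) / 2"
  unfolding e using diff[of "u\<^sub>0 - v\<^sub>0" "\<i> *\<^sub>C E"] diff[OF X0] E(2) by auto
qed

end

text \<open>Both curves are bounded on the segment from 0 to t by compactness, and
  \<open>stability\<close> is applied to equal data.\<close>

lemma L2_unique:
 assumes I: "is_interval I" "0 \<in> I" and u: "solution UNIV norm I u\<^sub>0 u" and v: "solution UNIV norm I u\<^sub>0 v" and t: "t \<in> I"
 shows "u t = v t"
proof -
 have seg: "closed_segment 0 t \<subseteq> I"
  using I t by (simp add: closed_segment_subset is_interval_convex)
 have c: "compact (u ` closed_segment 0 t)" "compact (v ` closed_segment 0 t)"
  by (intro compact_continuous_image continuous_on_subset[OF _ seg] L2.solution_L2(2)[OF u] L2.solution_L2(2)[OF v] compact_segment)+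
 obtain m1 m2 where m1: "\<forall>x\<in>u ` closed_segment 0 t. norm x <= m1" and m2: "\<forall>x\<in>v ` closed_segment 0 t. norm x <= m2"
  using compact_imp_bounded[OF c(1)] compact_imp_bounded[OF c(2)] unfolding bounded_iff by blast
 have "\<And>s. s \<in> closed_segment 0 t ==> norm (u s) <= m1" "\<And>s. s \<in> closed_segment 0 t ==> norm (v s) <= m2"
  using m1 m2 by auto
 then have "norm (u t - v t) <= 2 * norm (u\<^sub>0 - u\<^sub>0) * exp (2 * (3 * L2_const * (max 1 (max m1 m2))\<^sup>2) * \<bar>t\<bar>)"
  by (intro L2.stability[OF I u v _ _ t]) (auto simp: le_max_iff_disj)
 then show ?thesis by simp
qed

lemma (in solution_space) unique: "unique_solutions X N"
 unfolding unique_solutions_def using L2_unique solution_L2(1) by blast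

section \<open>Existence\<close>

text \<open>The nonlinearity is precomposed with the radial projection onto a ball of \<open>L\<^sup>2\<close>, which makes it
 globally Lipschitz; conservation of mass shows that the projection is not felt.\<close>

definition radial :: "real => L2 => L2" where
 "radial R x = (R / max R (norm x)) *\<^sub>R x"

definition cut_T4 :: "real => L2 => L2" where
 "cut_T4 R x = T4 (radial R x) (radial R x) (radial R x)"

primrec picard :: "real => L2 => nat => real => L2" where
 "picard R u\<^sub>0 0 = (%t. u\<^sub>0)"
| "picard R u\<^sub>0 (Suc n) = (%t. u\<^sub>0 - \<i> *\<^sub>C prim (%s. cut_T4 R (picard R u\<^sub>0 n s)) t)"

lemma radial_id: "0 < R ==> norm x <= R ==> radial R x = x"
 by (simp add: radial_def max_def)

lemma norm_radial: "0 < R ==> norm (radial R x) <= R"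
proof -
 assume R: "0 < R"
 have "R * norm x <= R * max R (norm x)" using R by (intro mult_left_mono) auto
 then show ?thesis using R by (simp add: radial_def pos_divide_le_eq less_max_iff_disj)
qed

lemma radial_lipschitz:
 assumes R: "0 < R" shows "norm (radial R x - radial R y) <= 2 * norm (x - y)"
proof -
 define a b where "a = max R (norm x)" and "b = max R (norm y)"
 have ab: "R <= a" "0 < a" "0 < b" "norm y <= b" "\<bar>b - a\<bar> <= norm (x - y)"
  using R norm_triangle_ineq3[of x y] by (auto simp: a_def b_def max_def)
 have "radial R x - radial R y = (R / a) *\<^sub>R (x - y) + (R / a - R / b) *\<^sub>R y"
  by (simp add: radial_def a_def b_def algebra_simps)
 also have "norm ... <= R / a * norm (x - y) + \<bar>R / a - R / b\<bar> * norm y"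
  using R ab by (intro norm_triangle_le add_mono) auto
 also have "\<bar>R / a - R / b\<bar> * norm y = (R / a) * (\<bar>b - a\<bar> * (norm y / b))"
 proof -
  have "R / a - R / b = (R / a) * ((b - a) / b)" using ab by (simp add: field_simps)
  then have "\<bar>R / a - R / b\<bar> = (R / a) * (\<bar>b - a\<bar> / b)" using R ab by (simp add: abs_mult)
  then show ?thesis by simp
 qed
 also have "(R / a) * (\<bar>b - a\<bar> * (norm y / b)) <= 1 * (norm (x - y) * 1)"
  using ab R by (intro mult_mono) auto
 also have "R / a * norm (x - y) <= 1 * norm (x - y)"
  using ab R by (intro mult_right_mono) auto
 finally show ?thesis by simp
qed

lemma (in solution_space) radial: "x \<in> X ==> 0 < R ==> radial R x \<in> X \<and> N (radial R x) <= N x"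
proof -
 assume x: "x \<in> X" and R: "0 < R"
 have "\<bar>R / max R (norm x)\<bar> <= 1" using R by simp
 from mult_right_mono[OF this N_nonneg[OF x]] scaleR[OF x, of "R / max R (norm x)"] show ?thesis
  unfolding radial_def by auto
qed

context
 fixes R :: real assumes R: "0 < R"
begin

lemma norm_cut_T4: "norm (cut_T4 R x) <= L2_const * R ^ 3"
proof -
 have "norm (cut_T4 R x) <= L2_const * norm (radial R x) * norm (radial R x) * norm (radial R x)"
  unfolding cut_T4_def using L2.T4_bound by simp
 also have "... <= L2_const * R * R * R"
  using norm_radial[OF R, of x] L2.C_pos R by (intro mult_mono) auto
 finally show ?thesis by (simp add: power3_eq_cube mult.assoc)
qed

definition "Lip = 6 * L2_const * R\<^sup>2"

lemma Lip_pos: "0 < Lip" using L2.C_pos R by (simp add: Lip_def)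

lemma cut_T4_lipschitz: "norm (cut_T4 R x - cut_T4 R y) <= Lip * norm (x - y)"
proof -
 have "norm (cut_T4 R x - cut_T4 R y) <= 3 * L2_const * R\<^sup>2 * norm (radial R x - radial R y)"
  unfolding cut_T4_def using L2.T4_lipschitz norm_radial[OF R] by blast
 also have "... <= 3 * L2_const * R\<^sup>2 * (2 * norm (x - y))"
  using L2.C_pos by (intro mult_left_mono radial_lipschitz R) auto
 finally show ?thesis by (simp add: Lip_def)
qed

lemma continuous_cut_T4: "continuous_on S v ==> continuous_on S (%s. cut_T4 R (v s))"
proof -
 have "Lip-lipschitz_on UNIV (cut_T4 R)"
  using cut_T4_lipschitz Lip_pos by (auto simp: lipschitz_on_def dist_norm)
 then have "continuous_on UNIV (cut_T4 R)" by (rule lipschitz_on_continuous_on)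
 then show "continuous_on S v ==> continuous_on S (%s. cut_T4 R (v s))"
  by (rule continuous_on_compose2) auto
qed

lemma prim_cut_lipschitz:
 assumes "continuous_on UNIV v"
 shows "norm (prim (%s. cut_T4 R (v s)) t - prim (%s. cut_T4 R (v s)) s) <= L2_const * R ^ 3 * \<bar>t - s\<bar>"
 using L2.prim_increment[OF is_interval_univ UNIV_I continuous_cut_T4[OF assms] UNIV_I UNIV_I, of s t "L2_const * R ^ 3"]
  norm_cut_T4 by simp

lemma continuous_of_lipschitz:
 fixes v :: "real => L2"
 assumes "\<And>s t. norm (v t - v s) <= L2_const * R ^ 3 * \<bar>t - s\<bar>" shows "continuous_on UNIV v"
proof -
 have "(L2_const * R ^ 3)-lipschitz_on UNIV v"
  using assms L2.C_pos R by (auto simp: lipschitz_on_def dist_norm dist_real_def)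
 then show ?thesis by (rule lipschitz_on_continuous_on)
qed

lemma picard_lipschitz:
 "continuous_on UNIV (picard R u\<^sub>0 n) \<and> (\<forall>s t. norm (picard R u\<^sub>0 n t - picard R u\<^sub>0 n s) <= L2_const * R ^ 3 * \<bar>t - s\<bar>)"
proof (induction n)
 case 0
 then show ?case using L2.C_pos R by simp
next
 case (Suc n)
 have "norm (picard R u\<^sub>0 (Suc n) t - picard R u\<^sub>0 (Suc n) s) <= L2_const * R ^ 3 * \<bar>t - s\<bar>" for s t
 proof -
  have "picard R u\<^sub>0 (Suc n) t - picard R u\<^sub>0 (Suc n) s =
   - (\<i> *\<^sub>C (prim (%s. cut_T4 R (picard R u\<^sub>0 n s)) t - prim (%s. cut_T4 R (picard R u\<^sub>0 n s)) s))"
   by (simp add: scaleC_diff)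
  then have "norm (picard R u\<^sub>0 (Suc n) t - picard R u\<^sub>0 (Suc n) s) =
   norm (prim (%s. cut_T4 R (picard R u\<^sub>0 n s)) t - prim (%s. cut_T4 R (picard R u\<^sub>0 n s)) s)"
   by (simp only: norm_minus_cancel norm_scaleC) simp
  also have "... <= L2_const * R ^ 3 * \<bar>t - s\<bar>" by (rule prim_cut_lipschitz) (use Suc in blast)
  finally show ?thesis .
 qed
 then show ?case using continuous_of_lipschitz by blast
qed

lemma norm_prim_cut_diff:
 assumes v: "continuous_on UNIV v" "continuous_on UNIV w" and c: "0 <= c"
  and le: "\<And>s. norm (v s - w s) <= c * exp (2 * Lip * \<bar>s\<bar>)"
 shows "norm ((u\<^sub>0 - \<i> *\<^sub>C prim (%s. cut_T4 R (v s)) t) - (u\<^sub>0 - \<i> *\<^sub>C prim (%s. cut_T4 R (w s)) t)) <= c / 2 * exp (2 * Lip * \<bar>t\<bar>)"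
proof -
 note cv = continuous_on_subset[OF continuous_cut_T4[OF v(1)] subset_UNIV[of "closed_segment 0 t"]]
  and cw = continuous_on_subset[OF continuous_cut_T4[OF v(2)] subset_UNIV[of "closed_segment 0 t"]]
 have "norm (prim (%s. cut_T4 R (v s) - cut_T4 R (w s)) t) <= (Lip * c) * exp ((2 * Lip) * \<bar>t\<bar>) / (2 * Lip)"
 proof (rule conjunct2[OF L2.prim_exp[OF continuous_on_diff[OF cv cw]]])
  fix r
  have "norm (cut_T4 R (v r) - cut_T4 R (w r)) <= Lip * (c * exp (2 * Lip * \<bar>r\<bar>))"
   by (rule order_trans[OF cut_T4_lipschitz mult_left_mono[OF le]]) (use Lip_pos in simp)
  then show "cut_T4 R (v r) - cut_T4 R (w r) \<in> UNIV \<and> norm (cut_T4 R (v r) - cut_T4 R (w r)) <= Lip * c * exp (2 * Lip * \<bar>r\<bar>)"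
   by (simp add: mult.assoc)
 qed (use Lip_pos c in auto)
 also have "... = c / 2 * exp (2 * Lip * \<bar>t\<bar>)" using Lip_pos by simp
 finally have "norm (prim (%s. cut_T4 R (v s)) t - prim (%s. cut_T4 R (w s)) t) <= c / 2 * exp (2 * Lip * \<bar>t\<bar>)"
  unfolding prim_diff[OF cv cw] .
 moreover have "(u\<^sub>0 - \<i> *\<^sub>C A) - (u\<^sub>0 - \<i> *\<^sub>C B) = - (\<i> *\<^sub>C (A - B))" for A B
  by (simp add: scaleC_diff)
 ultimately show ?thesis by (simp only: norm_minus_cancel norm_scaleC) simp
qed

text \<open>Relative to the weight exp(2 Lip |t|) consecutive increments halve on the whole time
  axis, because the truncated nonlinearity is globally Lipschitz. The first increment grows linearly
  in time and is put below the weight by x \<le> exp x.\<close>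

lemma picard_limit:
 "\<exists>u. (\<forall>t. (%n. picard R u\<^sub>0 n t) \<longlonglongrightarrow> u t) \<and> continuous_on UNIV u \<and>
   (\<forall>t. u t = u\<^sub>0 - \<i> *\<^sub>C prim (%s. cut_T4 R (u s)) t)"
proof -
 let ?p = "picard R u\<^sub>0"
 define K where "K = L2_const * R ^ 3 / (2 * Lip)"
 define E where "E t = exp (2 * Lip * \<bar>t\<bar>)" for t
 have K: "0 <= K" using L2.C_pos R Lip_pos by (simp add: K_def)
 have pc: "continuous_on UNIV (?p n)" for n using picard_lipschitz by blast
 have step: "norm (?p (Suc n) t - ?p n t) <= K * (1/2) ^ n * E t" for n t
 proof (induction n arbitrary: t)
  case 0
  have "norm (?p (Suc 0) t - ?p 0 t) <= L2_const * R ^ 3 * \<bar>t\<bar>"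
   using picard_lipschitz[of u\<^sub>0 "Suc 0"] prim_cut_lipschitz[of "%_. u\<^sub>0" t 0]
   by (simp add: norm_scaleC zero_ereal_def)
  also have "... = K * (2 * Lip * \<bar>t\<bar>)" using Lip_pos by (simp add: K_def)
  also have "... <= K * E t"
   unfolding E_def using exp_ge_add_one_self[of "2 * Lip * \<bar>t\<bar>"] by (intro mult_left_mono K) linarith
  finally show ?case by simp
 next
  case (Suc n)
  have "norm (?p (Suc (Suc n)) t - ?p (Suc n) t) <= (K * (1/2) ^ n) / 2 * exp (2 * Lip * \<bar>t\<bar>)"
   unfolding picard.simps(2)[of R u\<^sub>0 "Suc n"] picard.simps(2)[of R u\<^sub>0 n]
   by (rule norm_prim_cut_diff[OF pc[of "Suc n", unfolded picard.simps(2)] pc[of n]]) (use K Suc in \<open>auto simp: E_def\<close>)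
  then show ?case by (simp add: E_def)
 qed
 have tail: "norm (?p (n + k) t - ?p n t) <= 2 * K * (1/2) ^ n * (1 - (1/2) ^ k) * E t" for n k t
 proof (induction k)
  case (Suc k)
  have "norm (?p (n + Suc k) t - ?p n t) <= norm (?p (Suc (n + k)) t - ?p (n + k) t) + norm (?p (n + k) t - ?p n t)"
   using norm_triangle_ineq[of "?p (Suc (n + k)) t - ?p (n + k) t" "?p (n + k) t - ?p n t"] by simp
  also have "... <= K * (1/2) ^ (n + k) * E t + 2 * K * (1/2) ^ n * (1 - (1/2) ^ k) * E t"
   by (intro add_mono step Suc)
  also have "... = 2 * K * (1/2) ^ n * (1 - (1/2) ^ Suc k) * E t" by (simp add: power_add algebra_simps)
  finally show ?case .
 qed simp
 have tail': "norm (?p (n + k) t - ?p n t) <= 2 * K * (1/2) ^ n * E t" for n k t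
 proof -
  have "2 * K * (1/2) ^ n * (1 - (1/2) ^ k) * E t <= 2 * K * (1/2) ^ n * 1 * E t"
   using K by (intro mult_right_mono mult_left_mono) (auto simp: E_def)
  then show ?thesis using tail[of n k t] by simp
 qed
 have half: "(%n. c * (1/2) ^ n) \<longlonglongrightarrow> 0" for c :: real
  by (rule tendsto_mult_right_zero) (rule LIMSEQ_power_zero, simp)
 have "convergent (%n. ?p n t)" for t
 proof -
  have "summable (%n. ?p (Suc n) t - ?p n t)"
  proof (rule summable_comparison_test'[of "%n. K * E t * (1/2) ^ n" 0])
   show "summable (%n. K * E t * (1/2) ^ n)" by (intro summable_mult summable_geometric) simp
   show "norm (?p (Suc n) t - ?p n t) <= K * E t * (1/2) ^ n" for n using step[of n t] by (simp add: ac_simps)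
  qed
  then have "convergent (%n. \<Sum>i<n. ?p (Suc i) t - ?p i t)" by (simp add: summable_iff_convergent)
  then have "convergent (%n. (?p n t - ?p 0 t) + ?p 0 t)"
   unfolding sum_lessThan_telescope[of "%n. ?p n t"] by (intro convergent_add convergent_const)
  then show ?thesis by simp
 qed
 then obtain u where u: "\<And>t. (%n. ?p n t) \<longlonglongrightarrow> u t" unfolding convergent_def by metis
 have close: "norm (?p n t - u t) <= 2 * K * (1/2) ^ n * E t" for n t
 proof -
  have "(%k. norm (?p (k + n) t - ?p n t)) \<longlonglongrightarrow> norm (u t - ?p n t)"
   by (intro tendsto_intros LIMSEQ_ignore_initial_segment u)
  then have "norm (u t - ?p n t) <= 2 * K * (1/2) ^ n * E t"
   by (rule LIMSEQ_le_const2) (use tail'[of n] in \<open>auto simp: add.commute\<close>)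
  then show ?thesis by (simp add: norm_minus_commute)
 qed
 have cu: "continuous_on UNIV u"
 proof (rule continuous_of_lipschitz)
  fix s t
  have "(%n. norm (?p n t - ?p n s)) \<longlonglongrightarrow> norm (u t - u s)" by (intro tendsto_intros u)
  then show "norm (u t - u s) <= L2_const * R ^ 3 * \<bar>t - s\<bar>"
   by (rule LIMSEQ_le_const2) (use picard_lipschitz in auto)
 qed
 have "u t = u\<^sub>0 - \<i> *\<^sub>C prim (%s. cut_T4 R (u s)) t" for t
 proof (rule LIMSEQ_unique[OF LIMSEQ_Suc[OF u[of t]]])
  have "(%n. ?p (Suc n) t - (u\<^sub>0 - \<i> *\<^sub>C prim (%s. cut_T4 R (u s)) t)) \<longlonglongrightarrow> 0"
  proof (rule Lim_null_comparison[OF always_eventually[OF allI] half])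
   fix n
   have "norm (?p (Suc n) t - (u\<^sub>0 - \<i> *\<^sub>C prim (%s. cut_T4 R (u s)) t)) <= (2 * K * (1/2) ^ n) / 2 * exp (2 * Lip * \<bar>t\<bar>)"
    unfolding picard.simps(2)
    by (rule norm_prim_cut_diff[OF pc cu]) (use K close in \<open>auto simp: E_def\<close>)
   then show "norm (?p (Suc n) t - (u\<^sub>0 - \<i> *\<^sub>C prim (%s. cut_T4 R (u s)) t)) <= K * exp (2 * Lip * \<bar>t\<bar>) * (1/2) ^ n"
    by (simp add: ac_simps)
  qed
  then show "(%n. ?p (Suc n) t) \<longlonglongrightarrow> u\<^sub>0 - \<i> *\<^sub>C prim (%s. cut_T4 R (u s)) t" by (rule LIM_zero_cancel)
 qed
 then show ?thesis using u cu by blast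
qed

text \<open>The derivative of the squared norm is -2 times the real inner product of
  \<open>\<i> *\<^sub>C cut_T4 R (u t)\<close> with \<open>u t\<close>.
  \<open>Im_cinner_T_from\<close> concerns the projected argument, which is a positive real multiple
  of \<open>u t\<close>, so the truncated equation conserves mass too.\<close>

lemma mass_conserved:
 assumes cu: "continuous_on UNIV u" and eq: "\<And>t. u t = u\<^sub>0 - \<i> *\<^sub>C prim (%s. cut_T4 R (u s)) t"
 shows "norm (u t) = norm u\<^sub>0"
proof -
 let ?V = "%s. cut_T4 R (u s)"
 have cV: "continuous_on UNIV ?V" by (rule continuous_cut_T4[OF cu])
 have dprim: "(prim ?V has_vector_derivative ?V t) (at t)" for t
 proof -
  have c: "continuous_on {t - 1..t + 1} ?V" by (rule continuous_on_subset[OF cV]) simp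
  have "((%r. integral {t - 1..r} ?V) has_vector_derivative ?V t) (at t within {t - 1..t + 1})"
   by (rule integral_has_vector_derivative[OF c]) simp
  then have d: "((%r. prim ?V (t - 1) + integral {t - 1..r} ?V) has_vector_derivative ?V t) (at t within {t - 1..t + 1})"
   using has_vector_derivative_add[OF has_vector_derivative_const] by fastforce
  have "prim ?V r = prim ?V (t - 1) + integral {t - 1..r} ?V" if "r \<in> {t - 1..t + 1}" for r
   using that integral_unique[OF has_integral_prim_diff[OF is_interval_univ UNIV_I cV UNIV_I UNIV_I, of "t - 1" r]] by simp
  from has_vector_derivative_transform[OF _ this d]
  have "(prim ?V has_vector_derivative ?V t) (at t within {t - 1..t + 1})" by simp
  then show ?thesis by (simp add: at_within_Icc_at)
 qed
 have orth: "(\<i> *\<^sub>C ?V t) \<bullet> u t = 0" for t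
 proof -
  define c where "c = R / max R (norm (u t))"
  have c: "0 < c" using R by (simp add: c_def less_max_iff_disj)
  have r: "radial R (u t) = cplx c *\<^sub>C u t" by (simp only: radial_def c_def scaleC_of_real)
  have "Im (cinner (?V t) (radial R (u t))) = 0"
   unfolding cut_T4_def T4_T_from scaleC_of_real[symmetric] using Im_cinner_T_from[of "- (pi / 4)" "radial R (u t)"]
   by (simp add: cinner_scaleC_left)
  then have "c * Im (cinner (?V t) (u t)) = 0" unfolding r cinner_scaleC_right by simp
  then have "Im (cinner (?V t) (u t)) = 0" using c by simp
  then show ?thesis by (simp add: cinner_scaleC_left flip: Re_cinner)
 qed
 have "((%t. u t \<bullet> u t) has_real_derivative 0) (at t)" for t
 proof -
  have d: "((%t. u\<^sub>0 - \<i> *\<^sub>C prim ?V t) has_vector_derivative 0 - \<i> *\<^sub>C ?V t) (at t)"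
   by (intro has_vector_derivative_diff has_vector_derivative_const
    bounded_linear.has_vector_derivative[OF bounded_linear_scaleC] dprim)
  have "(u has_vector_derivative - (\<i> *\<^sub>C ?V t)) (at t)"
   using has_vector_derivative_transform[of t UNIV u, OF UNIV_I eq d] by simp
  then have "(u has_derivative (%h. h *\<^sub>R - (\<i> *\<^sub>C ?V t))) (at t)" by (simp add: has_vector_derivative_def)
  from has_derivative_inner[OF this this]
  have "((%t. u t \<bullet> u t) has_derivative (%h. 0)) (at t)"
   by (simp add: inner_commute[of "u t"] orth)
  then show ?thesis by (simp add: has_field_derivative_def mult_zero_left[abs_def])
 qed
 then have "u t \<bullet> u t = u 0 \<bullet> u 0" by (intro DERIV_isconst_all) auto
 moreover have "u 0 = u\<^sub>0" using eq[of 0] scaleC_zero by (simp add: zero_ereal_def)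
 ultimately show ?thesis by (simp add: norm_eq_sqrt_inner)
qed

end

text \<open>A limit of Picard iterates, with a cut-off radius above the conserved norm. Bounds on
  the iterates thus pass to \<open>flow\<close> in every space \<open>X\<close>, by
  \<open>closed\<close>.\<close>

definition flow :: "L2 => real => L2" where
 "flow u\<^sub>0 t = lim (%n. picard (norm u\<^sub>0 + 1) u\<^sub>0 n t)"

lemma flow:
 shows picard_flow: "(%n. picard (norm u\<^sub>0 + 1) u\<^sub>0 n t) \<longlonglongrightarrow> flow u\<^sub>0 t"
  and norm_flow: "norm (flow u\<^sub>0 t) = norm u\<^sub>0"
  and continuous_flow: "continuous_on S (flow u\<^sub>0)"
  and flow_eq: "flow u\<^sub>0 t = u\<^sub>0 - \<i> *\<^sub>C prim (%s. T4 (flow u\<^sub>0 s) (flow u\<^sub>0 s) (flow u\<^sub>0 s)) t"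
proof -
 have R: "0 < norm u\<^sub>0 + 1" by (simp add: add_nonneg_pos)
 obtain u where u: "\<And>t. (%n. picard (norm u\<^sub>0 + 1) u\<^sub>0 n t) \<longlonglongrightarrow> u t" "continuous_on UNIV u"
  "\<And>t. u t = u\<^sub>0 - \<i> *\<^sub>C prim (%s. cut_T4 (norm u\<^sub>0 + 1) (u s)) t"
  using picard_limit[OF R, of u\<^sub>0] by blast
 have f: "flow u\<^sub>0 = u" by (rule ext) (simp add: flow_def limI[OF u(1)])
 have n: "norm (u s) = norm u\<^sub>0" for s by (rule mass_conserved[OF R u(2,3)])
 then have "cut_T4 (norm u\<^sub>0 + 1) (u s) = T4 (u s) (u s) (u s)" for s by (simp add: cut_T4_def radial_id[OF R])
 then show "flow u\<^sub>0 t = u\<^sub>0 - \<i> *\<^sub>C prim (%s. T4 (flow u\<^sub>0 s) (flow u\<^sub>0 s) (flow u\<^sub>0 s)) t"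
  unfolding f using u(3)[of t] by simp
 show "(%n. picard (norm u\<^sub>0 + 1) u\<^sub>0 n t) \<longlonglongrightarrow> flow u\<^sub>0 t" unfolding f by (rule u(1))
 show "norm (flow u\<^sub>0 t) = norm u\<^sub>0" unfolding f by (rule n)
 show "continuous_on S (flow u\<^sub>0)" unfolding f by (rule continuous_on_subset[OF u(2)]) simp
qed

context solution_space
begin

lemma cut_T4_X: "x \<in> X ==> 0 < R ==> cut_T4 R x \<in> X"
 unfolding cut_T4_def using radial T4_bound by blast

text \<open>The iterates stay in the ball of radius 2 r as long as C (2 r)^3 |t| \<le> r, which
  gives the time 1 / (8 C r^2). The radial projection multiplies by a factor in [0, 1] and does not
  increase \<open>N\<close>.\<close>

lemma flow_local:
 assumes u0: "u\<^sub>0 \<in> X" "N u\<^sub>0 <= r" and r: "0 < r" and t: "\<bar>t\<bar> <= 1 / (8 * C * r\<^sup>2)"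
 shows "flow u\<^sub>0 t \<in> X \<and> N (flow u\<^sub>0 t) <= 2 * r"
proof -
 have R: "0 < norm u\<^sub>0 + 1" by (simp add: add_nonneg_pos)
 have "picard (norm u\<^sub>0 + 1) u\<^sub>0 n s \<in> X \<and> N (picard (norm u\<^sub>0 + 1) u\<^sub>0 n s) <= 2 * r" if "\<bar>s\<bar> <= 1 / (8 * C * r\<^sup>2)" for n s
  using that
 proof (induction n arbitrary: s)
  case 0
  then show ?case using u0 r by simp
 next
  case (Suc n)
  let ?V = "%s. cut_T4 (norm u\<^sub>0 + 1) (picard (norm u\<^sub>0 + 1) u\<^sub>0 n s)"
  have cV: "continuous_on UNIV ?V" by (rule continuous_cut_T4[OF R]) (use picard_lipschitz[OF R] in blast)
  have "prim ?V s - prim ?V 0 \<in> X \<and> N (prim ?V s - prim ?V 0) <= 8 * C * r ^ 3 * \<bar>s - 0\<bar>"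
  proof (rule prim_increment[OF is_interval_univ UNIV_I cV UNIV_I UNIV_I])
   fix q assume "q \<in> closed_segment 0 s"
   then have "\<bar>q\<bar> <= \<bar>s\<bar>" by (auto simp: segment_0 split: if_splits)
   then have IH: "picard (norm u\<^sub>0 + 1) u\<^sub>0 n q \<in> X" "N (picard (norm u\<^sub>0 + 1) u\<^sub>0 n q) <= 2 * r" using Suc by auto
   define x where "x = radial (norm u\<^sub>0 + 1) (picard (norm u\<^sub>0 + 1) u\<^sub>0 n q)"
   have x: "x \<in> X" "0 <= N x" "N x <= 2 * r" using radial[OF IH(1) R] IH(2) N_nonneg unfolding x_def by auto
   have "C * N x * N x * N x <= C * (2 * r) * (2 * r) * (2 * r)" using x C_pos r by (intro mult_mono) auto
   also have "... = 8 * C * r ^ 3" by (simp add: power3_eq_cube)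
   finally show "?V q \<in> X \<and> N (?V q) <= 8 * C * r ^ 3"
    unfolding cut_T4_def x_def[symmetric] using T4_bound[OF x(1) x(1) x(1)] by auto
  qed
  then have P: "prim ?V s \<in> X" "N (prim ?V s) <= 8 * C * r ^ 3 * \<bar>s\<bar>" by (simp_all add: zero_ereal_def)
  have "8 * C * r ^ 3 * \<bar>s\<bar> <= 8 * C * r ^ 3 * (1 / (8 * C * r\<^sup>2))"
   using Suc.prems C_pos r by (intro mult_left_mono) auto
  also have "... = r" using C_pos r by (simp add: power2_eq_square power3_eq_cube)
  finally have "N (prim ?V s) <= r" using P by simp
  then have "\<i> *\<^sub>C prim ?V s \<in> X" "N (\<i> *\<^sub>C prim ?V s) <= r" using scaleC[OF P(1), of \<i>] by auto
  then show ?case using diff[OF u0(1), of "\<i> *\<^sub>C prim ?V s"] u0(2) by auto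
 qed
 then show ?thesis by (intro closed[OF _ picard_flow]) (use t in auto)
qed

text \<open>Boundedness in \<open>X\<close> gives continuity in \<open>X\<close>: by the Duhamel
  formula the flow is then Lipschitz in time with constant C m^3.\<close>

lemma solution_flow:
 assumes I: "is_interval I" "0 \<in> I" and X: "\<And>t. t \<in> I ==> flow u\<^sub>0 t \<in> X \<and> N (flow u\<^sub>0 t) <= m"
 shows "solution X N I u\<^sub>0 (flow u\<^sub>0)"
 unfolding solution_def
proof (intro conjI ballI flow_eq)
 fix t assume t: "t \<in> I"
 then show "flow u\<^sub>0 t \<in> X" using X by blast
 have m: "0 <= m" using X[OF t] N_nonneg[of "flow u\<^sub>0 t"] by auto
 let ?V = "%s. T4 (flow u\<^sub>0 s) (flow u\<^sub>0 s) (flow u\<^sub>0 s)"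
 show "((%s. N (flow u\<^sub>0 s - flow u\<^sub>0 t)) \<longlongrightarrow> 0) (at t within I)"
 proof (rule Lim_null_comparison)
  have "norm (N (flow u\<^sub>0 s - flow u\<^sub>0 t)) <= C * m ^ 3 * \<bar>s - t\<bar>" if s: "s \<in> I" for s
  proof -
   have "prim ?V s - prim ?V t \<in> X \<and> N (prim ?V s - prim ?V t) <= C * m ^ 3 * \<bar>s - t\<bar>"
   proof (rule prim_increment[OF I continuous_on_T4[OF continuous_flow] t s])
    fix r assume "r \<in> closed_segment t s"
    then have "r \<in> I" using closed_segment_subset[OF t s] I by (auto simp: is_interval_convex)
    note r = X[OF this, THEN conjunct1] X[OF this, THEN conjunct2]
    have "C * N (flow u\<^sub>0 r) * N (flow u\<^sub>0 r) * N (flow u\<^sub>0 r) <= C * m * m * m"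
     using r N_nonneg[OF r(1)] C_pos m by (intro mult_mono) auto
    then show "?V r \<in> X \<and> N (?V r) <= C * m ^ 3"
     using T4_bound[OF r(1) r(1) r(1)] by (auto simp: power3_eq_cube mult.assoc)
   qed
   then have "- \<i> *\<^sub>C (prim ?V s - prim ?V t) \<in> X" "N (- \<i> *\<^sub>C (prim ?V s - prim ?V t)) <= C * m ^ 3 * \<bar>s - t\<bar>"
    using scaleC[of "prim ?V s - prim ?V t" "- \<i>"] by auto
   moreover have "flow u\<^sub>0 s - flow u\<^sub>0 t = - \<i> *\<^sub>C (prim ?V s - prim ?V t)"
   proof -
    have "flow u\<^sub>0 s - flow u\<^sub>0 t = (u\<^sub>0 - \<i> *\<^sub>C prim ?V s) - (u\<^sub>0 - \<i> *\<^sub>C prim ?V t)"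
     by (rule arg_cong2[OF flow_eq flow_eq])
    also have "... = (-1) *\<^sub>R (\<i> *\<^sub>C (prim ?V s - prim ?V t))"
     unfolding scaleC_diff by simp
    also have "... = - \<i> *\<^sub>C (prim ?V s - prim ?V t)"
     unfolding scaleC_of_real[symmetric] scaleC_scaleC by simp
    finally show ?thesis .
   qed
   ultimately show ?thesis using N_nonneg by simp
  qed
  then show "\<forall>\<^sub>F s in at t within I. norm (N (flow u\<^sub>0 s - flow u\<^sub>0 t)) <= C * m ^ 3 * \<bar>s - t\<bar>"
   unfolding eventually_at_filter by (intro always_eventually) blast
  show "((%s. C * m ^ 3 * \<bar>s - t\<bar>) \<longlongrightarrow> 0) (at t within I)" by (rule tendsto_eq_intros refl | simp)+
 qed
qed

text \<open>The clause \<open>x < 1\<close> keeps perturbed data in a fixed ball in the global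
  statement.\<close>

lemma dependence_small:
 assumes "0 < e" "0 < K" shows "\<exists>\<eta>>0. \<forall>x\<ge>0. x < \<eta> --> 2 * x * K < (e::real) \<and> x < 1"
proof (intro exI[of _ "min 1 (e / (2 * K))"] conjI allI impI)
 fix x :: real assume "0 <= x" "x < min 1 (e / (2 * K))"
 then have "x < 1" "x < e / (2 * K)" by auto
 then show "2 * x * K < e" "x < 1" using assms by (auto simp: pos_less_divide_eq ac_simps)
qed (use assms in auto)

lemma local: "locally_wellposed X N"
 unfolding locally_wellposed_def Let_def
proof (intro conjI ballI unique)
 fix u\<^sub>0 assume u0: "u\<^sub>0 \<in> X"
 \<comment> \<open>All data at distance less than 1 from the centre have norm at most r, so one
   existence time serves the whole neighbourhood.\<close>
 define r where "r = N u\<^sub>0 + 1"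
 have r: "0 < r" using N_nonneg[OF u0] by (simp add: r_def)
 define T where "T = 1 / (8 * C * r\<^sup>2)"
 have T: "0 < T" using C_pos r by (simp add: T_def)
 have I: "is_interval {-T..T}" "0 \<in> {-T..T}" using T by (auto simp: is_interval_cc)
 have B: "N v <= r" if "v \<in> X" "N (v - u\<^sub>0) < 1" for v
  using add[OF conjunct1[OF diff[OF that(1) u0]] u0] that by (simp add: r_def)
 have X: "flow v t \<in> X \<and> N (flow v t) <= 2 * r" if "v \<in> X" "N (v - u\<^sub>0) < 1" "t \<in> {-T..T}" for v t
  by (rule flow_local[OF that(1) B[OF that(1,2)] r]) (use that(3) in \<open>auto simp: T_def\<close>)
 have S: "solution X N {-T..T} v (flow v)" if "v \<in> X" "N (v - u\<^sub>0) < 1" for v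
  by (rule solution_flow[OF I X[OF that]])
 show "\<exists>T>0. \<exists>\<delta>>0. \<exists>S. (\<forall>v\<in>{v \<in> X. N (v - u\<^sub>0) < \<delta>}. solution X N {-T..T} v (S v)) \<and>
   (\<forall>v\<in>{v \<in> X. N (v - u\<^sub>0) < \<delta>}. \<forall>\<epsilon>>0. \<exists>\<eta>>0. \<forall>w\<in>{v \<in> X. N (v - u\<^sub>0) < \<delta>}. N (w - v) < \<eta> --> (\<forall>t\<in>{-T..T}. N (S w t - S v t) < \<epsilon>))"
 proof (rule exI[of _ T], rule conjI[OF T], rule exI[of _ 1], rule conjI[OF zero_less_one], rule exI[of _ flow],
   intro conjI ballI allI impI)
  show "solution X N {-T..T} v (flow v)" if "v \<in> {v \<in> X. N (v - u\<^sub>0) < 1}" for v using S that by simp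
  fix v and e :: real assume v: "v \<in> {v \<in> X. N (v - u\<^sub>0) < 1}" and e: "0 < e"
  define K where "K = exp (2 * (3 * C * (2 * r)\<^sup>2) * T)"
  obtain \<eta> where \<eta>: "0 < \<eta>" "\<And>x. 0 <= x ==> x < \<eta> ==> 2 * x * K < e"
   using dependence_small[OF e, of K] by (auto simp: K_def)
  show "\<exists>\<eta>>0. \<forall>w\<in>{v \<in> X. N (v - u\<^sub>0) < 1}. N (w - v) < \<eta> --> (\<forall>t\<in>{-T..T}. N (flow w t - flow v t) < e)"
  proof (intro exI[of _ \<eta>] conjI ballI impI \<eta>(1))
   fix w t assume w: "w \<in> {v \<in> X. N (v - u\<^sub>0) < 1}" and wv: "N (w - v) < \<eta>" and t: "t \<in> {-T..T}"
   have vX: "v \<in> X" "N (v - u\<^sub>0) < 1" and wX: "w \<in> X" "N (w - u\<^sub>0) < 1" using v w by auto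
   have seg: "s \<in> {-T..T}" if "s \<in> closed_segment 0 t" for s
    using that t T by (auto simp: segment_0 split: if_splits)
   have d0: "0 <= N (w - v)" using diff[OF wX(1) vX(1)] N_nonneg by blast
   have "N (flow w t - flow v t) <= 2 * N (w - v) * exp (2 * (3 * C * (2 * r)\<^sup>2) * \<bar>t\<bar>)"
    by (rule stability[OF I S[OF wX] S[OF vX] wX(1) vX(1) t]) (use r X[OF wX] X[OF vX] seg in auto)
   also have "... <= 2 * N (w - v) * K"
    unfolding K_def using t C_pos d0 by (intro mult_left_mono) (auto intro!: mult_left_mono)
   also have "... < e" by (rule \<eta>(2)[OF d0 wv])
   finally show "N (flow w t - flow v t) < e" .
  qed
 qed
qed

text \<open>The hypothesis on \<open>T4\<close> is linear in \<open>N\<close>, with a coefficient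
  fixed by the L^2 radius R to which arguments are projected. The iterates therefore grow at most
  like exp(2 k |s|), uniformly in n and for all times.\<close>

lemma flow_persistence:
 assumes D: "0 < D" "\<And>u R. u \<in> X ==> 0 < R ==> norm u <= R ==> N (T4 u u u) <= D * R\<^sup>2 * N u" and u0: "u\<^sub>0 \<in> X"
 shows "flow u\<^sub>0 t \<in> X"
proof -
 define R where "R = norm u\<^sub>0 + 1"
 have R: "0 < R" by (simp add: R_def add_nonneg_pos)
 define k where "k = D * R\<^sup>2"
 have k: "0 < k" using D R by (simp add: k_def)
 define r where "r = N u\<^sub>0"
 have r: "0 <= r" using N_nonneg[OF u0] by (simp add: r_def)
 have "picard R u\<^sub>0 n s \<in> X \<and> N (picard R u\<^sub>0 n s) <= 2 * r * exp (2 * k * \<bar>s\<bar>)" for n s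
 proof (induction n arbitrary: s)
  case 0
  have "r * 1 <= 2 * r * exp (2 * k * \<bar>s\<bar>)" using r k by (intro mult_mono) auto
  then show ?case using u0 by (simp add: r_def)
 next
  case (Suc n)
  let ?V = "%s. cut_T4 R (picard R u\<^sub>0 n s)"
  have cV: "continuous_on (closed_segment 0 s) ?V"
   by (rule continuous_on_subset[OF continuous_cut_T4[OF R]]) (use picard_lipschitz[OF R] in auto)
  have "prim ?V s \<in> X \<and> N (prim ?V s) <= (2 * k * r) * exp (2 * k * \<bar>s\<bar>) / (2 * k)"
  proof (rule prim_exp[OF cV])
   fix q
   note IH = conjunct1[OF Suc.IH[of q]] conjunct2[OF Suc.IH[of q]]
   have x: "radial R (picard R u\<^sub>0 n q) \<in> X" "N (radial R (picard R u\<^sub>0 n q)) <= N (picard R u\<^sub>0 n q)"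
    using radial[OF IH(1) R] by auto
   have "N (?V q) <= k * N (radial R (picard R u\<^sub>0 n q))"
    unfolding cut_T4_def k_def by (rule D(2)[OF x(1) R norm_radial[OF R]])
   also have "... <= k * (2 * r * exp (2 * k * \<bar>q\<bar>))" using x(2) IH(2) k by (intro mult_left_mono) auto
   finally show "?V q \<in> X \<and> N (?V q) <= 2 * k * r * exp (2 * k * \<bar>q\<bar>)"
    using cut_T4_X[OF IH(1) R] by (simp add: ac_simps)
  qed (use k r in auto)
  then have P: "prim ?V s \<in> X" "N (prim ?V s) <= r * exp (2 * k * \<bar>s\<bar>)" using k by auto
  have Q: "\<i> *\<^sub>C prim ?V s \<in> X" "N (\<i> *\<^sub>C prim ?V s) <= r * exp (2 * k * \<bar>s\<bar>)"
   using scaleC[OF P(1), of \<i>] P(2) by auto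
  have "r * 1 <= r * exp (2 * k * \<bar>s\<bar>)" using r k by (intro mult_left_mono) auto
  then show ?case using diff[OF u0 Q(1)] Q(2) unfolding r_def[symmetric] by auto
 qed
 then show ?thesis using closed[OF _ picard_flow[of u\<^sub>0 t]] unfolding R_def by blast
qed

end

lemma global_L2: "globally_wellposed UNIV norm"
 unfolding globally_wellposed_def
proof (intro conjI L2.unique exI[of _ flow] ballI allI impI)
 show S: "solution UNIV norm UNIV v (flow v)" for v
  by (rule L2.solution_flow[OF is_interval_univ UNIV_I, where m = "norm v"]) (simp add: norm_flow)
 fix v :: L2 and T e :: real assume T: "0 < T" and e: "0 < e"
 \<comment> \<open>By mass conservation m bounds both solutions for all times once the data differ
   by less than 1; \<open>stability\<close> then applies on any bounded time interval.\<close>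
 define m where "m = norm v + 1"
 have m: "0 < m" by (simp add: m_def add_nonneg_pos)
 define K where "K = exp (2 * (3 * L2_const * m\<^sup>2) * T)"
 obtain \<eta> where \<eta>: "0 < \<eta>" "\<And>x. 0 <= x ==> x < \<eta> ==> 2 * x * K < e \<and> x < 1"
  using L2.dependence_small[OF e, of K] by (auto simp: K_def)
 show "\<exists>\<eta>>0. \<forall>w\<in>UNIV. norm (w - v) < \<eta> --> (\<forall>t\<in>{-T..T}. norm (flow w t - flow v t) < e)"
 proof (intro exI[of _ \<eta>] conjI ballI impI \<eta>(1))
  fix w :: L2 and t :: real assume wv: "norm (w - v) < \<eta>" and t: "t \<in> {-T..T}"
  have \<eta>': "2 * norm (w - v) * K < e" "norm (w - v) < 1" using \<eta>(2)[OF norm_ge_zero wv] by auto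
  have "norm w <= m" using \<eta>'(2) norm_triangle_sub[of w v] by (simp add: m_def)
  then have "norm (flow w t - flow v t) <= 2 * norm (w - v) * exp (2 * (3 * L2_const * m\<^sup>2) * \<bar>t\<bar>)"
   by (intro L2.stability[OF is_interval_univ UNIV_I S S UNIV_I UNIV_I UNIV_I m]) (auto simp: norm_flow m_def)
  also have "... <= 2 * norm (w - v) * K"
   unfolding K_def using t L2.C_pos by (intro mult_left_mono) (auto intro!: mult_left_mono)
  also have "... < e" by (rule \<eta>'(1))
  finally show "norm (flow w t - flow v t) < e" .
 qed
qed

theorem theorem4p9:
  shows
    "(locally_wellposed UNIV norm \<and>
      (\<forall>\<sigma>\<ge>0. locally_wellposed (Lp_space 2 \<sigma>) (Lp_norm 2 \<sigma>)) \<and>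
      (\<forall>\<sigma>\<ge>0. locally_wellposed (sobolev \<sigma>) (sobolev_norm \<sigma>)) \<and>
      (\<forall>s>1/2. locally_wellposed (Linf_space s) (Linf_norm s)) \<and>
      (\<forall>p\<ge>2. \<forall>s>1/2 - 1/p. locally_wellposed (Lp_space p s) (Lp_norm p s))) \<and>
     globally_wellposed UNIV norm \<and>
     (\<forall>\<sigma>\<ge>0. \<forall>u\<^sub>0\<in>sobolev \<sigma>. \<forall>u. solution UNIV norm UNIV u\<^sub>0 u \<longrightarrow> (\<forall>t. u t \<in> sobolev \<sigma>))"
proof (intro conjI allI impI ballI)
 show "locally_wellposed UNIV norm" by (rule L2.local)
 show "locally_wellposed (Lp_space 2 \<sigma>) (Lp_norm 2 \<sigma>)" if "0 <= \<sigma>" for \<sigma>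
  using ex_solution_space_Lp[of 2 \<sigma>] that solution_space.local by auto
 show "locally_wellposed (sobolev \<sigma>) (sobolev_norm \<sigma>)" if "0 <= \<sigma>" for \<sigma>
  using ex_solution_space_sobolev[OF that] solution_space.local by blast
 show "locally_wellposed (Linf_space s) (Linf_norm s)" if "1 / 2 < s" for s
  using ex_solution_space_Linf[OF that] solution_space.local by blast
 show "locally_wellposed (Lp_space p s) (Lp_norm p s)" if "2 <= p" "1 / 2 - 1 / p < s" for p s
  using ex_solution_space_Lp[OF that(1) disjI1[OF that(2)]] solution_space.local by blast
 show "globally_wellposed UNIV norm" by (rule global_L2)
 fix \<sigma> :: real and u\<^sub>0 u t
 assume \<sigma>: "0 <= \<sigma>" and u0: "u\<^sub>0 \<in> sobolev \<sigma>" and u: "solution UNIV norm UNIV u\<^sub>0 u"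
 obtain C where C: "solution_space (sobolev \<sigma>) (sobolev_norm \<sigma>) C" using ex_solution_space_sobolev[OF \<sigma>] by blast
 obtain D where D: "0 < D" "\<And>u R. u \<in> sobolev \<sigma> ==> 0 < R ==> norm u <= R ==> sobolev_norm \<sigma> (T4 u u u) <= D * R\<^sup>2 * sobolev_norm \<sigma> u"
  using sobolev_T4_tame[OF \<sigma>] by blast
 have "solution UNIV norm UNIV u\<^sub>0 (flow u\<^sub>0)"
  by (rule L2.solution_flow[OF is_interval_univ UNIV_I, where m = "norm u\<^sub>0"]) (simp add: norm_flow)
 \<comment> \<open>Uniqueness identifies an arbitrary L^2 solution with the flow, for which
   persistence is known.\<close>
 from L2_unique[OF is_interval_univ UNIV_I u this UNIV_I] have "u t = flow u\<^sub>0 t" .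
 moreover have "flow u\<^sub>0 t \<in> sobolev \<sigma>"
  by (rule solution_space.flow_persistence[OF C D(1) _ u0]) (rule D(2))
 ultimately show "u t \<in> sobolev \<sigma>" by simp
qed

end
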